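(* Let $m,n\ge1$. Let $\lambda,\mu\in\mathbb{C}^m$ be such that all coordinates of $\nu=\lambda-\mu$ are integers with absolute values not exceeding $n$, and such that the weight $\bar\lambda=\mu+\bar\nu$ is dominant, where $\bar\nu_a=\nu_a$ if $\nu_a\ge0$ and $\bar\nu_a=n+\nu_a$ if $\nu_a<0$. Then the operator $$I^\lambda_\mu=(-1)^{\bar N}\,G_{\sigma_0(|\nu|)}^{-1}\,\sigma_0\,Z^\lambda_\mu\,G_{|\nu|}:\ \Phi^\lambda_\mu\to\Phi^{\sigma_0(\lambda)}_{\sigma_0(\mu)}$$ where $\bar N=\sum_{1\le a<b\le m}\bar\nu_a\bar\nu_b$ and $$Z^\lambda_\mu=\prod_{1\le a<b\le m}^{\longrightarrow}\begin{cases}X^{\bar\lambda\,\varepsilon}_{ab}&\text{if }\bar\nu_a\ge\bar\nu_b,\\ Y^{\mu\,\varepsilon}_{ab}&\text{if }\bar\nu_a<\bar\nu_b,\end{cases}$$ the factors being ordered from left to right according to a normal ordering of the pairs $a<b$: (i) is not zero; (ii) does not depend on the choice of the normal ordering; (iii) commutes with the action of the Yangian $\mathrm{Y}(\mathfrak{gl}_n)$; (iv) has image irreducible under the action of $\mathrm{Y}(\mathfrak{gl}_n)$.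
   Context: **The Yangian.** $\mathrm{Y}(\mathfrak{gl}_n)$ is the complex unital associative algebra with generators $T_{ij}^{(r)}$, $r\ge1$, $1\le i,j\le n$, and relations $$(u-v)[T_{ij}(u),T_{kl}(v)]=T_{kj}(u)T_{il}(v)-T_{kj}(v)T_{il}(u),$$ where $T_{ij}(u)=\delta_{ij}+T^{(1)}_{ij}u^{-1}+T^{(2)}_{ij}u^{-2}+\cdots$. Tensor products of modules are formed with the comultiplication $T_{ij}(u)\mapsto\sum_{k=1}^n T_{ik}(u)\otimes T_{kj}(u)$. **Standard rational modules.** For $0\le d\le n$ and $z\in\mathbb{C}$, $\Phi^d_z$ and $\Phi^{-d}_z$ are the $\mathrm{Y}(\mathfrak{gl}_n)$-modules with underlying space $\Lambda^d(\mathbb{C}^n)$ on which $T_{ij}(u)$ acts respectively as $$\delta_{ij}+\frac{e_{ij}}{u-z}\qquad\text{and}\qquad\delta_{ij}-\frac{e_{ji}}{u-z+1}$$ (expanded in $u^{-1}$), where $e_{ij}$ is the standard matrix unit of $\mathfrak{gl}_n$ acting on the $\mathfrak{gl}_n$-module $\Lambda^d(\mathbb{C}^n)$. (For $d=0$ both are the trivial module.) For $\lambda,\mu\in\mathbb{C}^m$ with $\nu=\lambda-\mu\in\{-n,\dots,n\}^m$ put $\Phi^\lambda_\mu=\Phi^{\nu_1}_{\mu_1}\otimes\cdots\otimes\Phi^{\nu_m}_{\mu_m}$; its underlying space is $\Lambda^{|\nu_1|}(\mathbb{C}^n)\otimes\cdots\otimes\Lambda^{|\nu_m|}(\mathbb{C}^n)$.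 Put $|\nu|=(|\nu_1|,\dots,|\nu_m|)$. A weight $\kappa\in\mathbb{C}^m$ is *dominant* if $\kappa_a-\kappa_b\ne-1,-2,\dots$ whenever $a<b$. **Symmetric group.** $\mathfrak S_m$ acts on $\mathbb{C}^m$ by $\sigma(\lambda)_a=\lambda_{\sigma^{-1}(a)}$; $\sigma_0$ is the longest element, $\sigma_0(a)=m+1-a$. **Grassmann algebra and operators.** $\mathcal G_{mn}$ is the Grassmann algebra on anticommuting variables $x_{ai}$ ($1\le a\le m$, $1\le i\le n$), and $\partial_{ai}$ is the left derivation with respect to $x_{ai}$. $\mathfrak S_m$ acts on $\mathcal G_{mn}$ by algebra automorphisms $\sigma(x_{ai})=x_{\sigma(a)i}$. For $\kappa\in\mathbb{Z}_{\ge0}^m$, $\mathcal G^{\kappa}_{mn}$ is the subspace of elements of degree $\kappa_a$ in $x_{a1},\dots,x_{an}$ for each $a$. Let $\varepsilon_a=+1$ if $\nu_a\ge0$ and $\varepsilon_a=-1$ if $\nu_a<0$. Put $D^\varepsilon_{ab}=\sum_{i=1}^n q_{ai}p_{bi}$, where $q_{ai}=x_{ai}$, $p_{ai}=\partial_{ai}$ if $\varepsilon_a=+1$, and $q_{ai}=\partial_{ai}$, $p_{ai}=x_{ai}$ if $\varepsilon_a=-1$ (here $x_{ai}$ denotes left multiplication). For $a<b$ and $\kappa\in\mathbb{C}^m$ with $\kappa_a-\kappa_b\ne-1,-2,\dots$ define operators on $\mathcal G_{mn}$ (finite sums) $$X^{\kappa\,\varepsilon}_{ab}=1+\sum_{r\ge1}\frac{(-1)^r(D^\varepsilon_{ba})^r(D^\varepsilon_{ab})^r}{r!\,(\kappa_a-\kappa_b+1)_r},\qquad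 Y^{\kappa\,\varepsilon}_{ab}=1+\sum_{r\ge1}\frac{(-1)^r(D^\varepsilon_{ab})^r(D^\varepsilon_{ba})^r}{r!\,(\kappa_a-\kappa_b+1)_r},$$ with $(u)_r=u(u+1)\cdots(u+r-1)$. If $\bar\lambda$ is dominant, $a<b$ and $\bar\nu_a<\bar\nu_b$, then $\mu_a-\mu_b\ne0,-1,-2,\dots$, so $Y^{\mu\,\varepsilon}_{ab}$ is defined. **The map $G_{|\nu|}$.** $G_{|\nu|}:\Phi^\lambda_\mu\to\mathcal G^{|\nu|}_{mn}$ is the linear isomorphism $$(e_{i_1}\wedge\cdots\wedge e_{i_{|\nu_1|}})\otimes\cdots\otimes(e_{j_1}\wedge\cdots\wedge e_{j_{|\nu_m|}})\mapsto(x_{1i_1}\cdots x_{1i_{|\nu_1|}})\cdots(x_{mj_1}\cdots x_{mj_{|\nu_m|}}).$$ **Normal ordering.** A total ordering of the pairs $(a,b)$, $1\le a<b\le m$, is normal if for all $a<b<c$ the pair $(a,c)$ lies between $(a,b)$ and $(b,c)$. *)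

theory Defs
  imports Complex_Main "HOL-Library.Poly_Mapping" "HOL-Algebra.QuotRing"
begin

section \<open>Complex vector spaces with a chosen basis\<close>

text \<open>A complex vector space with a basis indexed by the type \<open>'b\<close> is represented by
  the finitely supported coordinate functions \<open>'b \<Rightarrow>\<^sub>0 complex\<close>; the basis vector with
  index \<open>k\<close> is \<open>Poly_Mapping.single k 1\<close>.\<close>

definition fscale :: "complex \<Rightarrow> ('b \<Rightarrow>\<^sub>0 complex) \<Rightarrow> ('b \<Rightarrow>\<^sub>0 complex)" where
  "fscale c v = Poly_Mapping.map ((*) c) v"

lemma lookup_fscale: "Poly_Mapping.lookup (fscale c v) k = c * Poly_Mapping.lookup v k"
  by (simp add: fscale_def Poly_Mapping.map.rep_eq when_def)

interpretation fvs: vector_space "fscale :: complex \<Rightarrow> ('b \<Rightarrow>\<^sub>0 complex) \<Rightarrow> ('b \<Rightarrow>\<^sub>0 complex)"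
  by unfold_locales
    (auto intro!: poly_mapping_eqI simp: lookup_fscale lookup_add algebra_simps)

definition lin_ext :: "('b \<Rightarrow> ('c \<Rightarrow>\<^sub>0 complex)) \<Rightarrow> ('b \<Rightarrow>\<^sub>0 complex) \<Rightarrow> ('c \<Rightarrow>\<^sub>0 complex)" where
  "lin_ext f v = (\<Sum>k\<in>Poly_Mapping.keys v. fscale (Poly_Mapping.lookup v k) (f k))"


section \<open>The Yangian\<close>

text \<open>The free monoid, written additively so that \<open>'g fword \<Rightarrow>\<^sub>0 complex\<close> with the
  convolution product of \<^theory>\<open>HOL-Library.Poly_Mapping\<close> is the free associative algebra.\<close>

datatype 'g fword = FWord (letters: "'g list")

instantiation fword :: (type) monoid_add
begin

definition zero_fword :: "'a fword" where
  "zero_fword = FWord []"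

definition plus_fword :: "'a fword \<Rightarrow> 'a fword \<Rightarrow> 'a fword" where
  "plus_fword v w = FWord (letters v @ letters w)"

instance
  by standard (simp_all add: zero_fword_def plus_fword_def)

end

text \<open>The triple \<open>(i, j, r)\<close> stands for the generator \<open>T\<^sub>i\<^sub>j\<close> with upper index \<open>r\<close>.\<close>

type_synonym ygen = "nat \<times> nat \<times> nat"

definition yfree :: "nat \<Rightarrow> (ygen fword \<Rightarrow>\<^sub>0 complex) ring" where
  "yfree n = \<lparr>carrier =
       {p. \<forall>w\<in>Poly_Mapping.keys p. set (letters w) \<subseteq> {1..n} \<times> {1..n} \<times> {1..}},
     mult = (*), one = 1, zero = 0, add = (+)\<rparr>"

text \<open>The coefficient of \<open>u\<close> to the power \<open>-r\<close> in \<open>T\<^sub>i\<^sub>j(u)\<close>.\<close>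

definition yT :: "nat \<Rightarrow> nat \<Rightarrow> nat \<Rightarrow> (ygen fword \<Rightarrow>\<^sub>0 complex)" where
  "yT i j r = (if r = 0 then (if i = j then 1 else 0)
               else Poly_Mapping.single (FWord [(i, j, r)]) 1)"

text \<open>The coefficient of \<open>u\<close> to the power \<open>-r\<close> times \<open>v\<close> to the power \<open>-s\<close> in
  \<open>(u - v) [T\<^sub>i\<^sub>j(u), T\<^sub>k\<^sub>l(v)] - (T\<^sub>k\<^sub>j(u) T\<^sub>i\<^sub>l(v) - T\<^sub>k\<^sub>j(v) T\<^sub>i\<^sub>l(u))\<close>. Only \<open>r, s \<ge> 0\<close> matter:
  the coefficients with a positive power of \<open>u\<close> or \<open>v\<close> are commutators with \<open>\<delta>\<^sub>i\<^sub>j\<close> or \<open>\<delta>\<^sub>k\<^sub>l\<close>.\<close>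

definition yangian_relation ::
  "nat \<Rightarrow> nat \<Rightarrow> nat \<Rightarrow> nat \<Rightarrow> nat \<Rightarrow> nat \<Rightarrow> (ygen fword \<Rightarrow>\<^sub>0 complex)" where
  "yangian_relation i j k l r s =
     (yT i j (r + 1) * yT k l s - yT k l s * yT i j (r + 1))
     - (yT i j r * yT k l (s + 1) - yT k l (s + 1) * yT i j r)
     - (yT k j r * yT i l s - yT k j s * yT i l r)"

lemma yfree_simps [simp]:
  "mult (yfree n) = (*)" "one (yfree n) = 1" "zero (yfree n) = 0" "add (yfree n) = (+)"
  by (simp_all add: yfree_def)

lemma carrier_yfree:
  "p \<in> carrier (yfree n) \<longleftrightarrow>
     (\<forall>w\<in>Poly_Mapping.keys p. set (letters w) \<subseteq> {1..n} \<times> {1..n} \<times> {1..})"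
  by (simp add: yfree_def)

lemma ring_yfree: "ring (yfree n)"
proof (rule ringI)
  show "abelian_group (yfree n)"
  proof (rule abelian_groupI)
    fix p q assume "p \<in> carrier (yfree n)" "q \<in> carrier (yfree n)"
    then show "p \<oplus>\<^bsub>yfree n\<^esub> q \<in> carrier (yfree n)"
      using keys_add[of p q] unfolding carrier_yfree yfree_simps by blast
  next
    fix p assume "p \<in> carrier (yfree n)"
    then have "- p \<in> carrier (yfree n)"
      by (simp add: carrier_yfree)
    then show "\<exists>q\<in>carrier (yfree n). q \<oplus>\<^bsub>yfree n\<^esub> p = \<zero>\<^bsub>yfree n\<^esub>"
      by (rule bexI[rotated]) simp
  qed (simp_all add: carrier_yfree add.assoc add.commute)
  have closed: "p * q \<in> carrier (yfree n)"
    if p: "p \<in> carrier (yfree n)" and q: "q \<in> carrier (yfree n)" for p q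
    unfolding carrier_yfree
  proof
    fix w assume "w \<in> Poly_Mapping.keys (p * q)"
    then obtain u v where "w = u + v" "u \<in> Poly_Mapping.keys p" "v \<in> Poly_Mapping.keys q"
      using keys_mult[of p q] by blast
    then show "set (letters w) \<subseteq> {1..n} \<times> {1..n} \<times> {1..}"
      using p q by (simp add: carrier_yfree plus_fword_def)
  qed
  have one: "1 \<in> carrier (yfree n)"
    by (simp add: carrier_yfree zero_fword_def)
  show "monoid (yfree n)"
    by (rule monoidI) (simp_all add: closed one mult.assoc)
qed (simp_all add: distrib_left distrib_right)

text \<open>The field of scalars is contained in \<open>yfree n\<close>, so a two-sided ideal is automatically
  a linear subspace, and the Yangian is the quotient algebra.\<close>

definition yangian :: "nat \<Rightarrow> (ygen fword \<Rightarrow>\<^sub>0 complex) set ring" where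
  "yangian n = yfree n Quot
     (Idl\<^bsub>yfree n\<^esub> {yangian_relation i j k l r s | i j k l r s.
        i \<in> {1..n} \<and> j \<in> {1..n} \<and> k \<in> {1..n} \<and> l \<in> {1..n}})"

text \<open>A module is given by the operators \<open>T i j r\<close> by which the generators act.  An element
  of the Yangian is a coset of elements of the free algebra, all of which act in the same way
  when the operators satisfy the defining relations.\<close>

type_synonym 'b gen_action = "nat \<Rightarrow> nat \<Rightarrow> nat \<Rightarrow> ('b \<Rightarrow>\<^sub>0 complex) \<Rightarrow> ('b \<Rightarrow>\<^sub>0 complex)"

definition yfree_act ::
  "'b gen_action \<Rightarrow> (ygen fword \<Rightarrow>\<^sub>0 complex) \<Rightarrow> ('b \<Rightarrow>\<^sub>0 complex) \<Rightarrow> ('b \<Rightarrow>\<^sub>0 complex)" where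
  "yfree_act T p v =
     (\<Sum>w\<in>Poly_Mapping.keys p.
        fscale (Poly_Mapping.lookup p w) (foldr (\<lambda>(i, j, r). T i j r) (letters w) v))"

definition yangian_act ::
  "'b gen_action \<Rightarrow> (ygen fword \<Rightarrow>\<^sub>0 complex) set \<Rightarrow> ('b \<Rightarrow>\<^sub>0 complex) \<Rightarrow> ('b \<Rightarrow>\<^sub>0 complex)" where
  "yangian_act T y v = (THE x. \<forall>p\<in>y. yfree_act T p v = x)"

definition yangian_submodule :: "nat \<Rightarrow> 'b gen_action \<Rightarrow> ('b \<Rightarrow>\<^sub>0 complex) set \<Rightarrow> bool" where
  "yangian_submodule n T U \<longleftrightarrow>
     fvs.subspace U \<and> (\<forall>y\<in>carrier (yangian n). \<forall>v\<in>U. yangian_act T y v \<in> U)"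

definition yangian_irreducible :: "nat \<Rightarrow> 'b gen_action \<Rightarrow> ('b \<Rightarrow>\<^sub>0 complex) set \<Rightarrow> bool" where
  "yangian_irreducible n T W \<longleftrightarrow>
     yangian_submodule n T W \<and> W \<noteq> {0} \<and>
     (\<forall>U. yangian_submodule n T U \<and> U \<subseteq> W \<longrightarrow> U = {0} \<or> U = W)"

definition yangian_hom ::
  "nat \<Rightarrow> 'b gen_action \<Rightarrow> ('b \<Rightarrow>\<^sub>0 complex) set \<Rightarrow> 'c gen_action \<Rightarrow> ('c \<Rightarrow>\<^sub>0 complex) set \<Rightarrow>
   (('b \<Rightarrow>\<^sub>0 complex) \<Rightarrow> ('c \<Rightarrow>\<^sub>0 complex)) \<Rightarrow> bool" where
  "yangian_hom n T V T' V' f \<longleftrightarrow>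
     f ` V \<subseteq> V' \<and>
     (\<forall>v\<in>V. \<forall>w\<in>V. f (v + w) = f v + f w) \<and>
     (\<forall>c. \<forall>v\<in>V. f (fscale c v) = fscale c (f v)) \<and>
     (\<forall>y\<in>carrier (yangian n). \<forall>v\<in>V. f (yangian_act T y v) = yangian_act T' y (f v))"


section \<open>Grassmann algebras\<close>

text \<open>The Grassmann algebra on a linearly ordered set of variables.  For a finite set \<open>A\<close> of
  variables \<open>x\<^sub>1 < \<dots> < x\<^sub>k\<close>, the basis vector with index \<open>A\<close> is the monomial \<open>x\<^sub>1 \<cdots> x\<^sub>k\<close>.\<close>

definition gmult ::
  "('x::linorder set \<Rightarrow>\<^sub>0 complex) \<Rightarrow> ('x set \<Rightarrow>\<^sub>0 complex) \<Rightarrow> ('x set \<Rightarrow>\<^sub>0 complex)" where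
  "gmult v w = lin_ext (\<lambda>A. lin_ext (\<lambda>B.
     if A \<inter> B = {}
     then Poly_Mapping.single (A \<union> B) ((-1) ^ card {(a, b). a \<in> A \<and> b \<in> B \<and> b < a})
     else 0) w) v"

definition gvar :: "'x \<Rightarrow> ('x::linorder set \<Rightarrow>\<^sub>0 complex)" where
  "gvar x = Poly_Mapping.single {x} 1"

definition gword :: "'x list \<Rightarrow> ('x::linorder set \<Rightarrow>\<^sub>0 complex)" where
  "gword xs = foldr (\<lambda>x. gmult (gvar x)) xs (Poly_Mapping.single {} 1)"

text \<open>The left derivation: move \<open>x\<close> to the front of the monomial and delete it.\<close>

definition gderiv :: "'x \<Rightarrow> ('x::linorder set \<Rightarrow>\<^sub>0 complex) \<Rightarrow> ('x set \<Rightarrow>\<^sub>0 complex)" where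
  "gderiv x = lin_ext (\<lambda>A.
     if x \<in> A then Poly_Mapping.single (A - {x}) ((-1) ^ card {b \<in> A. b < x}) else 0)"


section \<open>Standard rational modules\<close>

text \<open>The exterior algebra of \<open>\<complex>\<^sup>n\<close> is the Grassmann algebra on \<open>e\<^sub>1, \<dots>, e\<^sub>n\<close>, with \<open>e\<^sub>i\<close>
  represented by the number \<open>i\<close>.  The matrix unit \<open>e\<^sub>i\<^sub>j\<close> sends \<open>e\<^sub>j\<close> to \<open>e\<^sub>i\<close>; it acts on a
  wedge product as the sum of its actions on the single factors.\<close>

type_synonym ext = "nat set \<Rightarrow>\<^sub>0 complex"

definition gl_act :: "nat \<Rightarrow> nat \<Rightarrow> ext \<Rightarrow> ext" where
  "gl_act i j = lin_ext (\<lambda>I. let js = sorted_list_of_set I in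
     (\<Sum>k | k < length js \<and> js ! k = j. gword (js[k := i])))"

text \<open>The coefficients of the expansions in \<open>1/u\<close> of \<open>\<delta>\<^sub>i\<^sub>j + e\<^sub>i\<^sub>j / (u - z)\<close> and
  \<open>\<delta>\<^sub>i\<^sub>j - e\<^sub>j\<^sub>i / (u - z + 1)\<close>; the coefficient of \<open>1/(u - z)\<close> at \<open>u\<close> to the power \<open>-r\<close>,
  \<open>r \<ge> 1\<close>, is \<open>z ^ (r - 1)\<close>.\<close>

definition Phi1_act :: "int \<Rightarrow> complex \<Rightarrow> nat \<Rightarrow> nat \<Rightarrow> nat \<Rightarrow> ext \<Rightarrow> ext" where
  "Phi1_act d z i j r v =
     (if r = 0 then (if i = j then v else 0)
      else if d \<ge> 0 then fscale (z ^ (r - 1)) (gl_act i j v)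
      else - fscale ((z - 1) ^ (r - 1)) (gl_act j i v))"

text \<open>The basis vector of a tensor product of exterior powers with index \<open>[I\<^sub>1, \<dots>, I\<^sub>m]\<close> is
  \<open>e\<^sub>I\<^sub>1 \<otimes> \<cdots> \<otimes> e\<^sub>I\<^sub>m\<close>, where \<open>e\<^sub>I\<close> is the wedge product of the \<open>e\<^sub>i\<close>, \<open>i \<in> I\<close>, in increasing order.\<close>

type_synonym tens = "nat set list \<Rightarrow>\<^sub>0 complex"

definition tensor :: "ext \<Rightarrow> tens \<Rightarrow> tens" where
  "tensor v w = lin_ext (\<lambda>I. lin_ext (\<lambda>Is. Poly_Mapping.single (I # Is) 1) w) v"

definition tensor_op :: "(ext \<Rightarrow> ext) \<Rightarrow> (tens \<Rightarrow> tens) \<Rightarrow> tens \<Rightarrow> tens" where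
  "tensor_op f g = lin_ext (\<lambda>Is. case Is of [] \<Rightarrow> 0 | I # Is' \<Rightarrow>
     tensor (f (Poly_Mapping.single I 1)) (g (Poly_Mapping.single Is' 1)))"

text \<open>Iterated tensor product along the comultiplication
  \<open>T\<^sub>i\<^sub>j(u) \<mapsto> \<Sum>\<^sub>k T\<^sub>i\<^sub>k(u) \<otimes> T\<^sub>k\<^sub>j(u)\<close>; the empty product is the trivial module.\<close>

fun Phi_list_act :: "nat \<Rightarrow> (int \<times> complex) list \<Rightarrow> nat \<Rightarrow> nat \<Rightarrow> nat \<Rightarrow> tens \<Rightarrow> tens" where
  "Phi_list_act n [] i j r v = (if i = j \<and> r = 0 then v else 0)"
| "Phi_list_act n ((d, z) # ps) i j r v =
     (\<Sum>k = 1..n. \<Sum>s = 0..r. tensor_op (Phi1_act d z i k s) (Phi_list_act n ps k j (r - s)) v)"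

text \<open>Vectors of \<open>\<complex>\<^sup>m\<close> are functions of which only the values at \<open>1, \<dots>, m\<close> are used.
  The vector \<open>\<nu> = \<lambda> - \<mu>\<close> is used only when its coordinates are integers; then taking
  the integer part of the real part changes only the type.\<close>

type_synonym wt = "nat \<Rightarrow> complex"

definition nu :: "wt \<Rightarrow> wt \<Rightarrow> nat \<Rightarrow> int" where
  "nu lam mu a = \<lfloor>Re (lam a - mu a)\<rfloor>"

definition Phi_space :: "nat \<Rightarrow> nat \<Rightarrow> wt \<Rightarrow> wt \<Rightarrow> tens set" where
  "Phi_space m n lam mu =
     {v. \<forall>Is\<in>Poly_Mapping.keys v.
        list_all2 (\<lambda>I a. I \<subseteq> {1..n} \<and> int (card I) = \<bar>nu lam mu a\<bar>) Is [1..<m + 1]}"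

definition Phi_act :: "nat \<Rightarrow> nat \<Rightarrow> wt \<Rightarrow> wt \<Rightarrow> nat set list gen_action" where
  "Phi_act m n lam mu = Phi_list_act n (map (\<lambda>a. (nu lam mu a, mu a)) [1..<m + 1])"


section \<open>The intertwining operator\<close>

definition nubar :: "nat \<Rightarrow> wt \<Rightarrow> wt \<Rightarrow> nat \<Rightarrow> nat" where
  "nubar n lam mu a = nat (if nu lam mu a \<ge> 0 then nu lam mu a else int n + nu lam mu a)"

definition lambar :: "nat \<Rightarrow> wt \<Rightarrow> wt \<Rightarrow> wt" where
  "lambar n lam mu a = mu a + of_nat (nubar n lam mu a)"

definition dominant :: "nat \<Rightarrow> wt \<Rightarrow> bool" where
  "dominant m kap \<longleftrightarrow>
     (\<forall>a b. 1 \<le> a \<and> a < b \<and> b \<le> m \<longrightarrow> (\<forall>k::nat. k \<ge> 1 \<longrightarrow> kap a - kap b \<noteq> - of_nat k))"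

definition wt_perm :: "(nat \<Rightarrow> nat) \<Rightarrow> wt \<Rightarrow> wt" where
  "wt_perm \<sigma> lam a = lam (inv_into UNIV \<sigma> a)"

definition sigma0 :: "nat \<Rightarrow> nat \<Rightarrow> nat" where
  "sigma0 m a = (if a \<in> {1..m} then m + 1 - a else a)"

text \<open>\<open>XV a i\<close> is the variable \<open>x\<^sub>a\<^sub>i\<close>; the variables are ordered lexicographically.\<close>

datatype xvar = XV (vrow: nat) (vcol: nat)

instantiation xvar :: linorder
begin

definition less_eq_xvar :: "xvar \<Rightarrow> xvar \<Rightarrow> bool" where
  "x \<le> y \<longleftrightarrow> vrow x < vrow y \<or> vrow x = vrow y \<and> vcol x \<le> vcol y"

definition less_xvar :: "xvar \<Rightarrow> xvar \<Rightarrow> bool" where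
  "x < y \<longleftrightarrow> vrow x < vrow y \<or> vrow x = vrow y \<and> vcol x < vcol y"

instance
proof
  fix x y z :: xvar
  show "x < y \<longleftrightarrow> x \<le> y \<and> \<not> y \<le> x" "x \<le> x" "x \<le> y \<or> y \<le> x"
    by (auto simp: less_eq_xvar_def less_xvar_def)
  show "x \<le> z" if "x \<le> y" "y \<le> z"
    using that by (auto simp: less_eq_xvar_def)
  show "x = y" if "x \<le> y" "y \<le> x"
    using that by (cases x; cases y) (auto simp: less_eq_xvar_def)
qed

end

type_synonym grass = "xvar set \<Rightarrow>\<^sub>0 complex"

definition grass_perm :: "(nat \<Rightarrow> nat) \<Rightarrow> grass \<Rightarrow> grass" where
  "grass_perm \<sigma> = lin_ext (\<lambda>A.
     gword (map (\<lambda>x. XV (\<sigma> (vrow x)) (vcol x)) (sorted_list_of_set A)))"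

definition nu_sign :: "wt \<Rightarrow> wt \<Rightarrow> nat \<Rightarrow> int" where
  "nu_sign lam mu a = (if nu lam mu a \<ge> 0 then 1 else -1)"

definition q_op :: "(nat \<Rightarrow> int) \<Rightarrow> nat \<Rightarrow> nat \<Rightarrow> grass \<Rightarrow> grass" where
  "q_op \<epsilon> a i = (if \<epsilon> a = 1 then gmult (gvar (XV a i)) else gderiv (XV a i))"

definition p_op :: "(nat \<Rightarrow> int) \<Rightarrow> nat \<Rightarrow> nat \<Rightarrow> grass \<Rightarrow> grass" where
  "p_op \<epsilon> a i = (if \<epsilon> a = 1 then gderiv (XV a i) else gmult (gvar (XV a i)))"

definition D_op :: "nat \<Rightarrow> (nat \<Rightarrow> int) \<Rightarrow> nat \<Rightarrow> nat \<Rightarrow> grass \<Rightarrow> grass" where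
  "D_op n \<epsilon> a b v = (\<Sum>i = 1..n. q_op \<epsilon> a i (p_op \<epsilon> b i v))"

text \<open>\<^const>\<open>Sum_any\<close> sums over all \<open>r\<close> with a nonzero summand; there are finitely many of
  them since \<open>D_op n \<epsilon> a b\<close> is nilpotent for \<open>a \<noteq> b\<close>.\<close>

definition X_op :: "nat \<Rightarrow> wt \<Rightarrow> (nat \<Rightarrow> int) \<Rightarrow> nat \<Rightarrow> nat \<Rightarrow> grass \<Rightarrow> grass" where
  "X_op n kap \<epsilon> a b v = v + Sum_any (\<lambda>r. if r \<ge> 1
     then fscale ((-1) ^ r / (fact r * pochhammer (kap a - kap b + 1) r))
            ((D_op n \<epsilon> b a ^^ r) ((D_op n \<epsilon> a b ^^ r) v))
     else 0)"

definition Y_op :: "nat \<Rightarrow> wt \<Rightarrow> (nat \<Rightarrow> int) \<Rightarrow> nat \<Rightarrow> nat \<Rightarrow> grass \<Rightarrow> grass" where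
  "Y_op n kap \<epsilon> a b v = v + Sum_any (\<lambda>r. if r \<ge> 1
     then fscale ((-1) ^ r / (fact r * pochhammer (kap a - kap b + 1) r))
            ((D_op n \<epsilon> a b ^^ r) ((D_op n \<epsilon> b a ^^ r) v))
     else 0)"

text \<open>A total ordering of the pairs is given as the list of the pairs in increasing order.\<close>

definition normal_ordering :: "nat \<Rightarrow> (nat \<times> nat) list \<Rightarrow> bool" where
  "normal_ordering m ps \<longleftrightarrow>
     distinct ps \<and> set ps = {(a, b). 1 \<le> a \<and> a < b \<and> b \<le> m} \<and>
     (\<forall>a b c i j k. a < b \<and> b < c \<and> i < length ps \<and> j < length ps \<and> k < length ps \<and>
        ps ! i = (a, b) \<and> ps ! j = (a, c) \<and> ps ! k = (b, c)
        \<longrightarrow> i < j \<and> j < k \<or> k < j \<and> j < i)"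

text \<open>The leftmost factor of the product is applied last.\<close>

definition Z_op :: "nat \<Rightarrow> wt \<Rightarrow> wt \<Rightarrow> (nat \<times> nat) list \<Rightarrow> grass \<Rightarrow> grass" where
  "Z_op n lam mu ps = foldr (\<lambda>(a, b).
     if nubar n lam mu a \<ge> nubar n lam mu b
     then X_op n (lambar n lam mu) (nu_sign lam mu) a b
     else Y_op n mu (nu_sign lam mu) a b) ps"

text \<open>On the basis vector with index \<open>[I\<^sub>1, \<dots>, I\<^sub>m]\<close>, \<open>I\<^sub>a\<close> contributes the variables
  \<open>x\<^sub>a\<^sub>i\<close>, \<open>i \<in> I\<^sub>a\<close>, in increasing order.\<close>

definition G_map :: "tens \<Rightarrow> grass" where
  "G_map = lin_ext (\<lambda>Is.
     gword (concat (map (\<lambda>(a, I). map (XV a) (sorted_list_of_set I)) (enumerate 1 Is))))"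

definition Nbar :: "nat \<Rightarrow> nat \<Rightarrow> wt \<Rightarrow> wt \<Rightarrow> nat" where
  "Nbar m n lam mu =
     (\<Sum>(a, b) | 1 \<le> a \<and> a < b \<and> b \<le> m. nubar n lam mu a * nubar n lam mu b)"

definition I_op :: "nat \<Rightarrow> nat \<Rightarrow> wt \<Rightarrow> wt \<Rightarrow> (nat \<times> nat) list \<Rightarrow> tens \<Rightarrow> tens" where
  "I_op m n lam mu ps v =
     fscale ((-1) ^ Nbar m n lam mu)
       (inv_into (Phi_space m n (wt_perm (sigma0 m) lam) (wt_perm (sigma0 m) mu)) G_map
          (grass_perm (sigma0 m) (Z_op n lam mu ps (G_map v))))"

end

theory Submission
  imports Defs "HOL-Computational_Algebra.Polynomial" "HOL-Computational_Algebra.Formal_Power_Series"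
begin

text \<open>The module of weight \<open>\<nu>\<close> is realised on the Grassmann algebra, where \<open>T(u)\<close> becomes a product of
  one matrix for each row with entries \<open>(1 - z / u) \<delta>\<^sub>i\<^sub>j + q\<^sub>i p\<^sub>j / u\<close>, up to a scalar series. For two rows
  the \<open>q\<^sub>i\<close> and the \<open>p\<^sub>i\<close> form doublets under the Lie algebra \<open>sl\<^sub>2\<close> spanned by the operators \<open>D\<close>, and
  the recurrence of the coefficients of \<open>X\<close> and \<open>Y\<close> is what makes these series exchange the two
  matrices. A normal ordering is a reduced sequence of adjacent transpositions leading to \<open>\<sigma>\<^sub>0\<close>, so the
  product \<open>Z\<close> intertwines the actions for the two orders of the rows.

  For irreducibility, take a nonzero submodule \<open>S\<close> of the target and the last row \<open>r\<close>. Add an auxiliary row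
  \<open>c\<close> with variable parameter \<open>u\<close>, filled with an arbitrary monomial. On this row the product of the
  factors for the pairs \<open>(b, c)\<close> is expressed by the matrices \<open>T(u)\<close>, so it keeps the coefficients
  with respect to row \<open>c\<close> in \<open>S\<close>. At \<open>u = z\<^sub>r\<close> the factor of \<open>r\<close> and \<open>c\<close> becomes the exchange of these
  rows, and the remaining factors are those of \<open>Z\<close> with second index \<open>r\<close>. Induction on the number of rows,
  applied to the coefficients of \<open>S\<close> with respect to row \<open>r\<close>, then shows that the image of \<open>Z\<close>
  lies in \<open>S\<close>. Independence of the normal ordering follows, since \<open>Z\<close> always fixes an extremal vector,
  the only one of its weight.\<close>

section \<open>Series in \<open>sl\<^sub>2\<close> and doublets\<close>

text \<open>X and Y intertwine the same two row matrices but have different normalisations and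
  poles. Dominance keeps the parameter of X off the positive integers, and that of Y off all natural
  numbers when the left row has the smaller degree; the case distinction in Z picks a finite form
  for each pair. The auxiliary row is a fusion procedure. Contracting the operators p of that row
  with T(u) lowers its degree by one and turns u into u + 1; on a full row the product of the
  factors is a scalar; and the sum of p_j q_j is n minus the degree, so every lower degree is
  reached from the full row. The scalars that occur have to be invertible, which needs generic u.
  The value u = z_r is reached by rationality: a polynomial with values in a subspace at infinitely
  many points has its coefficients there. No Yang-Baxter relation is proved for the factors.\<close>

locale complex_algebra =
  fixes scl :: "complex \<Rightarrow> 'r::ring_1 \<Rightarrow> 'r" (infixr "\<star>" 75)
  assumes scl_right_distrib: "a \<star> (x + y) = a \<star> x + a \<star> y"
    and scl_left_distrib: "(a + b) \<star> x = a \<star> x + b \<star> x"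
    and scl_scl: "a \<star> b \<star> x = (a * b) \<star> x"
    and scl_one: "1 \<star> x = x"
    and scl_mult_left: "(a \<star> x) * y = a \<star> (x * y)"
    and scl_mult_right: "x * (a \<star> y) = a \<star> (x * y)"
begin

lemma scl_zero_left [simp]: "0 \<star> x = 0"
  using scl_left_distrib[of 0 0 x] by simp

lemma scl_zero_right [simp]: "a \<star> 0 = 0"
  using scl_right_distrib[of a 0 0] by simp

lemma scl_minus_left: "(- a) \<star> x = - (a \<star> x)"
proof -
  have "(- a) \<star> x + a \<star> x = 0"
    by (simp add: scl_left_distrib[symmetric])
  then show ?thesis by (simp add: add_eq_0_iff2)
qed

lemma scl_minus_right: "a \<star> (- x) = - (a \<star> x)"
proof -
  have "a \<star> (- x) + a \<star> x = 0"
    by (simp add: scl_right_distrib[symmetric])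
  then show ?thesis by (simp add: add_eq_0_iff2)
qed

lemma scl_diff_left: "(a - b) \<star> x = a \<star> x - b \<star> x"
  using scl_left_distrib[of a "- b" x] by (simp add: scl_minus_left)

lemma scl_diff_right: "a \<star> (x - y) = a \<star> x - a \<star> y"
  using scl_right_distrib[of a x "- y"] by (simp add: scl_minus_right)

lemma scl_sum: "a \<star> (\<Sum>i\<in>S. f i) = (\<Sum>i\<in>S. a \<star> f i)"
  by (induction S rule: infinite_finite_induct) (simp_all add: scl_right_distrib)

lemmas scl_simps = scl_scl scl_one scl_mult_left scl_mult_right
  scl_right_distrib scl_diff_right scl_minus_right

lemma scl_numerals:
  "2 \<star> x = x + x" "(a * 2) \<star> x = a \<star> x + a \<star> x" "(a * (b * 2)) \<star> x = (a * b) \<star> x + (a * b) \<star> x"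
  "3 \<star> x = x + x + x" "(a * 3) \<star> x = a \<star> x + a \<star> x + a \<star> x" "(- 1) \<star> x = - x"
  "4 \<star> x = x + x + x + x"
proof -
  have 2: "2 \<star> x = x + x" for x
    using scl_left_distrib[of 1 1 x] by (simp add: scl_one)
  have 3: "3 \<star> x = x + x + x" for x
    using scl_left_distrib[of 2 1 x] by (simp add: scl_one 2)
  show "2 \<star> x = x + x" "(a * 2) \<star> x = a \<star> x + a \<star> x" "(a * (b * 2)) \<star> x = (a * b) \<star> x + (a * b) \<star> x"
    "3 \<star> x = x + x + x" "(a * 3) \<star> x = a \<star> x + a \<star> x + a \<star> x"
    using 2 3 scl_scl[of a 2 x] scl_scl[of "a * b" 2 x] scl_scl[of a 3 x]
    by (simp_all add: scl_right_distrib mult.assoc)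
  show "(- 1) \<star> x = - x" by (simp add: scl_minus_left scl_one)
  show "4 \<star> x = x + x + x + x"
    using scl_left_distrib[of 3 1 x] by (simp add: scl_one 3)
qed

lemmas scl_nf = scl_simps scl_left_distrib scl_diff_left scl_minus_left scl_numerals

lemma scl_cong: "a = b \<Longrightarrow> a \<star> x = b \<star> x"
  by simp

lemma scl_eq_0: "a \<star> x = 0 \<Longrightarrow> a \<noteq> 0 \<Longrightarrow> x = 0"
  using scl_scl[of "inverse a" a x] by (simp add: scl_one)

end

text \<open>The coefficients of X and Y with \<open>t\<close> equal to kap_b - kap_a, so that 1 - t
  is the kap_a - kap_b + 1 of the Pochhammer symbol. The r-th one has its poles at t = 1, ...,
  r.\<close>

definition rcoef :: "complex \<Rightarrow> nat \<Rightarrow> complex" where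
  "rcoef t r = (-1) ^ r / (fact r * pochhammer (1 - t) r)"

lemma rcoef_0 [simp]: "rcoef t 0 = 1"
  by (simp add: rcoef_def)

text \<open>A factor r (t - r) appears when an operator is moved through the r-th term of a series;
  by this recurrence the r-th contribution cancels the one left over at r - 1.\<close>

lemma rcoef_Suc:
  assumes "t \<noteq> of_nat (Suc r)"
  shows "of_nat (Suc r) * (t - of_nat (Suc r)) * rcoef t (Suc r) = rcoef t r"
proof -
  have 1: "1 - t + of_nat r \<noteq> 0"
    using assms by (auto simp: algebra_simps)
  have "rcoef t (Suc r) = - rcoef t r / (of_nat (Suc r) * (1 - t + of_nat r))"
    by (simp add: rcoef_def pochhammer_Suc divide_inverse del: of_nat_Suc)
  also have "of_nat (Suc r) * (t - of_nat (Suc r)) * \<dots> =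
      (of_nat (Suc r) * (1 - t + of_nat r)) * (rcoef t r / (of_nat (Suc r) * (1 - t + of_nat r)))"
    by (simp add: algebra_simps del: times_divide_eq_right times_divide_eq_left)
  also have "\<dots> = rcoef t r"
    using 1 by (simp del: of_nat_Suc)
  finally show ?thesis .
qed

text \<open>The symbols (1 - t)_r and (-t)_r share all factors but one at each end, so the
  coefficients at t and t + 1 agree up to linear factors. The relations for Y compare these two
  parameters.\<close>

lemma rcoef_shift:
  assumes "\<forall>k\<le>r. t \<noteq> of_nat k"
  shows "t * rcoef (t + 1) r = (t - of_nat r) * rcoef t r"
  using assms
proof (induction r)
  case (Suc r)
  have t: "t \<noteq> of_nat (Suc r)" "t \<noteq> of_nat r"
    using Suc.prems by auto
  have "of_nat (Suc r) * (t + 1 - of_nat (Suc r)) * rcoef (t + 1) (Suc r) = rcoef (t + 1) r"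
    by (rule rcoef_Suc) (use t in \<open>auto simp: algebra_simps\<close>)
  then have "of_nat (Suc r) * (t - of_nat r) * (t * rcoef (t + 1) (Suc r)) = t * rcoef (t + 1) r"
    by (simp add: algebra_simps)
  also have "\<dots> = (t - of_nat r) * rcoef t r"
    using Suc by simp
  also have "\<dots> = (t - of_nat r) * (of_nat (Suc r) * (t - of_nat (Suc r)) * rcoef t (Suc r))"
    using rcoef_Suc[OF t(1)] by simp
  finally have "(of_nat (Suc r) * (t - of_nat r)) * (t * rcoef (t + 1) (Suc r)) =
      (of_nat (Suc r) * (t - of_nat r)) * ((t - of_nat (Suc r)) * rcoef t (Suc r))"
    by (simp add: mult_ac)
  then show ?case
    using t by (subst (asm) mult_cancel_left) (auto simp del: of_nat_Suc)
qed auto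

lemma rcoef_shift_Suc:
  assumes "\<forall>k\<le>r. t \<noteq> of_nat k"
  shows "of_nat (Suc r) * (t * rcoef (t + 1) (Suc r)) = rcoef t r"
proof -
  have t: "t \<noteq> of_nat r" using assms by auto
  have "of_nat (Suc r) * (t + 1 - of_nat (Suc r)) * rcoef (t + 1) (Suc r) = rcoef (t + 1) r"
    by (rule rcoef_Suc) (use t in \<open>auto simp: algebra_simps\<close>)
  then have "of_nat (Suc r) * (t - of_nat r) * (t * rcoef (t + 1) (Suc r)) = t * rcoef (t + 1) r"
    by (simp add: algebra_simps)
  also have "\<dots> = (t - of_nat r) * rcoef t r"
    using rcoef_shift[OF assms] .
  finally show ?thesis using t by (simp add: mult_ac del: of_nat_Suc)
qed

lemma rcoef_0_Suc:
  "rcoef 0 (Suc r) * of_nat (Suc r) = (-1) ^ Suc r / (fact (Suc r) * fact r)"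
proof -
  have "rcoef 0 (Suc r) = (-1) ^ Suc r / (fact (Suc r) * (of_nat (Suc r) * fact r))"
    by (simp only: rcoef_def diff_zero pochhammer_fact[symmetric] fact_Suc)
  then show ?thesis
    by (simp del: of_nat_Suc power_Suc fact_Suc)
qed

section \<open>Triples for \<open>sl2\<close> with nilpotent raising and lowering operators, and
  their two series\<close>

locale sl2 = complex_algebra where scl = scl for scl :: "complex \<Rightarrow> 'a::ring_1 \<Rightarrow> 'a" (infixr "\<star>" 75) +
  fixes A B :: 'a and R :: nat
  assumes A_nilpotent: "A ^ Suc R = 0" and B_nilpotent: "B ^ Suc R = 0"
    and HA: "(A * B - B * A) * A = A * (A * B - B * A) + 2 \<star> A"
    and HB: "(A * B - B * A) * B = B * (A * B - B * A) - 2 \<star> B"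
begin

definition H :: 'a where "H = A * B - B * A"

lemma AB: "A * B = B * A + H"
  by (simp add: H_def)

lemma H_pow_A: "H * A ^ r = A ^ r * H + (2 * of_nat r) \<star> A ^ r"
proof (induction r)
  case (Suc r)
  have "H * A ^ Suc r = (H * A) * A ^ r"
    by (simp add: mult.assoc)
  also have "H * A = A * H + 2 \<star> A"
    using HA by (simp add: H_def)
  also have "(A * H + 2 \<star> A) * A ^ r = A * (H * A ^ r) + 2 \<star> A ^ Suc r"
    by (simp add: distrib_right scl_mult_left mult.assoc)
  also have "\<dots> = A ^ Suc r * H + (2 * of_nat (Suc r)) \<star> A ^ Suc r"
    by (simp add: Suc distrib_left scl_mult_right mult.assoc scl_left_distrib algebra_simps)
  finally show ?case .
qed simp

lemma H_pow_B: "H * B ^ r = B ^ r * H - (2 * of_nat r) \<star> B ^ r"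
proof (induction r)
  case (Suc r)
  have "H * B ^ Suc r = (H * B) * B ^ r"
    by (simp add: mult.assoc)
  also have "H * B = B * H - 2 \<star> B"
    using HB by (simp add: H_def)
  also have "(B * H - 2 \<star> B) * B ^ r = B * (H * B ^ r) - 2 \<star> B ^ Suc r"
    by (simp add: left_diff_distrib scl_mult_left mult.assoc)
  also have "\<dots> = B ^ Suc r * H - (2 * of_nat (Suc r)) \<star> B ^ Suc r"
    by (simp add: Suc right_diff_distrib scl_mult_right mult.assoc scl_left_distrib algebra_simps)
  finally show ?case .
qed simp

lemma A_pow_B: "A * B ^ Suc r = B ^ Suc r * A + of_nat (Suc r) \<star> (B ^ r * H)
    - (of_nat (Suc r) * of_nat r) \<star> B ^ r"
proof (induction r)
  case 0
  then show ?case by (simp add: AB scl_one)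
next
  case (Suc r)
  have "A * B ^ Suc (Suc r) = (A * B) * B ^ Suc r"
    by (simp add: mult.assoc)
  also have "\<dots> = B * (A * B ^ Suc r) + H * B ^ Suc r"
    by (simp only: AB distrib_right mult.assoc)
  also have "\<dots> = B ^ Suc (Suc r) * A + of_nat (Suc (Suc r)) \<star> (B ^ Suc r * H)
    - (of_nat (Suc (Suc r)) * of_nat (Suc r)) \<star> B ^ Suc r"
    unfolding Suc H_pow_B
    by (simp add: algebra_simps scl_nf)
  finally show ?case .
qed

lemma B_pow_A: "B * A ^ Suc r = A ^ Suc r * B - of_nat (Suc r) \<star> (A ^ r * H)
    - (of_nat (Suc r) * of_nat r) \<star> A ^ r"
proof (induction r)
  case 0
  then show ?case by (simp add: AB scl_one)
next
  case (Suc r)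
  have "B * A ^ Suc (Suc r) = (B * A) * A ^ Suc r"
    by (simp add: mult.assoc)
  also have "B * A = A * B - H"
    by (simp add: AB)
  also have "(A * B - H) * A ^ Suc r = A * (B * A ^ Suc r) - H * A ^ Suc r"
    by (simp only: left_diff_distrib mult.assoc)
  also have "\<dots> = A ^ Suc (Suc r) * B - of_nat (Suc (Suc r)) \<star> (A ^ Suc r * H)
    - (of_nat (Suc (Suc r)) * of_nat (Suc r)) \<star> A ^ Suc r"
    unfolding Suc H_pow_A
    by (simp add: algebra_simps scl_nf)
  finally show ?case .
qed

definition Yser :: "complex \<Rightarrow> 'a" where
  "Yser t = (\<Sum>r\<le>R. rcoef t r \<star> (A ^ r * B ^ r))"

definition Xser :: "complex \<Rightarrow> 'a" where
  "Xser s = (\<Sum>r\<le>R. rcoef s r \<star> (B ^ r * A ^ r))"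

text \<open>The cancellation common to the relations below: the top term of one sum dies by
  nilpotency, the bottom term of the other by a factor 0, and the rest match after a shift of the
  index.\<close>

lemma sum_shift_left:
  assumes "f R = (0 :: 'a)" "g 0 = 0" "\<And>r. r < R \<Longrightarrow> f r = g (Suc r)"
  shows "(\<Sum>r\<le>R. f r) = (\<Sum>r\<le>R. g r)"
proof -
  have "(\<Sum>r\<le>R. f r) = (\<Sum>r<R. f r)"
    using assms(1) by (simp add: lessThan_Suc_atMost[symmetric])
  also have "\<dots> = (\<Sum>r\<le>R. g r)"
    using assms by (simp add: sum.atMost_shift)
  finally show ?thesis .
qed

text \<open>\<open>A\<close> raises the weight by 2, so \<open>y\<close> would be killed by the
  lowering operator while having positive weight. \<open>B_pow_A\<close> gives B A^(i+1) y =
  -(i+1)(k+i) A^i y with a nonzero factor, and so the vanishing of A^(R+1) y descends to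
  \<open>y\<close>.\<close>

lemma highest_weight_eq_0:
  assumes B: "B * y = 0" and H: "H * y = of_nat k \<star> y" and k: "k > 0"
  shows "y = 0"
proof -
  have "A ^ (Suc R - j) * y = 0" if "j \<le> Suc R" for j
    using that
  proof (induction j)
    case 0
    then show ?case using A_nilpotent by simp
  next
    case (Suc j)
    let ?i = "Suc R - Suc j"
    have i: "Suc R - j = Suc ?i"
      using Suc.prems by auto
    have "A ^ Suc ?i * y = 0"
      using Suc i by simp
    then have "0 = B * A ^ Suc ?i * y"
      by (metis mult.assoc mult_zero_right)
    also have "\<dots> = A ^ Suc ?i * (B * y) - of_nat (Suc ?i) \<star> (A ^ ?i * (H * y))
        - (of_nat (Suc ?i) * of_nat ?i) \<star> (A ^ ?i * y)"
      unfolding B_pow_A by (simp only: left_diff_distrib mult.assoc scl_mult_left)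
    also have "\<dots> = (- (of_nat (Suc ?i) * of_nat (k + ?i))) \<star> (A ^ ?i * y)"
      unfolding B H
      by (simp add: scl_nf algebra_simps)
    finally have "(- (of_nat (Suc ?i) * of_nat (k + ?i))) \<star> (A ^ ?i * y) = 0"
      by simp
    then show ?case
      by (rule scl_eq_0) (use k in \<open>simp del: of_nat_Suc of_nat_add\<close>)
  qed
  from this[of "Suc R"] show ?thesis by simp
qed

text \<open>On weight 1, moving \<open>B\<close> through A^r yields exactly the factor r^2 of the
  recurrence at t = 0, so the terms of B (Yser 0) v cancel. The vector Yser 0 v is then killed by
  \<open>B\<close> and has weight 1, hence vanishes.\<close>

lemma Yser_0_weight_1:
  assumes H: "H * v = v"
  shows "Yser 0 * v = 0"
proof -
  let ?c = "rcoef 0"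
  have HB: "H * B ^ r * v = (1 - 2 * of_nat r) \<star> (B ^ r * v)" for r
    by (simp add: H_pow_B left_diff_distrib mult.assoc H scl_mult_left scl_diff_left scl_one)
  have "B * Yser 0 * v = (\<Sum>r\<le>R. ?c r \<star> (B * A ^ r * B ^ r * v))"
    by (simp add: Yser_def sum_distrib_left sum_distrib_right scl_simps mult.assoc)
  also have "\<dots> = (\<Sum>r\<le>R. ?c r \<star> (A ^ r * B ^ Suc r * v) +
      (?c r * of_nat r ^ 2) \<star> (A ^ (r - 1) * B ^ r * v))"
  proof (rule sum.cong)
    fix r
    show "?c r \<star> (B * A ^ r * B ^ r * v) = ?c r \<star> (A ^ r * B ^ Suc r * v) +
      (?c r * of_nat r ^ 2) \<star> (A ^ (r - 1) * B ^ r * v)"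
    proof (cases r)
      case (Suc k)
      have "B * A ^ Suc k * B ^ Suc k * v = A ^ Suc k * B ^ Suc (Suc k) * v
        - of_nat (Suc k) \<star> (A ^ k * (H * B ^ Suc k * v))
        - (of_nat (Suc k) * of_nat k) \<star> (A ^ k * B ^ Suc k * v)"
        unfolding B_pow_A by (simp add: left_diff_distrib scl_mult_left mult.assoc)
      also have "\<dots> = A ^ Suc k * B ^ Suc (Suc k) * v
        + (of_nat (Suc k) ^ 2) \<star> (A ^ k * B ^ Suc k * v)"
        unfolding HB
        by (simp add: power2_eq_square algebra_simps scl_nf)
      finally show ?thesis
        unfolding Suc by (simp add: scl_simps del: power_Suc of_nat_Suc)
    qed simp
  qed simp
  also have "\<dots> = 0"
  proof -
    have "(\<Sum>r\<le>R. ?c r \<star> (A ^ r * B ^ Suc r * v)) =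
      (\<Sum>r\<le>R. - ((?c r * of_nat r ^ 2) \<star> (A ^ (r - 1) * B ^ r * v)))"
    proof (rule sum_shift_left)
      show "?c R \<star> (A ^ R * B ^ Suc R * v) = 0"
        unfolding B_nilpotent by simp
      fix r
      have "of_nat (Suc r) * (0 - of_nat (Suc r)) * ?c (Suc r) = ?c r"
        by (rule rcoef_Suc) (simp only: of_nat_eq_0_iff eq_commute[of 0]; simp)
      then have "?c r = - (?c (Suc r) * of_nat (Suc r) ^ 2)"
        by (simp add: power2_eq_square algebra_simps)
      then show "?c r \<star> (A ^ r * B ^ Suc r * v) =
         - ((?c (Suc r) * of_nat (Suc r) ^ 2) \<star> (A ^ (Suc r - 1) * B ^ Suc r * v))"
        by (simp add: scl_minus_left del: power_Suc of_nat_Suc)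
    qed simp
    then show ?thesis
      by (simp add: sum.distrib sum_negf del: power_Suc)
  qed
  finally have "B * (Yser 0 * v) = 0"
    by (simp add: mult.assoc)
  moreover have "H * (Yser 0 * v) = of_nat 1 \<star> (Yser 0 * v)"
  proof -
    have "H * (A ^ r * B ^ r * v) = A ^ r * B ^ r * v" for r
    proof -
      have "H * (A ^ r * B ^ r * v) = (H * A ^ r) * (B ^ r * v)"
        by (simp add: mult.assoc)
      also have "\<dots> = A ^ r * (H * B ^ r * v) + (2 * of_nat r) \<star> (A ^ r * B ^ r * v)"
        unfolding H_pow_A by (simp add: distrib_right scl_mult_left mult.assoc)
      finally show ?thesis
        unfolding HB by (simp add: scl_nf algebra_simps)
    qed
    then show ?thesis
      by (simp add: Yser_def sum_distrib_left sum_distrib_right scl_simps mult.assoc)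
  qed
  ultimately show ?thesis
    by (rule highest_weight_eq_0) simp
qed

text \<open>Only the term r = 0 survives. Through this normalisation of the two series the product Z
  fixes an extremal vector.\<close>

lemma Yser_lowest: "B * v = 0 \<Longrightarrow> Yser t * v = v"
proof -
  assume B: "B * v = 0"
  have "rcoef t r \<star> (A ^ r * B ^ r * v) = (if r = 0 then v else 0)" for r
    using B by (cases r) (simp_all add: mult.assoc power_Suc2 scl_one del: power_Suc)
  then show ?thesis
    by (simp add: Yser_def sum_distrib_right scl_mult_left)
qed

lemma Xser_lowest: "A * v = 0 \<Longrightarrow> Xser t * v = v"
proof -
  assume A: "A * v = 0"
  have "rcoef t r \<star> (B ^ r * A ^ r * v) = (if r = 0 then v else 0)" for r
    using A by (cases r) (simp_all add: mult.assoc power_Suc2 scl_one del: power_Suc)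
  then show ?thesis
    by (simp add: Xser_def sum_distrib_right scl_mult_left)
qed

text \<open>\<open>B\<close> undoes one power of \<open>A\<close> at a time up to a factor, so each
  B^r A^r acts on \<open>v\<close> by a scalar. Used when the auxiliary row is full: the vector then
  has to stay on its line.\<close>

lemma Xser_highest:
  assumes B: "B * v = 0" and H: "H * v = h \<star> v"
  shows "\<exists>c. Xser s * v = c \<star> v"
proof -
  have BA: "\<exists>c. B * (A ^ Suc r * v) = c \<star> (A ^ r * v)" for r
  proof -
    have "B * (A ^ Suc r * v) = A ^ Suc r * (B * v) - of_nat (Suc r) \<star> (A ^ r * (H * v))
        - (of_nat (Suc r) * of_nat r) \<star> (A ^ r * v)"
      unfolding mult.assoc[symmetric] B_pow_A
      by (simp only: left_diff_distrib mult.assoc scl_mult_left)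
    also have "\<dots> = (- of_nat (Suc r) * h - of_nat (Suc r) * of_nat r) \<star> (A ^ r * v)"
      unfolding B H by (simp add: scl_nf algebra_simps)
    finally show ?thesis by blast
  qed
  have BA: "\<exists>c. B ^ r * A ^ r * v = c \<star> v" for r
  proof (induction r)
    case 0
    then show ?case by (metis mult_1 power_0 scl_one)
  next
    case (Suc r)
    obtain c where "B * (A ^ Suc r * v) = c \<star> (A ^ r * v)" using BA by blast
    then have "B ^ Suc r * A ^ Suc r * v = c \<star> (B ^ r * A ^ r * v)"
      by (simp add: power_Suc2 mult.assoc scl_simps del: power_Suc)
    then show ?case using Suc by (metis scl_scl)
  qed
  then obtain c where "\<And>r. B ^ r * A ^ r * v = c r \<star> v" by metis
  then have "Xser s * v = (\<Sum>r\<le>R. rcoef s r * c r) \<star> v"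
    by (simp add: Xser_def sum_distrib_right scl_simps)
      (induction R; simp add: scl_left_distrib)
  then show ?thesis by blast
qed

end

text \<open>Commutation with \<open>A\<close> and \<open>B\<close> makes \<open>P0\<close> and
  \<open>P1\<close> span a two-dimensional representation. In the application A = D x y, B = D y x,
  P0 = p y j and P1 = p x j.\<close>

locale doublet = sl2 where scl = scl for scl :: "complex \<Rightarrow> 'a::ring_1 \<Rightarrow> 'a" (infixr "\<star>" 75) +
  fixes P0 P1 :: 'a
  assumes P0A: "P0 * A = A * P0" and P1A: "P1 * A = A * P1 + P0"
    and P0B: "P0 * B = B * P0 + P1" and P1B: "P1 * B = B * P1"
begin

lemma P0_pow_A: "P0 * A ^ r = A ^ r * P0"
  by (induction r) (simp_all add: mult.assoc[symmetric] P0A, simp add: mult.assoc)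

lemma P1_pow_B: "P1 * B ^ r = B ^ r * P1"
  by (induction r) (simp_all add: mult.assoc[symmetric] P1B, simp add: mult.assoc)

lemma P1_pow_A: "P1 * A ^ r = A ^ r * P1 + of_nat r \<star> (A ^ (r - 1) * P0)"
proof (induction r)
  case (Suc r)
  have "P1 * A ^ Suc r = A * (P1 * A ^ r) + P0 * A ^ r"
    by (simp add: mult.assoc[symmetric] P1A distrib_right)
  also have "\<dots> = A ^ Suc r * P1 + of_nat (Suc r) \<star> (A ^ r * P0)"
    unfolding Suc P0_pow_A
    by (cases r) (simp_all add: algebra_simps scl_nf)
  finally show ?case by simp
qed simp

lemma P0_pow_B: "P0 * B ^ r = B ^ r * P0 + of_nat r \<star> (B ^ (r - 1) * P1)"
proof (induction r)
  case (Suc r)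
  have "P0 * B ^ Suc r = B * (P0 * B ^ r) + P1 * B ^ r"
    by (simp add: mult.assoc[symmetric] P0B distrib_right)
  also have "\<dots> = B ^ Suc r * P0 + of_nat (Suc r) \<star> (B ^ r * P1)"
    unfolding Suc P1_pow_B
    by (cases r) (simp_all add: algebra_simps scl_nf)
  finally show ?case by simp
qed simp

lemma HP0: "H * P0 = P0 * H + P0"
proof -
  have "P0 * (A * B) = A * B * P0 + A * P1"
    by (simp only: mult.assoc[symmetric] P0A) (simp add: mult.assoc P0B distrib_left)
  moreover have "P0 * (B * A) = B * A * P0 + A * P1 + P0"
    by (simp only: mult.assoc[symmetric] P0B distrib_right)
      (simp add: mult.assoc P0A P1A distrib_left)
  ultimately show ?thesis by (simp add: H_def algebra_simps)
qed

lemma HP1: "H * P1 = P1 * H - P1"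
proof -
  have "P1 * (A * B) = A * B * P1 + B * P0 + P1"
    by (simp only: mult.assoc[symmetric] P1A distrib_right)
      (simp add: mult.assoc P0B P1B distrib_left)
  moreover have "P1 * (B * A) = B * A * P1 + B * P0"
    by (simp only: mult.assoc[symmetric] P1B) (simp add: mult.assoc P1A distrib_left)
  ultimately show ?thesis by (simp add: H_def algebra_simps)
qed

text \<open>Moving \<open>P1\<close> through A^r turns the coefficient of the terms with
  \<open>P0\<close> into t - r, which \<open>rcoef_shift\<close> converts to the parameter t + 1.
  The terms with \<open>P1\<close> are what \<open>P0\<close> leaves behind on its way to the right
  of B^r.\<close>

lemma Yser_P:
  assumes t: "\<forall>k\<le>R. t \<noteq> of_nat k"
  shows "(t \<star> P0 - A * P1) * Yser t = t \<star> (Yser (t + 1) * P0)"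
proof -
  have 1: "(t \<star> P0 - A * P1) * (A ^ r * B ^ r) =
      (t - of_nat r) \<star> (A ^ r * P0 * B ^ r) - A ^ Suc r * P1 * B ^ r" for r
  proof -
    have "P0 * (A ^ r * B ^ r) = A ^ r * P0 * B ^ r"
      by (simp add: mult.assoc[symmetric] P0_pow_A)
    moreover have "A * P1 * (A ^ r * B ^ r) = A * (P1 * A ^ r) * B ^ r"
      by (simp only: mult.assoc)
    moreover have "\<dots> = A ^ Suc r * P1 * B ^ r + of_nat r \<star> (A ^ r * P0 * B ^ r)"
      unfolding P1_pow_A by (cases r) (simp_all add: algebra_simps scl_simps)
    ultimately show ?thesis
      by (simp add: left_diff_distrib scl_mult_left scl_diff_left)
  qed
  have "(t \<star> P0 - A * P1) * Yser t = (\<Sum>r\<le>R. ((t - of_nat r) * rcoef t r) \<star> (A ^ r * P0 * B ^ r))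
      - (\<Sum>r\<le>R. rcoef t r \<star> (A ^ Suc r * P1 * B ^ r))"
    by (simp add: Yser_def sum_distrib_left scl_mult_right 1 scl_diff_right scl_scl
        sum_subtractf mult_ac del: power_Suc)
  also have "(\<Sum>r\<le>R. rcoef t r \<star> (A ^ Suc r * P1 * B ^ r)) =
      (\<Sum>r\<le>R. (of_nat r * (t * rcoef (t + 1) r)) \<star> (A ^ r * P1 * B ^ (r - 1)))"
  proof (rule sum_shift_left)
    show "rcoef t R \<star> (A ^ Suc R * P1 * B ^ R) = 0"
      unfolding A_nilpotent by simp
    fix r assume "r < R"
    then have "of_nat (Suc r) * (t * rcoef (t + 1) (Suc r)) = rcoef t r"
      using t by (intro rcoef_shift_Suc) auto
    then show "rcoef t r \<star> (A ^ Suc r * P1 * B ^ r) =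
        (of_nat (Suc r) * (t * rcoef (t + 1) (Suc r))) \<star> (A ^ Suc r * P1 * B ^ (Suc r - 1))"
      by simp
  qed simp
  also have "(\<Sum>r\<le>R. ((t - of_nat r) * rcoef t r) \<star> (A ^ r * P0 * B ^ r)) =
      (\<Sum>r\<le>R. (t * rcoef (t + 1) r) \<star> (A ^ r * P0 * B ^ r))"
    using t by (intro sum.cong refl) (simp add: rcoef_shift)
  finally have *: "(t \<star> P0 - A * P1) * Yser t = (\<Sum>r\<le>R. (t * rcoef (t + 1) r) \<star> (A ^ r * P0 * B ^ r))
     - (\<Sum>r\<le>R. (of_nat r * (t * rcoef (t + 1) r)) \<star> (A ^ r * P1 * B ^ (r - 1)))" .
  have "A ^ r * B ^ r * P0 = A ^ r * P0 * B ^ r - of_nat r \<star> (A ^ r * P1 * B ^ (r - 1))" for r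
    using P0_pow_B[of r] P1_pow_B[of "r - 1"]
    by (simp add: mult.assoc distrib_left scl_mult_right)
  then show ?thesis
    unfolding *
    by (simp add: Yser_def sum_distrib_right scl_mult_left scl_sum scl_scl scl_diff_right
        sum_subtractf mult_ac)
qed

text \<open>Moving \<open>A\<close> through B^r produces \<open>H\<close>, so the relation is one on
  weight vectors with \<open>t\<close> tied to the weight. The parameter \<open>s\<close> does not
  move: \<open>P0\<close> raises the weight by one, hence the t + 1 on the right.\<close>

lemma Xser_P:
  assumes s: "\<forall>k. 1 \<le> k \<and> k \<le> R \<longrightarrow> s \<noteq> of_nat k" and H: "H * v = h \<star> v" and t: "t = s + h"
  shows "(t \<star> P0 - A * P1) * Xser s * v = (t + 1) \<star> (Xser s * P0 * v)"
proof -
  have HA: "H * (A ^ r * v) = (h + 2 * of_nat r) \<star> (A ^ r * v)" for r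
    by (simp add: mult.assoc[symmetric] H_pow_A distrib_right)
      (simp add: mult.assoc H scl_simps scl_left_distrib)
  have HPA: "H * (P1 * A ^ r * v) = (h + 2 * of_nat r - 1) \<star> (P1 * A ^ r * v)" for r
  proof -
    have "H * (P1 * A ^ r * v) = P1 * (H * (A ^ r * v)) - P1 * A ^ r * v"
      by (simp add: mult.assoc[symmetric] HP1 left_diff_distrib)
    then show ?thesis
      unfolding HA by (simp add: scl_nf algebra_simps)
  qed
  have 1: "(t \<star> P0 - A * P1) * (B ^ r * A ^ r) * v =
      (t + 1) \<star> (B ^ r * A ^ r * P0 * v) - B ^ r * P1 * A ^ Suc r * v
      + (of_nat r * (s - of_nat r)) \<star> (B ^ (r - 1) * P1 * A ^ r * v)" for r
  proof -
    have 2: "P0 * (B ^ r * A ^ r) * v = B ^ r * A ^ r * P0 * v + of_nat r \<star> (B ^ (r - 1) * P1 * A ^ r * v)"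
      by (simp add: mult.assoc[symmetric] P0_pow_B distrib_right)
        (simp add: mult.assoc scl_simps, simp add: mult.assoc[symmetric], simp add: mult.assoc P0_pow_A)
    have "A * P1 * (B ^ r * A ^ r) * v = A * B ^ r * (P1 * A ^ r * v)"
      by (simp add: mult.assoc[symmetric]) (simp add: mult.assoc P1_pow_B)
    also have "\<dots> = B ^ r * A * P1 * A ^ r * v
        + (of_nat r * (h + of_nat r)) \<star> (B ^ (r - 1) * P1 * A ^ r * v)"
    proof (cases r)
      case (Suc k)
      show ?thesis
        unfolding Suc A_pow_B
        apply (simp only: distrib_right left_diff_distrib scl_mult_left mult.assoc)
        apply (simp only: mult.assoc[symmetric])
        apply (simp only: mult.assoc[of _ _ v] mult.assoc[of _ _ "A ^ _ * v"])
        apply (simp only: mult.assoc[symmetric, of P1])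
        using HPA[of "Suc k"]
        apply (simp add: mult.assoc scl_simps del: power_Suc)
        apply (simp add: scl_diff_left[symmetric] scl_left_distrib[symmetric] add_diff_eq[symmetric] del: power_Suc)
        apply (rule scl_cong)
        apply (simp add: algebra_simps)
        done
    qed (simp add: mult.assoc)
    also have "B ^ r * A * P1 * A ^ r * v = B ^ r * P1 * A ^ Suc r * v - B ^ r * A ^ r * P0 * v"
    proof -
      have "B ^ r * A * P1 * A ^ r * v = B ^ r * (P1 * A - P0) * A ^ r * v"
        by (simp only: P1A mult.assoc add_diff_cancel_right')
      also have "\<dots> = B ^ r * P1 * A ^ Suc r * v - B ^ r * (P0 * A ^ r) * v"
        by (simp add: algebra_simps)
      finally show ?thesis by (simp add: P0_pow_A mult.assoc)
    qed
    finally show ?thesis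
      using 2 by (simp add: left_diff_distrib scl_simps scl_left_distrib t algebra_simps scl_diff_left)
  qed
  have "(t \<star> P0 - A * P1) * Xser s * v = (\<Sum>r\<le>R. rcoef s r \<star> ((t \<star> P0 - A * P1) * (B ^ r * A ^ r) * v))"
    by (simp add: Xser_def sum_distrib_left sum_distrib_right scl_simps)
  also have "\<dots> = (\<Sum>r\<le>R. (t + 1) \<star> rcoef s r \<star> (B ^ r * A ^ r * P0 * v))
     - (\<Sum>r\<le>R. rcoef s r \<star> (B ^ r * P1 * A ^ Suc r * v))
     + (\<Sum>r\<le>R. (of_nat r * (s - of_nat r) * rcoef s r) \<star> (B ^ (r - 1) * P1 * A ^ r * v))"
    unfolding 1 by (simp add: scl_simps sum.distrib sum_subtractf mult_ac del: power_Suc)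
  also have "(\<Sum>r\<le>R. rcoef s r \<star> (B ^ r * P1 * A ^ Suc r * v)) =
     (\<Sum>r\<le>R. (of_nat r * (s - of_nat r) * rcoef s r) \<star> (B ^ (r - 1) * P1 * A ^ r * v))"
  proof (rule sum_shift_left)
    show "rcoef s R \<star> (B ^ R * P1 * A ^ Suc R * v) = 0"
      unfolding A_nilpotent by simp
    fix r assume "r < R"
    then have "of_nat (Suc r) * (s - of_nat (Suc r)) * rcoef s (Suc r) = rcoef s r"
      using s[rule_format, of "Suc r"] by (intro rcoef_Suc) auto
    then show "rcoef s r \<star> (B ^ r * P1 * A ^ Suc r * v) = (of_nat (Suc r) * (s - of_nat (Suc r)) *
        rcoef s (Suc r)) \<star> (B ^ (Suc r - 1) * P1 * A ^ Suc r * v)"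
      by (simp del: power_Suc)
  qed simp
  finally show ?thesis
    by (simp add: Xser_def sum_distrib_left sum_distrib_right scl_simps mult.assoc scl_sum)
qed

text \<open>The coefficient that \<open>P1\<close> acquires when \<open>P0\<close> passes
  \<open>Yser 0\<close>. It takes the place of \<open>Yser_P\<close>, which excludes t = 0.\<close>

definition Vser :: 'a where
  "Vser = (\<Sum>r\<le>R. ((-1) ^ Suc r / (fact (Suc r) * fact r)) \<star> (A ^ Suc r * B ^ r))"

lemma P0_Yser_0: "P0 * Yser 0 = Yser 0 * P0 + Vser * P1"
proof -
  have 1: "P0 * (A ^ r * B ^ r) = A ^ r * B ^ r * P0 + of_nat r \<star> (A ^ r * B ^ (r - 1) * P1)" for r
  proof -
    have "P0 * (A ^ r * B ^ r) = A ^ r * (P0 * B ^ r)"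
      by (simp add: mult.assoc[symmetric] P0_pow_A)
    then show ?thesis unfolding P0_pow_B by (simp add: algebra_simps scl_simps)
  qed
  have "P0 * Yser 0 = Yser 0 * P0 + (\<Sum>r\<le>R. (rcoef 0 r * of_nat r) \<star> (A ^ r * B ^ (r - 1) * P1))"
    by (simp add: Yser_def sum_distrib_left sum_distrib_right scl_simps 1 sum.distrib)
  also have "(\<Sum>r\<le>R. (rcoef 0 r * of_nat r) \<star> (A ^ r * B ^ (r - 1) * P1)) = Vser * P1"
    unfolding Vser_def sum_distrib_right scl_mult_left
  proof (rule sum_shift_left[symmetric])
    show "((-1) ^ Suc R / (fact (Suc R) * fact R)) \<star> (A ^ Suc R * B ^ R * P1) = 0"
      unfolding A_nilpotent by simp
    show "((-1) ^ Suc r / (fact (Suc r) * fact r)) \<star> (A ^ Suc r * B ^ r * P1) =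
       (rcoef 0 (Suc r) * of_nat (Suc r)) \<star> (A ^ Suc r * B ^ (Suc r - 1) * P1)" for r
      by (simp only: rcoef_0_Suc diff_Suc_1)
  qed simp
  finally show ?thesis .
qed

text \<open>The way back from \<open>Vser\<close> to \<open>Yser 0\<close>. Chained after
  \<open>P0_Yser_0\<close>, with two doublets coming from two columns, it carries a pair of
  operators through \<open>Yser 0\<close> with the rows exchanged.\<close>

lemma P1_Vser: "P1 * Vser = - (Yser 0 * P0)"
proof -
  let ?v = "\<lambda>r. (-1) ^ Suc r / (fact (Suc r) * fact r) :: complex"
  have 1: "P1 * (A ^ Suc r * B ^ r) = A ^ Suc r * B ^ r * P1 + of_nat (Suc r) \<star> (A ^ r * B ^ r * P0)
      + (of_nat (Suc r) * of_nat r) \<star> (A ^ r * B ^ (r - 1) * P1)" for r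
  proof -
    have "P1 * (A ^ Suc r * B ^ r) = A ^ Suc r * (P1 * B ^ r) + of_nat (Suc r) \<star> (A ^ r * (P0 * B ^ r))"
      unfolding mult.assoc[symmetric] P1_pow_A by (simp add: algebra_simps scl_simps)
    then show ?thesis unfolding P0_pow_B P1_pow_B by (simp add: algebra_simps scl_simps)
  qed
  have "P1 * Vser = Vser * P1 + (\<Sum>r\<le>R. (?v r * of_nat (Suc r)) \<star> (A ^ r * B ^ r * P0))
     + (\<Sum>r\<le>R. (?v r * (of_nat (Suc r) * of_nat r)) \<star> (A ^ r * B ^ (r - 1) * P1))"
    unfolding Vser_def sum_distrib_left sum_distrib_right scl_mult_left scl_mult_right 1
    by (simp add: scl_right_distrib scl_scl sum.distrib del: power_Suc of_nat_Suc fact_Suc)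
  also have "(\<Sum>r\<le>R. (?v r * of_nat (Suc r)) \<star> (A ^ r * B ^ r * P0)) = - (Yser 0 * P0)"
    unfolding Yser_def sum_distrib_right sum_negf[symmetric] scl_mult_left scl_minus_left[symmetric]
  proof (intro sum.cong refl scl_cong)
    fix r
    have "?v r * of_nat (Suc r) = - ((-1) ^ r / (fact r * fact r))"
      unfolding fact_Suc by (simp del: of_nat_Suc)
    then show "?v r * of_nat (Suc r) = - rcoef 0 r"
      by (simp only: rcoef_def diff_zero pochhammer_fact[symmetric])
  qed
  also have "(\<Sum>r\<le>R. (?v r * (of_nat (Suc r) * of_nat r)) \<star> (A ^ r * B ^ (r - 1) * P1)) = - (Vser * P1)"
    unfolding Vser_def sum_distrib_right sum_negf[symmetric] scl_mult_left scl_minus_left[symmetric]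
  proof (rule sum_shift_left[symmetric])
    show "(- ?v R) \<star> (A ^ Suc R * B ^ R * P1) = 0"
      unfolding A_nilpotent by simp
    show "(- ?v r) \<star> (A ^ Suc r * B ^ r * P1) = (?v (Suc r) * (of_nat (Suc (Suc r)) * of_nat (Suc r)))
        \<star> (A ^ Suc r * B ^ (Suc r - 1) * P1)" for r
    proof -
      have "- ?v r = ?v (Suc r) * (of_nat (Suc (Suc r)) * of_nat (Suc r))"
        unfolding fact_Suc[of "Suc r"] fact_Suc[of r] by (simp del: of_nat_Suc)
      then show ?thesis by simp
    qed
  qed simp
  finally show ?thesis by simp
qed

end

text \<open>\<open>Q0\<close> and \<open>Q1\<close> form the dual doublet. No relation between the Q
  and the P is assumed: the series is carried past the Q on one side of a product and past the P on
  the other.\<close>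

locale double_doublet = doublet where scl = scl for scl :: "complex \<Rightarrow> 'a::ring_1 \<Rightarrow> 'a" (infixr "\<star>" 75) +
  fixes Q0 Q1 :: 'a
  assumes AQ0: "A * Q0 = Q0 * A + Q1" and AQ1: "A * Q1 = Q1 * A"
    and BQ0: "B * Q0 = Q0 * B" and BQ1: "B * Q1 = Q1 * B + Q0"
begin

lemma pow_A_Q1: "A ^ r * Q1 = Q1 * A ^ r"
  by (induction r) (simp_all add: mult.assoc, simp_all add: mult.assoc[symmetric] AQ1)

lemma pow_B_Q0: "B ^ r * Q0 = Q0 * B ^ r"
  by (induction r) (simp_all add: mult.assoc, simp_all add: mult.assoc[symmetric] BQ0)

lemma pow_A_Q0: "A ^ r * Q0 = Q0 * A ^ r + of_nat r \<star> (Q1 * A ^ (r - 1))"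
proof (induction r)
  case (Suc r)
  have "A ^ Suc r * Q0 = (A ^ r * Q0) * A + A ^ r * Q1"
    unfolding power_Suc2 mult.assoc AQ0 by (simp add: distrib_left)
  also have "\<dots> = Q0 * A ^ Suc r + of_nat (Suc r) \<star> (Q1 * A ^ r)"
    unfolding Suc pow_A_Q1
    by (cases r) (simp_all add: algebra_simps scl_nf power_commutes)
  finally show ?case by simp
qed simp

lemma pow_B_Q1: "B ^ r * Q1 = Q1 * B ^ r + of_nat r \<star> (Q0 * B ^ (r - 1))"
proof (induction r)
  case (Suc r)
  have "B ^ Suc r * Q1 = (B ^ r * Q1) * B + B ^ r * Q0"
    unfolding power_Suc2 mult.assoc BQ1 by (simp add: distrib_left)
  also have "\<dots> = Q1 * B ^ Suc r + of_nat (Suc r) \<star> (Q0 * B ^ r)"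
    unfolding Suc pow_B_Q0
    by (cases r) (simp_all add: algebra_simps scl_nf power_commutes)
  finally show ?case by simp
qed simp

lemma Yser_Q:
  assumes t: "\<forall>k\<le>R. t \<noteq> of_nat k"
  shows "Yser t * (t \<star> Q0 - Q1 * B) = t \<star> (Q0 * Yser (t + 1))"
proof -
  have 1: "A ^ r * B ^ r * (t \<star> Q0 - Q1 * B) = (t - of_nat r) \<star> (Q0 * A ^ r * B ^ r)
     + (of_nat r * (t - of_nat r)) \<star> (Q1 * A ^ (r - 1) * B ^ r) - Q1 * A ^ r * B ^ Suc r" for r
  proof -
    have 2: "A ^ r * B ^ r * Q0 = Q0 * A ^ r * B ^ r + of_nat r \<star> (Q1 * A ^ (r - 1) * B ^ r)"
      by (simp only: mult.assoc pow_B_Q0) (simp only: mult.assoc[symmetric] pow_A_Q0, simp add: algebra_simps scl_simps)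
    have "A ^ r * B ^ r * (Q1 * B) = A ^ r * (B ^ r * Q1) * B"
      by (simp only: mult.assoc)
    also have "\<dots> = (A ^ r * Q1) * B ^ Suc r + of_nat r \<star> ((A ^ r * Q0) * B ^ r)"
      unfolding pow_B_Q1
      by (cases r) (simp_all add: algebra_simps scl_simps power_commutes)
    also have "\<dots> = Q1 * A ^ r * B ^ Suc r + of_nat r \<star> (Q0 * A ^ r * B ^ r)
        + (of_nat r * of_nat r) \<star> (Q1 * A ^ (r - 1) * B ^ r)"
      unfolding pow_A_Q1 pow_A_Q0 by (simp add: algebra_simps scl_simps)
    finally show ?thesis
      unfolding right_diff_distrib scl_mult_right 2
      by (simp add: algebra_simps scl_simps scl_left_distrib scl_diff_left del: power_Suc)
  qed
  have "Yser t * (t \<star> Q0 - Q1 * B) = (\<Sum>r\<le>R. ((t - of_nat r) * rcoef t r) \<star> (Q0 * A ^ r * B ^ r))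
     + (\<Sum>r\<le>R. (of_nat r * (t - of_nat r) * rcoef t r) \<star> (Q1 * A ^ (r - 1) * B ^ r))
     - (\<Sum>r\<le>R. rcoef t r \<star> (Q1 * A ^ r * B ^ Suc r))"
    by (simp add: Yser_def sum_distrib_right scl_mult_left 1 scl_simps sum.distrib
        sum_subtractf mult.commute mult.left_commute del: power_Suc)
  also have "(\<Sum>r\<le>R. rcoef t r \<star> (Q1 * A ^ r * B ^ Suc r)) =
     (\<Sum>r\<le>R. (of_nat r * (t - of_nat r) * rcoef t r) \<star> (Q1 * A ^ (r - 1) * B ^ r))"
  proof (rule sum_shift_left)
    show "rcoef t R \<star> (Q1 * A ^ R * B ^ Suc R) = 0"
      unfolding B_nilpotent by simp
    fix r assume "r < R"
    then have "of_nat (Suc r) * (t - of_nat (Suc r)) * rcoef t (Suc r) = rcoef t r"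
      using t[rule_format, of "Suc r"] by (intro rcoef_Suc) auto
    then show "rcoef t r \<star> (Q1 * A ^ r * B ^ Suc r) = (of_nat (Suc r) * (t - of_nat (Suc r)) *
        rcoef t (Suc r)) \<star> (Q1 * A ^ (Suc r - 1) * B ^ Suc r)"
      by (simp del: power_Suc)
  qed simp
  also have "(\<Sum>r\<le>R. ((t - of_nat r) * rcoef t r) \<star> (Q0 * A ^ r * B ^ r)) =
     (\<Sum>r\<le>R. (t * rcoef (t + 1) r) \<star> (Q0 * A ^ r * B ^ r))"
    using t by (intro sum.cong refl) (simp add: rcoef_shift)
  finally show ?thesis
    by (simp add: Yser_def sum_distrib_left scl_simps scl_sum mult.assoc)
qed

lemma Xser_Q:
  assumes s: "\<forall>k. 1 \<le> k \<and> k \<le> R \<longrightarrow> s \<noteq> of_nat k"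
    and H: "H * v = (h + 1) \<star> v" and t: "t = s + h"
  shows "Xser s * (t \<star> Q0 - Q1 * B) * v = (t + 1) \<star> (Q0 * Xser s * v)"
proof -
  have 1: "B ^ r * A ^ r * (t \<star> Q0 - Q1 * B) * v = (t + 1) \<star> (Q0 * B ^ r * A ^ r * v)
     + (of_nat r * (s - of_nat r)) \<star> (B ^ r * Q1 * A ^ (r - 1) * v) - B ^ Suc r * Q1 * A ^ r * v" for r
  proof -
    have 2: "B ^ r * A ^ r * Q0 * v = Q0 * B ^ r * A ^ r * v + of_nat r \<star> (B ^ r * Q1 * A ^ (r - 1) * v)"
    proof -
      have "B ^ r * A ^ r * Q0 * v = B ^ r * (A ^ r * Q0) * v"
        by (simp only: mult.assoc)
      also have "\<dots> = (B ^ r * Q0) * A ^ r * v + of_nat r \<star> (B ^ r * Q1 * A ^ (r - 1) * v)"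
        unfolding pow_A_Q0 by (simp add: algebra_simps scl_simps)
      finally show ?thesis unfolding pow_B_Q0 .
    qed
    have 3: "A ^ r * B * v = B * A ^ r * v + (of_nat r * (h + of_nat r)) \<star> (A ^ (r - 1) * v)"
    proof (cases r)
      case (Suc k)
      have "B * A ^ Suc k * v = A ^ Suc k * B * v - of_nat (Suc k) \<star> (A ^ k * (H * v))
          - (of_nat (Suc k) * of_nat k) \<star> (A ^ k * v)"
        unfolding B_pow_A by (simp add: left_diff_distrib scl_mult_left mult.assoc)
      then show ?thesis
        unfolding Suc H
        by (simp add: scl_nf algebra_simps)
    qed simp
    have "B ^ r * A ^ r * (Q1 * B) * v = B ^ r * (A ^ r * Q1) * B * v"
      by (simp only: mult.assoc)
    also have "\<dots> = B ^ r * Q1 * (A ^ r * B * v)"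
      unfolding pow_A_Q1 by (simp only: mult.assoc)
    also have "\<dots> = B ^ r * (Q1 * B) * A ^ r * v + (of_nat r * (h + of_nat r)) \<star> (B ^ r * Q1 * A ^ (r - 1) * v)"
      unfolding 3 by (simp add: algebra_simps scl_simps)
    also have "B ^ r * (Q1 * B) * A ^ r * v = B ^ r * (B * Q1 - Q0) * A ^ r * v"
      by (simp add: BQ1)
    also have "B ^ r * (B * Q1 - Q0) * A ^ r * v = B ^ Suc r * Q1 * A ^ r * v - (B ^ r * Q0) * A ^ r * v"
      by (simp add: algebra_simps power_commutes) (simp add: mult.assoc[symmetric] power_commutes)
    finally have 4: "B ^ r * A ^ r * (Q1 * B) * v = B ^ Suc r * Q1 * A ^ r * v - Q0 * B ^ r * A ^ r * v
       + (of_nat r * (h + of_nat r)) \<star> (B ^ r * Q1 * A ^ (r - 1) * v)"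
      unfolding pow_B_Q0 .
    have "B ^ r * A ^ r * (t \<star> Q0 - Q1 * B) * v = t \<star> (B ^ r * A ^ r * Q0 * v) - B ^ r * A ^ r * (Q1 * B) * v"
      by (simp add: left_diff_distrib right_diff_distrib scl_simps)
    then show ?thesis
      unfolding 2 4 t
      by (simp add: scl_simps algebra_simps scl_left_distrib scl_diff_left del: power_Suc)
  qed
  have "Xser s * (t \<star> Q0 - Q1 * B) * v = (\<Sum>r\<le>R. rcoef s r \<star> (B ^ r * A ^ r * (t \<star> Q0 - Q1 * B) * v))"
    by (simp add: Xser_def sum_distrib_left sum_distrib_right scl_simps)
  also have "\<dots> = (\<Sum>r\<le>R. (t + 1) \<star> rcoef s r \<star> (Q0 * B ^ r * A ^ r * v))
     + (\<Sum>r\<le>R. (of_nat r * (s - of_nat r) * rcoef s r) \<star> (B ^ r * Q1 * A ^ (r - 1) * v))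
     - (\<Sum>r\<le>R. rcoef s r \<star> (B ^ Suc r * Q1 * A ^ r * v))"
    unfolding 1 by (simp add: scl_simps sum.distrib sum_subtractf mult_ac del: power_Suc)
  also have "(\<Sum>r\<le>R. rcoef s r \<star> (B ^ Suc r * Q1 * A ^ r * v)) =
     (\<Sum>r\<le>R. (of_nat r * (s - of_nat r) * rcoef s r) \<star> (B ^ r * Q1 * A ^ (r - 1) * v))"
  proof (rule sum_shift_left)
    show "rcoef s R \<star> (B ^ Suc R * Q1 * A ^ R * v) = 0"
      unfolding B_nilpotent by simp
    fix r assume "r < R"
    then have "of_nat (Suc r) * (s - of_nat (Suc r)) * rcoef s (Suc r) = rcoef s r"
      using s[rule_format, of "Suc r"] by (intro rcoef_Suc) auto
    then show "rcoef s r \<star> (B ^ Suc r * Q1 * A ^ r * v) = (of_nat (Suc r) * (s - of_nat (Suc r)) *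
        rcoef s (Suc r)) \<star> (B ^ Suc r * Q1 * A ^ (Suc r - 1) * v)"
      by (simp del: power_Suc)
  qed simp
  finally show ?thesis
    by (simp add: Xser_def sum_distrib_left sum_distrib_right scl_simps mult.assoc scl_sum)
qed

text \<open>Both sides equal t Q0 (Yser (t + 1)) P0: the shifted parameter in the middle is reached
  from one side by \<open>Yser_Q\<close> and from the other by \<open>Yser_P\<close>.\<close>

lemma Yser_intertwines:
  assumes t: "\<forall>k\<le>R. t \<noteq> of_nat k"
  shows "Yser t * (t \<star> (Q0 * P0) - Q1 * B * P0) = (t \<star> (Q0 * P0) - Q0 * A * P1) * Yser t"
proof -
  have "Yser t * (t \<star> (Q0 * P0) - Q1 * B * P0) = Yser t * (t \<star> Q0 - Q1 * B) * P0"
    by (simp add: algebra_simps scl_simps)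
  also have "\<dots> = Q0 * ((t \<star> P0 - A * P1) * Yser t)"
    unfolding Yser_Q[OF t] Yser_P[OF t] by (simp add: scl_simps mult.assoc)
  finally show ?thesis
    by (simp add: algebra_simps scl_simps)
qed

lemma Xser_intertwines:
  assumes s: "\<forall>k. 1 \<le> k \<and> k \<le> R \<longrightarrow> s \<noteq> of_nat k"
    and H: "H * v = h \<star> v" and t: "t = s + h"
  shows "Xser s * (t \<star> (Q0 * P0) - Q1 * B * P0) * v = (t \<star> (Q0 * P0) - Q0 * A * P1) * Xser s * v"
proof -
  have H': "H * (P0 * v) = (h + 1) \<star> (P0 * v)"
    by (simp add: mult.assoc[symmetric] HP0 distrib_right)
      (simp add: mult.assoc H scl_simps scl_left_distrib)
  have "Xser s * (t \<star> (Q0 * P0) - Q1 * B * P0) * v = Xser s * (t \<star> Q0 - Q1 * B) * (P0 * v)"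
    by (simp add: algebra_simps scl_simps)
  also have "\<dots> = Q0 * ((t \<star> P0 - A * P1) * Xser s * v)"
    unfolding Xser_Q[OF s H' t] Xser_P[OF s H t] by (simp add: scl_simps mult.assoc)
  finally show ?thesis
    by (simp add: algebra_simps scl_simps)
qed

end

section \<open>The algebra of linear operators\<close>

lemma lookup_lin_ext:
  "Poly_Mapping.lookup (lin_ext f v) c =
     (\<Sum>k\<in>Poly_Mapping.keys v. Poly_Mapping.lookup v k * Poly_Mapping.lookup (f k) c)"
  by (simp add: lin_ext_def lookup_sum lookup_fscale)

lemma lookup_lin_ext_superset:
  assumes "finite K" "Poly_Mapping.keys v \<subseteq> K"
  shows "Poly_Mapping.lookup (lin_ext f v) c =
     (\<Sum>k\<in>K. Poly_Mapping.lookup v k * Poly_Mapping.lookup (f k) c)"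
  unfolding lookup_lin_ext
  by (rule sum.mono_neutral_left) (use assms in \<open>auto simp: in_keys_iff\<close>)

lemma lin_ext_add: "lin_ext f (v + w) = lin_ext f v + lin_ext f w"
proof (rule poly_mapping_eqI)
  fix c
  let ?K = "Poly_Mapping.keys v \<union> Poly_Mapping.keys w"
  have K: "finite ?K" "Poly_Mapping.keys (v + w) \<subseteq> ?K"
    using keys_add[of v w] by auto
  show "Poly_Mapping.lookup (lin_ext f (v + w)) c = Poly_Mapping.lookup (lin_ext f v + lin_ext f w) c"
    using K by (simp add: lookup_lin_ext_superset[of ?K] lookup_add distrib_right sum.distrib)
qed

lemma lin_ext_fscale: "lin_ext f (fscale a v) = fscale a (lin_ext f v)"
proof (rule poly_mapping_eqI)
  fix c
  have "Poly_Mapping.keys (fscale a v) \<subseteq> Poly_Mapping.keys v"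
    by (auto simp: in_keys_iff lookup_fscale)
  then show "Poly_Mapping.lookup (lin_ext f (fscale a v)) c = Poly_Mapping.lookup (fscale a (lin_ext f v)) c"
    by (simp add: lookup_lin_ext_superset[of "Poly_Mapping.keys v"] lookup_fscale sum_distrib_left mult.assoc)
qed

lemma lin_ext_single [simp]: "lin_ext f (Poly_Mapping.single k a) = fscale a (f k)"
  by (rule poly_mapping_eqI) (simp add: lookup_lin_ext lookup_fscale)

lemma fscale_single [simp]: "fscale a (Poly_Mapping.single k b) = Poly_Mapping.single k (a * b)"
  by (rule poly_mapping_eqI) (simp add: lookup_fscale lookup_single when_def)

lemma fscale_sum: "fscale a (\<Sum>i\<in>S. f i) = (\<Sum>i\<in>S. fscale a (f i))"
  by (rule fvs.scale_sum_right)

lemma fscale_one [simp]: "fscale 1 v = v"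
  by (rule fvs.scale_one)

lemma fscale_zero_right [simp]: "fscale a 0 = 0"
  by (rule fvs.scale_zero_right)

lemma fscale_zero_left [simp]: "fscale 0 v = 0"
  by (rule fvs.scale_zero_left)

lemma fscale_fscale [simp]: "fscale a (fscale b v) = fscale (a * b) v"
  by (rule fvs.scale_scale)

lemma basis_expansion:
  "(\<Sum>k\<in>Poly_Mapping.keys v. Poly_Mapping.single k (Poly_Mapping.lookup v k)) = v"
proof (rule poly_mapping_eqI)
  fix c
  have "Poly_Mapping.lookup (\<Sum>k\<in>Poly_Mapping.keys v. Poly_Mapping.single k (Poly_Mapping.lookup v k)) c =
      (\<Sum>k\<in>Poly_Mapping.keys v. if k = c then Poly_Mapping.lookup v c else 0)"
    unfolding lookup_sum by (intro sum.cong) (auto simp: lookup_single)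
  then show "Poly_Mapping.lookup (\<Sum>k\<in>Poly_Mapping.keys v. Poly_Mapping.single k (Poly_Mapping.lookup v k)) c =
      Poly_Mapping.lookup v c"
    by (simp add: in_keys_iff)
qed

definition linop :: "(('b \<Rightarrow>\<^sub>0 complex) \<Rightarrow> ('c \<Rightarrow>\<^sub>0 complex)) \<Rightarrow> bool" where
  "linop f \<longleftrightarrow> (\<forall>v w. f (v + w) = f v + f w) \<and> (\<forall>a v. f (fscale a v) = fscale a (f v))"

lemma linopI:
  "(\<And>v w. f (v + w) = f v + f w) \<Longrightarrow> (\<And>a v. f (fscale a v) = fscale a (f v)) \<Longrightarrow> linop f"
  by (simp add: linop_def)

lemma linop_add: "linop f \<Longrightarrow> f (v + w) = f v + f w"
  and linop_fscale: "linop f \<Longrightarrow> f (fscale a v) = fscale a (f v)"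
  by (simp_all add: linop_def)

lemma linop_zero: "linop f \<Longrightarrow> f 0 = 0"
  using linop_fscale[of f 0 0] by simp

lemma fscale_minus_one: "fscale (- 1) v = - v"
  by (rule poly_mapping_eqI) (simp add: lookup_fscale)

lemma linop_minus: "linop f \<Longrightarrow> f (- v) = - f v"
  using linop_fscale[of f "- 1" v] by (simp add: fscale_minus_one)

lemma linop_diff: "linop f \<Longrightarrow> f (v - w) = f v - f w"
  using linop_add[of f v "- w"] linop_minus[of f w] by simp

lemma linop_sum: "linop f \<Longrightarrow> f (\<Sum>i\<in>S. g i) = (\<Sum>i\<in>S. f (g i))"
  by (induction S rule: infinite_finite_induct) (simp_all add: linop_zero linop_add)

lemma linop_lin_ext [simp]: "linop (lin_ext f)"
  by (rule linopI) (simp_all add: lin_ext_add lin_ext_fscale)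

lemma linop_compose: "linop f \<Longrightarrow> linop g \<Longrightarrow> linop (\<lambda>v. f (g v))"
  by (simp add: linop_def)

text \<open>Only basis vectors that occur in \<open>v\<close> are compared, so identities valid for
  part of the indices, such as finite sets or given rows, can still be proved by linearity.\<close>

lemma linop_eq_on_keys:
  assumes "linop f" "linop g" "\<And>k. k \<in> Poly_Mapping.keys v \<Longrightarrow>
     f (Poly_Mapping.single k 1) = g (Poly_Mapping.single k 1)"
  shows "f v = g v"
proof -
  have "f (\<Sum>k\<in>Poly_Mapping.keys v. fscale (Poly_Mapping.lookup v k) (Poly_Mapping.single k 1)) =
      g (\<Sum>k\<in>Poly_Mapping.keys v. fscale (Poly_Mapping.lookup v k) (Poly_Mapping.single k 1))"
    unfolding linop_sum[OF assms(1)] linop_sum[OF assms(2)]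
    by (intro sum.cong refl) (simp only: linop_fscale[OF assms(1)] linop_fscale[OF assms(2)] assms(3))
  then show ?thesis
    by (simp add: basis_expansion)
qed

text \<open>Operators form a type so that they can be an instance of \<open>ring_1\<close>, from
  which the matrix products and formal power series below take their coefficients.\<close>

typedef 'b lop = "{f :: ('b \<Rightarrow>\<^sub>0 complex) \<Rightarrow> ('b \<Rightarrow>\<^sub>0 complex). linop f}"
  morphisms app Lop
proof
  show "(\<lambda>v. v) \<in> {f :: ('b \<Rightarrow>\<^sub>0 complex) \<Rightarrow> ('b \<Rightarrow>\<^sub>0 complex). linop f}"
    by (simp add: linop_def)
qed

lemma linop_app [simp]: "linop (app T)"
  using app[of T] by simp

lemma app_Lop: "linop f \<Longrightarrow> app (Lop f) = f"
  by (simp add: Lop_inverse)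

lemmas app_simps = linop_add[OF linop_app] linop_fscale[OF linop_app] linop_zero[OF linop_app]
  linop_minus[OF linop_app] linop_diff[OF linop_app] linop_sum[OF linop_app]

lemma lop_eqI: "(\<And>v. app S v = app T v) \<Longrightarrow> S = T"
  by (simp add: app_inject[symmetric] fun_eq_iff)

lemma lop_eqI_basis:
  "(\<And>k. app S (Poly_Mapping.single k 1) = app T (Poly_Mapping.single k 1)) \<Longrightarrow> S = T"
  by (rule lop_eqI, rule linop_eq_on_keys) simp_all

instantiation lop :: (type) ring_1
begin

definition "zero_lop = Lop (\<lambda>v. 0)"
definition "one_lop = Lop (\<lambda>v. v)"
definition "plus_lop S T = Lop (\<lambda>v. app S v + app T v)"
definition "minus_lop S T = Lop (\<lambda>v. app S v - app T v)"
definition "uminus_lop T = Lop (\<lambda>v. - app T v)"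
definition "times_lop S T = Lop (\<lambda>v. app S (app T v))"

lemma app_ops:
  shows app_zero: "app 0 v = 0"
    and app_one: "app 1 v = v"
    and app_plus: "app (S + T) v = app S v + app T v"
    and app_minus: "app (S - T) v = app S v - app T v"
    and app_uminus: "app (- T) v = - app T v"
    and app_times: "app (S * T) v = app S (app T v)"
proof -
  have m: "fscale a (v - w) = fscale a v - fscale a w" "fscale a (- v) = - fscale a v"
    for a and v w :: "'b \<Rightarrow>\<^sub>0 complex"
    by (rule fvs.scale_right_diff_distrib fvs.scale_minus_right)+
  show "app 0 v = 0" "app 1 v = v" "app (S + T) v = app S v + app T v"
    "app (S - T) v = app S v - app T v" "app (- T) v = - app T v"
    "app (S * T) v = app S (app T v)"
    unfolding zero_lop_def one_lop_def plus_lop_def minus_lop_def uminus_lop_def times_lop_def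
    by (subst app_Lop; simp add: linop_def app_simps fvs.scale_right_distrib m)+
qed

instance
proof
  have "app (0 :: 'a lop) (Poly_Mapping.single undefined 1) \<noteq> app 1 (Poly_Mapping.single undefined 1)"
    by (simp only: app_ops) (metis lookup_single_eq lookup_zero zero_neq_one)
  then show "(0 :: 'a lop) \<noteq> 1" by auto
qed (rule lop_eqI, simp add: app_ops app_simps)+

end

lemma app_sum: "app (\<Sum>i\<in>S. f i) v = (\<Sum>i\<in>S. app (f i) v)"
  by (induction S rule: infinite_finite_induct) (simp_all add: app_ops)

definition lscale :: "complex \<Rightarrow> 'b lop \<Rightarrow> 'b lop" (infixr "\<star>" 75) where
  "lscale a T = Lop (\<lambda>v. fscale a (app T v))"

lemma app_lscale: "app (a \<star> T) v = fscale a (app T v)"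
  unfolding lscale_def
  by (subst app_Lop) (simp_all add: linop_def app_simps fvs.scale_right_distrib mult.commute)

interpretation lop: complex_algebra "lscale :: complex \<Rightarrow> 'b lop \<Rightarrow> 'b lop"
  by unfold_locales
    (rule lop_eqI; simp add: app_ops app_lscale app_simps fvs.scale_right_distrib fvs.scale_left_distrib)+

section \<open>Creation and annihilation operators\<close>

text \<open>For infinite sets, which do not index elements of a Grassmann algebra, the sign is chosen
  relative to a set of reference that differs in finitely many elements, so that the
  anticommutation relations hold without exception.\<close>

definition refset :: "'x set \<Rightarrow> 'x set" where
  "refset A = (if finite A then {} else (SOME B. finite (sym_diff A B)))"

definition gsign :: "'x::linorder set \<Rightarrow> 'x \<Rightarrow> complex" where
  "gsign A x = (-1) ^ card {b \<in> sym_diff A (refset A). b < x}"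

lemma gsign_finite: "finite A \<Longrightarrow> gsign A x = (-1) ^ card {b \<in> A. b < x}"
  by (simp add: gsign_def refset_def)

lemma finite_refset: "finite (sym_diff A (refset A))"
proof (cases "finite A")
  case False
  have "finite (sym_diff A A)" by simp
  then show ?thesis
    unfolding refset_def using False someI[of "\<lambda>B. finite (sym_diff A B)" A] by simp
qed (simp add: refset_def)

text \<open>Adding one element does not change which sets are at finite distance, and for infinite
  sets the choice depends on nothing else.\<close>

lemma refset_insert: "refset (insert y A) = refset A"
proof -
  have "finite (sym_diff (insert y A) B) \<longleftrightarrow> finite (sym_diff A B)" for B
  proof -
    have "sym_diff (insert y A) B \<subseteq> insert y (sym_diff A B)"
      "sym_diff A B \<subseteq> insert y (sym_diff (insert y A) B)" by auto
    then show ?thesis by (meson finite_insert finite_subset)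
  qed
  then show ?thesis by (simp add: refset_def)
qed

lemma gsign_insert:
  assumes "y \<notin> A"
  shows "gsign (insert y A) x = (if y < x then - gsign A x else gsign A x)"
proof -
  let ?D = "{b \<in> sym_diff A (refset A). b < x}"
  have fin: "finite ?D" by (rule finite_subset[OF _ finite_refset[of A]]) auto
  consider "\<not> y < x" | "y < x" "y \<in> refset A" | "y < x" "y \<notin> refset A" by blast
  then show ?thesis
  proof cases
    case 1
    then have "{b \<in> sym_diff (insert y A) (refset A). b < x} = ?D" by auto
    then show ?thesis using 1 by (simp add: gsign_def refset_insert)
  next
    case 2
    then have "{b \<in> sym_diff (insert y A) (refset A). b < x} = ?D - {y}" "y \<in> ?D"
      using assms by auto
    then have "card ?D = Suc (card {b \<in> sym_diff (insert y A) (refset A). b < x})"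
      using fin by (metis card_Suc_Diff1)
    then show ?thesis using 2 by (simp add: gsign_def refset_insert)
  next
    case 3
    then have "{b \<in> sym_diff (insert y A) (refset A). b < x} = insert y ?D" "y \<notin> ?D"
      using assms by auto
    then show ?thesis using 3 fin by (simp add: gsign_def refset_insert)
  qed
qed

lemma gsign_remove:
  assumes "y \<in> A"
  shows "gsign (A - {y}) x = (if y < x then - gsign A x else gsign A x)"
  using gsign_insert[of y "A - {y}" x] assms by (auto simp: insert_absorb)

lemma gsign_square [simp]: "gsign A x * gsign A x = 1"
  by (simp add: gsign_def power_mult_distrib[symmetric])

definition cre :: "'x::linorder \<Rightarrow> 'x set lop" where
  "cre x = Lop (lin_ext (\<lambda>A. if x \<in> A then 0 else Poly_Mapping.single (insert x A) (gsign A x)))"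

definition ann :: "'x::linorder \<Rightarrow> 'x set lop" where
  "ann x = Lop (lin_ext (\<lambda>A. if x \<in> A then Poly_Mapping.single (A - {x}) (gsign A x) else 0))"

lemma cre_single: "app (cre x) (Poly_Mapping.single A a) =
    (if x \<in> A then 0 else Poly_Mapping.single (insert x A) (a * gsign A x))"
  by (simp add: cre_def app_Lop)

lemma ann_single: "app (ann x) (Poly_Mapping.single A a) =
    (if x \<in> A then Poly_Mapping.single (A - {x}) (a * gsign A x) else 0)"
  by (simp add: ann_def app_Lop)

lemma single_minus: "Poly_Mapping.single k (- a) = - Poly_Mapping.single k (a :: complex)"
  by (rule poly_mapping_eqI) (simp add: lookup_single when_def)

lemma cre_cre: "cre x * cre y = - (cre y * cre x)"
proof (rule lop_eqI_basis)
  fix A :: "'a set"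
  show "app (cre x * cre y) (Poly_Mapping.single A 1) = app (- (cre y * cre x)) (Poly_Mapping.single A 1)"
    by (cases x y rule: linorder_cases)
      (auto simp: app_ops app_simps cre_single gsign_insert insert_commute single_minus mult.commute)
qed

lemma ann_ann: "ann x * ann y = - (ann y * ann x)"
proof (rule lop_eqI_basis)
  fix A :: "'a set"
  have 1: "A - {x} - {y} = A - {y, x}" "A - {y} - {x} = A - {y, x}" by auto
  show "app (ann x * ann y) (Poly_Mapping.single A 1) = app (- (ann y * ann x)) (Poly_Mapping.single A 1)"
    by (cases x y rule: linorder_cases; cases "x \<in> A"; cases "y \<in> A")
      (simp_all add: app_ops app_simps ann_single gsign_remove single_minus mult.commute 1 less_not_sym)
qed

lemma ann_cre: "ann x * cre y = (if x = y then 1 else 0) - cre y * ann x"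
proof (rule lop_eqI_basis)
  fix A :: "'a set"
  have 1: "x \<noteq> y \<Longrightarrow> insert y A - {x} = insert y (A - {x})" by auto
  show "app (ann x * cre y) (Poly_Mapping.single A 1) =
     app ((if x = y then 1 else 0) - cre y * ann x) (Poly_Mapping.single A 1)"
  proof (cases x y rule: linorder_cases)
    case equal
    then show ?thesis
      by (cases "y \<in> A") (simp_all add: app_ops app_simps ann_single cre_single gsign_insert
          gsign_remove insert_absorb)
  next
    case less
    then have "x \<noteq> y" "\<not> y < x" by auto
    with less show ?thesis
      by (cases "x \<in> A"; cases "y \<in> A") (simp_all add: app_ops app_simps ann_single cre_single
          gsign_insert gsign_remove 1 single_minus mult.commute)
  next
    case greater
    then have "x \<noteq> y" "\<not> x < y" by auto
    with greater show ?thesis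
      by (cases "x \<in> A"; cases "y \<in> A") (simp_all add: app_ops app_simps ann_single cre_single
          gsign_insert gsign_remove 1 single_minus mult.commute)
  qed
qed

lemma cre_ann: "cre y * ann x = (if x = y then 1 else 0) - ann x * cre y"
  by (simp add: ann_cre)

text \<open>The signs agree on finite sets, where the reference set is empty; on infinite sets
  \<open>cre\<close> is deliberately different.\<close>

lemma gmult_gvar:
  assumes "\<And>A. A \<in> Poly_Mapping.keys v \<Longrightarrow> finite A"
  shows "gmult (gvar x) v = app (cre x) v"
proof -
  let ?F = "lin_ext (\<lambda>B. if {x} \<inter> B = {}
     then Poly_Mapping.single ({x} \<union> B) ((-1) ^ card {(a, b). a \<in> {x} \<and> b \<in> B \<and> b < a}) else 0)"
  have "gmult (gvar x) v = ?F v"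
    by (simp add: gmult_def gvar_def)
  also have "?F v = app (cre x) v"
  proof (rule linop_eq_on_keys[of ?F "app (cre x)"])
    fix A assume "A \<in> Poly_Mapping.keys v"
    then have "gsign A x = (-1) ^ card {b \<in> A. b < x}"
      using assms gsign_finite by blast
    moreover have "{(a, b). a \<in> {x} \<and> b \<in> A \<and> b < a} = Pair x ` {b \<in> A. b < x}" by auto
    then have "card {(a, b). a \<in> {x} \<and> b \<in> A \<and> b < a} = card {b \<in> A. b < x}"
      by (simp add: card_image inj_on_def)
    ultimately show "?F (Poly_Mapping.single A 1) = app (cre x) (Poly_Mapping.single A 1)"
      by (simp add: cre_single)
  qed simp_all
  finally show ?thesis .
qed

lemma gderiv_ann:
  assumes "\<And>A. A \<in> Poly_Mapping.keys v \<Longrightarrow> finite A"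
  shows "gderiv x v = app (ann x) v"
  unfolding gderiv_def
  by (rule linop_eq_on_keys[of "lin_ext _" "app (ann x)"]) (use assms in \<open>auto simp: ann_single gsign_finite\<close>)

section \<open>Products of matrices over a ring\<close>

fun mat_prod :: "nat \<Rightarrow> (nat \<Rightarrow> nat \<Rightarrow> nat \<Rightarrow> 'r::ring_1) \<Rightarrow> nat list \<Rightarrow> nat \<Rightarrow> nat \<Rightarrow> 'r" where
  "mat_prod n L [] i j = (if i = j then 1 else 0)"
| "mat_prod n L (a # l) i j = (\<Sum>k = 1..n. L a i k * mat_prod n L l k j)"

lemma sum_delta_mult_left:
  fixes f :: "nat \<Rightarrow> 'r::ring_1"
  assumes "i \<in> {1..n}"
  shows "(\<Sum>k = 1..n. (if i = k then c else 0) * f k) = c * f i"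
proof -
  have "(\<Sum>k = 1..n. (if i = k then c else 0) * f k) = (\<Sum>k = 1..n. if i = k then c * f k else 0)"
    by (intro sum.cong) auto
  then show ?thesis using assms by simp
qed

lemma sum_delta_mult_right:
  fixes f :: "nat \<Rightarrow> 'r::ring_1"
  assumes "j \<in> {1..n}"
  shows "(\<Sum>k = 1..n. f k * (if k = j then c else 0)) = f j * c"
proof -
  have "(\<Sum>k = 1..n. f k * (if k = j then c else 0)) = (\<Sum>k = 1..n. if k = j then f k * c else 0)"
    by (intro sum.cong) auto
  then show ?thesis using assms by simp
qed

lemma mat_prod_single: "j \<in> {1..n} \<Longrightarrow> mat_prod n L [a] i j = L a i j"
  using sum_delta_mult_right[of j n "L a i" 1] by simp

lemma mat_prod_append:
  assumes "i \<in> {1..n}"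
  shows "mat_prod n L (l @ l') i j = (\<Sum>k = 1..n. mat_prod n L l i k * mat_prod n L l' k j)"
  using assms
proof (induction l arbitrary: i)
  case Nil
  then show ?case using sum_delta_mult_left[of i n 1 "\<lambda>k. mat_prod n L l' k j"] by simp
next
  case (Cons a l)
  have "mat_prod n L ((a # l) @ l') i j =
      (\<Sum>k = 1..n. \<Sum>k' = 1..n. L a i k * mat_prod n L l k k' * mat_prod n L l' k' j)"
    using Cons.IH by (simp add: sum_distrib_left mult.assoc)
  also have "\<dots> = (\<Sum>k' = 1..n. \<Sum>k = 1..n. L a i k * mat_prod n L l k k' * mat_prod n L l' k' j)"
    by (rule sum.swap)
  finally show ?case by (simp add: sum_distrib_right)
qed

lemma mat_prod_commutes:
  assumes "\<And>a i j. a \<in> set l \<Longrightarrow> i \<in> {1..n} \<Longrightarrow> j \<in> {1..n} \<Longrightarrow> w * L a i j = L a i j * w"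
    and "i \<in> {1..n}" "j \<in> {1..n}"
  shows "w * mat_prod n L l i j = mat_prod n L l i j * w"
  using assms
proof (induction l arbitrary: i)
  case (Cons a l)
  have "w * (L a i k * mat_prod n L l k j) = L a i k * mat_prod n L l k j * w" if "k \<in> {1..n}" for k
  proof -
    have "w * L a i k = L a i k * w" "w * mat_prod n L l k j = mat_prod n L l k j * w"
      using Cons that by auto
    then show ?thesis by (metis mult.assoc)
  qed
  then show ?case by (simp add: sum_distrib_left sum_distrib_right)
qed auto

lemma mat_prod_commutes_all:
  assumes "\<And>a i j. a \<in> set l \<Longrightarrow> w * L a i j = L a i j * w"
  shows "w * mat_prod n L l i j = mat_prod n L l i j * w"
  using assms
proof (induction l arbitrary: i)
  case (Cons a l)
  have "w * (L a i k * mat_prod n L l k j) = L a i k * mat_prod n L l k j * w" for k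
  proof -
    have "w * L a i k = L a i k * w" "w * mat_prod n L l k j = mat_prod n L l k j * w"
      using Cons by auto
    then show ?thesis by (metis mult.assoc)
  qed
  then show ?case by (simp add: sum_distrib_left sum_distrib_right)
qed auto

lemma mat_prod_central_factor:
  assumes "\<And>a i j. a \<in> set l \<Longrightarrow> L' a i j = c a * L a i j"
    and "\<And>a x. a \<in> set l \<Longrightarrow> c a * x = x * c a"
  shows "mat_prod n L' l i j = prod_list (map c l) * mat_prod n L l i j"
  using assms
proof (induction l arbitrary: i)
  case (Cons a l)
  have "c a * L a i k * (prod_list (map c l) * x) = c a * prod_list (map c l) * (L a i k * x)" for k x
  proof -
    have "\<And>a x. a \<in> set l \<Longrightarrow> c a * x = x * c a" using Cons.prems(2) by simp
    then have "prod_list (map c l) * y = y * prod_list (map c l)" for y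
    proof (induction l)
      case (Cons b l)
      have "prod_list (map c (b # l)) * y = c b * (prod_list (map c l) * y)"
        by (simp add: mult.assoc)
      also have "\<dots> = c b * (y * prod_list (map c l))"
        using Cons by (metis list.set_intros(2))
      also have "\<dots> = y * prod_list (map c (b # l))"
        using Cons.prems by (metis list.set_intros(1) list.simps(9) mult.assoc prod_list.Cons)
      finally show ?case .
    qed simp
    then show ?thesis by (metis mult.assoc)
  qed
  then show ?case using Cons by (simp add: sum_distrib_left)
qed simp

text \<open>The relation \<open>(u - v) [T(u), T'(v)] = \<dots>\<close> multiplied by \<open>e = 1 / (u v)\<close>, so that \<open>c = 1/v - 1/u\<close>.\<close>

definition rtt :: "nat \<Rightarrow> 'r::ring_1 \<Rightarrow> 'r \<Rightarrow> (nat \<Rightarrow> nat \<Rightarrow> 'r) \<Rightarrow> (nat \<Rightarrow> nat \<Rightarrow> 'r) \<Rightarrow> bool" where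
  "rtt n c e T T' \<longleftrightarrow> (\<forall>i\<in>{1..n}. \<forall>j\<in>{1..n}. \<forall>k\<in>{1..n}. \<forall>l\<in>{1..n}.
     c * (T i j * T' k l) - e * (T k j * T' i l) = c * (T' k l * T i j) - e * (T' k j * T i l))"

text \<open>Closure under the comultiplication. Entries of different factors commute, so the
  products can be regrouped, and the relation of \<open>M\<close> is used on the left pair, that of
  \<open>N\<close> on the right pair.\<close>

lemma rtt_mult:
  assumes M: "rtt n c e M M'" and N: "rtt n c e N N'"
    and c: "\<And>x. c * x = x * c" and e: "\<And>x. e * x = x * e"
    and comm: "\<And>i j k l. N i j * M' k l = M' k l * N i j" "\<And>i j k l. N' i j * M k l = M k l * N' i j"
  shows "rtt n c e (\<lambda>i j. \<Sum>x = 1..n. M i x * N x j) (\<lambda>i j. \<Sum>x = 1..n. M' i x * N' x j)"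
  unfolding rtt_def
proof (intro ballI)
  fix i j k l assume ijkl: "i \<in> {1..n}" "j \<in> {1..n}" "k \<in> {1..n}" "l \<in> {1..n}"
  let ?S = "\<lambda>f. \<Sum>x = 1..n. \<Sum>y = 1..n. f x y"
  have swap: "?S f = ?S (\<lambda>x y. f y x)" for f :: "nat \<Rightarrow> nat \<Rightarrow> 'a"
    by (rule sum.swap)
  have prod: "(\<Sum>x = 1..n. M a x * N x b) * (\<Sum>y = 1..n. M' a' y * N' y b') =
      ?S (\<lambda>x y. M a x * M' a' y * (N x b * N' y b'))" for a b a' b'
  proof -
    have "M a x * N x b * (M' a' y * N' y b') = M a x * M' a' y * (N x b * N' y b')" for x y
      using comm(1)[of x b a' y] by (metis mult.assoc)
    then show ?thesis by (simp add: sum_product)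
  qed
  have prod': "(\<Sum>y = 1..n. M' a' y * N' y b') * (\<Sum>x = 1..n. M a x * N x b) =
      ?S (\<lambda>x y. M' a' y * M a x * (N' y b' * N x b))" for a b a' b'
  proof -
    have "M' a' y * N' y b' * (M a x * N x b) = M' a' y * M a x * (N' y b' * N x b)" for x y
      using comm(2)[of y b' a x] by (metis mult.assoc)
    then show ?thesis by (subst sum.swap) (simp add: sum_product)
  qed
  have mid: "c * (X * Y) = X * (c * Y)" "e * (X * Y) = X * (e * Y)" for X Y
    using c[of X] e[of X] by (metis mult.assoc)+
  have "c * ?S (\<lambda>x y. M i x * M' k y * (N x j * N' y l)) - e * ?S (\<lambda>x y. M k x * M' i y * (N x j * N' y l))
     = ?S (\<lambda>x y. (c * (M i x * M' k y) - e * (M k x * M' i y)) * (N x j * N' y l))"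
    by (simp add: sum_distrib_left left_diff_distrib sum_subtractf mult.assoc)
  also have "\<dots> = ?S (\<lambda>x y. (c * (M' k y * M i x) - e * (M' k x * M i y)) * (N x j * N' y l))"
    using M ijkl by (intro sum.cong refl arg_cong2[where f = "(*)"]) (auto simp: rtt_def)
  also have "\<dots> = ?S (\<lambda>x y. M' k y * M i x * (c * (N x j * N' y l))) -
      ?S (\<lambda>x y. M' k x * M i y * (e * (N x j * N' y l)))"
    by (simp add: left_diff_distrib sum_subtractf mult.assoc mid)
  \<comment> \<open>Renaming the indices gives both sums the same left factor M' k y * M i x, so
    that the relation of \<open>N\<close> applies to the difference on the right.\<close>
  also have "?S (\<lambda>x y. M' k x * M i y * (e * (N x j * N' y l))) =
      ?S (\<lambda>x y. M' k y * M i x * (e * (N y j * N' x l)))"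
    by (rule swap)
  also have "?S (\<lambda>x y. M' k y * M i x * (c * (N x j * N' y l))) -
      ?S (\<lambda>x y. M' k y * M i x * (e * (N y j * N' x l))) =
      ?S (\<lambda>x y. M' k y * M i x * (c * (N x j * N' y l) - e * (N y j * N' x l)))"
    by (simp add: right_diff_distrib sum_subtractf)
  also have "\<dots> = ?S (\<lambda>x y. M' k y * M i x * (c * (N' y l * N x j) - e * (N' y j * N x l)))"
    using N ijkl by (intro sum.cong refl arg_cong2[where f = "(*)"]) (auto simp: rtt_def)
  also have "\<dots> = c * ?S (\<lambda>x y. M' k y * M i x * (N' y l * N x j)) -
      e * ?S (\<lambda>x y. M' k y * M i x * (N' y j * N x l))"
    by (simp add: right_diff_distrib sum_subtractf sum_distrib_left mid)
  finally show "c * ((\<Sum>x = 1..n. M i x * N x j) * (\<Sum>x = 1..n. M' k x * N' x l)) -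
       e * ((\<Sum>x = 1..n. M k x * N x j) * (\<Sum>x = 1..n. M' i x * N' x l)) =
       c * ((\<Sum>x = 1..n. M' k x * N' x l) * (\<Sum>x = 1..n. M i x * N x j)) -
       e * ((\<Sum>x = 1..n. M' k x * N' x j) * (\<Sum>x = 1..n. M i x * N x l))"
    unfolding prod prod' .
qed

section \<open>Polynomial identities with vector coefficients\<close>

lemma subspace_sum: "fvs.subspace U \<Longrightarrow> (\<And>i. i \<in> S \<Longrightarrow> f i \<in> U) \<Longrightarrow> sum f S \<in> U"
  by (rule fvs.subspace_sum)

text \<open>A Vandermonde argument by divided differences. Subtracting the value at X0 and dividing
  by X - X0 gives a polynomial of smaller degree with values in \<open>U\<close> at all other
  points; its top coefficient is \<open>c K\<close>, which can then be removed. With U = {0} this is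
  comparison of coefficients.\<close>

lemma polynomial_values_in_subspace:
  assumes U: "fvs.subspace U" and I: "infinite I"
    and mem: "\<And>X. X \<in> I \<Longrightarrow> (\<Sum>r<K. fscale (X ^ r) (c r)) \<in> U" and r: "r < K"
  shows "c r \<in> U"
  using I mem r
proof (induction K arbitrary: c r I)
  case (Suc K)
  obtain X0 where X0: "X0 \<in> I" using Suc.prems(1) by (metis ex_in_conv finite.emptyI)
  let ?d = "\<lambda>k. \<Sum>r\<in>{k<..K}. fscale (X0 ^ (r - Suc k)) (c r)"
  have "(\<Sum>k<K. fscale (X ^ k) (?d k)) \<in> U" if X: "X \<in> I - {X0}" for X
  proof -
    have ne: "X - X0 \<noteq> 0" using X by auto
    have "(\<Sum>r<Suc K. fscale (X ^ r) (c r)) - (\<Sum>r<Suc K. fscale (X0 ^ r) (c r)) \<in> U"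
      using Suc.prems(2) X X0 U by (intro fvs.subspace_diff) auto
    also have "(\<Sum>r<Suc K. fscale (X ^ r) (c r)) - (\<Sum>r<Suc K. fscale (X0 ^ r) (c r)) =
       (\<Sum>r<Suc K. \<Sum>k<r. fscale (X - X0) (fscale (X ^ k) (fscale (X0 ^ (r - Suc k)) (c r))))"
    proof -
      have "fscale (X ^ r) (c r) - fscale (X0 ^ r) (c r) =
         (\<Sum>k<r. fscale (X - X0) (fscale (X ^ k) (fscale (X0 ^ (r - Suc k)) (c r))))" for r
      proof -
        have "X ^ r - X0 ^ r = (\<Sum>k<r. (X - X0) * (X ^ k * X0 ^ (r - Suc k)))"
          unfolding power_diff_sumr2 sum_distrib_left by (intro sum.cong refl) (simp add: mult_ac)
        then show ?thesis
          by (simp add: fvs.scale_left_diff_distrib[symmetric] fvs.scale_sum_left)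
      qed
      then show ?thesis by (simp only: sum_subtractf[symmetric])
    qed
    also have "\<dots> = (\<Sum>r\<in>{..<Suc K}. \<Sum>k\<in>{k\<in>{..<K}. k < r}.
        fscale (X - X0) (fscale (X ^ k) (fscale (X0 ^ (r - Suc k)) (c r))))"
      by (intro sum.cong refl) auto
    also have "\<dots> = (\<Sum>k\<in>{..<K}. \<Sum>r\<in>{r\<in>{..<Suc K}. k < r}.
        fscale (X - X0) (fscale (X ^ k) (fscale (X0 ^ (r - Suc k)) (c r))))"
      by (rule sum.swap_restrict) auto
    also have "\<dots> = fscale (X - X0) (\<Sum>k<K. fscale (X ^ k) (?d k))"
      unfolding fscale_sum by (intro sum.cong refl) auto
    finally have "fscale (inverse (X - X0)) (fscale (X - X0) (\<Sum>k<K. fscale (X ^ k) (?d k))) \<in> U"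
      using U fvs.subspace_scale by blast
    then show ?thesis using ne by simp
  qed
  moreover have "infinite (I - {X0})" using Suc.prems(1) by simp
  ultimately have d: "?d k \<in> U" if "k < K" for k
    using Suc.IH[of "I - {X0}" ?d k] that by blast
  have top: "c K \<in> U"
  proof (cases K)
    case 0
    then show ?thesis using Suc.prems(2)[OF X0] by simp
  next
    case (Suc k)
    then have "{k<..K} = {K}" by auto
    then show ?thesis using d[of k] Suc by simp
  qed
  show ?case
  proof (cases "r = K")
    case False
    have "(\<Sum>r<K. fscale (X ^ r) (c r)) \<in> U" if "X \<in> I" for X
    proof -
      have "(\<Sum>r<Suc K. fscale (X ^ r) (c r)) - fscale (X ^ K) (c K) \<in> U"
        using Suc.prems(2)[OF that] top U by (intro fvs.subspace_diff fvs.subspace_scale)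
      then show ?thesis by simp
    qed
    then show ?thesis using Suc.IH[of I c r] Suc.prems(1,3) False by simp
  qed (use top in simp)
qed simp

section \<open>Operators on the Grassmann algebra\<close>

definition qo :: "(nat \<Rightarrow> int) \<Rightarrow> nat \<Rightarrow> nat \<Rightarrow> xvar set lop" where
  "qo \<epsilon> a i = (if \<epsilon> a = 1 then cre (XV a i) else ann (XV a i))"

definition po :: "(nat \<Rightarrow> int) \<Rightarrow> nat \<Rightarrow> nat \<Rightarrow> xvar set lop" where
  "po \<epsilon> a i = (if \<epsilon> a = 1 then ann (XV a i) else cre (XV a i))"

text \<open>The sign is attached to a row, so operators of different signs belong to different rows
  and the delta of \<open>ann_cre\<close> is absent.\<close>

lemma qo_qo: "qo \<epsilon> a i * qo \<epsilon> b j = - (qo \<epsilon> b j * qo \<epsilon> a i)"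
proof -
  consider "\<epsilon> a = 1" "\<epsilon> b = 1" | "\<epsilon> a \<noteq> 1" "\<epsilon> b \<noteq> 1"
    | "\<epsilon> a = 1" "\<epsilon> b \<noteq> 1" "a \<noteq> b" | "\<epsilon> a \<noteq> 1" "\<epsilon> b = 1" "a \<noteq> b"
    by metis
  then show ?thesis
  proof cases
    case 1
    then show ?thesis by (simp only: qo_def simp_thms if_True) (rule cre_cre)
  next
    case 2
    then show ?thesis by (simp only: qo_def simp_thms if_False) (rule ann_ann)
  next
    case 3
    then show ?thesis by (simp add: qo_def ann_cre)
  next
    case 4
    then show ?thesis by (simp add: qo_def ann_cre)
  qed
qed

lemma po_po: "po \<epsilon> a i * po \<epsilon> b j = - (po \<epsilon> b j * po \<epsilon> a i)"
proof -
  consider "\<epsilon> a = 1" "\<epsilon> b = 1" | "\<epsilon> a \<noteq> 1" "\<epsilon> b \<noteq> 1"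
    | "\<epsilon> a = 1" "\<epsilon> b \<noteq> 1" "a \<noteq> b" | "\<epsilon> a \<noteq> 1" "\<epsilon> b = 1" "a \<noteq> b"
    by metis
  then show ?thesis
  proof cases
    case 1
    then show ?thesis by (simp only: po_def simp_thms if_True) (rule ann_ann)
  next
    case 2
    then show ?thesis by (simp only: po_def simp_thms if_False) (rule cre_cre)
  next
    case 3
    then show ?thesis by (simp add: po_def ann_cre)
  next
    case 4
    then show ?thesis by (simp add: po_def ann_cre)
  qed
qed

lemma po_qo: "po \<epsilon> a i * qo \<epsilon> b j = (if a = b \<and> i = j then 1 else 0) - qo \<epsilon> b j * po \<epsilon> a i"
proof -
  consider "\<epsilon> a = 1" "\<epsilon> b = 1" | "\<epsilon> a \<noteq> 1" "\<epsilon> b \<noteq> 1"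
    | "\<epsilon> a = 1" "\<epsilon> b \<noteq> 1" "a \<noteq> b" | "\<epsilon> a \<noteq> 1" "\<epsilon> b = 1" "a \<noteq> b"
    by metis
  then show ?thesis
  proof cases
    case 1
    then show ?thesis by (simp add: po_def qo_def ann_cre)
  next
    case 2
    then show ?thesis by (auto simp add: po_def qo_def ann_cre)
  next
    case 3
    then show ?thesis using ann_ann[of "XV a i" "XV b j"] by (simp add: po_def qo_def)
  next
    case 4
    then show ?thesis using cre_cre[of "XV a i" "XV b j"] by (simp add: po_def qo_def)
  qed
qed

lemma qo_po: "qo \<epsilon> a i * po \<epsilon> b j = (if a = b \<and> i = j then 1 else 0) - po \<epsilon> b j * qo \<epsilon> a i"
  using po_qo[of \<epsilon> b j a i] by simp

text \<open>Since T * vop w = vop (app T w), vectors become ring elements, and the eigenvector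
  lemmas of the abstract locales apply to them. The index \<open>undefined\<close> is just a fixed
  basis element.\<close>

definition vop :: "('b \<Rightarrow>\<^sub>0 complex) \<Rightarrow> 'b lop" where
  "vop w = Lop (\<lambda>u. fscale (Poly_Mapping.lookup u undefined) w)"

lemma app_vop: "app (vop w) u = fscale (Poly_Mapping.lookup u undefined) w"
  unfolding vop_def
  by (subst app_Lop) (simp_all add: linop_def lookup_add lookup_fscale fvs.scale_left_distrib)

lemma vop_simps: "T * vop w = vop (app T w)" "a \<star> vop w = vop (fscale a w)"
  by (rule lop_eqI; simp add: app_ops app_lscale app_vop app_simps mult.commute)+

lemma vop_inject: "vop v = vop w \<longleftrightarrow> v = w"
proof
  assume "vop v = vop w"
  then have "app (vop v) (Poly_Mapping.single undefined 1) = app (vop w) (Poly_Mapping.single undefined 1)"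
    by simp
  then show "v = w" by (simp add: app_vop)
qed simp

definition wt :: "xvar set lop \<Rightarrow> complex \<Rightarrow> grass \<Rightarrow> bool" where
  "wt N c w \<longleftrightarrow> app N w = fscale c w"

lemma wt_commute: "T * N = N * T \<Longrightarrow> wt N c w \<Longrightarrow> wt N c (app T w)"
  by (metis app_times linop_fscale linop_app wt_def)

locale fock =
  fixes n :: nat and eps :: "nat \<Rightarrow> int"
begin

abbreviation "q \<equiv> qo eps"
abbreviation "p \<equiv> po eps"

definition D :: "nat \<Rightarrow> nat \<Rightarrow> xvar set lop" where
  "D a b = (\<Sum>i = 1..n. q a i * p b i)"

lemma sum_if_eq:
  assumes "j \<in> {1..n}"
  shows "(\<Sum>i = 1..n. if P \<and> i = j then f i else 0) = (if P then f j else (0 :: xvar set lop))"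
  using assms by (cases P) simp_all

lemma D_p:
  assumes "j \<in> {1..n}"
  shows "D a b * p c j = p c j * D a b - (if a = c then p b j else 0)"
proof -
  have "q a i * p b i * p c j = p c j * (q a i * p b i) - (if a = c \<and> i = j then p b i else 0)" for i
  proof -
    have "q a i * p b i * p c j = q a i * (p b i * p c j)"
      by (simp only: mult.assoc)
    also have "\<dots> = - (q a i * p c j) * p b i"
      unfolding po_po[of eps b i c j] by (simp add: mult.assoc)
    also have "\<dots> = p c j * (q a i * p b i) - (if a = c \<and> i = j then p b i else 0)"
      unfolding qo_po[of eps a i c j] by (simp add: algebra_simps)
    finally show ?thesis .
  qed
  then show ?thesis
    using sum_if_eq[OF assms, of "a = c" "p b"]
    by (simp add: D_def sum_distrib_left sum_distrib_right sum_subtractf)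
qed

lemma D_q:
  assumes "j \<in> {1..n}"
  shows "D a b * q c j = q c j * D a b + (if b = c then q a j else 0)"
proof -
  have "q a i * p b i * q c j = q c j * (q a i * p b i) + (if b = c \<and> i = j then q a i else 0)" for i
  proof -
    have "q a i * p b i * q c j = q a i * (p b i * q c j)"
      by (simp add: mult.assoc)
    also have "\<dots> = (if b = c \<and> i = j then q a i else 0) - (q a i * q c j) * p b i"
      by (simp add: po_qo[of eps b i c j] algebra_simps)
    finally show ?thesis by (simp add: qo_qo[of eps a i c j] algebra_simps)
  qed
  then show ?thesis
    using sum_if_eq[OF assms, of "b = c" "q a"]
    by (simp add: D_def sum_distrib_left sum_distrib_right sum.distrib)
qed

lemma D_D: "D a b * D c d = D c d * D a b + (if b = c then D a d else 0) - (if a = d then D c b else 0)"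
proof -
  have "D a b * (q c i * p d i) = q c i * p d i * D a b + (if b = c then q a i * p d i else 0)
      - (if a = d then q c i * p b i else 0)" if "i \<in> {1..n}" for i
  proof -
    have "D a b * (q c i * p d i) = (D a b * q c i) * p d i"
      by (simp add: mult.assoc)
    also have "\<dots> = q c i * (D a b * p d i) + (if b = c then q a i * p d i else 0)"
      unfolding D_q[OF that] by (simp add: algebra_simps)
    finally show ?thesis unfolding D_p[OF that] by (cases "a = d"; cases "b = c") (simp_all add: algebra_simps)
  qed
  then have "D a b * D c d = (\<Sum>i = 1..n. q c i * p d i * D a b + (if b = c then q a i * p d i else 0)
      - (if a = d then q c i * p b i else 0))"
    unfolding D_def[of c d] sum_distrib_left by (intro sum.cong) auto
  then show ?thesis
    by (simp add: D_def[of c d] D_def[of a d] D_def[of c b] sum.distrib sum_subtractf sum_distrib_right)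
qed

text \<open>In a row of sign -1 the operator \<open>q\<close> removes a variable, so a column counts
  as occupied when its variable is absent. With this convention \<open>D a a\<close> counts occupied
  columns for either sign, and its eigenvalue on the module is \<open>nubar\<close>.\<close>

definition occupied :: "nat \<Rightarrow> nat \<Rightarrow> xvar set \<Rightarrow> bool" where
  "occupied a i A \<longleftrightarrow> (XV a i \<in> A) = (eps a = 1)"

definition nocc :: "nat \<Rightarrow> xvar set \<Rightarrow> nat" where
  "nocc a A = card {i \<in> {1..n}. occupied a i A}"

lemma nocc_le: "nocc a A \<le> n"
proof -
  have "nocc a A \<le> card {1..n}"
    unfolding nocc_def by (rule card_mono) auto
  then show ?thesis by simp
qed

lemma qp_single: "app (q a i * p a i) (Poly_Mapping.single A c) =
    (if occupied a i A then Poly_Mapping.single A c else 0)"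
  by (auto simp: qo_def po_def app_ops app_simps cre_single ann_single occupied_def insert_absorb
      gsign_insert gsign_remove mult.assoc)

lemma D_diag_single: "app (D a a) (Poly_Mapping.single A c) = fscale (of_nat (nocc a A)) (Poly_Mapping.single A c)"
proof -
  have "app (D a a) (Poly_Mapping.single A c) =
      (\<Sum>i\<in>{1..n}. if occupied a i A then Poly_Mapping.single A c else 0)"
    unfolding D_def app_sum qp_single ..
  also have "\<dots> = (\<Sum>i\<in>{i\<in>{1..n}. occupied a i A}. Poly_Mapping.single A c)"
    by (rule sum.inter_filter[symmetric]) simp
  finally show ?thesis
    by (simp add: nocc_def fvs.sum_constant_scale)
qed

lemma lookup_D_diag: "Poly_Mapping.lookup (app (D a a) v) A = of_nat (nocc a A) * Poly_Mapping.lookup v A"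
proof -
  define f where "f = (\<lambda>A. Poly_Mapping.single A (of_nat (nocc a A) :: complex))"
  have "app (D a a) v = lin_ext f v"
    by (rule linop_eq_on_keys) (simp_all add: D_diag_single f_def)
  moreover have "Poly_Mapping.lookup v k * Poly_Mapping.lookup (f k) A =
      (if k = A then of_nat (nocc a A) * Poly_Mapping.lookup v A else 0)" for k
    by (simp add: f_def lookup_single)
  ultimately show ?thesis
    by (simp add: lookup_lin_ext in_keys_iff)
qed

lemma wt_iff_keys: "wt (D a a) (of_nat k) v \<longleftrightarrow> (\<forall>A\<in>Poly_Mapping.keys v. nocc a A = k)"
proof -
  have "wt (D a a) (of_nat k) v \<longleftrightarrow>
      (\<forall>A. of_nat (nocc a A) * Poly_Mapping.lookup v A = of_nat k * Poly_Mapping.lookup v A)"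
    unfolding wt_def poly_mapping_eq_iff by (simp add: fun_eq_iff lookup_D_diag lookup_fscale)
  then show ?thesis by (auto simp: in_keys_iff)
qed

lemma wt_too_large: "wt (D a a) (of_nat k) v \<Longrightarrow> k > n \<Longrightarrow> v = 0"
  using nocc_le[of a] by (metis wt_iff_keys ex_in_conv keys_eq_empty not_le)

lemma D_diag_D:
  assumes "a \<noteq> b"
  shows "D a a * D a b = D a b * D a a + D a b" "D b b * D a b = D a b * D b b - D a b"
  using assms by (simp_all add: D_D[of _ _ a b])

lemma D_diag_pow:
  assumes "a \<noteq> b"
  shows "D a a * D a b ^ r = D a b ^ r * D a a + of_nat r \<star> D a b ^ r"
proof (induction r)
  case (Suc r)
  have "D a a * D a b ^ Suc r = (D a a * D a b) * D a b ^ r"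
    by (simp add: mult.assoc)
  also have "\<dots> = D a b * (D a a * D a b ^ r) + D a b ^ Suc r"
    unfolding D_diag_D(1)[OF assms] by (simp add: algebra_simps)
  finally show ?case
    unfolding Suc by (simp add: algebra_simps lop.scl_nf)
qed simp

text \<open>Every application of \<open>D a b\<close> occupies one more column of row
  \<open>a\<close>, which has only n columns.\<close>

lemma D_nilpotent:
  assumes "a \<noteq> b"
  shows "D a b ^ Suc n = 0"
proof (rule lop_eqI_basis)
  fix A
  let ?v = "Poly_Mapping.single A 1 :: grass"
  have "app (D a a) (app (D a b ^ Suc n) ?v) = fscale (of_nat (nocc a A + Suc n)) (app (D a b ^ Suc n) ?v)"
    unfolding app_times[symmetric] D_diag_pow[OF assms]
    by (simp only: app_plus app_times app_lscale D_diag_single linop_fscale[OF linop_app]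
        fvs.scale_left_distrib of_nat_add)
  then have "wt (D a a) (of_nat (nocc a A + Suc n)) (app (D a b ^ Suc n) ?v)"
    by (simp add: wt_def)
  then have "app (D a b ^ Suc n) ?v = 0"
    by (rule wt_too_large) simp
  then show "app (D a b ^ Suc n) ?v = app 0 ?v"
    by (simp only: app_zero)
qed

lemma double_doublet:
  assumes "x \<noteq> y" "i \<in> {1..n}" "j \<in> {1..n}"
  shows "double_doublet (D x y) (D y x) n (p y j) (p x j) lscale (q y i) (q x i)"
proof unfold_locales
  have H: "D x y * D y x - D y x * D x y = D x x - D y y"
    using D_D[of x y y x] by simp
  show "(D x y * D y x - D y x * D x y) * D x y = D x y * (D x y * D y x - D y x * D x y) + 2 \<star> D x y"
    unfolding H using D_diag_D[OF assms(1)] by (simp add: algebra_simps lop.scl_numerals)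
  show "(D x y * D y x - D y x * D x y) * D y x = D y x * (D x y * D y x - D y x * D x y) - 2 \<star> D y x"
    unfolding H using D_diag_D[of y x] assms(1) by (simp add: algebra_simps lop.scl_numerals)
qed (use assms in \<open>simp_all add: D_nilpotent D_p D_q del: power_Suc\<close>)

lemma sl2:
  assumes "x \<noteq> y"
  shows "sl2 lscale (D x y) (D y x) n"
proof unfold_locales
  have H: "D x y * D y x - D y x * D x y = D x x - D y y"
    using D_D[of x y y x] by simp
  show "(D x y * D y x - D y x * D x y) * D x y = D x y * (D x y * D y x - D y x * D x y) + 2 \<star> D x y"
    unfolding H using D_diag_D[OF assms(1)] by (simp add: algebra_simps lop.scl_numerals)
  show "(D x y * D y x - D y x * D x y) * D y x = D y x * (D x y * D y x - D y x * D x y) - 2 \<star> D y x"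
    unfolding H using D_diag_D[of y x] assms(1) by (simp add: algebra_simps lop.scl_numerals)
qed (use assms in \<open>simp_all add: D_nilpotent D_p D_q del: power_Suc\<close>)

lemma sl2_H: "sl2.H (D x y) (D y x) = D x x - D y y" if "x \<noteq> y"
  unfolding sl2.H_def[OF sl2[OF that]] using D_D[of x y y x] by simp

definition X_ser :: "nat \<Rightarrow> nat \<Rightarrow> complex \<Rightarrow> xvar set lop" where
  "X_ser x y s = (\<Sum>r\<le>n. rcoef s r \<star> (D y x ^ r * D x y ^ r))"

definition Y_ser :: "nat \<Rightarrow> nat \<Rightarrow> complex \<Rightarrow> xvar set lop" where
  "Y_ser x y t = (\<Sum>r\<le>n. rcoef t r \<star> (D x y ^ r * D y x ^ r))"

lemma X_ser: "x \<noteq> y \<Longrightarrow> sl2.Xser lscale (D x y) (D y x) n = X_ser x y"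
  and Y_ser: "x \<noteq> y \<Longrightarrow> sl2.Yser lscale (D x y) (D y x) n = Y_ser x y"
  by (simp_all add: fun_eq_iff sl2.Xser_def[OF sl2] sl2.Yser_def[OF sl2] X_ser_def Y_ser_def)

lemma series_commutes:
  assumes "w * D x y = D x y * w" "w * D y x = D y x * w"
  shows "w * X_ser x y s = X_ser x y s * w" "w * Y_ser x y s = Y_ser x y s * w"
proof -
  have "w * D x y ^ r = D x y ^ r * w" "w * D y x ^ r = D y x ^ r * w" for r
    using assms by (metis power_commuting_commutes)+
  then have "w * (D x y ^ r * D y x ^ r) = D x y ^ r * D y x ^ r * w"
    "w * (D y x ^ r * D x y ^ r) = D y x ^ r * D x y ^ r * w" for r
    by (metis mult.assoc)+
  then show "w * X_ser x y s = X_ser x y s * w" "w * Y_ser x y s = Y_ser x y s * w"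
    by (simp_all add: X_ser_def Y_ser_def sum_distrib_left sum_distrib_right lop.scl_simps)
qed

lemma D_diag_pow':
  assumes "a \<noteq> b"
  shows "D b b * D a b ^ r = D a b ^ r * D b b - of_nat r \<star> D a b ^ r"
proof (induction r)
  case (Suc r)
  have "D b b * D a b ^ Suc r = (D b b * D a b) * D a b ^ r"
    by (simp add: mult.assoc)
  also have "\<dots> = D a b * (D b b * D a b ^ r) - D a b ^ Suc r"
    unfolding D_diag_D(2)[OF assms] by (simp add: algebra_simps)
  finally show ?case
    unfolding Suc by (simp add: algebra_simps lop.scl_nf)
qed simp

lemma D_diag_series:
  assumes "x \<noteq> y"
  shows "X_ser x y s * D c c = D c c * X_ser x y s" "Y_ser x y s * D c c = D c c * Y_ser x y s"
proof -
  have bal: "D c c * (D a b ^ r * D b a ^ r) = D a b ^ r * D b a ^ r * D c c" if "a \<noteq> b" for a b r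
  proof -
    consider "c = a" | "c = b" | "c \<noteq> a" "c \<noteq> b" by blast
    then show ?thesis
    proof cases
      case 1
      have "D a a * (D a b ^ r * D b a ^ r) = (D a a * D a b ^ r) * D b a ^ r"
        by (simp add: mult.assoc)
      also have "\<dots> = D a b ^ r * (D a a * D b a ^ r) + of_nat r \<star> (D a b ^ r * D b a ^ r)"
        unfolding D_diag_pow[OF that] by (simp add: algebra_simps lop.scl_simps)
      finally show ?thesis
        unfolding 1 D_diag_pow'[OF that[symmetric]] by (simp add: algebra_simps lop.scl_simps)
    next
      case 2
      have "D b b * (D a b ^ r * D b a ^ r) = (D b b * D a b ^ r) * D b a ^ r"
        by (simp add: mult.assoc)
      also have "\<dots> = D a b ^ r * (D b b * D b a ^ r) - of_nat r \<star> (D a b ^ r * D b a ^ r)"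
        unfolding D_diag_pow'[OF that] by (simp add: algebra_simps lop.scl_simps)
      finally show ?thesis
        unfolding 2 D_diag_pow[OF that[symmetric]] by (simp add: algebra_simps lop.scl_simps)
    next
      case 3
      then have "D c c * D a b = D a b * D c c" "D c c * D b a = D b a * D c c"
        by (simp_all add: D_D[of c c])
      then show ?thesis
        by (metis mult.assoc power_commuting_commutes)
    qed
  qed
  show "X_ser x y s * D c c = D c c * X_ser x y s" "Y_ser x y s * D c c = D c c * Y_ser x y s"
    using assms by (simp_all add: X_ser_def Y_ser_def sum_distrib_left sum_distrib_right lop.scl_simps bal)
qed

section \<open>Matrices attached to rows, and their exchange by the two series\<close>

definition E :: "nat \<Rightarrow> nat \<Rightarrow> nat \<Rightarrow> xvar set lop" where
  "E a i j = q a i * p a j"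

text \<open>\<open>D x y\<close> commutes with gl_n acting on the two rows together: the terms
  coming from row \<open>x\<close> and from row \<open>y\<close> are opposite.\<close>

lemma D_E_sum:
  assumes "x \<noteq> y" "i \<in> {1..n}" "j \<in> {1..n}"
  shows "(E x i j + E y i j) * D x y = D x y * (E x i j + E y i j)"
proof -
  have "D x y * E x i j = q x i * (D x y * p x j)" "D x y * E y i j = q y i * (D x y * p y j) + q x i * p y j"
    using assms by (simp_all add: E_def mult.assoc[symmetric] D_q distrib_right)
  then show ?thesis
    using assms by (simp add: D_p E_def algebra_simps)
qed

lemma D_E_other:
  assumes "c \<noteq> a" "c \<noteq> b" "i \<in> {1..n}" "j \<in> {1..n}"
  shows "E c i j * D a b = D a b * E c i j"
proof -
  have "D a b * E c i j = q c i * (D a b * p c j)"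
    using assms by (simp add: E_def mult.assoc[symmetric] D_q)
  then show ?thesis using assms by (simp add: D_p E_def mult.assoc)
qed

lemma E_q_other: "c \<noteq> a \<Longrightarrow> E c i j * q a k = q a k * E c i j"
  by (simp add: E_def mult.assoc po_qo[of eps c j a k]) (simp add: mult.assoc[symmetric] qo_qo[of eps c i a k])

lemma E_p_other: "c \<noteq> a \<Longrightarrow> E c i j * p a k = p a k * E c i j"
  by (simp add: E_def mult.assoc po_po[of eps c j a k]) (simp add: mult.assoc[symmetric] qo_po[of eps c i a k])

lemma E_E_other: "c \<noteq> a \<Longrightarrow> E c i j * E a k l = E a k l * E c i j"
  unfolding E_def[of a] using E_q_other[of c a i j k] E_p_other[of c a i j l] by (metis mult.assoc)

lemma D_diag_E: "i \<in> {1..n} \<Longrightarrow> j \<in> {1..n} \<Longrightarrow> E c i j * D a a = D a a * E c i j"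
proof -
  assume ij: "i \<in> {1..n}" "j \<in> {1..n}"
  have "D a a * E c i j = q c i * (D a a * p c j) + (if a = c then E c i j else 0)"
    using ij by (simp add: E_def mult.assoc[symmetric] D_q distrib_right)
  then show ?thesis
    unfolding D_p[OF ij(2)] by (cases "a = c") (simp_all add: E_def algebra_simps)
qed

text \<open>The variable \<open>X\<close> stands for \<open>1 / u\<close>.\<close>

definition Le :: "(nat \<Rightarrow> complex) \<Rightarrow> complex \<Rightarrow> nat \<Rightarrow> nat \<Rightarrow> nat \<Rightarrow> xvar set lop" where
  "Le z X a i j = (if i = j then (1 - z a * X) \<star> 1 else 0) + X \<star> E a i j"

lemma Le_commutes: "w * E a i j = E a i j * w \<Longrightarrow> w * Le z X a i j = Le z X a i j * w"
  by (simp add: Le_def algebra_simps lop.scl_simps)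

lemma mat_prod_Le_pair:
  assumes "x \<noteq> y" "i \<in> {1..n}" "j \<in> {1..n}"
  shows "mat_prod n (Le z X) [x, y] i j = (if i = j then ((1 - z x * X) * (1 - z y * X)) \<star> 1 else 0)
     + ((1 - z x * X) * X) \<star> E y i j + ((1 - z y * X) * X) \<star> E x i j
     - (X * X) \<star> (q x i * D y x * p y j)"
proof -
  have EE: "(\<Sum>k = 1..n. E x i k * E y k j) = - (q x i * D y x * p y j)"
  proof -
    have "E x i k * E y k j = - (q x i * (q y k * p x k) * p y j)" for k
      using assms(1) po_qo[of eps x k y k] by (simp add: E_def mult.assoc[symmetric])
        (simp add: mult.assoc)
    then show ?thesis by (simp add: D_def sum_distrib_left sum_distrib_right sum_negf)
  qed
  have "mat_prod n (Le z X) [x, y] i j = (\<Sum>k = 1..n. Le z X x i k * Le z X y k j)"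
    using mat_prod_single[OF assms(3), of "Le z X" y] by simp
  also have "\<dots> = (\<Sum>k = 1..n. (if i = k then (1 - z x * X) \<star> 1 else 0) * Le z X y k j)
     + (\<Sum>k = 1..n. X \<star> (E x i k * (if k = j then (1 - z y * X) \<star> 1 else 0)))
     + (\<Sum>k = 1..n. (X * X) \<star> (E x i k * E y k j))"
    unfolding Le_def[of _ _ x] sum.distrib[symmetric]
    by (intro sum.cong refl) (simp add: Le_def algebra_simps lop.scl_simps)
  also have "(\<Sum>k = 1..n. (if i = k then (1 - z x * X) \<star> 1 else 0) * Le z X y k j) = (1 - z x * X) \<star> Le z X y i j"
    unfolding sum_delta_mult_left[OF assms(2)] by (simp add: lop.scl_simps)
  also have "(\<Sum>k = 1..n. X \<star> (E x i k * (if k = j then (1 - z y * X) \<star> 1 else 0))) = (X * (1 - z y * X)) \<star> E x i j"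
    unfolding lop.scl_sum[symmetric] sum_delta_mult_right[OF assms(3)] by (simp add: lop.scl_simps)
  also have "(\<Sum>k = 1..n. (X * X) \<star> (E x i k * E y k j)) = - ((X * X) \<star> (q x i * D y x * p y j))"
    unfolding lop.scl_sum[symmetric] EE by (rule lop.scl_minus_right)
  finally show ?thesis
    by (simp add: Le_def lop.scl_simps mult.commute)
qed

text \<open>As \<open>S\<close> commutes with E x + E y, exchanging the two row matrices for all X
  reduces to a single relation free of X, the coefficient of X * X.\<close>

lemma mat_prod_Le_swap:
  assumes xy: "x \<noteq> y" "i \<in> {1..n}" "j \<in> {1..n}"
    and comm: "S * (E x i j + E y i j) = (E x i j + E y i j) * S"
    and S: "S * ((z y - z x) \<star> (q y i * p y j) - q x i * D y x * p y j) * v =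
       ((z y - z x) \<star> (q y i * p y j) - q y i * D x y * p x j) * S * v"
  shows "S * mat_prod n (Le z X) [x, y] i j * v = mat_prod n (Le z X) [y, x] i j * S * v"
proof -
  let ?c = "(if i = j then ((1 - z x * X) * (1 - z y * X)) \<star> 1 else 0) :: xvar set lop"
  \<comment> \<open>Only the sum E x + E y is known to commute with \<open>S\<close>, so both are
    given a common coefficient; the coefficients differ by X * X * (z y - z x), which joins the
    quadratic term.\<close>
  have split: "((1 - z x * X) * X) \<star> E y i j + ((1 - z y * X) * X) \<star> E x i j =
     ((1 - z y * X) * X) \<star> (E x i j + E y i j) + (X * X) \<star> (z y - z x) \<star> E y i j"
  proof -
    have "(1 - z x * X) * X = (1 - z y * X) * X + X * X * (z y - z x)"
      by (simp add: algebra_simps)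
    then show ?thesis
      by (simp only: lop.scl_left_distrib lop.scl_right_distrib lop.scl_scl) (simp add: add_ac)
  qed
  have xy1: "mat_prod n (Le z X) [x, y] i j = ?c + ((1 - z y * X) * X) \<star> (E x i j + E y i j)
     + (X * X) \<star> ((z y - z x) \<star> (q y i * p y j) - q x i * D y x * p y j)"
    unfolding mat_prod_Le_pair[OF xy] add.assoc split E_def[of y, symmetric]
    by (simp add: lop.scl_diff_right E_def)
  have yx1: "mat_prod n (Le z X) [y, x] i j = ?c + ((1 - z y * X) * X) \<star> (E x i j + E y i j)
     + (X * X) \<star> ((z y - z x) \<star> (q y i * p y j) - q y i * D x y * p x j)"
  proof -
    have "mat_prod n (Le z X) [y, x] i j = ?c + (((1 - z x * X) * X) \<star> E y i j + ((1 - z y * X) * X) \<star> E x i j)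
       - (X * X) \<star> (q y i * D x y * p x j)"
      unfolding mat_prod_Le_pair[OF xy(1)[symmetric] xy(2,3)] by (simp add: mult.commute add_ac)
    then show ?thesis
      unfolding split by (simp add: lop.scl_diff_right E_def)
  qed
  have c: "S * ?c = ?c * S" by (simp add: lop.scl_simps)
  have "S * mat_prod n (Le z X) [x, y] i j * v = S * ?c * v
     + ((1 - z y * X) * X) \<star> (S * (E x i j + E y i j) * v)
     + (X * X) \<star> (S * ((z y - z x) \<star> (q y i * p y j) - q x i * D y x * p y j) * v)"
    unfolding xy1 by (simp only: distrib_left distrib_right lop.scl_mult_left lop.scl_mult_right)
  also have "\<dots> = mat_prod n (Le z X) [y, x] i j * S * v"
    unfolding S c comm yx1 by (simp only: distrib_left distrib_right lop.scl_mult_left lop.scl_mult_right mult.assoc)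
  finally show ?thesis .
qed

lemma X_ser_swap:
  assumes xy: "x \<noteq> y" "i \<in> {1..n}" "j \<in> {1..n}"
    and s: "\<forall>k. 1 \<le> k \<and> k \<le> n \<longrightarrow> s \<noteq> of_nat k"
    and H: "(D x x - D y y) * v = h \<star> v" and t: "z y - z x = s + h"
  shows "X_ser x y s * mat_prod n (Le z X) [x, y] i j * v = mat_prod n (Le z X) [y, x] i j * X_ser x y s * v"
proof (rule mat_prod_Le_swap[OF xy])
  interpret double_doublet "D x y" "D y x" n "p y j" "p x j" lscale "q y i" "q x i"
    by (rule double_doublet[OF xy])
  show "X_ser x y s * (E x i j + E y i j) = (E x i j + E y i j) * X_ser x y s"
    using series_commutes(1)[OF D_E_sum[OF xy]] D_E_sum[of y x i j] xy by (simp add: add.commute)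
  show "X_ser x y s * ((z y - z x) \<star> (q y i * p y j) - q x i * D y x * p y j) * v =
       ((z y - z x) \<star> (q y i * p y j) - q y i * D x y * p x j) * X_ser x y s * v"
    using Xser_intertwines[OF s _ t, of v] H sl2_H[OF xy(1)] by (simp add: X_ser[OF xy(1)])
qed

lemma Y_ser_swap:
  assumes xy: "x \<noteq> y" "i \<in> {1..n}" "j \<in> {1..n}"
    and t: "\<forall>k\<le>n. z y - z x \<noteq> of_nat k"
  shows "Y_ser x y (z y - z x) * mat_prod n (Le z X) [x, y] i j * v =
     mat_prod n (Le z X) [y, x] i j * Y_ser x y (z y - z x) * v"
proof (rule mat_prod_Le_swap[OF xy])
  interpret double_doublet "D x y" "D y x" n "p y j" "p x j" lscale "q y i" "q x i"
    by (rule double_doublet[OF xy])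
  show "Y_ser x y (z y - z x) * (E x i j + E y i j) = (E x i j + E y i j) * Y_ser x y (z y - z x)"
    using series_commutes(2)[OF D_E_sum[OF xy]] D_E_sum[of y x i j] xy by (simp add: add.commute)
  show "Y_ser x y (z y - z x) * ((z y - z x) \<star> (q y i * p y j) - q x i * D y x * p y j) * v =
       ((z y - z x) \<star> (q y i * p y j) - q y i * D x y * p x j) * Y_ser x y (z y - z x) * v"
    using Yser_intertwines[OF t] by (simp add: Y_ser[OF xy(1)])
qed

end

section \<open>Factors of Z as intertwiners between products in different orders of the rows\<close>

context fock
begin

text \<open>On degrees nu x and nu y the operator D x x - D y y has eigenvalue nu x - nu y, and the
  parameter of X plus this eigenvalue is z y - z x, as \<open>X_ser_swap\<close> requires. Hence X
  carries the weight z + nu, that is lambda-bar, and Y the weight z, that is mu.\<close>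

definition Zfac :: "(nat \<Rightarrow> nat) \<Rightarrow> (nat \<Rightarrow> complex) \<Rightarrow> nat \<times> nat \<Rightarrow> xvar set lop" where
  "Zfac \<nu> z = (\<lambda>(x, y). if \<nu> x \<ge> \<nu> y then X_ser x y ((z y + of_nat (\<nu> y)) - (z x + of_nat (\<nu> x)))
     else Y_ser x y (z y - z x))"

definition Zprod :: "(nat \<Rightarrow> nat) \<Rightarrow> (nat \<Rightarrow> complex) \<Rightarrow> (nat \<times> nat) list \<Rightarrow> xvar set lop" where
  "Zprod \<nu> z ps = foldr (\<lambda>xy. (*) (Zfac \<nu> z xy)) ps 1"

lemma Zprod_simps [simp]: "Zprod \<nu> z [] = 1" "Zprod \<nu> z (xy # ps) = Zfac \<nu> z xy * Zprod \<nu> z ps"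
  by (simp_all add: Zprod_def)

definition good :: "(nat \<Rightarrow> nat) \<Rightarrow> (nat \<Rightarrow> complex) \<Rightarrow> nat \<Rightarrow> nat \<Rightarrow> bool" where
  "good \<nu> z x y \<longleftrightarrow> (\<forall>k\<ge>1. (z x + of_nat (\<nu> x)) - (z y + of_nat (\<nu> y)) \<noteq> - of_nat k)"

definition Wt :: "(nat \<Rightarrow> nat) \<Rightarrow> nat set \<Rightarrow> grass set" where
  "Wt \<nu> R = {w. \<forall>a\<in>R. wt (D a a) (of_nat (\<nu> a)) w}"

lemma good_X:
  assumes "good \<nu> z x y"
  shows "\<forall>k. 1 \<le> k \<and> k \<le> n \<longrightarrow> (z y + of_nat (\<nu> y)) - (z x + of_nat (\<nu> x)) \<noteq> of_nat k"
proof (intro allI impI notI)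
  fix k assume "1 \<le> k \<and> k \<le> n" and *: "(z y + of_nat (\<nu> y)) - (z x + of_nat (\<nu> x)) = of_nat k"
  have "(z x + of_nat (\<nu> x)) - (z y + of_nat (\<nu> y)) = - of_nat k"
    using * by (metis minus_diff_eq)
  then show False using assms \<open>1 \<le> k \<and> k \<le> n\<close> unfolding good_def by blast
qed

text \<open>A value z y - z x = k would make the difference of the z + nu equal to -(k + nu y - nu
  x). As nu x < nu y is strict, this covers k = 0, which the relations for Y exclude too.\<close>

lemma good_Y:
  assumes "good \<nu> z x y" "\<nu> x < \<nu> y"
  shows "z y - z x \<noteq> of_nat k"
proof
  assume *: "z y - z x = of_nat k"
  have "(of_nat (k + (\<nu> y - \<nu> x)) :: complex) = of_nat k + of_nat (\<nu> y) - of_nat (\<nu> x)"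
    using assms(2) by (simp add: of_nat_diff)
  then have "(z x + of_nat (\<nu> x)) - (z y + of_nat (\<nu> y)) = - of_nat (k + (\<nu> y - \<nu> x))"
    unfolding *[symmetric] by (simp add: algebra_simps)
  moreover have "k + (\<nu> y - \<nu> x) \<ge> 1" using assms(2) by simp
  ultimately show False using assms(1) unfolding good_def by blast
qed

lemma wt_diff:
  assumes "wt (D x x) a w" "wt (D y y) b w"
  shows "(D x x - D y y) * vop w = (a - b) \<star> vop w"
  using assms unfolding wt_def vop_simps by (simp only: app_minus fvs.scale_left_diff_distrib)

lemma Zfac_swap:
  assumes xy: "x \<noteq> y" "i \<in> {1..n}" "j \<in> {1..n}" and g: "good \<nu> z x y" and w: "w \<in> Wt \<nu> {x, y}"
  shows "app (Zfac \<nu> z (x, y) * mat_prod n (Le z X) [x, y] i j) w =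
    app (mat_prod n (Le z X) [y, x] i j * Zfac \<nu> z (x, y)) w"
proof -
  have H: "(D x x - D y y) * vop w = (of_nat (\<nu> x) - of_nat (\<nu> y)) \<star> vop w"
    by (rule wt_diff) (use w in \<open>auto simp: Wt_def\<close>)
  have "Zfac \<nu> z (x, y) * mat_prod n (Le z X) [x, y] i j * vop w =
    mat_prod n (Le z X) [y, x] i j * Zfac \<nu> z (x, y) * vop w"
  proof (cases "\<nu> x \<ge> \<nu> y")
    case True
    then show ?thesis
      using X_ser_swap[OF xy good_X[OF g] H, of z X] by (simp add: Zfac_def del: mat_prod.simps)
  next
    case False
    then have "\<forall>k\<le>n. z y - z x \<noteq> of_nat k"
      using good_Y[OF g] by simp
    then show ?thesis
      using Y_ser_swap[OF xy, of z X "vop w"] False by (simp add: Zfac_def del: mat_prod.simps)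
  qed
  then show ?thesis by (simp only: vop_simps vop_inject)
qed

lemma Zfac_commutes:
  assumes "w * D x y = D x y * w" "w * D y x = D y x * w"
  shows "w * Zfac \<nu> z (x, y) = Zfac \<nu> z (x, y) * w"
  using series_commutes[OF assms] by (simp add: Zfac_def)

lemma Zfac_D_diag: "x \<noteq> y \<Longrightarrow> Zfac \<nu> z (x, y) * D c c = D c c * Zfac \<nu> z (x, y)"
  by (simp add: Zfac_def D_diag_series)

lemma Zfac_Wt: "x \<noteq> y \<Longrightarrow> w \<in> Wt \<nu>' R \<Longrightarrow> app (Zfac \<nu> z (x, y)) w \<in> Wt \<nu>' R"
  by (auto simp: Wt_def intro: wt_commute Zfac_D_diag)

lemma mat_prod_Le_commutes:
  assumes "\<And>a i j. a \<in> set l \<Longrightarrow> i \<in> {1..n} \<Longrightarrow> j \<in> {1..n} \<Longrightarrow> w * E a i j = E a i j * w"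
    "i \<in> {1..n}" "j \<in> {1..n}"
  shows "w * mat_prod n (Le z X) l i j = mat_prod n (Le z X) l i j * w"
  using assms by (intro mat_prod_commutes Le_commutes) auto

lemma mat_prod_Le_D_diag:
  assumes "i \<in> {1..n}" "j \<in> {1..n}"
  shows "mat_prod n (Le z X) l i j * D c c = D c c * mat_prod n (Le z X) l i j"
  using mat_prod_Le_commutes[of l "D c c" i j z X] D_diag_E assms by simp

lemma mat_prod_Le_Wt:
  "i \<in> {1..n} \<Longrightarrow> j \<in> {1..n} \<Longrightarrow> w \<in> Wt \<nu> R \<Longrightarrow> app (mat_prod n (Le z X) l i j) w \<in> Wt \<nu> R"
  unfolding Wt_def using wt_commute[OF mat_prod_Le_D_diag[of i j z X l]] by blast

lemma Zfac_mat_prod_other: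
  assumes "x \<notin> set l" "y \<notin> set l" "i \<in> {1..n}" "j \<in> {1..n}"
  shows "Zfac \<nu> z (x, y) * mat_prod n (Le z X) l i j = mat_prod n (Le z X) l i j * Zfac \<nu> z (x, y)"
proof (rule mat_prod_Le_commutes[OF _ assms(3,4)])
  fix a i j assume a: "a \<in> set l" "i \<in> {1..n}" "j \<in> {1..n}"
  then have "a \<noteq> x" "a \<noteq> y" using assms by auto
  then show "Zfac \<nu> z (x, y) * E a i j = E a i j * Zfac \<nu> z (x, y)"
    using Zfac_commutes[of "E a i j" x y \<nu> z] D_E_other[of a x y i j] D_E_other[of a y x i j] a by simp
qed

text \<open>Asked on weight vectors, because X intertwines only there; preservation of
  \<open>Wt\<close> is included so that intertwiners can be composed.\<close>

definition intertwines :: "(nat \<Rightarrow> nat) \<Rightarrow> (nat \<Rightarrow> complex) \<Rightarrow> nat set \<Rightarrow> nat list \<Rightarrow> nat list \<Rightarrow> xvar set lop \<Rightarrow> bool" where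
  "intertwines \<nu> z R l l' T \<longleftrightarrow> (\<forall>w\<in>Wt \<nu> R. app T w \<in> Wt \<nu> R \<and>
     (\<forall>X. \<forall>i\<in>{1..n}. \<forall>j\<in>{1..n}. app (T * mat_prod n (Le z X) l i j) w = app (mat_prod n (Le z X) l' i j * T) w))"

lemma intertwines_mult:
  assumes "intertwines \<nu> z R l l' T" "intertwines \<nu> z R l' l'' T'"
  shows "intertwines \<nu> z R l l'' (T' * T)"
  using assms unfolding intertwines_def app_times by metis

lemma intertwines_one: "intertwines \<nu> z R l l 1"
  by (simp add: intertwines_def app_one)

lemma intertwines_Cons:
  assumes T: "intertwines \<nu> z R l l' T"
    and comm: "\<And>i j. i \<in> {1..n} \<Longrightarrow> j \<in> {1..n} \<Longrightarrow> T * E b i j = E b i j * T"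
  shows "intertwines \<nu> z R (b # l) (b # l') T"
  unfolding intertwines_def
proof (intro ballI conjI allI)
  fix w X i j assume w: "w \<in> Wt \<nu> R" and ij: "i \<in> {1..n}" "j \<in> {1..n}"
  have "app (T * (Le z X b i k * mat_prod n (Le z X) l k j)) w = app (Le z X b i k * mat_prod n (Le z X) l' k j * T) w"
    if k: "k \<in> {1..n}" for k
  proof -
    have "T * (Le z X b i k * mat_prod n (Le z X) l k j) = Le z X b i k * (T * mat_prod n (Le z X) l k j)"
      using Le_commutes[OF comm[OF ij(1) k], of z X] by (metis mult.assoc)
    then show ?thesis
      using T w k ij(2) by (simp only: app_times intertwines_def)
  qed
  then show "app (T * mat_prod n (Le z X) (b # l) i j) w = app (mat_prod n (Le z X) (b # l') i j * T) w"
    by (simp add: sum_distrib_left sum_distrib_right app_sum)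
qed (use T in \<open>simp add: intertwines_def\<close>)

text \<open>The matrices of the remaining rows stand to the right, preserve weights and commute with
  the factor, so the relation for two rows can be used on the vectors they produce.\<close>

lemma intertwines_adjacent_head:
  assumes xy: "x \<noteq> y" "x \<in> R" "y \<in> R" "x \<notin> set l" "y \<notin> set l" and g: "good \<nu> z x y"
  shows "intertwines \<nu> z R (x # y # l) (y # x # l) (Zfac \<nu> z (x, y))"
  unfolding intertwines_def
proof (intro ballI conjI allI)
  fix w assume w: "w \<in> Wt \<nu> R"
  then show "app (Zfac \<nu> z (x, y)) w \<in> Wt \<nu> R"
    using Zfac_Wt xy by blast
  fix X i j assume ij: "i \<in> {1..n}" "j \<in> {1..n}"
  let ?M = "mat_prod n (Le z X)"
  have app2: "?M (a # b # l) i j = (\<Sum>k = 1..n. ?M [a, b] i k * ?M l k j)" for a b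
    using mat_prod_append[OF ij(1), of "Le z X" "[a, b]" l j] by (simp del: mat_prod.simps)
  have "app (Zfac \<nu> z (x, y) * (?M [x, y] i k * ?M l k j)) w = app (?M [y, x] i k * ?M l k j * Zfac \<nu> z (x, y)) w"
    if k: "k \<in> {1..n}" for k
  proof -
    let ?w = "app (?M l k j) w"
    have "?w \<in> Wt \<nu> {x, y}"
      using mat_prod_Le_Wt[OF k ij(2) w] xy by (auto simp: Wt_def)
    then have "app (Zfac \<nu> z (x, y) * ?M [x, y] i k) ?w = app (?M [y, x] i k * Zfac \<nu> z (x, y)) ?w"
      by (rule Zfac_swap[OF xy(1) ij(1) k g])
    moreover have "Zfac \<nu> z (x, y) * ?M l k j = ?M l k j * Zfac \<nu> z (x, y)"
      by (rule Zfac_mat_prod_other[OF xy(4,5) k ij(2)])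
    ultimately show ?thesis
      by (simp only: app_times) (metis app_times)
  qed
  then show "app (Zfac \<nu> z (x, y) * ?M (x # y # l) i j) w = app (?M (y # x # l) i j * Zfac \<nu> z (x, y)) w"
    unfolding app2 by (simp add: sum_distrib_left sum_distrib_right app_sum del: mat_prod.simps)
qed

lemma intertwines_adjacent:
  assumes "x \<noteq> y" "x \<in> R" "y \<in> R" "x \<notin> set (l1 @ l2)" "y \<notin> set (l1 @ l2)" and g: "good \<nu> z x y"
  shows "intertwines \<nu> z R (l1 @ x # y # l2) (l1 @ y # x # l2) (Zfac \<nu> z (x, y))"
  using assms
proof (induction l1)
  case Nil
  then show ?case using intertwines_adjacent_head by simp
next
  case (Cons a l1)
  have "intertwines \<nu> z R (a # (l1 @ x # y # l2)) (a # (l1 @ y # x # l2)) (Zfac \<nu> z (x, y))"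
  proof (rule intertwines_Cons)
    fix i j assume ij: "i \<in> {1..n}" "j \<in> {1..n}"
    show "Zfac \<nu> z (x, y) * E a i j = E a i j * Zfac \<nu> z (x, y)"
      using Zfac_commutes[of "E a i j" x y \<nu> z] D_E_other[of a x y i j] D_E_other[of a y x i j] ij
        Cons.prems by simp
  qed (use Cons in simp)
  then show ?case by simp
qed

lemma Zprod_commutes:
  assumes "\<And>x y. (x, y) \<in> set ps \<Longrightarrow> w * D x y = D x y * w \<and> w * D y x = D y x * w"
  shows "w * Zprod \<nu> z ps = Zprod \<nu> z ps * w"
  using assms
proof (induction ps)
  case (Cons xy ps)
  obtain x y where xy: "xy = (x, y)" by (cases xy)
  have "w * Zfac \<nu> z xy = Zfac \<nu> z xy * w" "w * Zprod \<nu> z ps = Zprod \<nu> z ps * w"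
    using Cons Zfac_commutes[of w x y] by (auto simp: xy)
  then show ?case by (metis Zprod_simps(2) mult.assoc)
qed simp

lemma Zprod_E_other:
  assumes "\<And>x y. (x, y) \<in> set ps \<Longrightarrow> a \<noteq> x \<and> a \<noteq> y" "i \<in> {1..n}" "j \<in> {1..n}"
  shows "Zprod \<nu> z ps * E a i j = E a i j * Zprod \<nu> z ps"
  using Zprod_commutes[of ps "E a i j" \<nu> z] assms D_E_other by metis

lemma intertwines_move:
  assumes "distinct (c # l)" "set (c # l) \<subseteq> R" "\<And>b. b \<in> set l \<Longrightarrow> good \<nu> z b c"
  shows "intertwines \<nu> z R (l @ [c]) (c # l) (Zprod \<nu> z (map (\<lambda>b. (b, c)) l))"
  using assms
proof (induction l)
  case Nil
  then show ?case by (simp add: intertwines_one)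
next
  case (Cons b l)
  have "intertwines \<nu> z R (b # (l @ [c])) (b # (c # l)) (Zprod \<nu> z (map (\<lambda>b. (b, c)) l))"
    by (rule intertwines_Cons[OF Cons.IH Zprod_E_other]) (use Cons.prems in auto)
  moreover have "intertwines \<nu> z R (b # c # l) (c # b # l) (Zfac \<nu> z (b, c))"
    by (rule intertwines_adjacent_head) (use Cons.prems in auto)
  ultimately show ?case
    using intertwines_mult by fastforce
qed

text \<open>The operator of the normal ordering in which the row \<open>k\<close> is moved to the front after the
  preceding rows have been reversed.\<close>

fun Zrec :: "(nat \<Rightarrow> nat) \<Rightarrow> (nat \<Rightarrow> complex) \<Rightarrow> nat \<Rightarrow> xvar set lop" where
  "Zrec \<nu> z 0 = 1"
| "Zrec \<nu> z (Suc k) = Zprod \<nu> z (map (\<lambda>b. (b, Suc k)) (rev [1..<Suc k])) * Zrec \<nu> z k"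

lemma intertwines_snoc:
  assumes "intertwines \<nu> z R l l' T"
    and E: "\<And>i j. i \<in> {1..n} \<Longrightarrow> j \<in> {1..n} \<Longrightarrow> T * E c i j = E c i j * T"
  shows "intertwines \<nu> z R (l @ [c]) (l' @ [c]) T"
  unfolding intertwines_def
proof (intro ballI conjI allI)
  fix w X i j assume w: "w \<in> Wt \<nu> R" and ij: "i \<in> {1..n}" "j \<in> {1..n}"
  let ?M = "mat_prod n (Le z X)"
  have "app (T * (?M l i k * ?M [c] k j)) w = app (?M l' i k * ?M [c] k j * T) w" if k: "k \<in> {1..n}" for k
  proof -
    have "T * ?M [c] k j = ?M [c] k j * T"
      by (rule mat_prod_Le_commutes) (use E k ij in auto)
    moreover have "app (?M [c] k j) w \<in> Wt \<nu> R" by (rule mat_prod_Le_Wt[OF k ij(2) w])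
    then have "app (T * ?M l i k) (app (?M [c] k j) w) = app (?M l' i k * T) (app (?M [c] k j) w)"
      using assms ij(1) k by (simp only: intertwines_def)
    ultimately show ?thesis by (simp only: app_times) (metis app_times)
  qed
  then show "app (T * ?M (l @ [c]) i j) w = app (?M (l' @ [c]) i j * T) w"
    unfolding mat_prod_append[OF ij(1)] by (simp add: sum_distrib_left sum_distrib_right app_sum del: mat_prod.simps)
qed (use assms in \<open>simp add: intertwines_def\<close>)

lemma Zrec_commutes:
  assumes "\<And>x y. 1 \<le> x \<Longrightarrow> x < y \<Longrightarrow> y \<le> k \<Longrightarrow> w * D x y = D x y * w \<and> w * D y x = D y x * w"
  shows "w * Zrec \<nu> z k = Zrec \<nu> z k * w"
  using assms
proof (induction k)
  case (Suc k)
  have "w * Zprod \<nu> z (map (\<lambda>b. (b, Suc k)) (rev [1..<Suc k])) =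
      Zprod \<nu> z (map (\<lambda>b. (b, Suc k)) (rev [1..<Suc k])) * w"
    by (rule Zprod_commutes) (use Suc.prems in auto)
  moreover have "w * Zrec \<nu> z k = Zrec \<nu> z k * w"
    using Suc by simp
  ultimately show ?case by (metis Zrec.simps(2) mult.assoc)
qed simp

lemma intertwines_Zrec:
  assumes "k \<le> m" "\<And>a b. 1 \<le> a \<Longrightarrow> a < b \<Longrightarrow> b \<le> m \<Longrightarrow> good \<nu> z a b"
  shows "intertwines \<nu> z {1..m} [1..<Suc k] (rev [1..<Suc k]) (Zrec \<nu> z k)"
  using assms(1)
proof (induction k)
  case 0
  then show ?case by (simp add: intertwines_one)
next
  case (Suc k)
  have "intertwines \<nu> z {1..m} ([1..<Suc k] @ [Suc k]) (rev [1..<Suc k] @ [Suc k]) (Zrec \<nu> z k)"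
  proof (rule intertwines_snoc)
    show "Zrec \<nu> z k * E (Suc k) i j = E (Suc k) i j * Zrec \<nu> z k" if "i \<in> {1..n}" "j \<in> {1..n}" for i j
      using Zrec_commutes[of k "E (Suc k) i j" \<nu> z] D_E_other[of "Suc k" _ _ i j] that by simp
  qed (use Suc in simp)
  moreover have "intertwines \<nu> z {1..m} (rev [1..<Suc k] @ [Suc k]) (Suc k # rev [1..<Suc k])
      (Zprod \<nu> z (map (\<lambda>b. (b, Suc k)) (rev [1..<Suc k])))"
    by (rule intertwines_move) (use Suc.prems assms(2) in auto)
  ultimately show ?case
    using intertwines_mult by fastforce
qed

end

section \<open>Normal orderings as sequences of adjacent transpositions\<close>

text \<open>The order of two rows in a list whose inverted pairs are exactly those in
  \<open>S\<close>.\<close>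

definition ord_after :: "(nat \<times> nat) set \<Rightarrow> nat \<Rightarrow> nat \<Rightarrow> bool" where
  "ord_after S x y \<longleftrightarrow> x < y \<and> (x, y) \<notin> S \<or> y < x \<and> (y, x) \<in> S"

text \<open>Factors act from the right, so \<open>vs\<close> holds the pairs already exchanged when
  \<open>r\<close> comes up. The excluded patterns are those in which (x, z) would not lie between
  (x, y) and (y, z).\<close>

lemma normal_ordering_between:
  assumes N: "normal_ordering m (us @ r # vs)" and xyz: "1 \<le> x" "x < y" "y < z" "z \<le> m"
    and A: "A = set vs"
  shows "\<not> ((x, z) = r \<and> ((x, y) \<in> A \<longleftrightarrow> (y, z) \<in> A))"
    "\<not> ((x, y) = r \<and> (x, z) \<notin> A \<and> (y, z) \<in> A)" "\<not> ((x, y) = r \<and> (x, z) \<in> A \<and> (y, z) \<notin> A)"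
    "\<not> ((y, z) = r \<and> (x, z) \<notin> A \<and> (x, y) \<in> A)" "\<not> ((y, z) = r \<and> (x, z) \<in> A \<and> (x, y) \<notin> A)"
proof -
  let ?ps = "us @ r # vs"
  have set: "set ?ps = {(a, b). 1 \<le> a \<and> a < b \<and> b \<le> m}" and dist: "distinct ?ps"
    using N by (simp_all add: normal_ordering_def)
  have "(x, y) \<in> set ?ps" "(x, z) \<in> set ?ps" "(y, z) \<in> set ?ps"
    unfolding set using xyz by auto
  then obtain i j k where ijk: "i < length ?ps" "j < length ?ps" "k < length ?ps"
    "?ps ! i = (x, y)" "?ps ! j = (x, z)" "?ps ! k = (y, z)"
    by (metis in_set_conv_nth)
  then have btw: "i < j \<and> j < k \<or> k < j \<and> j < i"
    using N xyz unfolding normal_ordering_def by blast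
  have idx: "(t \<in> A \<longleftrightarrow> l > length us) \<and> (t = r \<longleftrightarrow> l = length us)" if "l < length ?ps" "?ps ! l = t" for l t
  proof -
    consider "l < length us" | "l = length us" | "l > length us" by linarith
    then show ?thesis
    proof cases
      case 1
      then have "t \<in> set us" using that by (auto simp: nth_append)
      then show ?thesis using dist 1 A by auto
    next
      case 2
      then show ?thesis using dist that A by (auto simp: nth_append)
    next
      case 3
      then have "t = vs ! (l - Suc (length us))" "l - Suc (length us) < length vs"
        using that by (auto simp: nth_append nth_Cons')
      then have "t \<in> set vs" by simp
      then show ?thesis using dist 3 A by auto
    qed
  qed
  note I = idx[OF ijk(1,4)] idx[OF ijk(2,5)] idx[OF ijk(3,6)]
  show "\<not> ((x, z) = r \<and> ((x, y) \<in> A \<longleftrightarrow> (y, z) \<in> A))"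
    "\<not> ((x, y) = r \<and> (x, z) \<notin> A \<and> (y, z) \<in> A)" "\<not> ((x, y) = r \<and> (x, z) \<in> A \<and> (y, z) \<notin> A)"
    "\<not> ((y, z) = r \<and> (x, z) \<notin> A \<and> (x, y) \<in> A)" "\<not> ((y, z) = r \<and> (x, z) \<in> A \<and> (x, y) \<notin> A)"
    using I btw by auto
qed

text \<open>The next pair is adjacent in the current list: a row standing between \<open>a\<close>
  and \<open>b\<close> would, whatever its number, create a pattern excluded by betweenness.
  Exchanging the two then adds just this inversion.\<close>

lemma normal_ordering_step:
  assumes N: "normal_ordering m (us @ (a, b) # vs)"
    and l: "distinct l" "set l = {1..m}" "sorted_wrt (ord_after (set vs)) l"
  shows "\<exists>l1 l2. l = l1 @ a # b # l2 \<and> sorted_wrt (ord_after (set ((a, b) # vs))) (l1 @ b # a # l2)"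
proof -
  have "(a, b) \<in> set (us @ (a, b) # vs)" by simp
  then have ab: "1 \<le> a" "a < b" "b \<le> m" and abS: "(a, b) \<notin> set vs"
    using N unfolding normal_ordering_def by auto
  have "a \<in> set l" using ab l(2) by simp
  then obtain l1 l' where l1: "l = l1 @ a # l'" by (metis split_list)
  have "b \<in> set l1 \<or> b \<in> set l'" using ab l(2) l1 by auto
  moreover have "b \<notin> set l1"
    using l(3) ab abS unfolding l1 by (auto simp: sorted_wrt_append ord_after_def)
  ultimately obtain l2 l3 where l': "l' = l2 @ b # l3" by (metis split_list)
  have "l2 = []"
  proof (rule ccontr)
    assume "l2 \<noteq> []"
    then obtain c where c: "c \<in> set l2" by (meson last_in_set)
    have o: "ord_after (set vs) a c" "ord_after (set vs) c b"
      using l(3) c unfolding l1 l' by (auto simp: sorted_wrt_append)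
    have cm: "1 \<le> c" "c \<le> m" "c \<noteq> a" "c \<noteq> b"
      using c l(1,2) unfolding l1 l' by auto
    then consider "a < c" "c < b" | "c < a" | "b < c" by linarith
    then show False
    proof cases
      case 1
      then show ?thesis
        using o normal_ordering_between(1)[OF N ab(1) 1 ab(3) refl] by (auto simp: ord_after_def)
    next
      case 2
      then show ?thesis
        using o normal_ordering_between(4)[OF N cm(1) 2 ab(2,3) refl] ab by (auto simp: ord_after_def)
    next
      case 3
      then show ?thesis
        using o normal_ordering_between(2)[OF N ab(1,2) 3 cm(2) refl] ab by (auto simp: ord_after_def)
    qed
  qed
  then have leq: "l = l1 @ a # b # l3" using l1 l' by simp
  have mono: "ord_after (set ((a, b) # vs)) x y" if "ord_after (set vs) x y" "{x, y} \<noteq> {a, b}" for x y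
    using that by (auto simp: ord_after_def)
  have "sorted_wrt (ord_after (set ((a, b) # vs))) (l1 @ b # a # l3)"
  proof -
    have d: "a \<notin> set l1" "b \<notin> set l1" "a \<notin> set l3" "b \<notin> set l3"
      using l(1) leq by auto
    have s: "sorted_wrt (ord_after (set vs)) l1" "sorted_wrt (ord_after (set vs)) l3"
      "\<And>x. x \<in> set l3 \<Longrightarrow> ord_after (set vs) a x \<and> ord_after (set vs) b x"
      "\<And>x. x \<in> set l1 \<Longrightarrow> ord_after (set vs) x a \<and> ord_after (set vs) x b"
      "\<And>x y. x \<in> set l1 \<Longrightarrow> y \<in> set l3 \<Longrightarrow> ord_after (set vs) x y"
      using l(3) unfolding leq by (auto simp: sorted_wrt_append)
    have "sorted_wrt (ord_after (set ((a, b) # vs))) l1" "sorted_wrt (ord_after (set ((a, b) # vs))) l3"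
      using s(1,2) d by (auto intro!: sorted_wrt_mono_rel[OF _ s(1)] sorted_wrt_mono_rel[OF _ s(2)] mono
        simp del: set_simps simp: doubleton_eq_iff)
    moreover have "ord_after (set ((a, b) # vs)) b a" using ab by (simp add: ord_after_def)
    ultimately show ?thesis
      using s(3-5) d mono unfolding sorted_wrt_append sorted_wrt.simps
      by (metis (no_types, lifting) doubleton_eq_iff set_ConsD)
  qed
  then show ?thesis using leq by blast
qed

context fock
begin

text \<open>Induction over the suffixes of the ordering. The inversions of the current list of rows
  are the pairs of the suffix; in the end all pairs are inverted, which leaves only the reversed
  list.\<close>

lemma intertwines_normal_ordering:
  assumes good: "\<And>a b. 1 \<le> a \<Longrightarrow> a < b \<Longrightarrow> b \<le> m \<Longrightarrow> good \<nu> z a b"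
    and N: "normal_ordering m ps"
  shows "intertwines \<nu> z {1..m} [1..<Suc m] (rev [1..<Suc m]) (Zprod \<nu> z ps)"
proof -
  have "\<exists>l. distinct l \<and> set l = {1..m} \<and> sorted_wrt (ord_after (set vs)) l \<and>
      intertwines \<nu> z {1..m} [1..<Suc m] l (Zprod \<nu> z vs)" if "ps = us @ vs" for us vs
    using that
  proof (induction vs arbitrary: us)
    case Nil
    have "sorted_wrt (ord_after {}) [1..<Suc m]"
      by (rule sorted_wrt_mono_rel[OF _ sorted_wrt_upt]) (simp add: ord_after_def)
    moreover have "set [1..<Suc m] = {1..m}" by auto
    ultimately show ?case
      by (intro exI[of _ "[1..<Suc m]"]) (simp add: intertwines_one del: upt_Suc set_upt)
  next
    case (Cons xy vs)
    obtain a b where xy: "xy = (a, b)" by (cases xy)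
    have "ps = (us @ [xy]) @ vs" using Cons.prems by simp
    from Cons.IH[OF this] obtain l where
      l: "distinct l" "set l = {1..m}" "sorted_wrt (ord_after (set vs)) l"
      "intertwines \<nu> z {1..m} [1..<Suc m] l (Zprod \<nu> z vs)" by blast
    have "normal_ordering m (us @ (a, b) # vs)"
      using N Cons.prems xy by simp
    from normal_ordering_step[OF this l(1-3)] obtain l1 l2 where
      l12: "l = l1 @ a # b # l2" "sorted_wrt (ord_after (set ((a, b) # vs))) (l1 @ b # a # l2)"
      by blast
    have "(a, b) \<in> set ps" using Cons.prems xy by simp
    then have ab: "1 \<le> a" "a < b" "b \<le> m"
      using N unfolding normal_ordering_def by auto
    have "intertwines \<nu> z {1..m} l (l1 @ b # a # l2) (Zfac \<nu> z (a, b))"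
      unfolding l12(1) by (rule intertwines_adjacent) (use l(1) l12(1) ab good in auto)
    then have "intertwines \<nu> z {1..m} [1..<Suc m] (l1 @ b # a # l2) (Zprod \<nu> z (xy # vs))"
      unfolding xy Zprod_simps by (rule intertwines_mult[OF l(4)])
    moreover have "distinct (l1 @ b # a # l2)" "set (l1 @ b # a # l2) = {1..m}"
      using l(1,2) unfolding l12(1) by auto
    ultimately show ?case
      using l12(2) unfolding xy by blast
  qed
  from this[of "[]" ps] obtain l where
    l: "distinct l" "set l = {1..m}" "sorted_wrt (ord_after (set ps)) l"
      "intertwines \<nu> z {1..m} [1..<Suc m] l (Zprod \<nu> z ps)" unfolding append_Nil by blast
  have "set ps = {(a, b). 1 \<le> a \<and> a < b \<and> b \<le> m}"
    using N by (simp add: normal_ordering_def)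
  then have "sorted_wrt (\<lambda>x y. y < x) l"
    using l(2) by (intro sorted_wrt_mono_rel[OF _ l(3)]) (auto simp: ord_after_def)
  then have "sorted_wrt (<) (rev l)"
    by (simp add: sorted_wrt_rev)
  then have "sorted (rev l)"
    by (rule strict_sorted_imp_sorted)
  moreover have "distinct (rev l)" using l(1) by simp
  ultimately have "sorted_list_of_set (set (rev l)) = rev l"
    by (rule sorted_list_of_set.idem_if_sorted_distinct)
  moreover have "set (rev l) = {1..<Suc m}"
    using l(2) by (simp only: set_rev atLeastLessThanSuc_atLeastAtMost)
  ultimately have "rev l = [1..<Suc m]"
    by (simp only: sorted_list_of_set_range)
  then have "l = rev [1..<Suc m]" by (simp only: rev_swap rev_rev_ident)
  then show ?thesis using l(4) by (simp only:)
qed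

end

section \<open>Rational families of operators\<close>

definition polyf :: "(complex \<Rightarrow> 'b lop) \<Rightarrow> bool" where
  "polyf F \<longleftrightarrow> (\<exists>N c. \<forall>u. F u = (\<Sum>r<N. u ^ r \<star> c r))"

lemma polyf_const: "polyf (\<lambda>u. T)"
  unfolding polyf_def by (rule exI[of _ "Suc 0"], rule exI[of _ "\<lambda>r. T"]) (simp add: lop.scl_one)

lemma polyf_add:
  assumes "polyf F" "polyf G"
  shows "polyf (\<lambda>u. F u + G u)"
proof -
  obtain N c where F: "\<And>u. F u = (\<Sum>r<N. u ^ r \<star> c r)" using assms(1) polyf_def by blast
  obtain M d where G: "\<And>u. G u = (\<Sum>r<M. u ^ r \<star> d r)" using assms(2) polyf_def by blast
  let ?e = "\<lambda>r. (if r < N then c r else 0) + (if r < M then d r else 0)"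
  have "F u + G u = (\<Sum>r<max N M. u ^ r \<star> ?e r)" for u
  proof -
    have "(\<Sum>r<N. u ^ r \<star> c r) = (\<Sum>r<max N M. u ^ r \<star> (if r < N then c r else 0))"
      by (rule sum.mono_neutral_cong_left) auto
    moreover have "(\<Sum>r<M. u ^ r \<star> d r) = (\<Sum>r<max N M. u ^ r \<star> (if r < M then d r else 0))"
      by (rule sum.mono_neutral_cong_left) auto
    ultimately show ?thesis
      by (simp add: F G sum.distrib lop.scl_right_distrib)
  qed
  then show ?thesis unfolding polyf_def by (intro exI[of _ "max N M"] exI[of _ ?e] allI)
qed

lemma polyf_shift: "polyf F \<Longrightarrow> polyf (\<lambda>u. u \<star> F u)"
proof -
  assume "polyf F"
  then obtain N c where F: "\<And>u. F u = (\<Sum>r<N. u ^ r \<star> c r)" using polyf_def by blast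
  have "u \<star> F u = (\<Sum>r<Suc N. u ^ r \<star> (case r of 0 \<Rightarrow> 0 | Suc s \<Rightarrow> c s))" for u
    unfolding F sum.lessThan_Suc_shift by (simp add: lop.scl_sum lop.scl_scl)
  then show ?thesis unfolding polyf_def by blast
qed

lemma polyf_mult_left: "polyf F \<Longrightarrow> polyf (\<lambda>u. T * F u)"
proof -
  assume "polyf F"
  then obtain N c where F: "\<And>u. F u = (\<Sum>r<N. u ^ r \<star> c r)" using polyf_def by blast
  have "T * F u = (\<Sum>r<N. u ^ r \<star> (T * c r))" for u
    unfolding F by (simp add: sum_distrib_left lop.scl_simps)
  then show ?thesis unfolding polyf_def by (intro exI[of _ N] exI[of _ "\<lambda>r. T * c r"] allI)
qed

lemma polyf_poly: "polyf F \<Longrightarrow> polyf (\<lambda>u. poly a u \<star> F u)"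
proof (induction a)
  case 0
  then show ?case using polyf_const[of 0] by simp
next
  case (pCons b a)
  have "polyf (\<lambda>u. b \<star> F u)"
    using polyf_mult_left[OF pCons.prems, of "b \<star> 1"] by (simp add: lop.scl_simps)
  moreover have "polyf (\<lambda>u. u \<star> poly a u \<star> F u)"
    using pCons by (intro polyf_shift) simp
  ultimately have "polyf (\<lambda>u. b \<star> F u + u \<star> poly a u \<star> F u)"
    by (rule polyf_add)
  then show ?case by (simp add: lop.scl_left_distrib lop.scl_scl)
qed

lemma polyf_sum: "(\<And>i. i \<in> S \<Longrightarrow> polyf (F i)) \<Longrightarrow> polyf (\<lambda>u. \<Sum>i\<in>S. F i u)"
  by (induction S rule: infinite_finite_induct) (simp_all add: polyf_const polyf_add)

lemma polyf_mult:
  assumes "polyf F" "polyf G"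
  shows "polyf (\<lambda>u. F u * G u)"
proof -
  obtain N c where F: "\<And>u. F u = (\<Sum>r<N. u ^ r \<star> c r)" using assms(1) polyf_def by blast
  have "polyf (\<lambda>u. \<Sum>r<N. poly (monom 1 r) u \<star> (c r * G u))"
    by (intro polyf_sum polyf_poly polyf_mult_left assms)
  then show ?thesis by (simp add: F sum_distrib_right lop.scl_simps poly_monom)
qed

text \<open>Rational in u without a pole at \<open>u0\<close>. The identity is asked only where the
  denominator is nonzero, since at a pole division returns 0 and the value of \<open>F\<close> says
  nothing.\<close>

definition regular_at :: "complex \<Rightarrow> (complex \<Rightarrow> 'b lop) \<Rightarrow> bool" where
  "regular_at u0 F \<longleftrightarrow> (\<exists>d G. poly d u0 \<noteq> 0 \<and> polyf G \<and> (\<forall>u. poly d u \<noteq> 0 \<longrightarrow> poly d u \<star> F u = G u))"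

lemma regular_at_const: "regular_at u0 (\<lambda>u. T)"
  unfolding regular_at_def
  by (intro exI[of _ 1] exI[of _ "\<lambda>u. T"]) (simp add: polyf_const lop.scl_one)

lemma regular_at_mult:
  assumes "regular_at u0 F" "regular_at u0 F'"
  shows "regular_at u0 (\<lambda>u. F u * F' u)"
proof -
  obtain d G where 1: "poly d u0 \<noteq> 0" "polyf G" "\<And>u. poly d u \<noteq> 0 \<Longrightarrow> poly d u \<star> F u = G u"
    using assms(1) unfolding regular_at_def by blast
  obtain d' G' where 2: "poly d' u0 \<noteq> 0" "polyf G'" "\<And>u. poly d' u \<noteq> 0 \<Longrightarrow> poly d' u \<star> F' u = G' u"
    using assms(2) unfolding regular_at_def by blast
  have "poly (d * d') u \<star> (F u * F' u) = G u * G' u" if "poly (d * d') u \<noteq> 0" for u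
    using that 1(3)[of u, symmetric] 2(3)[of u, symmetric]
    by (simp add: lop.scl_simps mult.commute[of "poly d' u"])
  then show ?thesis
    unfolding regular_at_def using 1 2 polyf_mult
    by (intro exI[of _ "d * d'"] exI[of _ "\<lambda>u. G u * G' u"]) auto
qed

lemma regular_at_add:
  assumes "regular_at u0 F" "regular_at u0 F'"
  shows "regular_at u0 (\<lambda>u. F u + F' u)"
proof -
  obtain d G where 1: "poly d u0 \<noteq> 0" "polyf G" "\<And>u. poly d u \<noteq> 0 \<Longrightarrow> poly d u \<star> F u = G u"
    using assms(1) unfolding regular_at_def by blast
  obtain d' G' where 2: "poly d' u0 \<noteq> 0" "polyf G'" "\<And>u. poly d' u \<noteq> 0 \<Longrightarrow> poly d' u \<star> F' u = G' u"
    using assms(2) unfolding regular_at_def by blast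
  have "poly (d * d') u \<star> (F u + F' u) = poly d' u \<star> G u + poly d u \<star> G' u"
    if "poly (d * d') u \<noteq> 0" for u
    using that 1(3)[of u, symmetric] 2(3)[of u, symmetric] by (simp add: lop.scl_simps mult.commute)
  moreover have "polyf (\<lambda>u. poly d' u \<star> G u + poly d u \<star> G' u)"
    using 1 2 by (intro polyf_add polyf_poly)
  ultimately show ?thesis
    unfolding regular_at_def using 1 2
    by (intro exI[of _ "d * d'"] exI[of _ "\<lambda>u. poly d' u \<star> G u + poly d u \<star> G' u"]) auto
qed

lemma regular_at_sum:
  "(\<And>i. i \<in> S \<Longrightarrow> regular_at u0 (F i)) \<Longrightarrow> regular_at u0 (\<lambda>u. \<Sum>i\<in>S. F i u)"
  by (induction S rule: infinite_finite_induct) (simp_all add: regular_at_const regular_at_add)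

lemma regular_at_fraction:
  assumes "poly b u0 \<noteq> 0"
  shows "regular_at u0 (\<lambda>u. (poly a u / poly b u) \<star> T)"
  unfolding regular_at_def
  using assms polyf_poly[OF polyf_const[of T], of a]
  by (intro exI[of _ b] exI[of _ "\<lambda>u. poly a u \<star> T"]) (simp add: lop.scl_scl)

lemma regular_at_rcoef:
  assumes "\<forall>k. 1 \<le> k \<and> k \<le> r \<longrightarrow> u0 + c \<noteq> of_nat k"
  shows "regular_at u0 (\<lambda>u. rcoef (u + c) r \<star> T)"
proof -
  define b :: "complex poly" where "b = smult (fact r) (\<Prod>k<r. [: 1 - c + of_nat k, - 1 :])"
  have b: "poly b u = fact r * pochhammer (1 - (u + c)) r" for u
    unfolding b_def pochhammer_prod poly_smult poly_prod
    by (simp add: atLeast0LessThan algebra_simps)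
  have "pochhammer (1 - (u0 + c)) r \<noteq> 0"
  proof
    assume "pochhammer (1 - (u0 + c)) r = 0"
    then obtain k where k: "k < r" "1 - (u0 + c) = - of_nat k"
      unfolding pochhammer_eq_0_iff by blast
    then have "u0 + c = of_nat (Suc k)" by (simp add: algebra_simps)
    then show False using assms[rule_format, of "Suc k"] k(1) by simp
  qed
  then have "regular_at u0 (\<lambda>u. (poly [: (- 1) ^ r :] u / poly b u) \<star> T)"
    by (intro regular_at_fraction) (simp add: b)
  then show ?thesis by (simp add: rcoef_def b)
qed

text \<open>Plays the part of a limit at \<open>u0\<close>. After clearing the denominator a
  polynomial has values in \<open>U\<close> at infinitely many points, hence its coefficients and
  its value at \<open>u0\<close> lie there as well.\<close>

lemma regular_at_subspace:
  assumes F: "regular_at u0 F" and U: "fvs.subspace U" and I: "infinite I"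
    and mem: "\<And>u. u \<in> I \<Longrightarrow> app (F u) w \<in> U"
  shows "app (F u0) w \<in> U"
proof -
  obtain d G where 1: "poly d u0 \<noteq> 0" "polyf G" "\<And>u. poly d u \<noteq> 0 \<Longrightarrow> poly d u \<star> F u = G u"
    using F unfolding regular_at_def by blast
  obtain N c where G: "\<And>u. G u = (\<Sum>r<N. u ^ r \<star> c r)" using 1(2) polyf_def by blast
  have appG: "app (G u) w = (\<Sum>r<N. fscale (u ^ r) (app (c r) w))" for u
    by (simp add: G app_sum app_lscale)
  have "d \<noteq> 0" using 1(1) by auto
  then have "finite {u. poly d u = 0}" by (rule poly_roots_finite)
  then have inf: "infinite (I - {u. poly d u = 0})" using I by simp
  have c: "app (c r) w \<in> U" if "r < N" for r
  proof (rule polynomial_values_in_subspace[OF U inf _ that])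
    fix u assume u: "u \<in> I - {u. poly d u = 0}"
    then have "app (G u) w = fscale (poly d u) (app (F u) w)"
      by (simp add: 1(3)[symmetric] app_lscale)
    then show "(\<Sum>r<N. fscale (u ^ r) (app (c r) w)) \<in> U"
      using mem u U by (simp add: appG[symmetric] fvs.subspace_scale)
  qed
  have "app (G u0) w \<in> U"
    unfolding appG using c U by (intro subspace_sum fvs.subspace_scale) auto
  then have "fscale (inverse (poly d u0)) (app (G u0) w) \<in> U"
    by (intro fvs.subspace_scale[OF U])
  moreover have "app (G u0) w = fscale (poly d u0) (app (F u0) w)"
    by (simp only: 1(3)[OF 1(1), symmetric] app_lscale)
  ultimately show ?thesis
    using 1(1) by simp
qed

section \<open>An auxiliary row\<close>

context fock
begin

text \<open>The factors of \<^const>\<open>Zprod\<close> for the pairs \<open>(b, c)\<close>, with the parameters of the auxiliary row \<open>c\<close>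
  replaced by a variable \<open>u\<close> and \<open>k\<close>; \<open>form b\<close> says which of the two series is used.\<close>

definition aux_fac :: "(nat \<Rightarrow> nat) \<Rightarrow> (nat \<Rightarrow> complex) \<Rightarrow> nat \<Rightarrow> (nat \<Rightarrow> bool) \<Rightarrow> complex \<Rightarrow> nat \<Rightarrow> nat \<Rightarrow> xvar set lop" where
  "aux_fac \<nu> z c form u k b =
     (if form b then X_ser b c (u + of_nat k - (z b + of_nat (\<nu> b))) else Y_ser b c (u - z b))"

definition aux_prod :: "(nat \<Rightarrow> nat) \<Rightarrow> (nat \<Rightarrow> complex) \<Rightarrow> nat \<Rightarrow> (nat \<Rightarrow> bool) \<Rightarrow> complex \<Rightarrow> nat \<Rightarrow> nat list \<Rightarrow> xvar set lop" where
  "aux_prod \<nu> z c form u k l = foldr (\<lambda>b. (*) (aux_fac \<nu> z c form u k b)) l 1"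

lemma aux_prod_simps [simp]: "aux_prod \<nu> z c form u k [] = 1"
  "aux_prod \<nu> z c form u k (b # l) = aux_fac \<nu> z c form u k b * aux_prod \<nu> z c form u k l"
  by (simp_all add: aux_prod_def)

text \<open>Stable under integer shifts of u, because each change of degree in the auxiliary row
  shifts u by one. It keeps u invertible and avoids the poles of the series and the zeros of
  \<open>aux_coef\<close>.\<close>

definition generic :: "(nat \<Rightarrow> complex) \<Rightarrow> nat list \<Rightarrow> complex \<Rightarrow> bool" where
  "generic z l u \<longleftrightarrow> (\<forall>k::int. u \<noteq> of_int k) \<and> (\<forall>b\<in>set l. \<forall>k::int. u - z b \<noteq> of_int k)"

lemma generic_minus_1: "generic z l u \<Longrightarrow> generic z l (u - 1)"
  unfolding generic_def
proof (intro conjI ballI allI)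
  assume g: "(\<forall>k::int. u \<noteq> of_int k) \<and> (\<forall>b\<in>set l. \<forall>k::int. u - z b \<noteq> of_int k)"
  fix k :: int
  show "u - 1 \<noteq> of_int k"
    using g[THEN conjunct1, rule_format, of "k + 1"] by (simp add: diff_eq_eq)
  fix b assume "b \<in> set l"
  then have "u - z b \<noteq> of_int (k + 1)" using g by blast
  then show "u - 1 - z b \<noteq> of_int k"
    by (simp add: algebra_simps)
qed

lemma infinite_generic: "infinite {u. generic z l u}"
proof
  assume fin: "finite {u. generic z l u}"
  let ?B = "insert 0 (Im ` z ` set l)"
  \<comment> \<open>A purely imaginary number whose imaginary part is neither 0 nor that of any z b
    differs from 0 and from every z b by a non-integer; only finitely many \<open>t\<close> are
    lost.\<close>
  have "Complex 0 t \<in> {u. generic z l u}" if t: "t \<notin> ?B" for t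
    unfolding generic_def mem_Collect_eq
  proof (intro conjI ballI allI notI)
    fix k :: int assume "Complex 0 t = of_int k"
    then have "Im (Complex 0 t) = Im (of_int k)" by simp
    then show False using t by simp
  next
    fix b and k :: int assume b: "b \<in> set l" "Complex 0 t - z b = of_int k"
    then have "Im (Complex 0 t - z b) = Im (of_int k)" by simp
    then have "t = Im (z b)" by simp
    then show False using t b(1) by blast
  qed
  then have "Complex 0 ` (- ?B) \<subseteq> {u. generic z l u}" by auto
  then have "finite (Complex 0 ` (- ?B))" using fin finite_subset by blast
  then have "finite (- ?B)" by (rule finite_imageD) (simp add: inj_on_def)
  moreover have "finite ?B" by simp
  ultimately have "finite (UNIV :: real set)" by (metis Compl_partition finite_Un)
  then show False by (simp add: infinite_UNIV_char_0)
qed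

text \<open>Up to 1 / u the contraction gives the operator t P0 - A P1 of \<open>Yser_P\<close> and
  \<open>Xser_P\<close>, with t = u - z b, A = D b c, P0 = p c j and P1 = p b j.\<close>

lemma sum_p_Le:
  assumes "c \<noteq> b" "j \<in> {1..n}" "u \<noteq> 0"
  shows "(\<Sum>i = 1..n. p c i * Le z (1 / u) b i j) = (1 / u) \<star> ((u - z b) \<star> p c j - D b c * p b j)"
proof -
  have E: "(\<Sum>i = 1..n. p c i * E b i j) = - (D b c * p b j)"
  proof -
    have "p c i * E b i j = - (q b i * p c i * p b j)" for i
      using assms(1) po_qo[of eps c i b i] by (simp add: E_def mult.assoc[symmetric])
    then show ?thesis by (simp add: D_def sum_distrib_right sum_negf)
  qed
  have "(\<Sum>i = 1..n. p c i * Le z (1 / u) b i j) =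
      (\<Sum>i = 1..n. p c i * (if i = j then (1 - z b * (1 / u)) \<star> 1 else 0)) + (1 / u) \<star> (\<Sum>i = 1..n. p c i * E b i j)"
    unfolding lop.scl_sum sum.distrib[symmetric]
    by (intro sum.cong refl) (simp add: Le_def distrib_left lop.scl_simps)
  also have "\<dots> = (1 - z b * (1 / u)) \<star> p c j - (1 / u) \<star> (D b c * p b j)"
    unfolding sum_delta_mult_right[OF assms(2)] E by (simp add: lop.scl_simps)
  also have "(1 - z b * (1 / u)) = (1 / u) * (u - z b)"
    using assms(3) by (simp add: field_simps)
  finally show ?thesis by (simp add: lop.scl_simps)
qed

text \<open>The factor 1 / u of \<open>sum_p_Le\<close> times the scalar on the right of
  \<open>Xser_P\<close>, which is t + 1, or of \<open>Yser_P\<close>, which is t.\<close>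

definition aux_coef :: "(nat \<Rightarrow> complex) \<Rightarrow> (nat \<Rightarrow> bool) \<Rightarrow> complex \<Rightarrow> nat \<Rightarrow> complex" where
  "aux_coef z form u b = (1 / u) * (if form b then u - z b + 1 else u - z b)"

text \<open>Passing \<open>p c j\<close> through a factor raises u by one and lowers the degree of
  row \<open>c\<close> by one. For Y this is the step from t to t + 1; for X the parameter stays,
  because the sum of u and the degree does.\<close>

lemma aux_fac_step:
  assumes cb: "c \<noteq> b" and j: "j \<in> {1..n}" and g: "generic z l u" and b: "b \<in> set l"
    and w: "wt (D c c) (of_nat (Suc k)) w" "wt (D b b) (of_nat (\<nu> b)) w"
  shows "app ((\<Sum>i = 1..n. p c i * Le z (1 / u) b i j) * aux_fac \<nu> z c form u (Suc k) b) w =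
     fscale (aux_coef z form u b) (app (aux_fac \<nu> z c form (u + 1) k b * p c j) w)"
proof -
  have g': "u \<noteq> of_int i" "u - z b \<noteq> of_int i" for i
    using g b by (auto simp: generic_def)
  have u0: "u \<noteq> 0" using g'(1)[of 0] by simp
  interpret double_doublet "D b c" "D c b" n "p c j" "p b j" lscale "q c j" "q b j"
    using double_doublet[of b c j j] cb j by simp
  have "((u - z b) \<star> p c j - D b c * p b j) * aux_fac \<nu> z c form u (Suc k) b * vop w =
     (if form b then u - z b + 1 else u - z b) \<star> (aux_fac \<nu> z c form (u + 1) k b * p c j * vop w)"
  proof (cases "form b")
    case True
    let ?s = "u + of_nat (Suc k) - (z b + of_nat (\<nu> b))"
    have s: "\<forall>i. 1 \<le> i \<and> i \<le> n \<longrightarrow> ?s \<noteq> of_nat i"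
    proof (intro allI impI notI)
      fix i assume "?s = of_nat i"
      then have "u - z b = of_int (int i + int (\<nu> b) - int (Suc k))"
        by (simp add: algebra_simps)
      then show False using g'(2) by blast
    qed
    have H: "(D b b - D c c) * vop w = (of_nat (\<nu> b) - of_nat (Suc k)) \<star> vop w"
      by (rule wt_diff[OF w(2,1)])
    have t: "u - z b = ?s + (of_nat (\<nu> b) - of_nat (Suc k))" by simp
    have s': "u + 1 + of_nat k - (z b + of_nat (\<nu> b)) = ?s" by simp
    show ?thesis
      using Xser_P[OF s _ t, of "vop w"] H sl2_H[OF cb[symmetric]] True
      by (simp only: aux_fac_def if_True s' X_ser[OF cb[symmetric]])
  next
    case False
    have "u - z b \<noteq> of_nat i" for i using g'(2)[of "int i"] by simp
    then have t: "\<forall>i\<le>n. u - z b \<noteq> of_nat i" by blast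
    have t': "u + 1 - z b = u - z b + 1" by simp
    show ?thesis
      using Yser_P[OF t] False
      by (simp only: aux_fac_def if_False t' Y_ser[OF cb[symmetric]] lop.scl_simps mult.assoc)
  qed
  then show ?thesis
    unfolding sum_p_Le[OF cb j u0] aux_coef_def
    by (simp add: vop_simps vop_inject lop.scl_mult_left app_lscale app_times mult.commute
        flip: fscale_fscale)
qed

lemma aux_fac_D_diag: "b \<noteq> c \<Longrightarrow> aux_fac \<nu> z c form u k b * D a a = D a a * aux_fac \<nu> z c form u k b"
  by (simp add: aux_fac_def D_diag_series)

lemma aux_fac_commutes:
  assumes "w * D b c = D b c * w" "w * D c b = D c b * w"
  shows "w * aux_fac \<nu> z c form u k b = aux_fac \<nu> z c form u k b * w"
  using series_commutes[OF assms] by (simp add: aux_fac_def)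

lemma aux_prod_wt:
  "c \<notin> set l \<Longrightarrow> wt (D a a) x w \<Longrightarrow> wt (D a a) x (app (aux_prod \<nu> z c form u k l) w)"
proof (induction l)
  case (Cons b l)
  then have "wt (D a a) x (app (aux_prod \<nu> z c form u k l) w)" by simp
  moreover have "aux_fac \<nu> z c form u k b * D a a = D a a * aux_fac \<nu> z c form u k b"
    using Cons.prems(1) by (intro aux_fac_D_diag) auto
  ultimately show ?case by (simp add: app_times wt_commute)
qed (simp add: app_one)

lemma aux_fac_mat_prod:
  assumes "b \<notin> set l" "c \<notin> set l" "i \<in> {1..n}" "j \<in> {1..n}"
  shows "aux_fac \<nu> z c form u k b * mat_prod n (Le z X) l i j = mat_prod n (Le z X) l i j * aux_fac \<nu> z c form u k b"
proof (rule mat_prod_Le_commutes[OF _ assms(3,4)])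
  fix a i j assume a: "a \<in> set l" "i \<in> {1..n}" "j \<in> {1..n}"
  then have "a \<noteq> b" "a \<noteq> c" using assms by auto
  then show "aux_fac \<nu> z c form u k b * E a i j = E a i j * aux_fac \<nu> z c form u k b"
    using aux_fac_commutes[of "E a i j" b c \<nu> z form u k] D_E_other[of a b c i j] D_E_other[of a c b i j] a by simp
qed

text \<open>The rows are treated from the left: the contraction passes through the first row matrix
  and its factor, and leaves \<open>p c\<close> contracted with the product over the remaining
  rows.\<close>

lemma aux_prod_step:
  assumes l: "distinct l" "c \<notin> set l" and j: "j \<in> {1..n}" and g: "generic z l0 u" "set l \<subseteq> set l0"
    and w: "wt (D c c) (of_nat (Suc k)) w" "w \<in> Wt \<nu> (set l)"
  shows "app ((\<Sum>i = 1..n. p c i * mat_prod n (Le z (1 / u)) l i j) * aux_prod \<nu> z c form u (Suc k) l) w =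
     fscale (\<Prod>b\<leftarrow>l. aux_coef z form u b) (app (aux_prod \<nu> z c form (u + 1) k l * p c j) w)"
  using assms
proof (induction l arbitrary: j)
  case Nil
  then show ?case using sum_delta_mult_right[of j n "p c" 1] by simp
next
  case (Cons b l)
  let ?M = "mat_prod n (Le z (1 / u))"
  let ?w = "app (aux_prod \<nu> z c form u (Suc k) l) w"
  let ?F = "aux_fac \<nu> z c form u (Suc k) b" and ?F' = "aux_fac \<nu> z c form (u + 1) k b"
  have wtw: "wt (D a a) x (app (?M l i j) ?w)" if "wt (D a a) x w" "i \<in> {1..n}" for a x i
    using aux_prod_wt[of c l a x w \<nu> z form u "Suc k"] that Cons.prems mat_prod_Le_D_diag wt_commute by auto
  have 1: "app ((\<Sum>i = 1..n. p c i * Le z (1 / u) b i x) * ?F) (app (?M l x j) ?w) =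
     fscale (aux_coef z form u b) (app (?F' * p c x) (app (?M l x j) ?w))" if x: "x \<in> {1..n}" for x
  proof (rule aux_fac_step)
    show "wt (D c c) (of_nat (Suc k)) (app (?M l x j) ?w)"
      using wtw[OF Cons.prems(6) x] .
    show "wt (D b b) (of_nat (\<nu> b)) (app (?M l x j) ?w)"
      using wtw[OF _ x] Cons.prems(7) by (simp add: Wt_def)
    show "generic z l0 u" "b \<in> set l0" using Cons.prems by auto
  qed (use Cons.prems x in auto)
  have "(\<Sum>i = 1..n. p c i * ?M (b # l) i j) * aux_prod \<nu> z c form u (Suc k) (b # l) =
     (\<Sum>x = 1..n. (\<Sum>i = 1..n. p c i * Le z (1 / u) b i x) * ?M l x j) * ?F * aux_prod \<nu> z c form u (Suc k) l"
  proof -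
    have "(\<Sum>i = 1..n. p c i * ?M (b # l) i j) = (\<Sum>i = 1..n. \<Sum>x = 1..n. p c i * Le z (1 / u) b i x * ?M l x j)"
      by (simp add: sum_distrib_left mult.assoc)
    also have "\<dots> = (\<Sum>x = 1..n. \<Sum>i = 1..n. p c i * Le z (1 / u) b i x * ?M l x j)"
      by (rule sum.swap)
    also have "\<dots> = (\<Sum>x = 1..n. (\<Sum>i = 1..n. p c i * Le z (1 / u) b i x) * ?M l x j)"
      by (simp only: sum_distrib_right)
    finally show ?thesis by (simp only: aux_prod_simps mult.assoc)
  qed
  also have "\<dots> = (\<Sum>x = 1..n. (\<Sum>i = 1..n. p c i * Le z (1 / u) b i x) * ?F * ?M l x j * aux_prod \<nu> z c form u (Suc k) l)"
  proof -
    define S where "S = (\<lambda>x. \<Sum>i = 1..n. p c i * Le z (1 / u) b i x)"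
    have "S x * ?M l x j * ?F * aux_prod \<nu> z c form u (Suc k) l =
        S x * ?F * ?M l x j * aux_prod \<nu> z c form u (Suc k) l" if "x \<in> {1..n}" for x
    proof -
      have "?M l x j * ?F = ?F * ?M l x j"
        using aux_fac_mat_prod[of b l c x j \<nu> z form u "Suc k" "1 / u"] Cons.prems that by simp
      then show ?thesis by (simp only: mult.assoc[of "S x"])
    qed
    then have "(\<Sum>x = 1..n. S x * ?M l x j) * ?F * aux_prod \<nu> z c form u (Suc k) l =
        (\<Sum>x = 1..n. S x * ?F * ?M l x j * aux_prod \<nu> z c form u (Suc k) l)"
      unfolding sum_distrib_right by (intro sum.cong refl)
    then show ?thesis unfolding S_def .
  qed
  finally have "app ((\<Sum>i = 1..n. p c i * ?M (b # l) i j) * aux_prod \<nu> z c form u (Suc k) (b # l)) w =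
     (\<Sum>x = 1..n. app ((\<Sum>i = 1..n. p c i * Le z (1 / u) b i x) * ?F) (app (?M l x j) ?w))"
    by (simp only: app_sum app_times)
  also have "\<dots> = (\<Sum>x = 1..n. fscale (aux_coef z form u b) (app (?F' * p c x) (app (?M l x j) ?w)))"
    using 1 by (rule sum.cong[OF refl])
  also have "\<dots> = fscale (aux_coef z form u b) (app ?F' (app ((\<Sum>x = 1..n. p c x * ?M l x j) * aux_prod \<nu> z c form u (Suc k) l) w))"
    by (simp add: app_times app_sum fscale_sum app_simps)
  also have "app ((\<Sum>x = 1..n. p c x * ?M l x j) * aux_prod \<nu> z c form u (Suc k) l) w =
     fscale (\<Prod>b\<leftarrow>l. aux_coef z form u b) (app (aux_prod \<nu> z c form (u + 1) k l * p c j) w)"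
    by (rule Cons.IH) (use Cons.prems in \<open>auto simp: Wt_def\<close>)
  finally show ?case
    by (simp add: app_times app_simps)
qed

text \<open>When row \<open>c\<close> is full, \<open>D c b\<close> kills the vector, since each of
  its terms contains some \<open>q c i\<close>. Then Y acts as the identity and X by a
  scalar.\<close>

lemma aux_prod_full:
  assumes "c \<notin> set l" "\<And>i. i \<in> {1..n} \<Longrightarrow> app (q c i) w = 0"
    "wt (D c c) x w" "w \<in> Wt \<nu> (set l)"
  shows "\<exists>y. app (aux_prod \<nu> z c form u k l) w = fscale y w"
  using assms
proof (induction l)
  case Nil
  then show ?case by (intro exI[of _ 1]) (simp add: app_one)
next
  case (Cons b l)
  obtain y where y: "app (aux_prod \<nu> z c form u k l) w = fscale y w"
    using Cons by (auto simp: Wt_def)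
  have cb: "b \<noteq> c" using Cons.prems by auto
  interpret sl2 lscale "D b c" "D c b" n by (rule sl2[OF cb])
  have "D c b = - (\<Sum>i = 1..n. p b i * q c i)"
  proof -
    have "q c i * p b i = - (p b i * q c i)" for i
      using cb qo_po[of eps c i b i] by simp
    then show ?thesis by (simp add: D_def sum_negf)
  qed
  then have "app (D c b) w = 0"
    using Cons.prems(2) by (simp add: app_ops app_sum app_simps)
  then have B: "D c b * vop w = 0"
    by (simp add: vop_simps) (simp add: vop_def fvs.scale_zero_right zero_lop_def)
  have "\<exists>y. aux_fac \<nu> z c form u k b * vop w = y \<star> vop w"
  proof (cases "form b")
    case True
    have "(D b b - D c c) * vop w = (of_nat (\<nu> b) - x) \<star> vop w"
      by (rule wt_diff) (use Cons.prems in \<open>auto simp: Wt_def\<close>)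
    then show ?thesis
      using Xser_highest[OF B] sl2_H[OF cb] True by (simp add: aux_fac_def X_ser[OF cb])
  next
    case False
    then show ?thesis
      using Yser_lowest[OF B] by (intro exI[of _ 1]) (simp add: aux_fac_def Y_ser[OF cb] lop.scl_one)
  qed
  then obtain y' where "app (aux_fac \<nu> z c form u k b) w = fscale y' w"
    by (auto simp: vop_simps vop_inject)
  then show ?case using y by (auto simp: app_times app_simps)
qed

lemma sum_p_q: "(\<Sum>j = 1..n. p c j * q c j) = of_nat n \<star> 1 - D c c"
proof -
  have "(\<Sum>j = 1..n. p c j * q c j) = (\<Sum>j = 1..n. 1 - q c j * p c j)"
    by (simp add: po_qo)
  moreover have "(of_nat k :: xvar set lop) = of_nat k \<star> 1" for k
    by (induction k) (simp_all add: lop.scl_left_distrib lop.scl_one)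
  ultimately show ?thesis
    by (simp add: sum_subtractf D_def)
qed

lemma D_diag_q: "i \<in> {1..n} \<Longrightarrow> wt (D c c) x w \<Longrightarrow> wt (D c c) (x + 1) (app (q c i) w)"
proof -
  assume i: "i \<in> {1..n}" and w: "wt (D c c) x w"
  have "app (D c c) (app (q c i) w) = app (D c c * q c i) w" by (simp add: app_times)
  also have "\<dots> = app (q c i) (app (D c c) w) + app (q c i) w"
    using i by (simp add: D_q app_ops)
  finally show ?thesis using w by (simp add: wt_def app_simps fvs.scale_left_distrib)
qed

lemma D_diag_p: "i \<in> {1..n} \<Longrightarrow> wt (D c c) (x + 1) w \<Longrightarrow> wt (D c c) x (app (p c i) w)"
proof -
  assume i: "i \<in> {1..n}" and w: "wt (D c c) (x + 1) w"
  have "app (D c c) (app (p c i) w) = app (D c c * p c i) w" by (simp add: app_times)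
  also have "\<dots> = app (p c i) (app (D c c) w) - app (p c i) w"
    using i by (simp add: D_p app_ops)
  finally show ?thesis using w by (simp add: wt_def app_simps fvs.scale_left_distrib)
qed

lemma D_diag_q_other: "i \<in> {1..n} \<Longrightarrow> a \<noteq> c \<Longrightarrow> wt (D a a) x w \<Longrightarrow> wt (D a a) x (app (q c i) w)"
  and D_diag_p_other: "i \<in> {1..n} \<Longrightarrow> a \<noteq> c \<Longrightarrow> wt (D a a) x w \<Longrightarrow> wt (D a a) x (app (p c i) w)"
  by (auto intro!: wt_commute simp: D_q D_p)

text \<open>Descending induction on the degree k of row \<open>c\<close>, starting from the full
  row. Below it, (n - k) w is the sum of the p_j q_j w, and \<open>aux_prod_step\<close> at u - 1
  expresses the product on p_j q_j w by the product on q_j w, of degree k + 1, followed by operators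
  that preserve \<open>U\<close>.\<close>

lemma aux_prod_generic:
  assumes U: "fvs.subspace U"
    and UT: "\<And>X i j v. i \<in> {1..n} \<Longrightarrow> j \<in> {1..n} \<Longrightarrow> v \<in> U \<Longrightarrow> app (mat_prod n (Le z X) l i j) v \<in> U"
    and Up: "\<And>i v. i \<in> {1..n} \<Longrightarrow> v \<in> U \<Longrightarrow> app (p c i) v \<in> U"
    and Uq: "\<And>i v. i \<in> {1..n} \<Longrightarrow> v \<in> U \<Longrightarrow> app (q c i) v \<in> U"
    and l: "distinct l" "c \<notin> set l"
    and g: "generic z l u" and k: "k \<le> n" and w: "wt (D c c) (of_nat k) w" "w \<in> Wt \<nu> (set l)" "w \<in> U"
  shows "app (aux_prod \<nu> z c form u k l) w \<in> U"
  using g k w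
proof (induction "n - k" arbitrary: k u w)
  case 0
  then have k: "k = n" by simp
  have "app (q c i) w = 0" if "i \<in> {1..n}" for i
  proof (rule wt_too_large[of c "Suc n"])
    show "wt (D c c) (of_nat (Suc n)) (app (q c i) w)"
      using D_diag_q[OF that 0(4)] k by (simp add: add.commute)
  qed simp
  then obtain y where "app (aux_prod \<nu> z c form u k l) w = fscale y w"
    using aux_prod_full[OF l(2) _ 0(4,5)] by blast
  then show ?case using 0(6) U by (simp add: fvs.subspace_scale)
next
  case (Suc d)
  have kn: "k < n" using Suc.hyps(2) by simp
  let ?v = "\<lambda>j. app (q c j) w"
  have step: "app (aux_prod \<nu> z c form u k l * p c j) (?v j) \<in> U" if j: "j \<in> {1..n}" for j
  proof -
    have v: "wt (D c c) (of_nat (Suc k)) (?v j)" "?v j \<in> U"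
      using D_diag_q[OF j Suc.prems(3)] Uq[OF j Suc.prems(5)] by (simp_all add: add.commute)
    have vW: "?v j \<in> Wt \<nu> (set l)"
      using Suc.prems(4) l(2) unfolding Wt_def by (auto intro!: D_diag_q_other[OF j])
    have g: "generic z l (u - 1)" by (rule generic_minus_1[OF Suc.prems(1)])
    have "app (aux_prod \<nu> z c form (u - 1) (Suc k) l) (?v j) \<in> U"
      using Suc.hyps(1)[OF _ g _ v(1) vW v(2)] Suc.hyps(2) kn by simp
    then have "app ((\<Sum>i = 1..n. p c i * mat_prod n (Le z (1 / (u - 1))) l i j) *
        aux_prod \<nu> z c form (u - 1) (Suc k) l) (?v j) \<in> U"
      unfolding app_times app_sum using j Up UT U by (intro subspace_sum) auto
    then have "fscale (\<Prod>b\<leftarrow>l. aux_coef z form (u - 1) b) (app (aux_prod \<nu> z c form u k l * p c j) (?v j)) \<in> U"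
      using aux_prod_step[OF l j g subset_refl v(1) vW, of form] by simp
    then have "fscale (inverse (\<Prod>b\<leftarrow>l. aux_coef z form (u - 1) b)) (fscale (\<Prod>b\<leftarrow>l. aux_coef z form (u - 1) b)
        (app (aux_prod \<nu> z c form u k l * p c j) (?v j))) \<in> U"
      by (rule fvs.subspace_scale[OF U])
    moreover have "(\<Prod>b\<leftarrow>l. aux_coef z form (u - 1) b) \<noteq> 0"
    proof -
      have "aux_coef z form (u - 1) b \<noteq> 0" if "b \<in> set l" for b
      proof -
        have "u - 1 \<noteq> of_int 0" "u - 1 - z b \<noteq> of_int 0" "u - 1 - z b \<noteq> of_int (- 1)"
          using g that unfolding generic_def by blast+
        then show ?thesis by (auto simp: aux_coef_def add_eq_0_iff2)
      qed
      then show ?thesis unfolding prod_list_zero_iff set_map by (metis imageE)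
    qed
    ultimately show ?thesis by simp
  qed
  have "fscale (of_nat (n - k)) w = (\<Sum>j = 1..n. app (p c j) (?v j))"
  proof -
    have "(\<Sum>j = 1..n. app (p c j) (?v j)) = app (of_nat n \<star> 1 - D c c) w"
      unfolding sum_p_q[symmetric] by (simp add: app_sum app_times)
    then show ?thesis
      using Suc.prems(3) kn by (simp add: wt_def app_ops app_lscale of_nat_diff fvs.scale_left_diff_distrib)
  qed
  then have "fscale (of_nat (n - k)) (app (aux_prod \<nu> z c form u k l) w) =
     (\<Sum>j = 1..n. app (aux_prod \<nu> z c form u k l * p c j) (?v j))"
    by (simp add: app_times linop_fscale[OF linop_app, symmetric] linop_sum[OF linop_app, symmetric])
  also have "\<dots> \<in> U"
    using step U by (intro subspace_sum) auto
  finally have "fscale (inverse (of_nat (n - k))) (fscale (of_nat (n - k)) (app (aux_prod \<nu> z c form u k l) w)) \<in> U"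
    by (rule fvs.subspace_scale[OF U])
  then show ?case using kn by simp
qed

lemma regular_at_aux_prod:
  assumes "\<And>b. b \<in> set l \<Longrightarrow> form b \<Longrightarrow> \<forall>i. 1 \<le> i \<and> i \<le> n \<longrightarrow> u0 + of_nat k - (z b + of_nat (\<nu> b)) \<noteq> of_nat i"
    and "\<And>b. b \<in> set l \<Longrightarrow> \<not> form b \<Longrightarrow> \<forall>i. 1 \<le> i \<and> i \<le> n \<longrightarrow> u0 - z b \<noteq> of_nat i"
  shows "regular_at u0 (\<lambda>u. aux_prod \<nu> z c form u k l)"
  using assms
proof (induction l)
  case (Cons b l)
  have "regular_at u0 (\<lambda>u. aux_fac \<nu> z c form u k b)"
  proof (cases "form b")
    case True
    have "regular_at u0 (\<lambda>u. rcoef (u + (of_nat k - (z b + of_nat (\<nu> b)))) r \<star> (D c b ^ r * D b c ^ r))"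
      if "r \<le> n" for r
      using Cons.prems(1)[of b] True that by (intro regular_at_rcoef) (auto simp: add_diff_eq)
    then have "regular_at u0 (\<lambda>u. \<Sum>r\<le>n. rcoef (u + (of_nat k - (z b + of_nat (\<nu> b)))) r \<star> (D c b ^ r * D b c ^ r))"
      by (intro regular_at_sum) simp
    then show ?thesis
      using True by (simp add: aux_fac_def X_ser_def add_diff_eq)
  next
    case False
    have "regular_at u0 (\<lambda>u. rcoef (u + (- z b)) r \<star> (D b c ^ r * D c b ^ r))" if "r \<le> n" for r
      using Cons.prems(2)[of b] False that by (intro regular_at_rcoef) auto
    then have "regular_at u0 (\<lambda>u. \<Sum>r\<le>n. rcoef (u + (- z b)) r \<star> (D b c ^ r * D c b ^ r))"
      by (intro regular_at_sum) simp
    then show ?thesis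
      using False by (simp add: aux_fac_def Y_ser_def)
  qed
  then show ?case
    using Cons by (simp add: regular_at_mult)
qed (simp add: regular_at_const)

lemma aux_prod_mem:
  assumes U: "fvs.subspace U"
    and UT: "\<And>X i j v. i \<in> {1..n} \<Longrightarrow> j \<in> {1..n} \<Longrightarrow> v \<in> U \<Longrightarrow> app (mat_prod n (Le z X) l i j) v \<in> U"
    and Up: "\<And>i v. i \<in> {1..n} \<Longrightarrow> v \<in> U \<Longrightarrow> app (p c i) v \<in> U"
    and Uq: "\<And>i v. i \<in> {1..n} \<Longrightarrow> v \<in> U \<Longrightarrow> app (q c i) v \<in> U"
    and l: "distinct l" "c \<notin> set l"
    and k: "k \<le> n" and w: "wt (D c c) (of_nat k) w" "w \<in> Wt \<nu> (set l)" "w \<in> U"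
    and r: "regular_at u0 (\<lambda>u. aux_prod \<nu> z c form u k l)"
  shows "app (aux_prod \<nu> z c form u0 k l) w \<in> U"
proof (rule regular_at_subspace[OF r U infinite_generic])
  fix u assume "u \<in> {u. generic z l u}"
  then show "app (aux_prod \<nu> z c form u k l) w \<in> U"
    using aux_prod_generic[OF U UT Up Uq l _ k w] by simp
qed

text \<open>At \<open>t = 0\<close> the series exchanges the contents of the two rows up to sign: it conjugates
  the operators \<open>p\<close> of one row into those of the other.\<close>

lemma Y_ser_0_exchange:
  assumes bc: "b \<noteq> c" and ij: "i \<in> {1..n}" "j \<in> {1..n}"
    and w: "wt (D b b) x w" "wt (D c c) x w"
  shows "app (p b i * p c j * Y_ser b c 0) w = app (Y_ser b c 0 * p b j * p c i) w"
proof -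
  interpret dj: double_doublet "D b c" "D c b" n "p c j" "p b j" lscale "q c j" "q b j"
    by (rule double_doublet[OF bc ij(2,2)])
  interpret di: double_doublet "D b c" "D c b" n "p c i" "p b i" lscale "q c i" "q b i"
    by (rule double_doublet[OF bc ij(1,1)])
  have H: "dj.H * vop w = 0"
    using wt_diff[OF w] sl2_H[OF bc] by simp
  \<comment> \<open>Equal degrees mean weight 0, so \<open>p c j\<close> leads to weight 1, where
    \<open>Yser 0\<close> vanishes; of \<open>P0_Yser_0\<close> only the term with
    \<open>Vser\<close> remains.\<close>
  have "dj.H * (p c j * vop w) = p c j * vop w"
    unfolding mult.assoc[symmetric] dj.HP0 by (simp add: distrib_right mult.assoc H)
  then have 0: "dj.Yser 0 * (p c j * vop w) = 0"
    by (rule dj.Yser_0_weight_1)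
  have "p b i * (p c j * dj.Yser 0) * vop w = p b i * (dj.Vser * p b j) * vop w"
    unfolding dj.P0_Yser_0 by (simp add: distrib_left distrib_right mult.assoc 0)
  also have "\<dots> = p b i * dj.Vser * p b j * vop w"
    by (simp only: mult.assoc)
  also have "\<dots> = - (dj.Yser 0 * p c i) * p b j * vop w"
    by (simp only: di.P1_Vser)
  also have "\<dots> = - dj.Yser 0 * (p c i * p b j) * vop w"
    by (simp add: mult.assoc)
  also have "\<dots> = dj.Yser 0 * p b j * p c i * vop w"
    unfolding po_po[of eps c i b j] by (simp add: mult.assoc)
  finally show ?thesis
    by (simp add: Y_ser[OF bc] vop_simps vop_inject mult.assoc[symmetric])
qed

end

section \<open>Supports and permutations of rows\<close>

lemma keys_lin:
  assumes "linop f" "\<And>k. k \<in> Poly_Mapping.keys v \<Longrightarrow> Poly_Mapping.keys (f (Poly_Mapping.single k 1)) \<subseteq> B"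
  shows "Poly_Mapping.keys (f v) \<subseteq> B"
proof -
  have "f v = (\<Sum>k\<in>Poly_Mapping.keys v. fscale (Poly_Mapping.lookup v k) (f (Poly_Mapping.single k 1)))"
    using linop_sum[OF assms(1), of "\<lambda>k. fscale (Poly_Mapping.lookup v k) (Poly_Mapping.single k 1)" "Poly_Mapping.keys v"]
    by (simp add: basis_expansion linop_fscale[OF assms(1)] del: fscale_single)
      (simp add: basis_expansion)
  also have "Poly_Mapping.keys \<dots> \<subseteq> (\<Union>k\<in>Poly_Mapping.keys v. Poly_Mapping.keys (fscale (Poly_Mapping.lookup v k) (f (Poly_Mapping.single k 1))))"
    by (rule Poly_Mapping.keys_sum)
  also have "\<dots> \<subseteq> B"
    using assms(2) by (fastforce simp: in_keys_iff lookup_fscale)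
  finally show ?thesis .
qed

lemma subspace_keys: "fvs.subspace {v. Poly_Mapping.keys v \<subseteq> B}"
proof (rule fvs.subspaceI)
  fix v w :: "'a \<Rightarrow>\<^sub>0 complex" and c
  assume vw: "v \<in> {v. Poly_Mapping.keys v \<subseteq> B}" "w \<in> {v. Poly_Mapping.keys v \<subseteq> B}"
  then show "v + w \<in> {v. Poly_Mapping.keys v \<subseteq> B}"
    using keys_add[of v w] by auto
  show "fscale c v \<in> {v. Poly_Mapping.keys v \<subseteq> B}"
    using vw by (auto simp: in_keys_iff lookup_fscale)
qed simp

definition VS :: "nat \<Rightarrow> nat set \<Rightarrow> grass set" where
  "VS n R = {v. Poly_Mapping.keys v \<subseteq> {A. finite A \<and> (\<forall>x\<in>A. vrow x \<in> R \<and> vcol x \<in> {1..n})}}"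

lemma subspace_VS: "fvs.subspace (VS n R)"
  unfolding VS_def by (rule subspace_keys)

lemma VS_mono: "R \<subseteq> R' \<Longrightarrow> VS n R \<subseteq> VS n R'"
  by (auto simp: VS_def)

lemma VS_finite: "v \<in> VS n R \<Longrightarrow> A \<in> Poly_Mapping.keys v \<Longrightarrow> finite A"
  by (auto simp: VS_def)

lemma cre_VS: "v \<in> VS n R \<Longrightarrow> a \<in> R \<Longrightarrow> i \<in> {1..n} \<Longrightarrow> app (cre (XV a i)) v \<in> VS n R"
  and ann_VS: "v \<in> VS n R \<Longrightarrow> app (ann x) v \<in> VS n R"
  unfolding VS_def mem_Collect_eq
  by (rule keys_lin[OF linop_app]; force simp: cre_single ann_single split: if_splits)+

lemma ann_VS_other: "v \<in> VS n R \<Longrightarrow> a \<notin> R \<Longrightarrow> app (ann (XV a i)) v = 0"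
  using linop_eq_on_keys[OF linop_app[of "ann (XV a i)"] linop_app[of 0], of v]
  by (force simp: VS_def ann_single app_zero)

lemma qo_VS: "v \<in> VS n R \<Longrightarrow> a \<in> R \<Longrightarrow> i \<in> {1..n} \<Longrightarrow> app (qo \<epsilon> a i) v \<in> VS n R"
  and po_VS: "v \<in> VS n R \<Longrightarrow> a \<in> R \<Longrightarrow> i \<in> {1..n} \<Longrightarrow> app (po \<epsilon> a i) v \<in> VS n R"
  by (simp_all add: qo_def po_def cre_VS ann_VS)

text \<open>Projects to the part free of row \<open>c\<close>. After derivatives by variables of
  that row it reads off a coefficient with respect to them.\<close>

definition rowless :: "nat \<Rightarrow> xvar set lop" where
  "rowless c = Lop (lin_ext (\<lambda>A. if \<exists>x\<in>A. vrow x = c then 0 else Poly_Mapping.single A 1))"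

lemma rowless_single: "app (rowless c) (Poly_Mapping.single A a) =
    (if \<exists>x\<in>A. vrow x = c then 0 else Poly_Mapping.single A a)"
  by (simp add: rowless_def app_Lop)

lemma rowless_cre: "rowless c * cre (XV c i) = 0"
  by (rule lop_eqI_basis) (auto simp: app_ops cre_single rowless_single app_simps)

lemma rowless_commutes:
  assumes "a \<noteq> c"
  shows "rowless c * cre (XV a i) = cre (XV a i) * rowless c"
    "rowless c * ann (XV a i) = ann (XV a i) * rowless c"
proof -
  have 1: "(\<exists>x\<in>A - {XV a i}. vrow x = c) \<longleftrightarrow> (\<exists>x\<in>A. vrow x = c)" for A
    using assms by auto
  have 2: "(\<exists>x\<in>insert (XV a i) A. vrow x = c) \<longleftrightarrow> (\<exists>x\<in>A. vrow x = c)" for A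
    using assms by auto
  show "rowless c * cre (XV a i) = cre (XV a i) * rowless c"
    by (rule lop_eqI_basis) (simp only: app_ops cre_single rowless_single if_distrib[of "app _"] 2 app_simps, simp add: cre_single rowless_single 2)
  show "rowless c * ann (XV a i) = ann (XV a i) * rowless c"
    by (rule lop_eqI_basis) (simp only: app_ops ann_single rowless_single if_distrib[of "app _"] 1 app_simps, simp add: ann_single rowless_single 1)
qed

lemma rowless_VS: "v \<in> VS n R \<Longrightarrow> c \<notin> R \<Longrightarrow> app (rowless c) v = v"
  using linop_eq_on_keys[OF linop_app[of "rowless c"] linop_app[of 1], of v]
  by (force simp: VS_def rowless_single app_one)

lemma gword_Cons:
  shows "gword (x # xs) = app (cre x) (gword xs)" and "\<forall>A\<in>Poly_Mapping.keys (gword xs). finite A"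
proof -
  have fin: "\<forall>A\<in>Poly_Mapping.keys (gword xs :: 'a set \<Rightarrow>\<^sub>0 complex). finite A" for xs :: "'a list"
  proof (induction xs)
    case Nil
    show ?case by (simp add: gword_def)
  next
    case (Cons x xs)
    have "gword (x # xs) = gmult (gvar x) (gword xs)"
      by (simp add: gword_def)
    also have "\<dots> = app (cre x) (gword xs)"
      by (rule gmult_gvar) (use Cons in blast)
    finally have eq: "gword (x # xs) = app (cre x) (gword xs)" .
    have "Poly_Mapping.keys (app (cre x) (gword xs)) \<subseteq> {A. finite A}"
    proof (rule keys_lin[OF linop_app])
      fix A assume "A \<in> Poly_Mapping.keys (gword xs)"
      then have "finite A" using Cons by blast
      then show "Poly_Mapping.keys (app (cre x) (Poly_Mapping.single A 1)) \<subseteq> {A. finite A}"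
        by (simp add: cre_single)
    qed
    then show ?case unfolding eq by blast
  qed
  then show "\<forall>A\<in>Poly_Mapping.keys (gword xs). finite A" by blast
  have "gword (x # xs) = gmult (gvar x) (gword xs)"
    by (simp add: gword_def)
  also have "\<dots> = app (cre x) (gword xs)"
    by (rule gmult_gvar) (use fin in blast)
  finally show "gword (x # xs) = app (cre x) (gword xs)" .
qed

lemma gword_Nil: "gword [] = Poly_Mapping.single {} 1"
  by (simp add: gword_def)

lemma gword_move: "gword (xs @ x # ys) = fscale ((-1) ^ length xs) (app (cre x) (gword (xs @ ys)))"
proof (induction xs)
  case (Cons y xs)
  let ?w = "gword (xs @ ys)"
  have "gword ((y # xs) @ x # ys) = fscale ((-1) ^ length xs) (app (cre y) (app (cre x) ?w))"
    by (simp only: append_Cons gword_Cons(1) Cons linop_fscale[OF linop_app])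
  also have "app (cre y) (app (cre x) ?w) = - app (cre x) (app (cre y) ?w)"
    using cre_cre[of y x] by (metis app_times app_uminus)
  also have "\<dots> = fscale (- 1) (app (cre x) (gword ((y # xs) @ ys)))"
    by (simp only: append_Cons gword_Cons(1) fscale_minus_one)
  finally show ?case by simp
qed (simp add: gword_Cons(1))

lemma cre_gword_mem:
  assumes "x \<in> set xs"
  shows "app (cre x) (gword xs) = 0"
proof -
  obtain ys zs where xs: "xs = ys @ x # zs" using assms by (metis split_list)
  have "cre x * cre x = 0"
    by (rule lop_eqI_basis) (auto simp: app_ops cre_single app_simps)
  then have "app (cre x) (app (cre x) v) = 0" for v
    by (metis app_times app_zero)
  then show ?thesis unfolding xs gword_move by (simp add: app_simps)
qed

lemma ann_gword: "x \<notin> set xs \<Longrightarrow> app (ann x) (gword xs) = 0"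
proof (induction xs)
  case Nil
  then show ?case by (simp add: gword_Nil ann_single)
next
  case (Cons y xs)
  have "app (ann x) (gword (y # xs)) = app (ann x * cre y) (gword xs)"
    by (simp only: gword_Cons(1) app_times)
  also have "\<dots> = - app (cre y) (app (ann x) (gword xs))"
    using Cons.prems by (simp add: ann_cre app_ops)
  finally show ?case using Cons by (simp add: app_simps)
qed

lemma gword_sorted: "sorted_wrt (<) xs \<Longrightarrow> gword xs = Poly_Mapping.single (set xs) 1"
proof (induction xs)
  case (Cons x xs)
  have "{b \<in> set xs. b < x} = {}" "x \<notin> set xs"
    using Cons.prems by auto
  then have "gsign (set xs) x = 1" "x \<notin> set xs"
    by (simp_all only: gsign_finite finite_set card.empty power_0 not_False_eq_True)
  then show ?case using Cons by (simp add: gword_Cons(1) cre_single)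
qed (simp add: gword_Nil)

lemma linop_ident [simp]: "linop (\<lambda>v. v)"
  by (simp add: linop_def)

lemma linop_scale [simp]: "linop (fscale a)"
  by (simp add: linop_def fvs.scale_right_distrib mult.commute)

section \<open>Permutations of rows acting on the Grassmann algebra\<close>

definition row_map :: "(nat \<Rightarrow> nat) \<Rightarrow> xvar \<Rightarrow> xvar" where
  "row_map \<sigma> x = XV (\<sigma> (vrow x)) (vcol x)"

lemma grass_perm_single: "grass_perm \<sigma> (Poly_Mapping.single A a) = fscale a (gword (map (row_map \<sigma>) (sorted_list_of_set A)))"
  by (simp add: grass_perm_def row_map_def[abs_def])

lemma linop_grass_perm [simp]: "linop (grass_perm \<sigma>)"
  by (simp add: grass_perm_def)

lemma sorted_list_of_set_split:
  assumes "finite A" "x \<notin> A"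
  shows "\<exists>xs ys. sorted_list_of_set A = xs @ ys \<and> sorted_list_of_set (insert x A) = xs @ x # ys \<and>
     length xs = card {b \<in> A. b < x}"
proof -
  let ?l = "sorted_list_of_set A"
  let ?xs = "takeWhile (\<lambda>y. y < x) ?l" and ?ys = "dropWhile (\<lambda>y. y < x) ?l"
  have s: "sorted_wrt (<) ?l" by simp
  have ys: "x < y" if "y \<in> set ?ys" for y
  proof -
    have "?ys \<noteq> []" using that by (metis empty_iff list.set(1))
    then have "\<not> hd ?ys < x" by (rule hd_dropWhile)
    moreover have "sorted_wrt (<) (?xs @ ?ys)" using s by (simp only: takeWhile_dropWhile_id)
    then have "hd ?ys = y \<or> hd ?ys < y"
      using that \<open>?ys \<noteq> []\<close> by (cases ?ys) (auto simp: sorted_wrt_append)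
    moreover have "y \<in> A" using that assms(1) set_dropWhileD by force
    ultimately show ?thesis using assms(2) by (metis linorder_neqE order.strict_trans)
  qed
  have xs: "y < x" if "y \<in> set ?xs" for y using that set_takeWhileD by fastforce
  have "sorted_wrt (<) (?xs @ ?ys)" using s by (simp only: takeWhile_dropWhile_id)
  then have "sorted_wrt (<) (?xs @ x # ?ys)"
    using xs ys by (auto simp: sorted_wrt_append intro: order.strict_trans)
  moreover have "set (?xs @ x # ?ys) = insert x A"
    using assms(1) by (metis Un_insert_right list.simps(15) set_append set_sorted_list_of_set takeWhile_dropWhile_id)
  ultimately have "sorted_list_of_set (insert x A) = ?xs @ x # ?ys"
    by (metis sorted_list_of_set.idem_if_sorted_distinct strict_sorted_iff)
  moreover have "{b \<in> A. b < x} = set ?xs"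
  proof -
    have "A = set ?xs \<union> set ?ys"
      using assms(1) by (metis set_append set_sorted_list_of_set takeWhile_dropWhile_id)
    then show ?thesis using xs ys by (auto dest: less_asym)
  qed
  then have "card {b \<in> A. b < x} = length ?xs"
    using assms(1) by (simp add: distinct_card distinct_takeWhile)
  ultimately show ?thesis
    using takeWhile_dropWhile_id by metis
qed

text \<open>Inserting x into a sorted monomial costs the sign of its position, and bringing its
  image to the front of the permuted word costs the same sign. If x is already present, both sides
  vanish, the right one by a repeated factor.\<close>

lemma grass_perm_cre:
  assumes fin: "\<And>A. A \<in> Poly_Mapping.keys v \<Longrightarrow> finite A"
  shows "grass_perm \<sigma> (app (cre x) v) = app (cre (row_map \<sigma> x)) (grass_perm \<sigma> v)"
proof (rule linop_eq_on_keys[of "\<lambda>v. grass_perm \<sigma> (app (cre x) v)" "\<lambda>v. app (cre (row_map \<sigma> x)) (grass_perm \<sigma> v)"])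
  fix A assume "A \<in> Poly_Mapping.keys v"
  then have A: "finite A" using fin by blast
  show "grass_perm \<sigma> (app (cre x) (Poly_Mapping.single A 1)) =
      app (cre (row_map \<sigma> x)) (grass_perm \<sigma> (Poly_Mapping.single A 1))"
  proof (cases "x \<in> A")
    case True
    then show ?thesis
      using A by (simp add: cre_single grass_perm_single linop_zero cre_gword_mem)
  next
    case False
    from sorted_list_of_set_split[OF A this] obtain xs ys where
      xy: "sorted_list_of_set A = xs @ ys" "sorted_list_of_set (insert x A) = xs @ x # ys"
      "length xs = card {b \<in> A. b < x}" by blast
    have "gsign A x = (-1) ^ length xs" using A xy(3) by (simp add: gsign_finite)
    then show ?thesis
      using False A by (simp add: cre_single grass_perm_single xy(1,2) gword_move power_mult_distrib[symmetric])
  qed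
qed (simp_all add: linop_compose)

text \<open>Reduces to multiplication: a monomial containing x is x times the rest, and the
  derivation removes the image of x again. By injectivity the image of the rest does not contain
  it.\<close>

lemma grass_perm_ann:
  assumes \<sigma>: "inj \<sigma>" and fin: "\<And>A. A \<in> Poly_Mapping.keys v \<Longrightarrow> finite A"
  shows "grass_perm \<sigma> (app (ann x) v) = app (ann (row_map \<sigma> x)) (grass_perm \<sigma> v)"
proof (rule linop_eq_on_keys[of "\<lambda>v. grass_perm \<sigma> (app (ann x) v)" "\<lambda>v. app (ann (row_map \<sigma> x)) (grass_perm \<sigma> v)"])
  have inj: "row_map \<sigma> x = row_map \<sigma> y \<longleftrightarrow> x = y" for x y
    using \<sigma> by (cases x; cases y) (auto simp: row_map_def inj_eq)
  fix A assume "A \<in> Poly_Mapping.keys v"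
  then have A: "finite A" using fin by blast
  have kill: "app (ann (row_map \<sigma> x)) (grass_perm \<sigma> (Poly_Mapping.single B a)) = 0" if "x \<notin> B" "finite B" for B a
    using that inj by (simp add: grass_perm_single app_simps) (subst ann_gword; auto)
  show "grass_perm \<sigma> (app (ann x) (Poly_Mapping.single A 1)) =
      app (ann (row_map \<sigma> x)) (grass_perm \<sigma> (Poly_Mapping.single A 1))"
  proof (cases "x \<in> A")
    case False
    then show ?thesis using kill A by (simp add: ann_single linop_zero)
  next
    case True
    let ?w = "Poly_Mapping.single (A - {x}) (gsign A x)"
    have w: "Poly_Mapping.single A 1 = app (cre x) ?w"
      using True by (simp add: cre_single gsign_remove insert_absorb)
    have "grass_perm \<sigma> (app (cre x) ?w) = app (cre (row_map \<sigma> x)) (grass_perm \<sigma> ?w)"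
      using A by (intro grass_perm_cre) (auto split: if_splits)
    then have "app (ann (row_map \<sigma> x)) (grass_perm \<sigma> (Poly_Mapping.single A 1)) =
        app (ann (row_map \<sigma> x) * cre (row_map \<sigma> x)) (grass_perm \<sigma> ?w)"
      by (simp add: w app_times)
    also have "\<dots> = grass_perm \<sigma> ?w - app (cre (row_map \<sigma> x)) (app (ann (row_map \<sigma> x)) (grass_perm \<sigma> ?w))"
      by (simp add: ann_cre app_ops)
    also have "\<dots> = grass_perm \<sigma> ?w"
      using kill[of "A - {x}"] A by (simp add: app_simps)
    finally show ?thesis using True by (simp add: ann_single)
  qed
qed (simp_all add: linop_compose)

lemma grass_perm_qo_po:
  assumes "inj \<sigma>" "\<And>A. A \<in> Poly_Mapping.keys v \<Longrightarrow> finite A" "\<epsilon>' (\<sigma> a) = \<epsilon> a"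
  shows "grass_perm \<sigma> (app (qo \<epsilon> a i) v) = app (qo \<epsilon>' (\<sigma> a) i) (grass_perm \<sigma> v)"
    "grass_perm \<sigma> (app (po \<epsilon> a i) v) = app (po \<epsilon>' (\<sigma> a) i) (grass_perm \<sigma> v)"
  using assms grass_perm_cre[of v \<sigma> "XV a i"] grass_perm_ann[of \<sigma> v "XV a i"]
  by (auto simp: qo_def po_def row_map_def)

lemma grass_perm_keys_single:
  assumes "finite A"
  shows "Poly_Mapping.keys (grass_perm \<sigma> (Poly_Mapping.single A a)) \<subseteq> {row_map \<sigma> ` A}"
proof -
  have "Poly_Mapping.keys (gword (map (row_map \<sigma>) xs)) \<subseteq> {row_map \<sigma> ` set xs}" for xs
  proof (induction xs)
    case (Cons x xs)
    show ?case
      unfolding list.map gword_Cons(1)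
      by (rule keys_lin[OF linop_app]) (use Cons in \<open>auto simp: cre_single split: if_splits\<close>)
  qed (simp add: gword_Nil)
  from this[of "sorted_list_of_set A"] show ?thesis
    using assms by (auto simp: grass_perm_single in_keys_iff lookup_fscale)
qed

lemma grass_perm_VS:
  assumes "v \<in> VS n R"
  shows "grass_perm \<sigma> v \<in> VS n (\<sigma> ` R)"
  unfolding VS_def mem_Collect_eq
proof (rule keys_lin[OF linop_grass_perm])
  fix A assume "A \<in> Poly_Mapping.keys v"
  then have A: "finite A" "\<forall>x\<in>A. vrow x \<in> R \<and> vcol x \<in> {1..n}" using assms by (auto simp: VS_def)
  show "Poly_Mapping.keys (grass_perm \<sigma> (Poly_Mapping.single A 1)) \<subseteq>
     {A. finite A \<and> (\<forall>x\<in>A. vrow x \<in> \<sigma> ` R \<and> vcol x \<in> {1..n})}"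
    using grass_perm_keys_single[OF A(1), of \<sigma> 1] A by (auto simp: row_map_def)
qed

lemma grass_perm_fixed:
  assumes "v \<in> VS n R" "\<And>a. a \<in> R \<Longrightarrow> \<sigma> a = a"
  shows "grass_perm \<sigma> v = v"
proof (rule linop_eq_on_keys[of "grass_perm \<sigma>" "\<lambda>v. v"])
  fix A assume "A \<in> Poly_Mapping.keys v"
  then have A: "finite A" "\<forall>x\<in>A. vrow x \<in> R" using assms by (auto simp: VS_def)
  then have "map (row_map \<sigma>) (sorted_list_of_set A) = sorted_list_of_set A"
    by (intro map_idI) (auto simp: row_map_def assms(2))
  then show "grass_perm \<sigma> (Poly_Mapping.single A 1) = Poly_Mapping.single A 1"
    using A by (simp add: grass_perm_single gword_sorted)
qed simp_all

definition exch :: "nat \<Rightarrow> nat \<Rightarrow> nat \<Rightarrow> nat" where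
  "exch b c a = (if a = b then c else if a = c then b else a)"

lemma inj_exch: "inj (exch b c)"
  by (auto simp: inj_def exch_def split: if_splits)

lemma exch_simps [simp]: "exch b c b = c" "exch b c c = b" "a \<noteq> b \<Longrightarrow> a \<noteq> c \<Longrightarrow> exch b c a = a"
  by (auto simp: exch_def)

text \<open>Both rows carry the columns \<open>J\<close>, so for each j in \<open>J\<close> the
  variables x_bj and x_cj trade places, and each such pair contributes one sign.\<close>

lemma grass_perm_exch_equal_rows:
  assumes J: "finite J" and bc: "b \<noteq> c" and A: "finite A"
    "\<And>i. XV b i \<in> A \<longleftrightarrow> i \<in> J" "\<And>i. XV c i \<in> A \<longleftrightarrow> i \<in> J"
  shows "grass_perm (exch b c) (Poly_Mapping.single A 1) = fscale ((-1) ^ card J) (Poly_Mapping.single A 1)"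
  using J A
proof (induction J arbitrary: A)
  case empty
  have "map (row_map (exch b c)) (sorted_list_of_set A) = sorted_list_of_set A"
  proof (rule map_idI)
    fix x assume "x \<in> set (sorted_list_of_set A)"
    then have "x \<in> A" using empty(1) by simp
    then have "vrow x \<noteq> b" "vrow x \<noteq> c" using empty(2,3) by (metis xvar.collapse empty_iff)+
    then show "row_map (exch b c) x = x" by (simp add: row_map_def)
  qed
  then show ?case using empty(1) by (simp add: grass_perm_single gword_sorted)
next
  case (insert j J)
  let ?x = "XV b j" and ?y = "XV c j"
  let ?A = "A - {?x} - {?y}"
  have xy: "?x \<in> A" "?y \<in> A" "?x \<noteq> ?y" using insert.prems bc by auto
  let ?s = "gsign A ?x * gsign (A - {?x}) ?y"
  have "app (cre ?x * cre ?y) (Poly_Mapping.single ?A ?s) = Poly_Mapping.single A 1"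
  proof -
    have "app (cre ?y) (Poly_Mapping.single ?A ?s) = Poly_Mapping.single (A - {?x}) (gsign A ?x)"
      using xy gsign_remove[of ?y "A - {?x}" ?y] by (simp add: cre_single insert_absorb mult.assoc)
    then show ?thesis
      using xy gsign_remove[of ?x A ?x] by (simp add: app_times cre_single insert_absorb)
  qed
  then have A: "Poly_Mapping.single A 1 = app (cre ?x) (app (cre ?y) (Poly_Mapping.single ?A ?s))"
    by (simp add: app_times)
  have fin: "finite ?A" using insert.prems by simp
  have IH: "grass_perm (exch b c) (Poly_Mapping.single ?A 1) = fscale ((-1) ^ card J) (Poly_Mapping.single ?A 1)"
    by (rule insert.IH) (use insert.hyps insert.prems bc in auto)
  have IH': "grass_perm (exch b c) (Poly_Mapping.single ?A ?s) = fscale ((-1) ^ card J) (Poly_Mapping.single ?A ?s)"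
    using IH linop_fscale[OF linop_grass_perm, of "exch b c" ?s "Poly_Mapping.single ?A 1"] by (simp add: mult.commute)
  have f1: "B \<in> Poly_Mapping.keys (Poly_Mapping.single ?A ?s) \<Longrightarrow> finite B" for B
    using fin by (auto split: if_splits)
  have f2: "B \<in> Poly_Mapping.keys (app (cre ?y) (Poly_Mapping.single ?A ?s)) \<Longrightarrow> finite B" for B
    using fin by (auto simp: cre_single split: if_splits)
  have "grass_perm (exch b c) (Poly_Mapping.single A 1) =
     app (cre ?y) (app (cre ?x) (fscale ((-1) ^ card J) (Poly_Mapping.single ?A ?s)))"
  proof -
    have e1: "row_map (exch b c) ?x = ?y" "row_map (exch b c) ?y = ?x" by (simp_all add: row_map_def)
    have "grass_perm (exch b c) (app (cre ?x) (app (cre ?y) (Poly_Mapping.single ?A ?s))) =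
        app (cre ?y) (grass_perm (exch b c) (app (cre ?y) (Poly_Mapping.single ?A ?s)))"
      using grass_perm_cre[of "app (cre ?y) (Poly_Mapping.single ?A ?s)" "exch b c" ?x] f2 e1 by simp
    also have "grass_perm (exch b c) (app (cre ?y) (Poly_Mapping.single ?A ?s)) =
        app (cre ?x) (grass_perm (exch b c) (Poly_Mapping.single ?A ?s))"
      using grass_perm_cre[of "Poly_Mapping.single ?A ?s" "exch b c" ?y] f1 e1 by simp
    finally show ?thesis unfolding A IH' .
  qed
  also have "\<dots> = - app (cre ?x) (app (cre ?y) (fscale ((-1) ^ card J) (Poly_Mapping.single ?A ?s)))"
    using cre_cre[of ?y ?x] by (metis app_times app_uminus)
  also have "\<dots> = fscale (- 1) (fscale ((-1) ^ card J) (app (cre ?x) (app (cre ?y) (Poly_Mapping.single ?A ?s))))"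
    by (simp only: linop_fscale[OF linop_app] fscale_minus_one)
  also have "\<dots> = fscale ((-1) ^ card (insert j J)) (Poly_Mapping.single A 1)"
    unfolding A[symmetric] using insert.hyps by simp
  finally show ?case .
qed

context fock
begin

lemma D_VS: "v \<in> VS n R \<Longrightarrow> a \<in> R \<Longrightarrow> b \<in> R \<Longrightarrow> app (D a b) v \<in> VS n R"
  unfolding D_def app_sum app_times
  by (intro subspace_sum subspace_VS qo_VS po_VS) auto

lemma E_VS: "v \<in> VS n R \<Longrightarrow> a \<in> R \<Longrightarrow> i \<in> {1..n} \<Longrightarrow> j \<in> {1..n} \<Longrightarrow> app (E a i j) v \<in> VS n R"
  unfolding E_def app_times by (intro qo_VS po_VS)

lemma series_VS:
  assumes "v \<in> VS n R" "a \<in> R" "b \<in> R"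
  shows "app (X_ser a b s) v \<in> VS n R" "app (Y_ser a b s) v \<in> VS n R"
proof -
  have pow: "w \<in> VS n R \<Longrightarrow> x \<in> R \<Longrightarrow> y \<in> R \<Longrightarrow> app (D x y ^ r) w \<in> VS n R" for r x y w
    by (induction r) (simp_all add: app_ops D_VS)
  show "app (X_ser a b s) v \<in> VS n R" "app (Y_ser a b s) v \<in> VS n R"
    unfolding X_ser_def Y_ser_def app_sum app_lscale app_times
    using assms by (auto intro!: subspace_sum subspace_VS fvs.subspace_scale pow)
qed

lemma Zfac_VS: "v \<in> VS n R \<Longrightarrow> a \<in> R \<Longrightarrow> b \<in> R \<Longrightarrow> app (Zfac \<nu> z (a, b)) v \<in> VS n R"
  by (simp add: Zfac_def series_VS)

lemma Zprod_VS: "v \<in> VS n R \<Longrightarrow> (\<And>a b. (a, b) \<in> set ps \<Longrightarrow> a \<in> R \<and> b \<in> R) \<Longrightarrow> app (Zprod \<nu> z ps) v \<in> VS n R"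
  by (induction ps) (auto simp: app_ops intro!: Zfac_VS)

end

lemma grass_perm_D:
  assumes "inj \<sigma>" "v \<in> VS n R" "a \<in> R" "b \<in> R" "eps' (\<sigma> a) = eps a" "eps' (\<sigma> b) = eps b"
  shows "grass_perm \<sigma> (app (fock.D n eps a b) v) = app (fock.D n eps' (\<sigma> a) (\<sigma> b)) (grass_perm \<sigma> v)"
proof -
  have fin: "\<And>A. A \<in> Poly_Mapping.keys v \<Longrightarrow> finite A" using assms(2) VS_finite by blast
  have "grass_perm \<sigma> (app (qo eps a i) (app (po eps b i) v)) =
      app (qo eps' (\<sigma> a) i) (app (po eps' (\<sigma> b) i) (grass_perm \<sigma> v))" if i: "i \<in> {1..n}" for i
  proof -
    have "\<And>A. A \<in> Poly_Mapping.keys (app (po eps b i) v) \<Longrightarrow> finite A"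
      using VS_finite[OF po_VS[OF assms(2,4) i]] by blast
    then show ?thesis
      using grass_perm_qo_po(1)[where \<sigma> = \<sigma> and v = "app (po eps b i) v" and \<epsilon>' = eps' and a = a and \<epsilon> = eps and i = i]
        grass_perm_qo_po(2)[where \<sigma> = \<sigma> and v = v and \<epsilon>' = eps' and a = b and \<epsilon> = eps and i = i] fin assms by simp
  qed
  then show ?thesis
    unfolding fock.D_def app_sum app_times linop_sum[OF linop_grass_perm]
    by (rule sum.cong[OF refl])
qed

lemma grass_perm_pow_D:
  assumes "inj \<sigma>" "v \<in> VS n R" "a \<in> R" "b \<in> R" "eps' (\<sigma> a) = eps a" "eps' (\<sigma> b) = eps b"
  shows "grass_perm \<sigma> (app (fock.D n eps a b ^ r) v) = app (fock.D n eps' (\<sigma> a) (\<sigma> b) ^ r) (grass_perm \<sigma> v) \<and>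
    app (fock.D n eps a b ^ r) v \<in> VS n R"
  by (induction r) (use assms in \<open>simp_all add: app_ops grass_perm_D[where R = R and eps' = eps'] fock.D_VS\<close>)

lemma grass_perm_Zfac:
  assumes "inj \<sigma>" "v \<in> VS n R" "a \<in> R" "b \<in> R" "eps' (\<sigma> a) = eps a" "eps' (\<sigma> b) = eps b"
    "\<nu>' (\<sigma> a) = \<nu> a" "\<nu>' (\<sigma> b) = \<nu> b" "z' (\<sigma> a) = z a" "z' (\<sigma> b) = z b"
  shows "grass_perm \<sigma> (app (fock.Zfac n eps \<nu> z (a, b)) v) = app (fock.Zfac n eps' \<nu>' z' (\<sigma> a, \<sigma> b)) (grass_perm \<sigma> v)"
proof -
  have 1: "grass_perm \<sigma> (app (fock.D n eps a b ^ r) (app (fock.D n eps b a ^ r) v)) =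
      app (fock.D n eps' (\<sigma> a) (\<sigma> b) ^ r) (app (fock.D n eps' (\<sigma> b) (\<sigma> a) ^ r) (grass_perm \<sigma> v))"
    "grass_perm \<sigma> (app (fock.D n eps b a ^ r) (app (fock.D n eps a b ^ r) v)) =
      app (fock.D n eps' (\<sigma> b) (\<sigma> a) ^ r) (app (fock.D n eps' (\<sigma> a) (\<sigma> b) ^ r) (grass_perm \<sigma> v))" for r
    using grass_perm_pow_D[where \<sigma> = \<sigma> and n = n and R = R and eps = eps and eps' = eps' and r = r and v = v and a = a and b = b]
      grass_perm_pow_D[where \<sigma> = \<sigma> and n = n and R = R and eps = eps and eps' = eps' and r = r and v = v and a = b and b = a]
      grass_perm_pow_D[where \<sigma> = \<sigma> and n = n and R = R and eps = eps and eps' = eps' and r = r and v = "app (fock.D n eps b a ^ r) v" and a = a and b = b]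
      grass_perm_pow_D[where \<sigma> = \<sigma> and n = n and R = R and eps = eps and eps' = eps' and r = r and v = "app (fock.D n eps a b ^ r) v" and a = b and b = a]
      assms by auto
  show ?thesis
    using assms(7-) by (simp add: fock.Zfac_def fock.X_ser_def fock.Y_ser_def app_sum app_lscale app_times
        linop_sum[OF linop_grass_perm] linop_fscale[OF linop_grass_perm] 1)
qed

section \<open>The series at parameter 0 as an exchange of two rows\<close>

context fock
begin

lemma wt_negative: "wt (D a a) (- 1) v \<Longrightarrow> v = 0"
proof (rule poly_mapping_eqI)
  fix A assume "wt (D a a) (- 1) v"
  then have "- Poly_Mapping.lookup v A = of_nat (nocc a A) * Poly_Mapping.lookup v A"
    using lookup_D_diag[of a v A] by (simp add: wt_def lookup_fscale)
  then have "(of_nat (nocc a A) + 1) * Poly_Mapping.lookup v A = 0"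
    unfolding distrib_right by (metis add.left_inverse add.commute mult_1)
  moreover have "(of_nat (nocc a A) + 1 :: complex) \<noteq> 0"
    by (metis of_nat_Suc of_nat_neq_0 add.commute)
  ultimately show "Poly_Mapping.lookup v A = Poly_Mapping.lookup 0 A" by simp
qed

lemma p_wt_0: "wt (D a a) 0 v \<Longrightarrow> i \<in> {1..n} \<Longrightarrow> app (p a i) v = 0"
  using wt_negative[of a] D_diag_p[of i a "- 1" v] by simp

text \<open>Induction on the common degree. By \<open>Y_ser_0_exchange\<close> and the induction
  hypothesis every p b i p c j kills Y v plus kappa times the permuted vector. A vector of positive
  degree killed by all \<open>p\<close> of a row is zero, so this sum vanishes. The constant changes
  sign at each step because the two \<open>p\<close> come back in the opposite order.\<close>

lemma Y_ser_0_exch: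
  assumes bc: "b \<noteq> c" and eps: "eps b = eps c"
  shows "\<exists>\<kappa>. \<kappa> \<noteq> 0 \<and> (\<forall>v. v \<in> VS n R \<longrightarrow> b \<in> R \<longrightarrow> c \<in> R \<longrightarrow> wt (D b b) (of_nat d) v \<longrightarrow> wt (D c c) (of_nat d) v \<longrightarrow>
      app (Y_ser b c 0) v = fscale \<kappa> (grass_perm (exch b c) v))"
proof (induction d)
  case 0
  \<comment> \<open>In degree 0 a row of sign +1 contains no variables and a row of sign -1 contains
    all of them.\<close>
  define J where "J = (if eps b = 1 then {} else {1..n})"
  show ?case
  proof (intro exI[of _ "(-1) ^ card J"] conjI allI impI)
    fix v assume v: "v \<in> VS n R" "b \<in> R" "c \<in> R" "wt (D b b) (of_nat 0) v" "wt (D c c) (of_nat 0) v"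
    have "app (D c b) v = 0"
      unfolding D_def app_sum app_times using p_wt_0[of b v] v(4) by (simp add: app_simps)
    then have "D c b * vop v = 0"
      by (simp add: vop_simps) (simp add: vop_def fvs.scale_zero_right zero_lop_def)
    then have "Y_ser b c 0 * vop v = vop v"
      using sl2.Yser_lowest[OF sl2[OF bc]] Y_ser[OF bc] by simp
    then have Y: "app (Y_ser b c 0) v = v" by (simp add: vop_simps vop_inject)
    have "grass_perm (exch b c) v = fscale ((-1) ^ card J) v"
    proof (rule linop_eq_on_keys[of "grass_perm (exch b c)" "fscale ((-1) ^ card J)"])
      fix A assume A: "A \<in> Poly_Mapping.keys v"
      have fin: "finite A" using VS_finite[OF v(1) A] .
      have cols: "\<forall>x\<in>A. vrow x \<in> R \<and> vcol x \<in> {1..n}" using v(1) A unfolding VS_def by blast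
      have mem: "XV a i \<in> A \<longleftrightarrow> i \<in> J" if a: "eps a = eps b" "nocc a A = 0" for a i
      proof -
        have "\<forall>i\<in>{1..n}. \<not> occupied a i A" using a(2) by (simp add: nocc_def)
        moreover have "XV a i \<in> A \<Longrightarrow> i \<in> {1..n}" using cols by (metis xvar.sel(2))
        ultimately show ?thesis using a(1) unfolding J_def occupied_def by (metis empty_iff)
      qed
      have "nocc b A = 0" "nocc c A = 0"
        using v(4,5) A unfolding wt_iff_keys by blast+
      then show "grass_perm (exch b c) (Poly_Mapping.single A 1) = fscale ((-1) ^ card J) (Poly_Mapping.single A 1)"
        using mem[of b] mem[of c] eps by (intro grass_perm_exch_equal_rows bc fin) (simp_all add: J_def)
    qed simp_all
    then show "app (Y_ser b c 0) v = fscale ((-1) ^ card J) (grass_perm (exch b c) v)"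
      by (simp add: Y power_mult_distrib[symmetric])
  qed simp
next
  case (Suc d)
  then obtain \<kappa> where \<kappa>: "\<kappa> \<noteq> 0" and IH: "\<And>v. v \<in> VS n R \<Longrightarrow> b \<in> R \<Longrightarrow> c \<in> R \<Longrightarrow> wt (D b b) (of_nat d) v \<Longrightarrow>
      wt (D c c) (of_nat d) v \<Longrightarrow> app (Y_ser b c 0) v = fscale \<kappa> (grass_perm (exch b c) v)"
    by blast
  let ?\<pi> = "grass_perm (exch b c)"
  show ?case
  proof (intro exI[of _ "- \<kappa>"] conjI allI impI)
    fix v assume v: "v \<in> VS n R" "b \<in> R" "c \<in> R" "wt (D b b) (of_nat (Suc d)) v" "wt (D c c) (of_nat (Suc d)) v"
    let ?u = "app (Y_ser b c 0) v + fscale \<kappa> (?\<pi> v)"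
    have \<pi>p: "?\<pi> (app (p a i) w) = app (p (exch b c a) i) (?\<pi> w)" if "w \<in> VS n R" "a \<in> {b, c}" for a i w
      using that eps VS_finite[OF that(1)] by (intro grass_perm_qo_po(2)[OF inj_exch]) auto
    have pp: "app (p b i) (app (p c j) ?u) = 0" if ij: "i \<in> {1..n}" "j \<in> {1..n}" for i j
    proof -
      let ?w = "app (p b j) (app (p c i) v)"
      have w: "app (p c i) v \<in> VS n R" "?w \<in> VS n R"
        using v ij by (auto intro!: po_VS)
      have "wt (D b b) (of_nat d) ?w"
        using ij v(4) bc by (intro D_diag_p D_diag_p_other) (auto simp: add.commute)
      moreover have "wt (D c c) (of_nat d) ?w"
        using ij v(5) bc by (intro D_diag_p_other D_diag_p) (auto simp: add.commute)
      ultimately have "app (Y_ser b c 0) ?w = fscale \<kappa> (?\<pi> ?w)"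
        using IH[OF w(2) v(2,3)] by blast
      moreover have "app (p b i) (app (p c j) (app (Y_ser b c 0) v)) = app (Y_ser b c 0) ?w"
        using Y_ser_0_exchange[OF bc ij v(4,5)] by (simp only: app_times)
      moreover have "?\<pi> ?w = - app (p b i) (app (p c j) (?\<pi> v))"
      proof -
        have "?\<pi> ?w = app (p c j) (app (p b i) (?\<pi> v))"
          using \<pi>p[OF w(1), of b j] \<pi>p[OF v(1), of c i] by simp
        then show ?thesis
          using po_po[of eps c j b i] by (metis app_times app_uminus)
      qed
      ultimately show ?thesis
        by (simp add: app_simps fvs.scale_minus_right)
    qed
    have \<pi>D: "?\<pi> (app (D a a) v) = app (D (exch b c a) (exch b c a)) (?\<pi> v)" if "a \<in> {b, c}" for a
      using that v eps by (intro grass_perm_D[OF inj_exch v(1)]) auto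
    have wu: "wt (D a a) (of_nat (Suc d)) ?u" if "a \<in> {b, c}" for a
    proof -
      have "wt (D a a) (of_nat (Suc d)) (app (Y_ser b c 0) v)"
        using that v(4,5) D_diag_series(2)[OF bc] wt_commute by auto
      moreover have "wt (D a a) (of_nat (Suc d)) (?\<pi> v)"
        using that \<pi>D[of b] \<pi>D[of c] v(4,5) by (auto simp: wt_def linop_fscale[OF linop_grass_perm])
      ultimately show ?thesis
        by (simp add: wt_def app_simps fvs.scale_right_distrib mult.commute)
    qed
    have zero: "w = 0" if "wt (D a a) (of_nat (Suc d)) w" "\<And>i. i \<in> {1..n} \<Longrightarrow> app (p a i) w = 0" for a w
    proof -
      have "app (D a a) w = 0" unfolding D_def app_sum app_times using that(2) by (simp add: app_simps)
      then have "fscale (of_nat (Suc d)) w = 0" using that(1) by (simp add: wt_def)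
      then show ?thesis by (metis fvs.scale_eq_0_iff of_nat_neq_0)
    qed
    have "app (p c j) ?u = 0" if j: "j \<in> {1..n}" for j
      by (rule zero[of b]) (use pp j wu[of b] bc D_diag_p_other[OF j] in auto)
    then have "?u = 0" using zero[of c] wu[of c] by blast
    then show "app (Y_ser b c 0) v = fscale (- \<kappa>) (?\<pi> v)"
      by (simp add: eq_neg_iff_add_eq_0)
  qed (use \<kappa> in simp)
qed

end

section \<open>The image of the intertwining operator lies in every nonzero submodule\<close>

lemma subspace_preimage:
  assumes "linop f" "fvs.subspace S"
  shows "fvs.subspace {v. f v \<in> S}"
  using assms by (auto intro!: fvs.subspaceI simp: linop_zero linop_add linop_fscale fvs.subspace_0
      fvs.subspace_add fvs.subspace_scale)

lemma span_preimage:
  assumes "linop f" "fvs.subspace S" "\<And>b. b \<in> B \<Longrightarrow> f b \<in> S" "v \<in> fvs.span B"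
  shows "f v \<in> S"
  using fvs.span_minimal[OF _ subspace_preimage[OF assms(1,2)], of B] assms(3,4) by blast

definition cstr :: "nat \<Rightarrow> nat list \<Rightarrow> xvar set lop" where
  "cstr r J = foldr (\<lambda>j. (*) (cre (XV r j))) J 1"

definition dstr :: "nat \<Rightarrow> nat list \<Rightarrow> xvar set lop" where
  "dstr r J = foldr (\<lambda>j. (*) (ann (XV r j))) J 1"

lemma cstr_simps [simp]: "cstr r [] = 1" "cstr r (j # J) = cre (XV r j) * cstr r J"
  by (simp_all add: cstr_def)

lemma dstr_simps [simp]: "dstr r [] = 1" "dstr r (j # J) = ann (XV r j) * dstr r J"
  by (simp_all add: dstr_def)

lemma dstr_append: "dstr r (J @ K) = dstr r J * dstr r K"
  by (induction J) (simp_all add: mult.assoc)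

lemma cstr_commutes: "(\<And>j. j \<in> set J \<Longrightarrow> w * cre (XV r j) = cre (XV r j) * w) \<Longrightarrow> w * cstr r J = cstr r J * w"
proof (induction J)
  case (Cons j J)
  then have "w * cre (XV r j) = cre (XV r j) * w" "w * cstr r J = cstr r J * w" by auto
  then show ?case by (metis cstr_simps(2) mult.assoc)
qed simp

lemma dstr_commutes: "(\<And>j. j \<in> set J \<Longrightarrow> w * ann (XV r j) = ann (XV r j) * w) \<Longrightarrow> w * dstr r J = dstr r J * w"
proof (induction J)
  case (Cons j J)
  then have "w * ann (XV r j) = ann (XV r j) * w" "w * dstr r J = dstr r J * w" by auto
  then show ?case by (metis dstr_simps(2) mult.assoc)
qed simp

lemma dstr_cstr:
  assumes "c \<noteq> r"
  shows "dstr c K * cstr r J = ((-1) ^ (length K * length J)) \<star> (cstr r J * dstr c K)"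
proof (induction K)
  case (Cons k K)
  have "ann (XV c k) * cstr r J = ((-1) ^ length J) \<star> (cstr r J * ann (XV c k))" for k
  proof (induction J)
    case (Cons j J)
    have "ann (XV c k) * cstr r (j # J) = - (cre (XV r j) * (ann (XV c k) * cstr r J))"
      using assms ann_cre[of "XV c k" "XV r j"] by (simp add: mult.assoc[symmetric])
    then show ?case unfolding Cons by (simp add: lop.scl_nf mult.assoc)
  qed (simp add: lop.scl_one)
  then have "dstr c (k # K) * cstr r J = ((-1) ^ (length K * length J)) \<star> (((-1) ^ length J) \<star> (cstr r J * ann (XV c k))) * dstr c K"
    unfolding dstr_simps mult.assoc Cons by (simp only: lop.scl_simps mult.assoc[symmetric])
  then show ?case
    by (simp add: lop.scl_simps power_add mult.assoc mult.commute)
qed (simp add: lop.scl_one)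

section \<open>Coefficients of the products of row matrices\<close>

context fock
begin

text \<open>\<open>Le\<close> with the number X replaced by the formal variable. Submodules are
  described by the coefficients \<open>cf\<close>, intertwiners by evaluation;
  \<open>mat_prod_Le_cf\<close> connects the two.\<close>

definition Lf :: "(nat \<Rightarrow> complex) \<Rightarrow> nat \<Rightarrow> nat \<Rightarrow> nat \<Rightarrow> xvar set lop fps" where
  "Lf z a i j = fps_const (if i = j then 1 else 0) + fps_const (E a i j - (if i = j then z a \<star> 1 else 0)) * fps_X"

definition cf :: "(nat \<Rightarrow> complex) \<Rightarrow> nat list \<Rightarrow> nat \<Rightarrow> nat \<Rightarrow> nat \<Rightarrow> xvar set lop" where
  "cf z l t i j = fps_nth (mat_prod n (Lf z) l i j) t"

lemma cf_Nil: "cf z [] t i j = (if i = j \<and> t = 0 then 1 else 0)"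
  by (simp add: cf_def)

lemma Lf_mult_nth:
  "fps_nth (Lf z a i k * F) 0 = (if i = k then 1 else 0) * fps_nth F 0"
  "fps_nth (Lf z a i k * F) (Suc t) = (if i = k then 1 else 0) * fps_nth F (Suc t) +
     (E a i k - (if i = k then z a \<star> 1 else 0)) * fps_nth F t"
  by (simp_all add: Lf_def distrib_right mult.assoc del: fps_const_sub)

lemma mult_Lf_nth:
  "fps_nth (F * Lf z a k j) 0 = fps_nth F 0 * (if k = j then 1 else 0)"
  "fps_nth (F * Lf z a k j) (Suc t) = fps_nth F (Suc t) * (if k = j then 1 else 0) +
     fps_nth F t * (E a k j - (if k = j then z a \<star> 1 else 0))"
  by (simp_all add: Lf_def distrib_left mult.assoc[symmetric] del: fps_const_sub)

lemma Lf_nth_0: "fps_nth (Lf z a i j) 0 = (if i = j then 1 else 0)"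
  by (simp add: Lf_def)

lemma cf_Cons:
  assumes "i \<in> {1..n}"
  shows "cf z (a # l) 0 i j = cf z l 0 i j"
    "cf z (a # l) (Suc t) i j = cf z l (Suc t) i j - z a \<star> cf z l t i j + (\<Sum>k = 1..n. E a i k * cf z l t k j)"
  using sum_delta_mult_left[OF assms, of 1 "\<lambda>k. cf z l 0 k j"]
    sum_delta_mult_left[OF assms, of 1 "\<lambda>k. cf z l (Suc t) k j"]
    sum_delta_mult_left[OF assms, of "z a \<star> 1" "\<lambda>k. cf z l t k j"]
  by (simp_all add: cf_def fps_sum_nth Lf_mult_nth(2) Lf_nth_0 left_diff_distrib sum.distrib sum_subtractf lop.scl_simps)

lemma cf_snoc:
  assumes "i \<in> {1..n}" "j \<in> {1..n}"
  shows "cf z (l @ [a]) 0 i j = cf z l 0 i j"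
    "cf z (l @ [a]) (Suc t) i j = cf z l (Suc t) i j - z a \<star> cf z l t i j + (\<Sum>k = 1..n. cf z l t i k * E a k j)"
  unfolding cf_def mat_prod_append[OF assms(1)] mat_prod_single[OF assms(2)]
  using sum_delta_mult_right[OF assms(2), of "\<lambda>k. cf z l 0 i k" 1]
    sum_delta_mult_right[OF assms(2), of "\<lambda>k. cf z l (Suc t) i k" 1]
    sum_delta_mult_right[OF assms(2), of "\<lambda>k. cf z l t i k" "z a \<star> 1"]
  by (simp_all add: cf_def fps_sum_nth mult_Lf_nth(2) Lf_nth_0 right_diff_distrib sum.distrib sum_subtractf lop.scl_simps)

lemma cf_commutes:
  assumes "\<And>a i j. a \<in> set l \<Longrightarrow> i \<in> {1..n} \<Longrightarrow> j \<in> {1..n} \<Longrightarrow> w * E a i j = E a i j * w"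
    "i \<in> {1..n}" "j \<in> {1..n}"
  shows "w * cf z l t i j = cf z l t i j * w"
  using assms
proof (induction l arbitrary: t i)
  case Nil
  then show ?case by (simp add: cf_Nil)
next
  case (Cons a l)
  have IH: "w * cf z l t k j = cf z l t k j * w" if "k \<in> {1..n}" for t k
    using Cons that by simp
  have "w * (E a i k * cf z l t k j) = E a i k * cf z l t k j * w" if "k \<in> {1..n}" for t k
  proof -
    have "w * E a i k = E a i k * w" using Cons.prems that by simp
    then show ?thesis using IH[OF that, of t] by (metis mult.assoc)
  qed
  then have "w * (\<Sum>k = 1..n. E a i k * cf z l t k j) = (\<Sum>k = 1..n. E a i k * cf z l t k j) * w" for t
    unfolding sum_distrib_left sum_distrib_right by (intro sum.cong refl)
  then show ?case
    using IH[OF Cons.prems(2)]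
    by (cases t) (simp_all add: cf_Cons[OF Cons.prems(2)] distrib_left distrib_right left_diff_distrib
        right_diff_distrib lop.scl_simps)
qed

lemma cf_D_diag: "i \<in> {1..n} \<Longrightarrow> j \<in> {1..n} \<Longrightarrow> cf z l t i j * D c c = D c c * cf z l t i j"
  using cf_commutes[of l "D c c" i j z t] D_diag_E by simp

lemma cf_Wt: "i \<in> {1..n} \<Longrightarrow> j \<in> {1..n} \<Longrightarrow> w \<in> Wt \<nu> R \<Longrightarrow> app (cf z l t i j) w \<in> Wt \<nu> R"
  unfolding Wt_def using wt_commute[OF cf_D_diag[of i j z l t]] by blast

lemma cf_VS:
  "i \<in> {1..n} \<Longrightarrow> j \<in> {1..n} \<Longrightarrow> v \<in> VS n R \<Longrightarrow> set l \<subseteq> R \<Longrightarrow> app (cf z l t i j) v \<in> VS n R"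
proof (induction l arbitrary: t i)
  case Nil
  then show ?case using fvs.subspace_0[OF subspace_VS] by (simp add: cf_Nil app_ops)
next
  case (Cons a l)
  then have IH: "app (cf z l t k j) v \<in> VS n R" if "k \<in> {1..n}" for t k
    using that by simp
  have "app (\<Sum>k = 1..n. E a i k * cf z l t k j) v \<in> VS n R" for t
    unfolding app_sum app_times using IH Cons.prems by (intro subspace_sum subspace_VS E_VS) auto
  then show ?case
    using IH Cons.prems(1) by (cases t) (auto simp: cf_Cons app_ops app_lscale intro!: fvs.subspace_add[OF subspace_VS]
        fvs.subspace_diff[OF subspace_VS] fvs.subspace_scale[OF subspace_VS])
qed

lemma cf_gt_length: "i \<in> {1..n} \<Longrightarrow> length l < t \<Longrightarrow> cf z l t i j = 0"
proof (induction l arbitrary: t i)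
  case (Cons a l)
  then show ?case by (cases t) (auto simp: cf_Cons intro!: sum.neutral)
qed (simp add: cf_Nil)

lemma mat_prod_Le_cf:
  "i \<in> {1..n} \<Longrightarrow> mat_prod n (Le z X) l i j = (\<Sum>t<Suc (length l). X ^ t \<star> cf z l t i j)"
proof (induction l arbitrary: i)
  case Nil
  then show ?case by (simp add: cf_Nil lop.scl_one)
next
  case (Cons a l)
  let ?M = "mat_prod n (Le z X) l"
  have "mat_prod n (Le z X) (a # l) i j = (\<Sum>k = 1..n. (if i = k then (1 - z a * X) \<star> 1 else 0) * ?M k j)
      + X \<star> (\<Sum>k = 1..n. E a i k * ?M k j)"
    by (simp add: Le_def distrib_right sum.distrib lop.scl_sum lop.scl_mult_left)
  also have "(\<Sum>k = 1..n. (if i = k then (1 - z a * X) \<star> 1 else 0) * ?M k j) = ?M i j - X \<star> z a \<star> ?M i j"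
    unfolding sum_delta_mult_left[OF Cons.prems]
    by (simp add: lop.scl_simps lop.scl_diff_left left_diff_distrib mult.commute)
  also have "(\<Sum>k = 1..n. E a i k * ?M k j) = (\<Sum>k = 1..n. \<Sum>t<Suc (length l). X ^ t \<star> (E a i k * cf z l t k j))"
    using Cons.IH by (intro sum.cong refl) (simp only: sum_distrib_left lop.scl_mult_right)
  also have "\<dots> = (\<Sum>t<Suc (length l). X ^ t \<star> (\<Sum>k = 1..n. E a i k * cf z l t k j))"
    unfolding lop.scl_sum by (rule sum.swap)
  finally have "mat_prod n (Le z X) (a # l) i j = ?M i j +
     (\<Sum>t<Suc (length l). X ^ Suc t \<star> (- (z a \<star> cf z l t i j) + (\<Sum>k = 1..n. E a i k * cf z l t k j)))"
    unfolding Cons.IH[OF Cons.prems]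
    by (simp only: lop.scl_sum lop.scl_right_distrib lop.scl_minus_right sum.distrib sum_negf lop.scl_scl
        power_Suc mult.assoc[of X] diff_conv_add_uminus add.assoc mult.commute[of _ "z a"] mult.left_commute[of _ "z a"])
  also have "?M i j = cf z l 0 i j + (\<Sum>t<Suc (length l). X ^ Suc t \<star> cf z l (Suc t) i j)"
  proof -
    have "?M i j = (\<Sum>t<Suc (Suc (length l)). X ^ t \<star> cf z l t i j)"
      using cf_gt_length[OF Cons.prems, of l "Suc (length l)" z j] Cons by simp
    then show ?thesis
      by (subst (asm) sum.lessThan_Suc_shift) (simp add: lop.scl_one del: sum.lessThan_Suc)
  qed
  finally show ?case
    unfolding length_Cons
    by (subst sum.lessThan_Suc_shift) (simp add: cf_Cons[OF Cons.prems] lop.scl_one lop.scl_right_distrib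
        lop.scl_diff_right lop.scl_minus_right sum.distrib sum_subtractf sum_negf del: sum.lessThan_Suc)
qed

text \<open>Equality for all numbers X gives equality of the coefficients, by interpolation in the
  subspace {0}.\<close>

lemma intertwines_cf:
  assumes T: "intertwines \<nu> z R l l' T" and len: "length l = length l'" and w: "w \<in> Wt \<nu> R"
    and ij: "i \<in> {1..n}" "j \<in> {1..n}"
  shows "app (T * cf z l t i j) w = app (cf z l' t i j * T) w"
proof (cases "t < Suc (length l)")
  case True
  let ?c = "\<lambda>t. app (T * cf z l t i j) w - app (cf z l' t i j * T) w"
  have "?c t \<in> {0}"
  proof (rule polynomial_values_in_subspace[OF _ _ _ True])
    show "infinite (UNIV :: complex set)" by (simp add: infinite_UNIV_char_0)
    fix X
    have "app (T * mat_prod n (Le z X) l i j) w = app (mat_prod n (Le z X) l' i j * T) w"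
      using T w ij unfolding intertwines_def by blast
    then have "(\<Sum>r<Suc (length l). fscale (X ^ r) (app (T * cf z l r i j) w)) =
       (\<Sum>r<Suc (length l). fscale (X ^ r) (app (cf z l' r i j * T) w))"
      unfolding mat_prod_Le_cf[OF ij(1)] len sum_distrib_left sum_distrib_right lop.scl_mult_left
        lop.scl_mult_right app_sum app_lscale .
    then show "(\<Sum>r<Suc (length l). fscale (X ^ r) (?c r)) \<in> {0}"
      by (simp only: fvs.scale_right_diff_distrib sum_subtractf diff_self singletonI)
  qed simp
  then show ?thesis by simp
next
  case False
  then show ?thesis using cf_gt_length ij len by (simp add: app_ops)
qed

text \<open>The model of the tensor product of the first k factors inside the Grassmann
  algebra.\<close>

definition Fk :: "(nat \<Rightarrow> nat) \<Rightarrow> nat \<Rightarrow> grass set" where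
  "Fk \<nu> k = VS n {1..k} \<inter> Wt \<nu> {1..k}"

lemma subspace_Wt: "fvs.subspace (Wt \<nu> R)"
  unfolding Wt_def wt_def
  by (rule fvs.subspaceI) (auto simp: app_simps fvs.scale_right_distrib mult.commute)

lemma subspace_Fk: "fvs.subspace (Fk \<nu> k)"
  unfolding Fk_def by (intro fvs.subspace_inter subspace_VS subspace_Wt)

lemma E_cre_other: "c \<noteq> a \<Longrightarrow> E c i j * cre (XV a k) = cre (XV a k) * E c i j"
  and E_ann_other: "c \<noteq> a \<Longrightarrow> E c i j * ann (XV a k) = ann (XV a k) * E c i j"
  using E_q_other[of c a i j k] E_p_other[of c a i j k]
  by (cases "eps a = 1"; simp add: qo_def po_def)+

lemma D_cre_other: "a \<noteq> x \<Longrightarrow> a \<noteq> y \<Longrightarrow> k \<in> {1..n} \<Longrightarrow> D x y * cre (XV a k) = cre (XV a k) * D x y"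
  and D_ann_other: "a \<noteq> x \<Longrightarrow> a \<noteq> y \<Longrightarrow> k \<in> {1..n} \<Longrightarrow> D x y * ann (XV a k) = ann (XV a k) * D x y"
  using D_q[of k x y a] D_p[of k x y a]
  by (cases "eps a = 1"; simp add: qo_def po_def)+

lemma D_rowless: "a \<noteq> x \<Longrightarrow> a \<noteq> y \<Longrightarrow> rowless a * D x y = D x y * rowless a"
  and E_rowless: "a \<noteq> x \<Longrightarrow> rowless a * E x i j = E x i j * rowless a"
proof -
  have q: "a \<noteq> b \<Longrightarrow> rowless a * q b i = q b i * rowless a"
    and p: "a \<noteq> b \<Longrightarrow> rowless a * p b i = p b i * rowless a" for b i
    by (simp_all add: qo_def po_def rowless_commutes)
  have qp: "rowless a * (q x i * p y j) = q x i * p y j * rowless a" if "a \<noteq> x" "a \<noteq> y" for i j x y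
    using q[OF that(1), of i] p[OF that(2), of j] by (metis mult.assoc)
  show "a \<noteq> x \<Longrightarrow> a \<noteq> y \<Longrightarrow> rowless a * D x y = D x y * rowless a"
    using qp by (simp add: D_def sum_distrib_left sum_distrib_right)
  show "a \<noteq> x \<Longrightarrow> rowless a * E x i j = E x i j * rowless a"
    unfolding E_def by (rule qp)
qed

text \<open>Here e is the number of variables of row \<open>r\<close>, whereas \<open>D r r\<close>
  counts occupied columns; for sign -1 the two numbers add up to n.\<close>

definition dg :: "nat \<Rightarrow> complex \<Rightarrow> grass \<Rightarrow> bool" where
  "dg r e v \<longleftrightarrow> wt (D r r) (if eps r = 1 then e else of_nat n - e) v"

lemma dg_cre: "j \<in> {1..n} \<Longrightarrow> dg r e v \<Longrightarrow> dg r (e + 1) (app (cre (XV r j)) v)"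
  using D_diag_q[of j r e v] D_diag_p[of j r "of_nat n - (e + 1)" v]
  by (cases "eps r = 1") (simp_all add: dg_def qo_def po_def)

lemma dg_ann: "j \<in> {1..n} \<Longrightarrow> dg r (e + 1) v \<Longrightarrow> dg r e (app (ann (XV r j)) v)"
  using D_diag_p[of j r e v] D_diag_q[of j r "of_nat n - (e + 1)" v]
  by (cases "eps r = 1") (simp_all add: dg_def qo_def po_def)

lemma dg_cstr: "set J \<subseteq> {1..n} \<Longrightarrow> dg r e v \<Longrightarrow> dg r (e + of_nat (length J)) (app (cstr r J) v)"
proof (induction J)
  case (Cons j J)
  then have "dg r (e + of_nat (length J) + 1) (app (cre (XV r j)) (app (cstr r J) v))"
    by (intro dg_cre) auto
  then show ?case by (simp add: app_times add_ac)
qed (simp add: app_one)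

lemma dg_dstr: "set J \<subseteq> {1..n} \<Longrightarrow> dg r (e + of_nat (length J)) v \<Longrightarrow> dg r e (app (dstr r J) v)"
proof (induction J arbitrary: e)
  case (Cons j J)
  then have "dg r (e + 1) (app (dstr r J) v)"
    by (simp add: add_ac)
  then show ?case using Cons.prems dg_ann by (simp add: app_times)
qed (simp add: app_one)

lemma dg_0: "v \<in> VS n R \<Longrightarrow> r \<notin> R \<Longrightarrow> dg r 0 v"
proof -
  assume v: "v \<in> VS n R" "r \<notin> R"
  have "nocc r A = (if eps r = 1 then 0 else n)" if "A \<in> Poly_Mapping.keys v" for A
  proof -
    have "XV r i \<notin> A" for i
    proof
      assume "XV r i \<in> A"
      moreover have "\<forall>x\<in>A. vrow x \<in> R" using v(1) that unfolding VS_def by blast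
      ultimately have "vrow (XV r i) \<in> R" by blast
      then show False using v(2) by simp
    qed
    then have "{i \<in> {1..n}. occupied r i A} = (if eps r = 1 then {} else {1..n})"
      unfolding occupied_def by auto
    then show ?thesis unfolding nocc_def by (simp only:) simp
  qed
  then have "wt (D r r) (of_nat (if eps r = 1 then 0 else n)) v"
    unfolding wt_iff_keys by blast
  then show ?thesis by (cases "eps r = 1") (simp_all add: dg_def)
qed

lemma VS_dg_0:
  assumes v: "v \<in> VS n R" "dg r 0 v"
  shows "v \<in> VS n (R - {r})"
  unfolding VS_def mem_Collect_eq
proof
  fix A assume A: "A \<in> Poly_Mapping.keys v"
  have A1: "finite A" "\<forall>x\<in>A. vrow x \<in> R \<and> vcol x \<in> {1..n}" using v(1) A unfolding VS_def by blast+
  have "wt (D r r) (of_nat (if eps r = 1 then 0 else n)) v"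
    using v(2) by (cases "eps r = 1") (simp_all add: dg_def)
  then have nocc: "nocc r A = (if eps r = 1 then 0 else n)"
    unfolding wt_iff_keys using A by blast
  have "XV r i \<notin> A" if i: "i \<in> {1..n}" for i
  proof (cases "eps r = 1")
    case True
    then have "{i \<in> {1..n}. occupied r i A} = {}" using nocc by (simp add: nocc_def)
    then show ?thesis using i True by (auto simp: occupied_def)
  next
    case False
    then have "card {i \<in> {1..n}. occupied r i A} = card {1..n}" using nocc by (simp add: nocc_def)
    then have "{i \<in> {1..n}. occupied r i A} = {1..n}"
      by (intro card_subset_eq) auto
    then have "occupied r i A" using i by blast
    then show ?thesis using False by (simp add: occupied_def)
  qed
  then have "vrow x \<noteq> r" if "x \<in> A" for x
    using A1 that by (metis xvar.collapse)
  then show "A \<in> {A. finite A \<and> (\<forall>x\<in>A. vrow x \<in> R - {r} \<and> vcol x \<in> {1..n})}"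
    using A1 by blast
qed

text \<open>Euler's identity for the degree in the variables of row \<open>r\<close>; it recovers a
  vector from its derivatives.\<close>

lemma sum_cre_ann:
  assumes "dg r e v"
  shows "(\<Sum>j = 1..n. app (cre (XV r j)) (app (ann (XV r j)) v)) = fscale e v"
proof (cases "eps r = 1")
  case True
  have "(\<Sum>j = 1..n. app (cre (XV r j)) (app (ann (XV r j)) v)) = app (D r r) v"
    using True by (simp add: D_def qo_def po_def app_sum app_times)
  then show ?thesis using assms True by (simp add: dg_def wt_def)
next
  case False
  have "(\<Sum>j = 1..n. app (cre (XV r j)) (app (ann (XV r j)) v)) = app (of_nat n \<star> 1 - D r r) v"
    unfolding sum_p_q[symmetric] using False by (simp add: qo_def po_def app_sum app_times)
  then show ?thesis using assms False
    by (simp add: dg_def wt_def app_ops app_lscale fvs.scale_left_diff_distrib)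
qed

lemma exists_dstr_nonzero:
  "dg r (of_nat d) v \<Longrightarrow> v \<noteq> 0 \<Longrightarrow> \<exists>K. set K \<subseteq> {1..n} \<and> length K = d \<and> app (dstr r K) v \<noteq> 0"
proof (induction d arbitrary: v)
  case 0
  then show ?case by (intro exI[of _ "[]"]) (simp add: app_one)
next
  case (Suc d)
  have "\<exists>j\<in>{1..n}. app (ann (XV r j)) v \<noteq> 0"
  proof (rule ccontr)
    assume "\<not> ?thesis"
    then have "fscale (of_nat (Suc d)) v = 0"
      unfolding sum_cre_ann[OF Suc.prems(1), symmetric] by (intro sum.neutral) (simp add: app_simps)
    then show False using Suc.prems(2) by (metis fvs.scale_eq_0_iff of_nat_neq_0)
  qed
  then obtain j where j: "j \<in> {1..n}" "app (ann (XV r j)) v \<noteq> 0" by blast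
  have "dg r (of_nat d) (app (ann (XV r j)) v)"
    using dg_ann[OF j(1), of r "of_nat d" v] Suc.prems(1) by (simp add: add.commute)
  from Suc.IH[OF this j(2)] obtain K where
    "set K \<subseteq> {1..n}" "length K = d" "app (dstr r K) (app (ann (XV r j)) v) \<noteq> 0" by blast
  then show ?case
    using j by (intro exI[of _ "K @ [j]"]) (simp add: dstr_append app_times)
qed

definition cspan :: "nat \<Rightarrow> nat \<Rightarrow> grass set \<Rightarrow> grass set" where
  "cspan r d G = fvs.span {app (cstr r J) g | J g. set J \<subseteq> {1..n} \<and> length J = d \<and> g \<in> G}"

lemma cspan_cre:
  assumes v: "v \<in> cspan r d G" and j: "j \<in> {1..n}"
  shows "app (cre (XV r j)) v \<in> cspan r (Suc d) G"
  unfolding cspan_def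
proof (rule span_preimage[OF linop_app fvs.subspace_span _ v[unfolded cspan_def]])
  fix b assume "b \<in> {app (cstr r J) g | J g. set J \<subseteq> {1..n} \<and> length J = d \<and> g \<in> G}"
  then obtain J g where J: "b = app (cstr r J) g" "set J \<subseteq> {1..n}" "length J = d" "g \<in> G" by blast
  have "app (cre (XV r j)) b = app (cstr r (j # J)) g" by (simp add: J app_times)
  then show "app (cre (XV r j)) b \<in> fvs.span {app (cstr r J) g | J g. set J \<subseteq> {1..n} \<and> length J = Suc d \<and> g \<in> G}"
    using j J by (intro fvs.span_base CollectI exI[of _ "j # J"] exI[of _ g]) auto
qed

lemma mem_cspan: "set J \<subseteq> {1..n} \<Longrightarrow> length J = d \<Longrightarrow> g \<in> G \<Longrightarrow> app (cstr r J) g \<in> cspan r d G"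
  unfolding cspan_def by (rule fvs.span_base) blast

lemma subspace_cspan: "fvs.subspace (cspan r d G)"
  unfolding cspan_def by (rule fvs.subspace_span)

text \<open>Euler's identity, divided by the degree, expands \<open>v\<close> through its
  derivatives by the variables of the last row, which have one variable less.\<close>

lemma Fk_cspan:
  assumes "v \<in> VS n {1..Suc k}" "v \<in> Wt \<nu> {1..k}" "dg (Suc k) (of_nat d) v"
  shows "v \<in> cspan (Suc k) d (Fk \<nu> k)"
  using assms
proof (induction d arbitrary: v)
  case 0
  have "{1..Suc k} - {Suc k} = {1..k}" by auto
  then have "v \<in> Fk \<nu> k" using VS_dg_0[of v "{1..Suc k}" "Suc k"] 0 by (simp add: Fk_def)
  then show ?case using mem_cspan[of "[]" 0 v] by (simp add: app_one)
next
  case (Suc d)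
  let ?r = "Suc k"
  have "app (cre (XV ?r j)) (app (ann (XV ?r j)) v) \<in> cspan ?r (Suc d) (Fk \<nu> k)" if j: "j \<in> {1..n}" for j
  proof (rule cspan_cre[OF Suc.IH j])
    show "app (ann (XV ?r j)) v \<in> VS n {1..?r}" by (rule ann_VS[OF Suc.prems(1)])
    show "app (ann (XV ?r j)) v \<in> Wt \<nu> {1..k}"
      using Suc.prems(2) wt_commute[OF D_ann_other[OF _ _ j, symmetric]] unfolding Wt_def by auto
    show "dg ?r (of_nat d) (app (ann (XV ?r j)) v)"
      using dg_ann[OF j, of ?r "of_nat d" v] Suc.prems(3) by (simp add: add.commute)
  qed
  then have "fscale (of_nat (Suc d)) v \<in> cspan ?r (Suc d) (Fk \<nu> k)"
    unfolding sum_cre_ann[OF Suc.prems(3), symmetric] by (intro subspace_sum subspace_cspan)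
  then have "fscale (inverse (of_nat (Suc d))) (fscale (of_nat (Suc d)) v) \<in> cspan ?r (Suc d) (Fk \<nu> k)"
    by (rule fvs.subspace_scale[OF subspace_cspan])
  then show ?case by (simp del: of_nat_Suc)
qed

text \<open>The derivative kills \<open>g\<close>, so it can only remove a variable of the string;
  multiplication then replaces that variable and the length is kept.\<close>

lemma cre_ann_cstr:
  assumes "a \<in> {1..n}" "set J \<subseteq> {1..n}" "app (ann (XV r b)) g = 0"
  shows "app (cre (XV r a)) (app (ann (XV r b)) (app (cstr r J) g)) \<in> cspan r (length J) {g}"
  using assms(2)
proof (induction J)
  case Nil
  then show ?case using assms(3) fvs.subspace_0[OF subspace_cspan] by (simp add: app_ops app_simps)
next
  case (Cons j J)
  let ?w = "app (cstr r J) g"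
  have "app (ann (XV r b)) (app (cre (XV r j)) ?w) =
     (if b = j then ?w else 0) - app (cre (XV r j)) (app (ann (XV r b)) ?w)"
  proof -
    have "app (ann (XV r b)) (app (cre (XV r j)) ?w) = app (ann (XV r b) * cre (XV r j)) ?w"
      by (simp only: app_times)
    then show ?thesis by (simp only: ann_cre) (simp add: app_ops)
  qed
  moreover define u where "u = app (ann (XV r b)) ?w"
  moreover have "app (cre (XV r a)) (app (cre (XV r j)) u) = - app (cre (XV r j)) (app (cre (XV r a)) u)"
    using cre_cre[of "XV r a" "XV r j"] by (metis app_times app_uminus)
  ultimately have "app (cre (XV r a)) (app (ann (XV r b)) (app (cstr r (j # J)) g)) =
     app (cre (XV r a)) (if b = j then ?w else 0) + app (cre (XV r j)) (app (cre (XV r a)) u)"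
    by (simp only: cstr_simps app_times linop_diff[OF linop_app] diff_minus_eq_add)
  also have "app (cre (XV r a)) (if b = j then ?w else 0) = (if b = j then app (cstr r (a # J)) g else 0)"
    by (simp add: app_times app_simps)
  finally have "app (cre (XV r a)) (app (ann (XV r b)) (app (cstr r (j # J)) g)) =
     (if b = j then app (cstr r (a # J)) g else 0) +
     app (cre (XV r j)) (app (cre (XV r a)) (app (ann (XV r b)) ?w))"
    unfolding u_def .
  moreover have "(if b = j then app (cstr r (a # J)) g else 0) \<in> cspan r (length (j # J)) {g}"
    using mem_cspan[of "a # J" "length (j # J)" g "{g}" r] assms(1) Cons.prems
      fvs.subspace_0[OF subspace_cspan] by auto
  moreover have "app (cre (XV r j)) (app (cre (XV r a)) (app (ann (XV r b)) ?w)) \<in> cspan r (length (j # J)) {g}"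
    using cspan_cre[OF Cons.IH] Cons.prems by simp
  ultimately show ?case using fvs.subspace_add[OF subspace_cspan] by simp
qed

lemma E_cstr:
  assumes "i \<in> {1..n}" "j \<in> {1..n}" "set J \<subseteq> {1..n}" "\<And>b. app (ann (XV r b)) g = 0"
  shows "app (E r i j) (app (cstr r J) g) \<in> cspan r (length J) {g}"
proof (cases "eps r = 1")
  case True
  then show ?thesis
    using cre_ann_cstr[OF assms(1,3,4)] by (simp add: E_def qo_def po_def app_times)
next
  case False
  have "E r i j = (if i = j then 1 else 0) - cre (XV r j) * ann (XV r i)"
    using False by (simp add: E_def qo_def po_def ann_cre)
  moreover have "app (if i = j then 1 else 0) (app (cstr r J) g) \<in> cspan r (length J) {g}"
    using mem_cspan[OF assms(3) refl, of g "{g}" r] fvs.subspace_0[OF subspace_cspan]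
    by (simp add: app_ops)
  ultimately show ?thesis
    using cre_ann_cstr[OF assms(2,3,4)] fvs.subspace_diff[OF subspace_cspan] by (simp add: app_ops)
qed

text \<open>The vectors whose coefficients with respect to the variables of row \<open>c\<close> all
  lie in \<open>S\<close>: in effect the tensor product of \<open>S\<close> with the Grassmann
  algebra of a row that \<open>S\<close> does not involve.\<close>

definition auxsub :: "nat \<Rightarrow> grass set \<Rightarrow> grass set" where
  "auxsub c S = {v. \<forall>K. set K \<subseteq> {1..n} \<longrightarrow> app (rowless c * dstr c K) v \<in> S}"

lemma subspace_auxsub: "fvs.subspace S \<Longrightarrow> fvs.subspace (auxsub c S)"
  unfolding auxsub_def
  by (rule fvs.subspaceI) (auto simp: app_simps fvs.subspace_0 fvs.subspace_add fvs.subspace_scale)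

lemma auxsub_ann: "v \<in> auxsub c S \<Longrightarrow> j \<in> {1..n} \<Longrightarrow> app (ann (XV c j)) v \<in> auxsub c S"
  unfolding auxsub_def
proof (intro CollectI allI impI)
  fix K assume v: "v \<in> {v. \<forall>K. set K \<subseteq> {1..n} \<longrightarrow> app (rowless c * dstr c K) v \<in> S}" and j: "j \<in> {1..n}"
    and K: "set K \<subseteq> {1..n}"
  have "app (rowless c * dstr c (K @ [j])) v \<in> S" using v j K by simp
  then show "app (rowless c * dstr c K) (app (ann (XV c j)) v) \<in> S"
    by (simp add: dstr_append app_times)
qed

text \<open>The new variable is moved to the left through the derivatives. Each commutation removes
  a derivative or passes on, and at the left end \<open>rowless\<close> kills what remains.\<close>

lemma auxsub_cre:
  assumes S: "fvs.subspace S" and v: "v \<in> auxsub c S"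
  shows "app (cre (XV c j)) v \<in> auxsub c S"
proof -
  have "app (rowless c * dstr c hs * cre (XV c j) * dstr c ks) v \<in> S"
    if "set hs \<subseteq> {1..n}" "set ks \<subseteq> {1..n}" for hs ks
    using that
  proof (induction hs arbitrary: ks rule: rev_induct)
    case Nil
    then show ?case using rowless_cre[of c j] S by (simp add: app_ops fvs.subspace_0)
  next
    case (snoc h hs)
    have "dstr c (hs @ [h]) * cre (XV c j) = (if h = j then dstr c hs else 0) - dstr c hs * cre (XV c j) * ann (XV c h)"
      by (simp add: dstr_append mult.assoc ann_cre right_diff_distrib)
    then have "rowless c * dstr c (hs @ [h]) * cre (XV c j) * dstr c ks =
       (if h = j then rowless c * dstr c (hs @ ks) else 0) - rowless c * dstr c hs * cre (XV c j) * dstr c (h # ks)"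
      by (simp add: mult.assoc dstr_append right_diff_distrib left_diff_distrib)
    moreover have "app (if h = j then rowless c * dstr c (hs @ ks) else 0) v \<in> S"
      using v snoc.prems S by (auto simp: auxsub_def app_ops fvs.subspace_0)
    moreover have "app (rowless c * dstr c hs * cre (XV c j) * dstr c (h # ks)) v \<in> S"
      using snoc by (intro snoc.IH) auto
    ultimately show ?case using fvs.subspace_diff[OF S] by (simp only: app_minus)
  qed
  from this[of _ "[]"] show ?thesis by (simp add: auxsub_def app_ops)
qed

lemma auxsub_commutes:
  assumes v: "v \<in> auxsub c S" and T: "\<And>s. s \<in> S \<Longrightarrow> app T s \<in> S"
    and "T * rowless c = rowless c * T" "\<And>j. j \<in> {1..n} \<Longrightarrow> T * ann (XV c j) = ann (XV c j) * T"
  shows "app T v \<in> auxsub c S"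
  unfolding auxsub_def
proof (intro CollectI allI impI)
  fix K assume K: "set K \<subseteq> {1..n}"
  have "T * dstr c K = dstr c K * T"
    using assms(4) K by (intro dstr_commutes) auto
  then have "T * (rowless c * dstr c K) = rowless c * dstr c K * T"
    using assms(3) by (metis mult.assoc)
  then have "app (rowless c * dstr c K) (app T v) = app T (app (rowless c * dstr c K) v)"
    by (metis app_times)
  then show "app (rowless c * dstr c K) (app T v) \<in> S"
    using v K T unfolding auxsub_def by simp
qed

lemma mem_auxsub:
  assumes S: "fvs.subspace S" "S \<subseteq> VS n R" "c \<notin> R" "s \<in> S"
  shows "s \<in> auxsub c S"
  unfolding auxsub_def
proof (intro CollectI allI impI)
  fix K
  show "app (rowless c * dstr c K) s \<in> S"
  proof (cases K rule: rev_cases)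
    case Nil
    then show ?thesis using rowless_VS[of s n R c] S by (auto simp: app_times app_one)
  next
    case (snoc K' k)
    then show ?thesis
      using ann_VS_other[of s n R c k] S by (auto simp: dstr_append app_times app_simps fvs.subspace_0 app_one)
  qed
qed

end

lemma grass_perm_Zprod:
  assumes "inj \<sigma>" "v \<in> VS n R"
    "\<And>a b. (a, b) \<in> set ps \<Longrightarrow> a \<in> R \<and> b \<in> R"
    "\<And>a. a \<in> R \<Longrightarrow> eps' (\<sigma> a) = eps a \<and> \<nu>' (\<sigma> a) = \<nu> a \<and> z' (\<sigma> a) = z a"
  shows "grass_perm \<sigma> (app (fock.Zprod n eps \<nu> z ps) v) =
    app (fock.Zprod n eps' \<nu>' z' (map (map_prod \<sigma> \<sigma>) ps)) (grass_perm \<sigma> v)"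
  using assms(3)
proof (induction ps)
  case Nil
  then show ?case by (simp add: fock.Zprod_simps app_one)
next
  case (Cons ab ps)
  obtain a b where ab: "ab = (a, b)" by (cases ab)
  have R: "a \<in> R" "b \<in> R" using Cons.prems ab by auto
  have "app (fock.Zprod n eps \<nu> z ps) v \<in> VS n R"
    using Cons.prems by (intro fock.Zprod_VS assms(2)) auto
  then have "grass_perm \<sigma> (app (fock.Zfac n eps \<nu> z (a, b)) (app (fock.Zprod n eps \<nu> z ps) v)) =
      app (fock.Zfac n eps' \<nu>' z' (\<sigma> a, \<sigma> b)) (grass_perm \<sigma> (app (fock.Zprod n eps \<nu> z ps) v))"
    using R assms(1,4) by (intro grass_perm_Zfac) auto
  moreover have "\<And>a b. (a, b) \<in> set ps \<Longrightarrow> a \<in> R \<and> b \<in> R" using Cons.prems by (meson list.set_intros(2))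
  note Cons.IH[OF this]
  ultimately show ?case
    by (simp add: fock.Zprod_simps app_times ab)
qed

section \<open>Induction over the rows for a nonzero submodule\<close>

context fock
begin

definition stable :: "(nat \<Rightarrow> complex) \<Rightarrow> nat list \<Rightarrow> grass set \<Rightarrow> bool" where
  "stable z l S \<longleftrightarrow> (\<forall>t. \<forall>i\<in>{1..n}. \<forall>j\<in>{1..n}. \<forall>v\<in>S. app (cf z l t i j) v \<in> S)"

lemma Zprod_D_diag:
  "(\<And>a b. (a, b) \<in> set ps \<Longrightarrow> a \<noteq> b) \<Longrightarrow> Zprod \<nu> z ps * D c c = D c c * Zprod \<nu> z ps"
proof (induction ps)
  case (Cons ab ps)
  obtain a b where ab: "ab = (a, b)" by (cases ab)
  have "Zfac \<nu> z ab * D c c = D c c * Zfac \<nu> z ab" "Zprod \<nu> z ps * D c c = D c c * Zprod \<nu> z ps"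
    using Cons Zfac_D_diag ab by auto
  then show ?case by (metis Zprod_simps(2) mult.assoc)
qed simp

text \<open>Pushing the content of row \<open>r\<close> of an element \<open>s\<close> of a submodule \<open>S\<close> to an auxiliary row
  \<open>c\<close> and applying the fused product of the operators \<open>T(u)\<close> at the parameter of row \<open>r\<close>:
  the factor of row \<open>r\<close> degenerates to the exchange of the rows \<open>r\<close> and \<open>c\<close>.\<close>

lemma slices_mem:
  fixes k r c d :: nat
  defines "r \<equiv> Suc k"
  defines "l \<equiv> rev [1..<Suc k]"
  assumes good: "\<And>b. 1 \<le> b \<Longrightarrow> b \<le> k \<Longrightarrow> good \<nu> z b r"
    and aux: "c > r" "eps c = eps r" "z c = z r" "\<nu> c = \<nu> r" and \<nu>r: "\<nu> r \<le> n"
    and d: "d = (if eps r = 1 then \<nu> r else n - \<nu> r)"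
    and S: "fvs.subspace S" "S \<subseteq> Fk \<nu> r" "stable z (r # l) S" and s: "s \<in> S"
    and JK: "set J \<subseteq> {1..n}" "length J = d" "set K \<subseteq> {1..n}" "length K = d"
  shows "app (Zprod \<nu> z (map (\<lambda>b. (b, r)) l) * cstr r J) (app (dstr r K) s) \<in> S"
    and "app (dstr r K) s \<in> Fk \<nu> k"
proof -
  define R where "R = Zprod \<nu> z (map (\<lambda>b. (b, r)) l)"
  define Ra where "Ra = Zprod \<nu> z (map (\<lambda>b. (b, c)) l)"
  \<comment> \<open>For b other than \<open>r\<close> this is the case distinction of
    \<open>Zfac\<close>. For b = r the degrees coincide and \<open>Zfac\<close> would take X; here Y
    is taken, whose parameter u - z r becomes 0 at u = z r, where it exchanges the rows.\<close>
  define form where "form = (\<lambda>b. b \<noteq> r \<and> \<nu> r \<le> \<nu> b)"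
  let ?\<pi> = "grass_perm (exch r c)"
  let ?R = "insert c {1..r}"
  have l: "set l = {1..k}" "distinct l" "r \<notin> set l" "c \<notin> set l" "distinct (r # l)" "c \<notin> set (r # l)"
    using aux(1) by (auto simp: l_def r_def)
  have rc: "r \<noteq> c" using aux(1) by simp
  have sF: "s \<in> VS n {1..r}" "s \<in> Wt \<nu> {1..r}" using S(2) s by (auto simp: Fk_def)
  have wtr: "wt (D x x) (of_nat (\<nu> r)) w \<longleftrightarrow> dg x (of_nat d) w" if "eps x = eps r" for x w
    using that \<nu>r by (cases "eps r = 1") (simp_all add: dg_def d of_nat_diff)
  have dgs: "dg r (of_nat d) s"
    using sF(2) wtr[of r s] by (auto simp: Wt_def r_def)
  define v where "v = app (cstr c J) s"
  have SV: "S \<subseteq> VS n {1..r}" using S(2) by (auto simp: Fk_def)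
  have cnot: "c \<notin> {1..r}" using aux(1) by simp
  have "s \<in> auxsub c S" by (rule mem_auxsub[OF S(1) SV cnot s])
  then have vS: "v \<in> auxsub c S"
    unfolding v_def using JK(1) by (induction J) (auto simp: app_ops intro: auxsub_cre S(1))
  have vVS: "v \<in> VS n ?R"
  proof -
    have "s \<in> VS n ?R" using sF(1) VS_mono[of "{1..r}" ?R] by auto
    then show ?thesis
      unfolding v_def using JK(1) by (induction J) (auto simp: app_ops intro!: cre_VS)
  qed
  have dgv: "dg c (of_nat d) v"
    using dg_cstr[OF JK(1) dg_0[OF sF(1) cnot]] by (simp add: v_def JK(2))
  have DJ: "D a a * cstr x J = cstr x J * D a a" if "a \<noteq> x" for a x
    using that JK(1) by (intro cstr_commutes D_cre_other) auto
  have vW: "v \<in> Wt \<nu> (set (r # l))"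
    unfolding Wt_def mem_Collect_eq
  proof
    fix a assume "a \<in> set (r # l)"
    then have a: "a \<in> {1..r}" using l(1) by (auto simp: r_def)
    then have "a \<noteq> c" using aux(1) by auto
    then show "wt (D a a) (of_nat (\<nu> a)) v"
      unfolding v_def using a sF(2) by (intro wt_commute[OF DJ[symmetric]]) (auto simp: Wt_def)
  qed
  \<comment> \<open>The value u = z r is admissible: dominance keeps the parameters of the other
    factors off their poles, and the factor of \<open>r\<close> has parameter 0.\<close>
  have mem: "app (aux_prod \<nu> z c form (z r) (\<nu> r) (r # l)) v \<in> auxsub c S"
  proof (rule aux_prod_mem[OF subspace_auxsub[OF S(1)] _ _ _ l(5,6) \<nu>r _ vW vS])
    fix X i j w assume ij: "i \<in> {1..n}" "j \<in> {1..n}" and w: "w \<in> auxsub c S"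
    have "app (cf z (r # l) t i j) w \<in> auxsub c S" for t
    proof (rule auxsub_commutes[OF w])
      show "app (cf z (r # l) t i j) s \<in> S" if "s \<in> S" for s
        using S(3) that ij by (simp add: stable_def)
      show "cf z (r # l) t i j * rowless c = rowless c * cf z (r # l) t i j"
        using l(6) ij by (intro cf_commutes[symmetric] E_rowless) auto
      show "cf z (r # l) t i j * ann (XV c y) = ann (XV c y) * cf z (r # l) t i j" for y
        using l(6) ij by (intro cf_commutes[symmetric] E_ann_other[symmetric]) auto
    qed
    then show "app (mat_prod n (Le z X) (r # l) i j) w \<in> auxsub c S"
      unfolding mat_prod_Le_cf[OF ij(1)] app_sum app_lscale
      by (intro subspace_sum subspace_auxsub S(1) fvs.subspace_scale)
  next
    fix i w assume "i \<in> {1..n}" "w \<in> auxsub c S"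
    then show "app (p c i) w \<in> auxsub c S" "app (q c i) w \<in> auxsub c S"
      by (simp_all add: po_def qo_def auxsub_ann auxsub_cre S(1))
  next
    show "wt (D c c) (of_nat (\<nu> r)) v" using dgv wtr[OF aux(2)] by blast
    show "regular_at (z r) (\<lambda>u. aux_prod \<nu> z c form u (\<nu> r) (r # l))"
    proof (rule regular_at_aux_prod)
      fix b assume b: "b \<in> set (r # l)"
      show "\<forall>i. 1 \<le> i \<and> i \<le> n \<longrightarrow> z r + of_nat (\<nu> r) - (z b + of_nat (\<nu> b)) \<noteq> of_nat i" if "form b"
        using good_X[OF good[of b]] that b l(1) by (auto simp: form_def)
      show "\<forall>i. 1 \<le> i \<and> i \<le> n \<longrightarrow> z r - z b \<noteq> of_nat i" if "\<not> form b"
      proof (cases "b = r")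
        case True
        then show ?thesis by simp
      next
        case False
        then show ?thesis
          using good_Y[OF good[of b]] that b l(1) by (auto simp: form_def)
      qed
    qed
  qed
  \<comment> \<open>Row \<open>c\<close> has the parameters of row \<open>r\<close>, so at u = z r
    the factors for b other than \<open>r\<close> are those of Z for the pairs (b, c).\<close>
  have "aux_prod \<nu> z c form (z r) (\<nu> r) xs = Zprod \<nu> z (map (\<lambda>b. (b, c)) xs)" if "r \<notin> set xs" for xs
    using that by (induction xs) (auto simp: aux_fac_def Zfac_def form_def aux(3,4))
  then have "aux_prod \<nu> z c form (z r) (\<nu> r) (r # l) = Y_ser r c 0 * Ra"
    using l(3) by (simp add: Ra_def aux_fac_def form_def)
  then have mem': "app (Y_ser r c 0) (app Ra v) \<in> auxsub c S"
    using mem by (simp add: app_times)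
  have RaVS: "app Ra v \<in> VS n ?R"
    unfolding Ra_def using l(1) by (intro Zprod_VS[OF vVS]) (auto simp: r_def)
  have RaD: "Ra * D a a = D a a * Ra" for a
    unfolding Ra_def using l(4) by (intro Zprod_D_diag) auto
  have wts: "wt (D r r) (of_nat (\<nu> r)) (app Ra v)" "wt (D c c) (of_nat (\<nu> r)) (app Ra v)"
    using vW dgv wtr[OF aux(2)] by (auto intro!: wt_commute[OF RaD] simp: Wt_def)
  obtain \<kappa> where \<kappa>: "\<kappa> \<noteq> 0" "app (Y_ser r c 0) (app Ra v) = fscale \<kappa> (?\<pi> (app Ra v))"
    using Y_ser_0_exch[OF rc aux(2)[symmetric], of ?R "\<nu> r"] RaVS wts by (auto simp: r_def)
  have "fscale (inverse \<kappa>) (fscale \<kappa> (?\<pi> (app Ra v))) \<in> auxsub c S"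
    by (rule fvs.subspace_scale[OF subspace_auxsub[OF S(1)] mem'[unfolded \<kappa>(2)]])
  then have "?\<pi> (app Ra v) \<in> auxsub c S" using \<kappa>(1) by simp
  \<comment> \<open>The exchange turns the factors for (b, c) into those for (b, r). The string
    \<open>J\<close>, which had been placed in row \<open>c\<close>, comes to row \<open>r\<close>,
    while the content of \<open>s\<close> in row \<open>r\<close> goes to row
    \<open>c\<close>.\<close>
  moreover have "?\<pi> (app Ra v) = app R (?\<pi> v)"
  proof -
    have ex: "exch r c b = b" if "b \<in> set l" for b
      using that l(3,4) by (intro exch_simps) auto
    then have eqm: "map (map_prod (exch r c) (exch r c)) (map (\<lambda>b. (b, c)) l) = map (\<lambda>b. (b, r)) l"
      by simp
    have "?\<pi> (app (Zprod \<nu> z (map (\<lambda>b. (b, c)) l)) v) =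
        app (Zprod \<nu> z (map (map_prod (exch r c) (exch r c)) (map (\<lambda>b. (b, c)) l))) (?\<pi> v)"
    proof (rule grass_perm_Zprod[OF inj_exch vVS])
      show "a \<in> ?R \<and> b \<in> ?R" if "(a, b) \<in> set (map (\<lambda>b. (b, c)) l)" for a b
        using that l(1) by (auto simp: r_def)
      show "eps (exch r c a) = eps a \<and> \<nu> (exch r c a) = \<nu> a \<and> z (exch r c a) = z a" for a
        using aux by (simp add: exch_def)
    qed
    then show ?thesis
      unfolding eqm Ra_def R_def .
  qed
  moreover have "?\<pi> v = app (cstr r J) (?\<pi> s)"
  proof -
    have "?\<pi> (app (cstr c J) s) = app (cstr r J) (?\<pi> s) \<and> app (cstr c J) s \<in> VS n ?R"
      using JK(1)
    proof (induction J)
      case Nil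
      then show ?case using sF(1) VS_mono[of "{1..r}" ?R] by (auto simp: app_one)
    next
      case (Cons j J)
      then show ?case
        using grass_perm_cre[of "app (cstr c J) s" "exch r c" "XV c j"] VS_finite[of "app (cstr c J) s" n ?R]
        by (auto simp: app_times row_map_def intro!: cre_VS)
    qed
    then show ?thesis by (simp add: v_def)
  qed
  \<comment> \<open>All coefficients with respect to row \<open>c\<close> lie in \<open>S\<close>;
    the one selected by \<open>K\<close> is, up to sign, the coefficient of \<open>s\<close> that
    was taken from row \<open>r\<close>.\<close>
  ultimately have "app (rowless c * dstr c K) (app R (app (cstr r J) (?\<pi> s))) \<in> S"
    using JK(3) by (simp add: auxsub_def)
  then have mem1: "app (rowless c * dstr c K * R * cstr r J) (?\<pi> s) \<in> S"
    by (simp only: app_times)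
  have dR: "dstr c K * R = R * dstr c K" "rowless c * R = R * rowless c"
  proof -
    have "Zprod \<nu> z (map (\<lambda>b. (b, r)) l) * ann (XV c y) = ann (XV c y) * Zprod \<nu> z (map (\<lambda>b. (b, r)) l)"
      if "y \<in> {1..n}" for y
      using l rc that by (intro Zprod_commutes[symmetric]) (auto simp: D_ann_other)
    then show "dstr c K * R = R * dstr c K"
      unfolding R_def using JK(3) by (intro dstr_commutes[symmetric]) auto
    show "rowless c * R = R * rowless c"
      unfolding R_def using l rc by (intro Zprod_commutes) (auto simp: D_rowless)
  qed
  have rJ: "rowless c * cstr r J = cstr r J * rowless c"
    using rc by (intro cstr_commutes rowless_commutes)
  define sg :: complex where "sg = (-1) ^ (length K * length J)"
  have sg: "sg * sg = 1" by (simp add: sg_def power_mult_distrib[symmetric])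
  have "rowless c * dstr c K * R * cstr r J = rowless c * (dstr c K * R) * cstr r J"
    by (simp only: mult.assoc)
  also have "\<dots> = rowless c * R * (dstr c K * cstr r J)"
    unfolding dR(1) by (simp only: mult.assoc)
  also have "\<dots> = sg \<star> (rowless c * R * cstr r J * dstr c K)"
    unfolding dstr_cstr[OF rc[symmetric]] sg_def by (simp only: lop.scl_mult_right mult.assoc)
  also have "rowless c * R * cstr r J * dstr c K = R * (rowless c * cstr r J) * dstr c K"
    unfolding dR(2) by (simp only: mult.assoc)
  also have "\<dots> = R * cstr r J * (rowless c * dstr c K)"
    unfolding rJ by (simp only: mult.assoc)
  finally have op: "rowless c * dstr c K * R * cstr r J = sg \<star> (R * cstr r J * (rowless c * dstr c K))" .
  have nVS: "app (dstr r K) s \<in> VS n {1..r}"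
    using sF(1) by (induction K) (auto simp: app_ops intro: ann_VS)
  \<comment> \<open>The string \<open>K\<close> removes all d variables of row \<open>r\<close>, so
    what is left lives on the earlier rows.\<close>
  have "dg r 0 (app (dstr r K) s)"
    using dg_dstr[OF JK(3), of r 0 s] dgs JK(4) by simp
  then have "app (dstr r K) s \<in> VS n ({1..r} - {r})"
    by (rule VS_dg_0[OF nVS])
  moreover have "{1..r} - {r} = {1..k}" by (auto simp: r_def)
  ultimately have nVS': "app (dstr r K) s \<in> VS n {1..k}" by simp
  have "D a a * dstr r K = dstr r K * D a a" if "a \<noteq> r" for a
    using that JK(3) by (intro dstr_commutes D_ann_other) auto
  then have "app (dstr r K) s \<in> Wt \<nu> {1..k}"
    using sF(2) unfolding Wt_def by (auto intro!: wt_commute simp: r_def)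
  then show "app (dstr r K) s \<in> Fk \<nu> k" using nVS' by (simp add: Fk_def)
  have "app (dstr c K) (?\<pi> s) = ?\<pi> (app (dstr r K) s)"
  proof -
    have "app (dstr c K) (?\<pi> s) = ?\<pi> (app (dstr r K) s) \<and> app (dstr r K) s \<in> VS n {1..r}"
    proof (induction K)
      case (Cons j K)
      then show ?case
        using grass_perm_ann[OF inj_exch, of "app (dstr r K) s" r c "XV r j"] VS_finite[of "app (dstr r K) s" n "{1..r}"]
        by (auto simp: app_times row_map_def intro!: ann_VS)
    qed (use sF(1) in \<open>simp add: app_one\<close>)
    then show ?thesis ..
  qed
  also have "\<dots> = app (dstr r K) s"
    using aux(1) by (intro grass_perm_fixed[OF nVS'] exch_simps) (auto simp: r_def)
  finally have e1: "app (dstr c K) (?\<pi> s) = app (dstr r K) s" .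
  have e: "app (rowless c) (app (dstr c K) (?\<pi> s)) = app (dstr r K) s"
    unfolding e1 using aux(1) by (intro rowless_VS[OF nVS']) (auto simp: r_def)
  have "fscale sg (app (R * cstr r J) (app (dstr r K) s)) \<in> S"
    using mem1 unfolding op app_lscale app_times e .
  then have "fscale sg (fscale sg (app (R * cstr r J) (app (dstr r K) s))) \<in> S"
    by (rule fvs.subspace_scale[OF S(1)])
  then show "app (Zprod \<nu> z (map (\<lambda>b. (b, r)) l) * cstr r J) (app (dstr r K) s) \<in> S"
    using sg by (simp add: R_def)
qed

text \<open>Induction on the number of rows; the rows m + k are copies of the rows k and serve as
  auxiliary rows. Let R be the product of the factors for the pairs (b, r) with \<open>r\<close> the
  last row. The vectors g on the earlier rows with R (x_J g) in \<open>S\<close> for all strings J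
  form a nonzero stable subspace, so by induction it contains the image of
  \<open>Zrec \<nu> z k\<close>. As this operator commutes with x_J, the image for all rows lies in
  \<open>S\<close>.\<close>

lemma Zrec_image_mem:
  assumes good: "\<And>a b. 1 \<le> a \<Longrightarrow> a < b \<Longrightarrow> b \<le> m \<Longrightarrow> good \<nu> z a b"
    and aux: "\<And>k. 1 \<le> k \<Longrightarrow> k \<le> m \<Longrightarrow> eps (m + k) = eps k \<and> z (m + k) = z k \<and> \<nu> (m + k) = \<nu> k \<and> \<nu> k \<le> n"
    and km: "k \<le> m" and S: "fvs.subspace S" "S \<subseteq> Fk \<nu> k" "S \<noteq> {0}" "stable z (rev [1..<Suc k]) S"
    and f: "f \<in> Fk \<nu> k"
  shows "app (Zrec \<nu> z k) f \<in> S"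
  using km S f
proof (induction k arbitrary: S f)
  case 0
  have F: "\<exists>c. v = Poly_Mapping.single {} c" if "v \<in> Fk \<nu> 0" for v
  proof -
    have "Poly_Mapping.keys v \<subseteq> {{}}" using that by (auto simp: Fk_def VS_def)
    then have "v = Poly_Mapping.single {} (Poly_Mapping.lookup v {})"
      by (intro poly_mapping_eqI) (auto simp: lookup_single in_keys_iff when_def)
    then show ?thesis by blast
  qed
  have "0 \<in> S" using fvs.subspace_0[OF 0(2)] .
  then obtain s where s: "s \<in> S" "s \<noteq> 0" using 0(4) by blast
  then obtain c where c: "s = Poly_Mapping.single {} c" using F 0(3) by blast
  obtain c' where c': "f = Poly_Mapping.single {} c'" using F 0(6) by blast
  have "c \<noteq> 0" using s c by auto
  then have "f = fscale (c' / c) s" by (simp add: c c')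
  then show ?case using fvs.subspace_scale[OF 0(2) s(1)] by (simp add: app_one)
next
  case (Suc k)
  note O = Suc.prems
  let ?r = "Suc k" and ?c = "m + Suc k"
  let ?l = "rev [1..<Suc k]"
  let ?d = "if eps ?r = 1 then \<nu> ?r else n - \<nu> ?r"
  define R where "R = Zprod \<nu> z (map (\<lambda>b. (b, ?r)) ?l)"
  have aux': "eps ?c = eps ?r" "z ?c = z ?r" "\<nu> ?c = \<nu> ?r" "\<nu> ?r \<le> n"
    using aux[of ?r] O(1) by auto
  have l: "set ?l = {1..k}" "length (?l @ [?r]) = length (?r # ?l)" by auto
  have rl: "rev [1..<Suc ?r] = ?r # ?l" by simp
  have sl: "app (R * cstr ?r J) (app (dstr ?r K) s) \<in> S" "app (dstr ?r K) s \<in> Fk \<nu> k"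
    if "s \<in> S" "set J \<subseteq> {1..n}" "length J = ?d" "set K \<subseteq> {1..n}" "length K = ?d" for s J K
  proof -
    have cr: "?c > ?r" using O(1) by simp
    have g: "good \<nu> z b ?r" if "1 \<le> b" "b \<le> k" for b
      using good[of b ?r] that O(1) by simp
    have st: "stable z (?r # ?l) S" using O(5) rl by simp
    show "app (R * cstr ?r J) (app (dstr ?r K) s) \<in> S" "app (dstr ?r K) s \<in> Fk \<nu> k"
      unfolding R_def
      using slices_mem[OF g cr aux' refl O(2,3) st that] by blast+
  qed
  define K1 where "K1 = {g \<in> Fk \<nu> k. \<forall>J. set J \<subseteq> {1..n} \<and> length J = ?d \<longrightarrow> app (R * cstr ?r J) g \<in> S}"
  have "fvs.subspace K1"
  proof -
    have "K1 = Fk \<nu> k \<inter> (\<Inter>J\<in>{J. set J \<subseteq> {1..n} \<and> length J = ?d}. {g. app (R * cstr ?r J) g \<in> S})"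
      by (auto simp: K1_def)
    moreover have "fvs.subspace (\<Inter>J\<in>{J. set J \<subseteq> {1..n} \<and> length J = ?d}. {g. app (R * cstr ?r J) g \<in> S})"
      by (intro fvs.subspace_Inter) (auto intro: subspace_preimage O(2))
    ultimately show ?thesis using fvs.subspace_inter[OF subspace_Fk] by simp
  qed
  note K1sub = this
  \<comment> \<open>By \<open>slices_mem\<close> the coefficients of elements of \<open>S\<close>
    with respect to row r lie in \<open>K1\<close>, and a nonzero element has a nonzero
    coefficient.\<close>
  have "K1 \<noteq> {0}"
  proof -
    have "0 \<in> S" using fvs.subspace_0[OF O(2)] .
    then obtain s where s: "s \<in> S" "s \<noteq> 0" using O(4) by blast
    have "wt (D ?r ?r) (of_nat (\<nu> ?r)) s" using s(1) O(3) by (auto simp: Fk_def Wt_def)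
    then have "dg ?r (of_nat ?d) s" using aux'(4) by (cases "eps ?r = 1") (simp_all add: dg_def of_nat_diff)
    from exists_dstr_nonzero[OF this s(2)] obtain K where
      K: "set K \<subseteq> {1..n}" "length K = ?d" "app (dstr ?r K) s \<noteq> 0" by blast
    have "app (dstr ?r K) s \<in> K1"
      unfolding K1_def using sl[OF s(1) _ _ K(1,2)] sl(2)[OF s(1) K(1,2) K(1,2)] by blast
    then show ?thesis using K(3) by blast
  qed
  moreover have "stable z ?l K1"
  proof -
    \<comment> \<open>Induction on the order t. R carries the product with row r last to the product
      with row r first, under which \<open>S\<close> is stable. The coefficient of order t + 1 of
      the former is that of the earlier rows plus coefficients of order t combined with gl_n on row
      r. The latter only changes the string, so these terms lie in \<open>S\<close> by induction and
      can be subtracted.\<close>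
    have "\<forall>i\<in>{1..n}. \<forall>j\<in>{1..n}. \<forall>g\<in>K1. app (cf z ?l t i j) g \<in> K1" for t
    proof (induction t)
      case 0
      show ?case
      proof (intro ballI)
        fix i j g assume ij: "i \<in> {1..n}" "j \<in> {1..n}" and g: "g \<in> K1"
        have "cf z xs 0 i j = (if i = j then 1 else 0)" for xs
          using ij by (induction xs) (simp_all add: cf_Nil cf_Cons)
        then show "app (cf z ?l 0 i j) g \<in> K1"
          using g fvs.subspace_0[OF K1sub] by (simp add: app_ops)
      qed
    next
      case (Suc t)
      show ?case
      proof (intro ballI)
        fix i j g assume ij: "i \<in> {1..n}" "j \<in> {1..n}" and g: "g \<in> K1"
        have gF: "g \<in> VS n {1..k}" "g \<in> Wt \<nu> {1..k}" using g by (auto simp: K1_def Fk_def)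
        have 1: "app (cf z ?l (Suc t) i j) g \<in> Fk \<nu> k"
          unfolding Fk_def using cf_VS[OF ij gF(1)] cf_Wt[OF ij gF(2)] l(1) by auto
        have "app (R * cstr ?r J) (app (cf z ?l (Suc t) i j) g) \<in> S"
          if J: "set J \<subseteq> {1..n}" "length J = ?d" for J
        proof -
          let ?x = "app (cstr ?r J) g"
          have cJ: "cf z ?l t' a b * cstr ?r J' = cstr ?r J' * cf z ?l t' a b"
            if "a \<in> {1..n}" "b \<in> {1..n}" for t' a b J'
          proof (rule cstr_commutes)
            fix y
            have "cre (XV ?r y) * cf z ?l t' a b = cf z ?l t' a b * cre (XV ?r y)"
            proof (rule cf_commutes[OF _ that])
              fix e i j assume "e \<in> set ?l"
              then have "e \<noteq> ?r" using l(1) by auto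
              then show "cre (XV ?r y) * E e i j = E e i j * cre (XV ?r y)"
                by (rule E_cre_other[symmetric])
            qed
            then show "cf z ?l t' a b * cre (XV ?r y) = cre (XV ?r y) * cf z ?l t' a b" by (rule sym)
          qed
          have xW: "?x \<in> Wt \<nu> {1..?r}"
          proof -
            have "wt (D a a) (of_nat (\<nu> a)) ?x" if a: "a \<in> {1..?r}" for a
            proof (cases "a = ?r")
              case False
              then have "D a a * cstr ?r J = cstr ?r J * D a a"
                using J(1) by (intro cstr_commutes D_cre_other) auto
              then show ?thesis
                using False a gF(2) by (intro wt_commute[OF sym]) (auto simp: Wt_def)
            next
              case True
              have "dg ?r (of_nat ?d) ?x"
                using dg_cstr[OF J(1) dg_0[OF gF(1), of ?r]] J(2) by simp
              then show ?thesis using True aux'(4)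
                by (cases "eps ?r = 1") (simp_all add: dg_def of_nat_diff)
            qed
            then show ?thesis by (simp add: Wt_def)
          qed
          have Rx: "app R ?x \<in> S" using g J by (simp add: K1_def app_times)
          have it: "intertwines \<nu> z {1..?r} (?l @ [?r]) (?r # ?l) R"
            unfolding R_def
          proof (rule intertwines_move)
            show "good \<nu> z b ?r" if "b \<in> set ?l" for b
            proof -
              have "b \<in> {1..k}" using that l(1) by blast
              then show ?thesis using good[of b ?r] O(1) by simp
            qed
          qed auto
          have "app (cf z (?r # ?l) (Suc t) i j) (app R ?x) \<in> S"
            using Rx O(5) ij unfolding rl stable_def by blast
          moreover have "app (R * cf z (?l @ [?r]) (Suc t) i j) ?x = app (cf z (?r # ?l) (Suc t) i j) (app R ?x)"
            using intertwines_cf[OF it l(2) xW ij] by (simp only: app_times)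
          ultimately have "app (R * cf z (?l @ [?r]) (Suc t) i j) ?x \<in> S"
            by (simp only:)
          then have a1: "app R (app (cf z ?l (Suc t) i j) ?x) - fscale (z ?r) (app R (app (cf z ?l t i j) ?x))
              + (\<Sum>y = 1..n. app R (app (cf z ?l t i y) (app (E ?r y j) ?x))) \<in> S"
            unfolding cf_snoc(2)[OF ij] by (simp only: app_ops app_lscale app_sum app_simps)
          have step: "app (R * cf z ?l t i y) u \<in> S" if y: "y \<in> {1..n}" and u: "u \<in> cspan ?r ?d {g}" for y u
          proof (rule span_preimage[OF linop_app O(2) _ u[unfolded cspan_def]])
            fix b assume "b \<in> {app (cstr ?r J) g' | J g'. set J \<subseteq> {1..n} \<and> length J = ?d \<and> g' \<in> {g}}"
            then obtain J' where J': "b = app (cstr ?r J') g" "set J' \<subseteq> {1..n}" "length J' = ?d" by blast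
            have "app (cf z ?l t i y) g \<in> K1" using Suc.IH ij(1) y g by blast
            then have "app (R * cstr ?r J') (app (cf z ?l t i y) g) \<in> S"
              using J' unfolding K1_def by blast
            moreover have "app (cf z ?l t i y) (app (cstr ?r J') g) = app (cstr ?r J') (app (cf z ?l t i y) g)"
              using cJ[OF ij(1) y, of t J'] by (metis app_times)
            ultimately show "app (R * cf z ?l t i y) b \<in> S"
              by (simp add: J'(1) app_times)
          qed
          have annz: "app (ann (XV ?r b)) g = 0" for b
            by (rule ann_VS_other[OF gF(1)]) simp
          have "(\<Sum>y = 1..n. app R (app (cf z ?l t i y) (app (E ?r y j) ?x))) \<in> S"
            using step E_cstr[OF _ ij(2) J(1) annz] J(2) O(2) by (intro subspace_sum) (auto simp: app_times)
          moreover have "fscale (z ?r) (app R (app (cf z ?l t i j) ?x)) \<in> S"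
            using step[OF ij(2)] mem_cspan[OF J(1,2), of g "{g}" ?r] O(2)
            by (intro fvs.subspace_scale) (auto simp: app_times)
          ultimately have "app R (app (cf z ?l (Suc t) i j) ?x) \<in> S"
            using fvs.subspace_add[OF O(2) fvs.subspace_diff[OF O(2) a1]] by fastforce
          moreover have "app (cf z ?l (Suc t) i j) ?x = app (cstr ?r J) (app (cf z ?l (Suc t) i j) g)"
            using cJ[OF ij, of "Suc t" J] by (metis app_times)
          ultimately show ?thesis by (simp add: app_times)
        qed
        then show "app (cf z ?l (Suc t) i j) g \<in> K1"
          using 1 unfolding K1_def by blast
      qed
    qed
    then show ?thesis by (simp add: stable_def)
  qed
  moreover have "K1 \<subseteq> Fk \<nu> k" by (auto simp: K1_def)
  ultimately have IH: "app (Zrec \<nu> z k) g \<in> K1" if "g \<in> Fk \<nu> k" for g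
    using Suc.IH[OF _ K1sub] O(1) that by simp
  have fF: "f \<in> VS n {1..?r}" "f \<in> Wt \<nu> {1..?r}" using O(6) by (auto simp: Fk_def)
  have "dg ?r (of_nat ?d) f"
    using fF(2) aux'(4) by (cases "eps ?r = 1") (auto simp: dg_def of_nat_diff Wt_def)
  then have "f \<in> cspan ?r ?d (Fk \<nu> k)"
    using fF by (intro Fk_cspan) (auto simp: Wt_def)
  then show ?case
    unfolding cspan_def
  proof (rule span_preimage[OF linop_app O(2), rotated])
    fix b assume "b \<in> {app (cstr ?r J) g | J g. set J \<subseteq> {1..n} \<and> length J = ?d \<and> g \<in> Fk \<nu> k}"
    then obtain J g where J: "b = app (cstr ?r J) g" "set J \<subseteq> {1..n}" "length J = ?d" "g \<in> Fk \<nu> k" by blast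
    have "Zrec \<nu> z k * cstr ?r J = cstr ?r J * Zrec \<nu> z k"
    proof (rule cstr_commutes)
      fix y assume "y \<in> set J"
      then have y: "y \<in> {1..n}" using J(2) by blast
      show "Zrec \<nu> z k * cre (XV ?r y) = cre (XV ?r y) * Zrec \<nu> z k"
        by (rule Zrec_commutes[symmetric]) (use D_cre_other[OF _ _ y] in auto)
    qed
    then have "app (Zrec \<nu> z k) (app (cstr ?r J) g) = app (cstr ?r J) (app (Zrec \<nu> z k) g)"
      by (metis app_times)
    then have "app (Zrec \<nu> z ?r) b = app (R * cstr ?r J) (app (Zrec \<nu> z k) g)"
      by (simp add: J(1) app_times R_def)
    also have "\<dots> \<in> S"
      using IH[OF J(4)] J(2,3) unfolding K1_def by blast
    finally show "app (Zrec \<nu> z ?r) b \<in> S" .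
  qed
qed

text \<open>The extremal monomial: in every row exactly the first nu a columns are occupied.\<close>

definition vac :: "(nat \<Rightarrow> nat) \<Rightarrow> nat \<Rightarrow> xvar set" where
  "vac \<nu> m = {XV a i | a i. a \<in> {1..m} \<and> i \<in> {1..n} \<and> (i \<le> \<nu> a) = (eps a = 1)}"

lemma occupied_vac: "a \<in> {1..m} \<Longrightarrow> i \<in> {1..n} \<Longrightarrow> occupied a i (vac \<nu> m) \<longleftrightarrow> i \<le> \<nu> a"
  by (auto simp: occupied_def vac_def)

lemma p_single: "app (p a i) (Poly_Mapping.single A c) =
    (if occupied a i A then Poly_Mapping.single (sym_diff A {XV a i}) (c * gsign A (XV a i)) else 0)"
  and q_single: "app (q a i) (Poly_Mapping.single A c) =
    (if occupied a i A then 0 else Poly_Mapping.single (sym_diff A {XV a i}) (c * gsign A (XV a i)))"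
proof -
  have "x \<in> A \<Longrightarrow> sym_diff A {x} = A - {x}" "x \<notin> A \<Longrightarrow> sym_diff A {x} = insert x A" for x by auto
  then show "app (p a i) (Poly_Mapping.single A c) =
    (if occupied a i A then Poly_Mapping.single (sym_diff A {XV a i}) (c * gsign A (XV a i)) else 0)"
    "app (q a i) (Poly_Mapping.single A c) =
    (if occupied a i A then 0 else Poly_Mapping.single (sym_diff A {XV a i}) (c * gsign A (XV a i)))"
    by (simp_all add: po_def qo_def occupied_def ann_single cre_single)
qed

text \<open>\<open>D a b\<close> moves a particle from row \<open>b\<close> to row \<open>a\<close>
  within a column, but every column occupied in row \<open>b\<close> is already occupied in row
  \<open>a\<close>.\<close>

lemma D_vac:
  assumes ab: "a \<in> {1..m}" "b \<in> {1..m}" "a \<noteq> b" and \<nu>: "\<nu> b \<le> \<nu> a"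
  shows "app (D a b) (Poly_Mapping.single (vac \<nu> m) 1) = 0"
proof -
  have "app (q a i) (app (p b i) (Poly_Mapping.single (vac \<nu> m) 1)) = 0" if i: "i \<in> {1..n}" for i
  proof (cases "i \<le> \<nu> b")
    case True
    have "occupied a i (sym_diff (vac \<nu> m) {XV b i}) \<longleftrightarrow> occupied a i (vac \<nu> m)"
      using ab(3) by (auto simp: occupied_def)
    then show ?thesis
      using True \<nu> i ab by (simp add: p_single q_single occupied_vac)
  next
    case False
    then show ?thesis using i ab by (simp add: p_single occupied_vac app_simps)
  qed
  then show ?thesis by (simp add: D_def app_sum app_times)
qed

text \<open>In \<open>Zfac\<close> the operator acting first, D a b in X and D b a in Y, moves
  particles towards the row that is at least as full, so it annihilates the vector and only the term
  1 of the series remains.\<close>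

lemma Zfac_vac:
  assumes ab: "a \<in> {1..m}" "b \<in> {1..m}" "a \<noteq> b"
  shows "app (Zfac \<nu> z (a, b)) (Poly_Mapping.single (vac \<nu> m) 1) = Poly_Mapping.single (vac \<nu> m) 1"
proof -
  let ?v = "Poly_Mapping.single (vac \<nu> m) 1 :: grass"
  have z: "T * vop ?v = 0" if "app T ?v = 0" for T :: "xvar set lop"
    using that by (simp add: vop_simps) (simp add: vop_def fvs.scale_zero_right zero_lop_def)
  have "Zfac \<nu> z (a, b) * vop ?v = vop ?v"
  proof (cases "\<nu> b \<le> \<nu> a")
    case True
    then show ?thesis
      using sl2.Xser_lowest[OF sl2[OF ab(3)] z[OF D_vac[OF ab True]]] X_ser[OF ab(3)] by (simp add: Zfac_def)
  next
    case False
    then have "\<nu> a \<le> \<nu> b" by simp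
    from sl2.Yser_lowest[OF sl2[OF ab(3)] z[OF D_vac[OF ab(2,1) ab(3)[symmetric] this]]] show ?thesis
      using Y_ser[OF ab(3)] False by (simp add: Zfac_def)
  qed
  then show ?thesis by (simp add: vop_simps vop_inject)
qed

lemma Zprod_vac:
  assumes "\<And>a b. (a, b) \<in> set ps \<Longrightarrow> a \<in> {1..m} \<and> b \<in> {1..m} \<and> a \<noteq> b"
  shows "app (Zprod \<nu> z ps) (Poly_Mapping.single (vac \<nu> m) 1) = Poly_Mapping.single (vac \<nu> m) 1"
  using assms
proof (induction ps)
  case (Cons ab ps)
  obtain a b where ab: "ab = (a, b)" by (cases ab)
  have IH: "app (Zprod \<nu> z ps) (Poly_Mapping.single (vac \<nu> m) 1) = Poly_Mapping.single (vac \<nu> m) 1"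
  proof (rule Cons.IH)
    show "a \<in> {1..m} \<and> b \<in> {1..m} \<and> a \<noteq> b" if "(a, b) \<in> set ps" for a b
      using Cons.prems[of a b] that by simp
  qed
  have "a \<in> {1..m}" "b \<in> {1..m}" "a \<noteq> b" using Cons.prems[of a b] ab by auto
  then have "app (Zfac \<nu> z (a, b)) (Poly_Mapping.single (vac \<nu> m) 1) = Poly_Mapping.single (vac \<nu> m) 1"
    by (rule Zfac_vac)
  then show ?case by (simp only: Zprod_simps app_times IH ab)
qed (simp add: app_one)

lemma Zrec_vac: "k \<le> m \<Longrightarrow> app (Zrec \<nu> z k) (Poly_Mapping.single (vac \<nu> m) 1) = Poly_Mapping.single (vac \<nu> m) 1"
proof (induction k)
  case (Suc k)
  have "app (Zprod \<nu> z (map (\<lambda>b. (b, Suc k)) (rev [1..<Suc k]))) (Poly_Mapping.single (vac \<nu> m) 1) =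
      Poly_Mapping.single (vac \<nu> m) 1"
    by (rule Zprod_vac) (use Suc.prems in auto)
  then show ?case using Suc by (simp add: app_times)
qed (simp add: app_one)

lemma nocc_vac: "a \<in> {1..m} \<Longrightarrow> \<nu> a \<le> n \<Longrightarrow> nocc a (vac \<nu> m) = \<nu> a"
proof -
  assume a: "a \<in> {1..m}" "\<nu> a \<le> n"
  have "{i \<in> {1..n}. occupied a i (vac \<nu> m)} = {1..\<nu> a}"
    using a by (auto simp: occupied_vac)
  then show ?thesis by (simp add: nocc_def)
qed

lemma vac_Fk:
  assumes "\<And>a. a \<in> {1..m} \<Longrightarrow> \<nu> a \<le> n"
  shows "Poly_Mapping.single (vac \<nu> m) 1 \<in> Fk \<nu> m"
proof -
  have "vac \<nu> m \<subseteq> case_prod XV ` ({1..m} \<times> {1..n})" by (auto simp: vac_def)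
  then have "finite (vac \<nu> m)" by (rule finite_subset) simp
  then show ?thesis
    using assms nocc_vac by (auto simp: Fk_def VS_def Wt_def wt_iff_keys vac_def)
qed

text \<open>The vector \<open>vac\<close> is the only one of its weight, so an operator preserving weights and
  annihilating it cannot have it in its image.\<close>

lemma not_in_image:
  assumes T: "\<And>i. i \<in> {1..n} \<Longrightarrow> T * (\<Sum>a\<in>{1..m}. E a i i) = (\<Sum>a\<in>{1..m}. E a i i) * T"
    and 0: "app T (Poly_Mapping.single (vac \<nu> m) 1) = 0"
    and \<nu>: "\<And>a. a \<in> {1..m} \<Longrightarrow> \<nu> a \<le> n"
    and f: "f \<in> Fk \<nu> m"
  shows "app T f \<noteq> Poly_Mapping.single (vac \<nu> m) 1"
proof -
  let ?A0 = "vac \<nu> m"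
  let ?w = "\<lambda>i A. card {a \<in> {1..m}. occupied a i A}"
  have E: "app (E a i i) (Poly_Mapping.single A c) = (if occupied a i A then Poly_Mapping.single A c else 0)" for a i A c
    by (simp add: E_def qp_single)
  have W: "app (\<Sum>a\<in>{1..m}. E a i i) (Poly_Mapping.single A c) = Poly_Mapping.single A (of_nat (?w i A) * c)" for i A c
  proof -
    have "app (\<Sum>a\<in>{1..m}. E a i i) (Poly_Mapping.single A c) = (\<Sum>a\<in>{a\<in>{1..m}. occupied a i A}. Poly_Mapping.single A c)"
      unfolding app_sum E by (rule sum.inter_filter[symmetric]) simp
    then show ?thesis by (simp add: fvs.sum_constant_scale)
  qed
  have lookupW: "Poly_Mapping.lookup (app (\<Sum>a\<in>{1..m}. E a i i) v) A = of_nat (?w i A) * Poly_Mapping.lookup v A" for i v A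
  proof -
    define g where "g = (\<lambda>A. Poly_Mapping.single A (of_nat (?w i A) :: complex))"
    have "app (\<Sum>a\<in>{1..m}. E a i i) v = lin_ext g v"
      by (rule linop_eq_on_keys[OF linop_app linop_lin_ext]) (simp only: W g_def lin_ext_single fscale_one mult.right_neutral)
    moreover have "Poly_Mapping.lookup v k * Poly_Mapping.lookup (g k) A =
        (if k = A then of_nat (?w i A) * Poly_Mapping.lookup v A else 0)" for k
      by (simp add: g_def lookup_single)
    ultimately show ?thesis
      by (simp add: lookup_lin_ext in_keys_iff)
  qed
  have key: "Poly_Mapping.lookup (app T (Poly_Mapping.single A 1)) ?A0 = 0" if A: "A \<in> Poly_Mapping.keys f" for A
  \<comment> \<open>A monomial of a different column weight cannot contribute, because
    \<open>T\<close> preserves column weights.\<close>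
  proof (cases "\<forall>i\<in>{1..n}. ?w i A = ?w i ?A0")
    case False
    then obtain i where i: "i \<in> {1..n}" "?w i A \<noteq> ?w i ?A0" by blast
    let ?u = "app T (Poly_Mapping.single A 1)"
    have "app (\<Sum>a\<in>{1..m}. E a i i) ?u = app (T * (\<Sum>a\<in>{1..m}. E a i i)) (Poly_Mapping.single A 1)"
      unfolding T[OF i(1)] app_times ..
    also have "\<dots> = app T (Poly_Mapping.single A (of_nat (?w i A)))"
      unfolding app_times W mult.right_neutral ..
    also have "\<dots> = fscale (of_nat (?w i A)) ?u"
      using linop_fscale[OF linop_app, of T "of_nat (?w i A)" "Poly_Mapping.single A 1"] by simp
    finally have eqW: "app (\<Sum>a\<in>{1..m}. E a i i) ?u = fscale (of_nat (?w i A)) ?u" .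
    have "of_nat (?w i ?A0) * Poly_Mapping.lookup ?u ?A0 = Poly_Mapping.lookup (app (\<Sum>a\<in>{1..m}. E a i i) ?u) ?A0"
      by (rule lookupW[symmetric])
    also have "\<dots> = of_nat (?w i A) * Poly_Mapping.lookup ?u ?A0"
      unfolding eqW by (rule lookup_fscale)
    finally have "of_nat (?w i ?A0) * Poly_Mapping.lookup ?u ?A0 = of_nat (?w i A) * Poly_Mapping.lookup ?u ?A0" .
    then show ?thesis using i(2) by simp
  next
    case True
    have cols: "A \<in> {A. finite A \<and> (\<forall>x\<in>A. vrow x \<in> {1..m} \<and> vcol x \<in> {1..n})}"
      using f A unfolding Fk_def VS_def by blast
    have nocc: "nocc a A = \<nu> a" if "a \<in> {1..m}" for a
      using f A that unfolding Fk_def Wt_def using wt_iff_keys by blast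
    \<comment> \<open>Occupied columns among the first j. A row of \<open>A\<close> has at most min
      j (nu a) of them, the number in the extremal monomial. Equal column weights give equal totals
      over the rows, hence equality in every row, and this determines \<open>A\<close>.\<close>
    let ?O = "\<lambda>a j B. card {i \<in> {1..j}. occupied a i B}"
    have dbl: "(\<Sum>a\<in>{1..m}. ?O a j B) = (\<Sum>i\<in>{1..j}. ?w i B)" for j B
    proof -
      have "(\<Sum>a\<in>{1..m}. ?O a j B) = (\<Sum>a\<in>{1..m}. \<Sum>i\<in>{1..j}. if occupied a i B then 1 else 0)"
        by (intro sum.cong refl) (simp add: sum.If_cases Int_def)
      also have "\<dots> = (\<Sum>i\<in>{1..j}. \<Sum>a\<in>{1..m}. if occupied a i B then 1 else 0)"
        by (rule sum.swap)
      also have "\<dots> = (\<Sum>i\<in>{1..j}. ?w i B)"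
        by (intro sum.cong refl) (simp add: sum.If_cases Int_def)
      finally show ?thesis .
    qed
    have O0: "?O a j ?A0 = min j (\<nu> a)" if "a \<in> {1..m}" "j \<le> n" for a j
    proof -
      have "{i \<in> {1..j}. occupied a i ?A0} = {1..min j (\<nu> a)}"
        using that by (auto simp: occupied_vac)
      then show ?thesis by simp
    qed
    have Ole: "?O a j A \<le> ?O a j ?A0" if "a \<in> {1..m}" "j \<le> n" for a j
    proof -
      have "?O a j A \<le> card {1..j}" by (rule card_mono) auto
      moreover have "?O a j A \<le> nocc a A"
        unfolding nocc_def using that(2) by (intro card_mono) auto
      ultimately show ?thesis using O0[OF that] nocc[OF that(1)] by simp
    qed
    have Oeq: "?O a j A = ?O a j ?A0" if "a \<in> {1..m}" "j \<le> n" for a j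
    proof -
      have "(\<Sum>a\<in>{1..m}. ?O a j A) = (\<Sum>a\<in>{1..m}. ?O a j ?A0)"
        unfolding dbl using True that(2) by (intro sum.cong refl) auto
      from sum_mono_inv[OF this _ that(1)] show ?thesis using Ole that(2) by simp
    qed
    have occ: "occupied a i A \<longleftrightarrow> i \<le> \<nu> a" if a: "a \<in> {1..m}" and i: "i \<in> {1..n}" for a i
    proof -
      have "?O a (\<nu> a) A = card {1..\<nu> a}"
        using Oeq[OF a \<nu>[OF a]] O0[OF a \<nu>[OF a]] by simp
      then have "{i \<in> {1..\<nu> a}. occupied a i A} = {1..\<nu> a}"
        by (intro card_subset_eq) auto
      then have sub: "{1..\<nu> a} \<subseteq> {i \<in> {1..n}. occupied a i A}" using \<nu>[OF a] by auto
      have "card {i \<in> {1..n}. occupied a i A} = card {1..\<nu> a}" using nocc[OF a] by (simp add: nocc_def)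
      then have "{1..\<nu> a} = {i \<in> {1..n}. occupied a i A}"
        using sub by (intro card_subset_eq) auto
      then have "i \<in> {1..\<nu> a} \<longleftrightarrow> i \<in> {i \<in> {1..n}. occupied a i A}" by (rule arg_cong)
      then show ?thesis using i by simp
    qed
    have mem: "x \<in> A \<longleftrightarrow> x \<in> ?A0" if "vrow x \<in> {1..m}" "vcol x \<in> {1..n}" for x
    proof -
      have "occupied (vrow x) (vcol x) A \<longleftrightarrow> occupied (vrow x) (vcol x) ?A0"
        using occ[OF that] occupied_vac[OF that] by blast
      then have "(XV (vrow x) (vcol x) \<in> A) = (XV (vrow x) (vcol x) \<in> ?A0)"
        unfolding occupied_def by blast
      then show ?thesis by (simp only: xvar.collapse)
    qed
    have "\<forall>x\<in>?A0. vrow x \<in> {1..m} \<and> vcol x \<in> {1..n}"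
      unfolding vac_def by auto
    then have "A = ?A0" using mem cols by blast
    then show ?thesis using 0 by simp
  qed
  have "Poly_Mapping.lookup (app T f) ?A0 =
     (\<Sum>A\<in>Poly_Mapping.keys f. Poly_Mapping.lookup f A * Poly_Mapping.lookup (app T (Poly_Mapping.single A 1)) ?A0)"
  proof -
    have "app T f = lin_ext (\<lambda>A. app T (Poly_Mapping.single A 1)) f"
      by (rule linop_eq_on_keys[OF linop_app linop_lin_ext]) simp_all
    then show ?thesis by (simp add: lookup_lin_ext)
  qed
  then have "Poly_Mapping.lookup (app T f) ?A0 = 0"
    using key by simp
  then show ?thesis by (metis lookup_single_eq zero_neq_one)
qed

lemma D_E_total:
  assumes "x \<in> {1..m}" "y \<in> {1..m}" "x \<noteq> y" "i \<in> {1..n}"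
  shows "(\<Sum>a\<in>{1..m}. E a i i) * D x y = D x y * (\<Sum>a\<in>{1..m}. E a i i)"
proof -
  have split: "(\<Sum>a\<in>{1..m}. E a i i) = (E x i i + E y i i) + (\<Sum>a\<in>{1..m} - {x, y}. E a i i)"
  proof -
    have "{1..m} = {x, y} \<union> ({1..m} - {x, y})" using assms by auto
    then have "(\<Sum>a\<in>{1..m}. E a i i) = (\<Sum>a\<in>{x, y}. E a i i) + (\<Sum>a\<in>{1..m} - {x, y}. E a i i)"
      by (metis finite.emptyI finite.insertI finite_Diff finite_atLeastAtMost sum.union_disjoint Diff_disjoint)
    then show ?thesis using assms(3) by simp
  qed
  have "(\<Sum>a\<in>{1..m} - {x, y}. E a i i) * D x y = D x y * (\<Sum>a\<in>{1..m} - {x, y}. E a i i)"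
    unfolding sum_distrib_left sum_distrib_right
    by (intro sum.cong refl D_E_other) (use assms in auto)
  then show ?thesis
    unfolding split using D_E_sum[OF assms(3,4,4)] by (simp only: distrib_left distrib_right)
qed

end

section \<open>Modules over the Yangian\<close>

definition word_act :: "'b gen_action \<Rightarrow> ygen fword \<Rightarrow> ('b \<Rightarrow>\<^sub>0 complex) \<Rightarrow> ('b \<Rightarrow>\<^sub>0 complex)" where
  "word_act T w v = foldr (\<lambda>(i, j, r). T i j r) (letters w) v"

lemma yfree_act_lin_ext: "yfree_act T p v = lin_ext (\<lambda>w. word_act T w v) p"
  by (simp add: yfree_act_def lin_ext_def word_act_def)

lemma word_act_plus: "word_act T (w + w') v = word_act T w (word_act T w' v)"
  by (simp add: word_act_def plus_fword_def)

lemma word_act_zero: "word_act T 0 v = v"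
  by (simp add: word_act_def zero_fword_def)

lemma poly_mapping_times_expand:
  fixes p q :: "'m::monoid_add \<Rightarrow>\<^sub>0 complex"
  shows "p * q = (\<Sum>k\<in>Poly_Mapping.keys p. \<Sum>l\<in>Poly_Mapping.keys q.
     Poly_Mapping.single (k + l) (Poly_Mapping.lookup p k * Poly_Mapping.lookup q l))"
proof -
  have "p * q = (\<Sum>k\<in>Poly_Mapping.keys p. Poly_Mapping.single k (Poly_Mapping.lookup p k)) *
      (\<Sum>l\<in>Poly_Mapping.keys q. Poly_Mapping.single l (Poly_Mapping.lookup q l))"
    by (simp only: basis_expansion)
  then show ?thesis
    by (simp only: sum_product mult_single)
qed

locale yangian_action =
  fixes T :: "'b gen_action"
  assumes lin: "linop (T i j r)"
begin

lemma linop_word_act: "linop (word_act T w)"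
proof -
  have "linop (\<lambda>v. foldr (\<lambda>(i, j, r). T i j r) xs v)" for xs
  proof (induction xs)
    case (Cons x xs)
    obtain i j r where x: "x = (i, j, r)" by (cases x)
    show ?case using linop_compose[OF lin[of i j r] Cons] by (simp add: x)
  qed simp
  then show ?thesis by (simp add: word_act_def[abs_def])
qed

lemma yfree_act_mult: "yfree_act T (p * q) v = yfree_act T p (yfree_act T q v)"
proof -
  have "yfree_act T (p * q) v = (\<Sum>k\<in>Poly_Mapping.keys p. \<Sum>l\<in>Poly_Mapping.keys q.
      fscale (Poly_Mapping.lookup p k * Poly_Mapping.lookup q l) (word_act T k (word_act T l v)))"
    by (simp add: yfree_act_lin_ext poly_mapping_times_expand linop_sum[OF linop_lin_ext] word_act_plus)
  also have "\<dots> = yfree_act T p (yfree_act T q v)"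
    by (simp add: yfree_act_lin_ext lin_ext_def linop_sum[OF linop_word_act] linop_fscale[OF linop_word_act] fscale_sum)
  finally show ?thesis .
qed

lemma yfree_act_plus: "yfree_act T (p + q) v = yfree_act T p v + yfree_act T q v"
  and yfree_act_uminus: "yfree_act T (- p) v = - yfree_act T p v"
  and yfree_act_diff: "yfree_act T (p - q) v = yfree_act T p v - yfree_act T q v"
  and yfree_act_0: "yfree_act T 0 v = 0"
  by (simp_all add: yfree_act_lin_ext linop_add linop_minus linop_diff linop_zero)

lemma yfree_act_zero_right: "yfree_act T p 0 = 0"
  by (simp add: yfree_act_lin_ext lin_ext_def linop_zero[OF linop_word_act])

lemma word_act_mem:
  assumes U: "\<And>i j r v. i \<in> {1..n} \<Longrightarrow> j \<in> {1..n} \<Longrightarrow> r \<ge> 1 \<Longrightarrow> v \<in> U \<Longrightarrow> T i j r v \<in> U"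
    and w: "set (letters w) \<subseteq> {1..n} \<times> {1..n} \<times> {1..}" and v: "v \<in> U"
  shows "word_act T w v \<in> U"
proof -
  have "foldr (\<lambda>(i, j, r). T i j r) xs v \<in> U" if "set xs \<subseteq> {1..n} \<times> {1..n} \<times> {1..}" for xs
    using that by (induction xs) (auto simp: v intro!: U)
  then show ?thesis using w by (simp add: word_act_def)
qed

lemma yfree_act_mem:
  assumes U: "fvs.subspace U" "\<And>i j r v. i \<in> {1..n} \<Longrightarrow> j \<in> {1..n} \<Longrightarrow> r \<ge> 1 \<Longrightarrow> v \<in> U \<Longrightarrow> T i j r v \<in> U"
    and p: "p \<in> carrier (yfree n)" and v: "v \<in> U"
  shows "yfree_act T p v \<in> U"
  unfolding yfree_act_lin_ext lin_ext_def
  using p by (intro subspace_sum[OF U(1)] fvs.subspace_scale[OF U(1)] word_act_mem[OF U(2) _ v])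
    (auto simp: carrier_yfree)

lemma yfree_act_yT: "yfree_act T (yT i j r) v = (if r = 0 then (if i = j then v else 0) else T i j r v)"
proof -
  have "yfree_act T 1 v = v"
    by (simp add: yfree_act_lin_ext word_act_zero flip: single_one)
  then show ?thesis
    by (simp add: yT_def yfree_act_0) (simp add: yfree_act_lin_ext word_act_def)
qed

end

text \<open>Closure and relations are asked on \<open>V\<close> only, since the operators are given
  on a whole coordinate space of which the module is a part.\<close>

locale yangian_module = yangian_action T
  for n :: nat and T :: "'b gen_action" and V :: "('b \<Rightarrow>\<^sub>0 complex) set" +
  assumes V: "fvs.subspace V"
    and closed: "i \<in> {1..n} \<Longrightarrow> j \<in> {1..n} \<Longrightarrow> r \<ge> 1 \<Longrightarrow> v \<in> V \<Longrightarrow> T i j r v \<in> V"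
    and rel: "i \<in> {1..n} \<Longrightarrow> j \<in> {1..n} \<Longrightarrow> k \<in> {1..n} \<Longrightarrow> l \<in> {1..n} \<Longrightarrow> v \<in> V \<Longrightarrow>
      yfree_act T (yangian_relation i j k l r s) v = 0"
begin

definition rels :: "(ygen fword \<Rightarrow>\<^sub>0 complex) set" where
  "rels = {yangian_relation i j k l r s | i j k l r s. i \<in> {1..n} \<and> j \<in> {1..n} \<and> k \<in> {1..n} \<and> l \<in> {1..n}}"

lemma yT_carrier: "i \<in> {1..n} \<Longrightarrow> j \<in> {1..n} \<Longrightarrow> yT i j r \<in> carrier (yfree n)"
  by (auto simp: yT_def carrier_yfree zero_fword_def split: if_splits)

lemma carrier_closed:
  assumes "p \<in> carrier (yfree n)" "q \<in> carrier (yfree n)"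
  shows "p * q \<in> carrier (yfree n)" "p - q \<in> carrier (yfree n)" "- p \<in> carrier (yfree n)" "p + q \<in> carrier (yfree n)"
proof -
  interpret ring "yfree n" by (rule ring_yfree)
  show "p * q \<in> carrier (yfree n)" "p + q \<in> carrier (yfree n)"
    using m_closed[OF assms] a_closed[OF assms] by simp_all
  show "- p \<in> carrier (yfree n)" using assms by (simp add: carrier_yfree)
  have "- q \<in> carrier (yfree n)" using assms by (simp add: carrier_yfree)
  from a_closed[OF assms(1) this] show "p - q \<in> carrier (yfree n)" by simp
qed

lemma rels_carrier: "rels \<subseteq> carrier (yfree n)"
  unfolding rels_def yangian_relation_def
  by (auto intro!: carrier_closed yT_carrier)

definition annih :: "(ygen fword \<Rightarrow>\<^sub>0 complex) set" where
  "annih = {p \<in> carrier (yfree n). \<forall>v\<in>V. yfree_act T p v = 0}"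

text \<open>As a two-sided ideal containing the defining relations, the annihilator of
  \<open>V\<close> contains the ideal they generate, and so the cosets act on
  \<open>V\<close>.\<close>

lemma ideal_annih: "ideal annih (yfree n)"
proof (rule idealI[OF ring_yfree])
  interpret ring "yfree n" by (rule ring_yfree)
  have inv: "inv\<^bsub>add_monoid (yfree n)\<^esub> p = - p" if "p \<in> carrier (yfree n)" for p
  proof -
    have "\<ominus>\<^bsub>yfree n\<^esub> p = - p"
      using that carrier_closed[OF that that] by (intro minus_equality) simp_all
    then show ?thesis by (simp add: a_inv_def)
  qed
  show "subgroup annih (add_monoid (yfree n))"
  proof (rule group.subgroupI[OF add.is_group])
    show "annih \<noteq> {}"
      using zero_closed by (auto simp: annih_def yfree_act_0 intro!: exI[of _ 0])
    show "inv\<^bsub>add_monoid (yfree n)\<^esub> a \<in> annih" if "a \<in> annih" for a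
      using that carrier_closed(3)[of a a] inv by (simp add: annih_def yfree_act_uminus)
    show "a \<otimes>\<^bsub>add_monoid (yfree n)\<^esub> b \<in> annih" if "a \<in> annih" "b \<in> annih" for a b
      using that carrier_closed by (simp add: annih_def yfree_act_plus)
  qed (auto simp: annih_def)
  show "x \<otimes>\<^bsub>yfree n\<^esub> a \<in> annih" "a \<otimes>\<^bsub>yfree n\<^esub> x \<in> annih" if "a \<in> annih" "x \<in> carrier (yfree n)" for a x
    using that carrier_closed yfree_act_mem[OF V closed that(2)]
    by (simp_all add: annih_def yfree_act_mult yfree_act_zero_right)
qed

abbreviation I where "I \<equiv> Idl\<^bsub>yfree n\<^esub> rels"

lemma I_annih: "I \<subseteq> annih"
proof (rule ring.genideal_minimal[OF ring_yfree ideal_annih])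
  show "rels \<subseteq> annih"
  proof
    fix x assume x: "x \<in> rels"
    then have "\<forall>v\<in>V. yfree_act T x v = 0" using rel by (auto simp: rels_def)
    then show "x \<in> annih" using x rels_carrier by (auto simp: annih_def)
  qed
qed

lemma ideal_I: "ideal I (yfree n)"
  by (rule ring.genideal_ideal[OF ring_yfree rels_carrier])

lemma yangian_eq: "yangian n = yfree n Quot I"
  by (simp add: yangian_def rels_def)

lemma carrier_yangian: "carrier (yangian n) = {{h + p | h. h \<in> I} | p. p \<in> carrier (yfree n)}"
  unfolding yangian_eq FactRing_def A_RCOSETS_def' a_r_coset_def' by auto

text \<open>Members of a coset differ by elements of the ideal, which annihilate \<open>V\<close>.
  Hence the description in \<open>yangian_act\<close> determines one vector, and any representative
  computes it.\<close>

lemma coset_act: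
  assumes y: "y \<in> carrier (yangian n)" and p: "p \<in> y" and v: "v \<in> V"
  shows "yangian_act T y v = yfree_act T p v" and "p \<in> carrier (yfree n)"
proof -
  obtain p0 where y0: "y = {h + p0 | h. h \<in> I}" "p0 \<in> carrier (yfree n)"
    using y unfolding carrier_yangian by blast
  have act: "yfree_act T q v = yfree_act T p0 v" if "q \<in> y" for q
  proof -
    obtain h where "h \<in> I" "q = h + p0" using \<open>q \<in> y\<close> y0 by blast
    then show ?thesis using I_annih v by (auto simp: yfree_act_plus annih_def)
  qed
  have eq: "yfree_act T q v = yfree_act T p v" if "q \<in> y" for q
    using act[OF that] act[OF p] by simp
  show "yangian_act T y v = yfree_act T p v"
    unfolding yangian_act_def
  proof (rule the_equality)
    show "x = yfree_act T p v" if "\<forall>p\<in>y. yfree_act T p v = x" for x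
      using bspec[OF that p] by (rule sym)
  qed (intro ballI eq)
  obtain h where "h \<in> I" "p = h + p0" using p y0 by blast
  then show "p \<in> carrier (yfree n)"
    using I_annih y0(2) carrier_closed(4)[of h p0] by (auto simp: annih_def)
qed

lemma coset_nonempty: "y \<in> carrier (yangian n) \<Longrightarrow> \<exists>p. p \<in> y"
proof -
  assume "y \<in> carrier (yangian n)"
  then obtain p where p: "y = {h + p | h. h \<in> I}" unfolding carrier_yangian by blast
  interpret ideal I "yfree n" by (rule ideal_I)
  have "0 \<in> I" using additive_subgroup.zero_closed[OF ideal.axioms(1)[OF ideal_I]] by simp
  then show ?thesis unfolding p by blast
qed

lemma generator_coset:
  assumes "i \<in> {1..n}" "j \<in> {1..n}" "r \<ge> 1"
  shows "\<exists>y\<in>carrier (yangian n). \<forall>v\<in>V. yangian_act T y v = T i j r v"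
proof -
  let ?p = "Poly_Mapping.single (FWord [(i, j, r)]) 1"
  interpret ideal I "yfree n" by (rule ideal_I)
  have p: "?p \<in> carrier (yfree n)" using assms by (simp add: carrier_yfree)
  have y: "{h + ?p | h. h \<in> I} \<in> carrier (yangian n)" unfolding carrier_yangian using p by blast
  have "0 \<in> I" using additive_subgroup.zero_closed[OF ideal.axioms(1)[OF ideal_I]] by simp
  then have p': "?p \<in> {h + ?p | h. h \<in> I}" by force
  have "yangian_act T {h + ?p | h. h \<in> I} v = T i j r v" if "v \<in> V" for v
    using coset_act(1)[OF y p' that] by (simp add: yfree_act_lin_ext word_act_def)
  then show ?thesis using y by blast
qed

text \<open>Every generator is represented by a coset, and conversely every coset acts by a
  polynomial in the generators.\<close>

lemma yangian_submodule_iff: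
  assumes U: "U \<subseteq> V"
  shows "yangian_submodule n T U \<longleftrightarrow> fvs.subspace U \<and>
    (\<forall>i\<in>{1..n}. \<forall>j\<in>{1..n}. \<forall>r\<ge>1. \<forall>v\<in>U. T i j r v \<in> U)"
proof
  assume L: "yangian_submodule n T U"
  have "T i j r v \<in> U" if ij: "i \<in> {1..n}" "j \<in> {1..n}" "r \<ge> 1" and v: "v \<in> U" for i j r v
  proof -
    obtain y where "y \<in> carrier (yangian n)" "\<forall>v\<in>V. yangian_act T y v = T i j r v"
      using generator_coset[OF ij] by blast
    then show ?thesis using L v U unfolding yangian_submodule_def by (metis subsetD)
  qed
  then show "fvs.subspace U \<and> (\<forall>i\<in>{1..n}. \<forall>j\<in>{1..n}. \<forall>r\<ge>1. \<forall>v\<in>U. T i j r v \<in> U)"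
    using L unfolding yangian_submodule_def by blast
next
  assume R: "fvs.subspace U \<and> (\<forall>i\<in>{1..n}. \<forall>j\<in>{1..n}. \<forall>r\<ge>1. \<forall>v\<in>U. T i j r v \<in> U)"
  have "yangian_act T y v \<in> U" if y: "y \<in> carrier (yangian n)" and v: "v \<in> U" for y v
  proof -
    obtain p where "p \<in> y" using coset_nonempty[OF y] by blast
    then have "yangian_act T y v = yfree_act T p v" "p \<in> carrier (yfree n)"
      using coset_act[OF y] v U by auto
    then show ?thesis using yfree_act_mem[of U n p v] R v by auto
  qed
  then show "yangian_submodule n T U" using R unfolding yangian_submodule_def by blast
qed

end

lemma yangian_homI:
  assumes M: "yangian_module n T V" and M': "yangian_module n T' V'"
    and f: "\<And>v. v \<in> V \<Longrightarrow> f v \<in> V'"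
    and add: "\<And>v w. v \<in> V \<Longrightarrow> w \<in> V \<Longrightarrow> f (v + w) = f v + f w"
    and scale: "\<And>c v. v \<in> V \<Longrightarrow> f (fscale c v) = fscale c (f v)"
    and comm: "\<And>i j r v. i \<in> {1..n} \<Longrightarrow> j \<in> {1..n} \<Longrightarrow> r \<ge> 1 \<Longrightarrow> v \<in> V \<Longrightarrow> f (T i j r v) = T' i j r (f v)"
  shows "yangian_hom n T V T' V' f"
proof -
  interpret M: yangian_module n T V by (rule M)
  interpret M': yangian_module n T' V' by (rule M')
  have word: "f (word_act T w v) = word_act T' w (f v)"
    if w: "set (letters w) \<subseteq> {1..n} \<times> {1..n} \<times> {1..}" and v: "v \<in> V" for w v
  proof -
    have "f (foldr (\<lambda>(i, j, r). T i j r) xs v) = foldr (\<lambda>(i, j, r). T' i j r) xs (f v) \<and>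
        foldr (\<lambda>(i, j, r). T i j r) xs v \<in> V" if "set xs \<subseteq> {1..n} \<times> {1..n} \<times> {1..}" for xs
      using that by (induction xs) (auto simp: v comm M.closed)
    then show ?thesis using w by (simp add: word_act_def)
  qed
  have sum: "f (\<Sum>k\<in>K. g k) = (\<Sum>k\<in>K. f (g k))" if "finite K" "\<And>k. k \<in> K \<Longrightarrow> g k \<in> V" for K and g :: "ygen fword \<Rightarrow> _"
    using that
  proof (induction K)
    case empty
    have "f (fscale 0 0) = fscale 0 (f 0)" using scale[OF fvs.subspace_0[OF M.V]] .
    then show ?case by simp
  next
    case (insert k K)
    then show ?case using add[of "g k" "sum g K"] subspace_sum[OF M.V, of K g] by simp
  qed
  have "f (yangian_act T y v) = yangian_act T' y (f v)" if y: "y \<in> carrier (yangian n)" and v: "v \<in> V" for y v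
  proof -
    obtain p where p: "p \<in> y" using M.coset_nonempty[OF y] by blast
    have 1: "yangian_act T y v = yfree_act T p v" "p \<in> carrier (yfree n)"
      using M.coset_act[OF y p v] by auto
    have 2: "yangian_act T' y (f v) = yfree_act T' p (f v)"
      using M'.coset_act[OF y p f[OF v]] by auto
    have w: "word_act T k v \<in> V" "f (word_act T k v) = word_act T' k (f v)" if "k \<in> Poly_Mapping.keys p" for k
      using 1(2) that word[OF _ v, of k] M.word_act_mem[OF M.closed _ v, where n = n and w = k] by (auto simp: carrier_yfree)
    have "f (yfree_act T p v) = (\<Sum>k\<in>Poly_Mapping.keys p. f (fscale (Poly_Mapping.lookup p k) (word_act T k v)))"
      unfolding yfree_act_lin_ext lin_ext_def
      by (rule sum) (auto intro: fvs.subspace_scale[OF M.V] w(1))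
    also have "\<dots> = yfree_act T' p (f v)"
      unfolding yfree_act_lin_ext lin_ext_def
      by (rule sum.cong[OF refl]) (simp add: scale w)
    finally show ?thesis using 1 2 by simp
  qed
  then show ?thesis
    unfolding yangian_hom_def using f add scale by blast
qed

section \<open>The defining relations\<close>

text \<open>Series in two variables are nested, with 1 / u as the inner and 1 / v as the outer
  variable; the coefficient of u^-r v^-s has the index s outside and r inside.\<close>

definition in_u :: "'r::ring_1 fps \<Rightarrow> 'r fps fps" where
  "in_u F = fps_const F"

definition in_v :: "'r::ring_1 fps \<Rightarrow> 'r fps fps" where
  "in_v F = Abs_fps (\<lambda>s. fps_const (fps_nth F s))"

lemma in_u_mult: "in_u (F * G) = in_u F * in_u G"
  by (simp add: in_u_def)

lemma in_u_sum: "in_u (\<Sum>i\<in>S. f i) = (\<Sum>i\<in>S. in_u (f i))"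
  by (induction S rule: infinite_finite_induct) (simp_all add: in_u_def flip: fps_const_add)

lemma in_v_add: "in_v (F + G) = in_v F + in_v G" and in_v_0: "in_v 0 = 0"
  by (rule fps_ext, simp add: in_v_def)+

lemma in_v_mult: "in_v (F * G) = in_v F * in_v G"
proof (rule fps_ext)
  fix s
  have "fps_const (\<Sum>i\<in>S. f i) = (\<Sum>i\<in>S. fps_const (f i))" for S and f :: "nat \<Rightarrow> 'a"
    by (induction S rule: infinite_finite_induct) (simp_all flip: fps_const_add)
  then show "fps_nth (in_v (F * G)) s = fps_nth (in_v F * in_v G) s"
    by (simp add: in_v_def fps_mult_nth)
qed

lemma in_v_sum: "in_v (\<Sum>i\<in>S. f i) = (\<Sum>i\<in>S. in_v (f i))"
  by (induction S rule: infinite_finite_induct) (simp_all add: in_v_add in_v_0)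

lemma in_u_in_v_nth: "fps_nth (fps_nth (in_u F * in_v G) s) r = fps_nth F r * fps_nth G s"
  and in_v_in_u_nth: "fps_nth (fps_nth (in_v G * in_u F) s) r = fps_nth G s * fps_nth F r"
  by (simp_all add: in_u_def in_v_def)

definition inv_u :: "'r::ring_1 fps fps" where "inv_u = fps_const fps_X"

definition inv_v :: "'r::ring_1 fps fps" where "inv_v = fps_X"

lemma inv_central: "inv_u * W = W * inv_u" "inv_v * W = W * inv_v"
proof -
  show "inv_v * W = W * inv_v" unfolding inv_v_def by (rule fps_mult_fps_X_commute)
  show "inv_u * W = W * inv_u"
    by (rule fps_ext) (simp add: inv_u_def fps_mult_fps_X_commute)
qed

lemma inv_u_nth: "fps_nth (fps_nth (inv_u * W) s) r = (if r = 0 then 0 else fps_nth (fps_nth W s) (r - 1))"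
  and inv_v_nth: "fps_nth (inv_v * W) s = (if s = 0 then 0 else fps_nth W (s - 1))"
  by (simp_all add: inv_u_def inv_v_def)

definition rttc :: "nat \<Rightarrow> (nat \<Rightarrow> nat \<Rightarrow> 'r::ring_1 fps) \<Rightarrow> bool" where
  "rttc n t \<longleftrightarrow> (\<forall>i\<in>{1..n}. \<forall>j\<in>{1..n}. fps_nth (t i j) 0 = (if i = j then 1 else 0)) \<and>
     (\<forall>i\<in>{1..n}. \<forall>j\<in>{1..n}. \<forall>k\<in>{1..n}. \<forall>l\<in>{1..n}. \<forall>r s.
     (fps_nth (t i j) (r + 1) * fps_nth (t k l) s - fps_nth (t k l) s * fps_nth (t i j) (r + 1))
     - (fps_nth (t i j) r * fps_nth (t k l) (s + 1) - fps_nth (t k l) (s + 1) * fps_nth (t i j) r)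
     = fps_nth (t k j) r * fps_nth (t i l) s - fps_nth (t k j) s * fps_nth (t i l) r)"

text \<open>After multiplication by 1 / (u v) the identity at orders r + 1 and s + 1 is the relation
  for r and s. At order 0 in u or v both sides agree, because the constant terms are deltas and
  commute with everything.\<close>

lemma rttc_iff_rtt:
  assumes t0: "\<forall>i\<in>{1..n}. \<forall>j\<in>{1..n}. fps_nth (t i j) 0 = (if i = j then 1 else 0)"
  shows "rttc n t \<longleftrightarrow> rtt n (inv_v - inv_u) (inv_u * inv_v) (\<lambda>i j. in_u (t i j)) (\<lambda>i j. in_v (t i j))"
proof -
  let ?c = "inv_v - inv_u :: 'a fps fps" and ?e = "inv_u * inv_v :: 'a fps fps"
  have "(\<forall>r s. (fps_nth (t i j) (r + 1) * fps_nth (t k l) s - fps_nth (t k l) s * fps_nth (t i j) (r + 1))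
     - (fps_nth (t i j) r * fps_nth (t k l) (s + 1) - fps_nth (t k l) (s + 1) * fps_nth (t i j) r)
     = fps_nth (t k j) r * fps_nth (t i l) s - fps_nth (t k j) s * fps_nth (t i l) r) \<longleftrightarrow>
     ?c * (in_u (t i j) * in_v (t k l)) - ?e * (in_u (t k j) * in_v (t i l)) =
     ?c * (in_v (t k l) * in_u (t i j)) - ?e * (in_v (t k j) * in_u (t i l))" (is "?L \<longleftrightarrow> ?R")
    if ij: "i \<in> {1..n}" "j \<in> {1..n}" "k \<in> {1..n}" "l \<in> {1..n}" for i j k l
  proof -
    let ?d = "\<lambda>s r. fps_nth (fps_nth (?c * (in_u (t i j) * in_v (t k l)) - ?e * (in_u (t k j) * in_v (t i l))
       - (?c * (in_v (t k l) * in_u (t i j)) - ?e * (in_v (t k j) * in_u (t i l)))) s) r"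
    have d: "?d s r = (if s = 0 then 0 else fps_nth (t i j) r * fps_nth (t k l) (s - 1) - fps_nth (t k l) (s - 1) * fps_nth (t i j) r)
       - (if r = 0 then 0 else fps_nth (t i j) (r - 1) * fps_nth (t k l) s - fps_nth (t k l) s * fps_nth (t i j) (r - 1))
       - (if r = 0 \<or> s = 0 then 0 else fps_nth (t k j) (r - 1) * fps_nth (t i l) (s - 1) - fps_nth (t k j) (s - 1) * fps_nth (t i l) (r - 1))" for s r
      by (simp add: left_diff_distrib mult.assoc inv_u_nth inv_v_nth in_u_in_v_nth in_v_in_u_nth
          del: fps_mult_nth_0 fps_mult_nth_1)
    have "?R \<longleftrightarrow> (\<forall>s r. ?d s r = 0)"
      by (subst eq_iff_diff_eq_0) (simp add: fps_eq_iff del: fps_mult_nth_0 fps_mult_nth_1 fps_sub_nth)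
    also have "\<dots> \<longleftrightarrow> ?L"
    proof
      assume D: "\<forall>s r. ?d s r = 0"
      show ?L
      proof (intro allI)
        fix r s
        show "(fps_nth (t i j) (r + 1) * fps_nth (t k l) s - fps_nth (t k l) s * fps_nth (t i j) (r + 1))
         - (fps_nth (t i j) r * fps_nth (t k l) (s + 1) - fps_nth (t k l) (s + 1) * fps_nth (t i j) r)
         = fps_nth (t k j) r * fps_nth (t i l) s - fps_nth (t k j) s * fps_nth (t i l) r"
          using D[rule_format, of "Suc s" "Suc r"] unfolding d by simp
      qed
    next
      assume L: ?L
      show "\<forall>s r. ?d s r = 0"
      proof (intro allI)
        fix s r
        show "?d s r = 0"
          unfolding d using L[rule_format, of "r - 1" "s - 1"] t0 ij by (cases r; cases s) auto
      qed
    qed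
    finally show ?thesis by blast
  qed
  note eq = this
  show ?thesis
    unfolding rttc_def rtt_def eqTrueI[OF t0] simp_thms
    by (intro ball_cong refl eq)
qed

text \<open>Generating series turn the relations with their index shifts into the ring identity
  treated in \<open>rtt_mult\<close>.\<close>

lemma rttc_mult:
  assumes M: "rttc n M" and N: "rttc n N"
    and comm: "\<And>i j k l r s. fps_nth (M i j) r * fps_nth (N k l) s = fps_nth (N k l) s * fps_nth (M i j) r"
  shows "rttc n (\<lambda>i j. \<Sum>x = 1..n. M i x * N x j)"
proof -
  have M0: "\<forall>i\<in>{1..n}. \<forall>j\<in>{1..n}. fps_nth (M i j) 0 = (if i = j then 1 else 0)"
    and N0: "\<forall>i\<in>{1..n}. \<forall>j\<in>{1..n}. fps_nth (N i j) 0 = (if i = j then 1 else 0)"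
    using M N by (auto simp: rttc_def)
  have MN0: "\<forall>i\<in>{1..n}. \<forall>j\<in>{1..n}. fps_nth (\<Sum>x = 1..n. M i x * N x j) 0 = (if i = j then 1 else 0)"
  proof (intro ballI)
    fix i j assume ij: "i \<in> {1..n}" "j \<in> {1..n}"
    have "fps_nth (\<Sum>x = 1..n. M i x * N x j) 0 = (\<Sum>x = 1..n. (if i = x then 1 else 0) * (if x = j then 1 else 0))"
      unfolding fps_sum_nth using M0 N0 ij by (intro sum.cong refl) auto
    then show "fps_nth (\<Sum>x = 1..n. M i x * N x j) 0 = (if i = j then 1 else 0)"
      unfolding sum_delta_mult_left[OF ij(1)] by simp
  qed
  have "rtt n (inv_v - inv_u) (inv_u * inv_v) (\<lambda>i j. \<Sum>x = 1..n. in_u (M i x) * in_u (N x j))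
     (\<lambda>i j. \<Sum>x = 1..n. in_v (M i x) * in_v (N x j))"
  proof (rule rtt_mult)
    show "rtt n (inv_v - inv_u) (inv_u * inv_v) (\<lambda>i j. in_u (M i j)) (\<lambda>i j. in_v (M i j))"
      using M rttc_iff_rtt[OF M0] by blast
    show "rtt n (inv_v - inv_u) (inv_u * inv_v) (\<lambda>i j. in_u (N i j)) (\<lambda>i j. in_v (N i j))"
      using N rttc_iff_rtt[OF N0] by blast
    show "(inv_v - inv_u) * x = x * (inv_v - inv_u)" for x :: "'a fps fps"
      using inv_central[of x] by (simp add: left_diff_distrib right_diff_distrib)
    show "(inv_u * inv_v) * x = x * (inv_u * inv_v)" for x :: "'a fps fps"
      using inv_central[of x] inv_central(1)[of "x * inv_v"] by (metis mult.assoc)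
    show "in_u (N i j) * in_v (M k l) = in_v (M k l) * in_u (N i j)" for i j k l
      by (intro fps_ext) (simp only: in_u_in_v_nth in_v_in_u_nth comm)
    show "in_v (N i j) * in_u (M k l) = in_u (M k l) * in_v (N i j)" for i j k l
      by (intro fps_ext) (simp only: in_u_in_v_nth in_v_in_u_nth comm)
  qed
  then show ?thesis
    unfolding rttc_iff_rtt[OF MN0] by (simp only: in_u_sum in_v_sum in_u_mult in_v_mult)
qed

section \<open>The action of the Yangian on Grassmann variables\<close>

text \<open>Scalar series as central elements; different normalisations of the row matrices differ
  by such factors.\<close>

definition sc :: "complex fps \<Rightarrow> 'b lop fps" where
  "sc g = Abs_fps (\<lambda>r. fps_nth g r \<star> 1)"

lemma sc_nth: "fps_nth (sc g) r = fps_nth g r \<star> 1"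
  by (simp add: sc_def)

lemma sc_mult_nth: "fps_nth (sc g * F) r = (\<Sum>s = 0..r. fps_nth g s \<star> fps_nth F (r - s))"
  by (simp add: fps_mult_nth sc_nth lop.scl_simps)

lemma sc_central: "sc g * F = F * sc g"
proof (rule fps_ext)
  fix r
  have "fps_nth (F * sc g) r = (\<Sum>s = 0..r. fps_nth g (r - s) \<star> fps_nth F s)"
    by (simp add: fps_mult_nth sc_nth lop.scl_simps)
  also have "\<dots> = (\<Sum>s = 0..r. fps_nth g s \<star> fps_nth F (r - s))"
    by (rule sum.reindex_bij_witness[of _ "\<lambda>s. r - s" "\<lambda>s. r - s"]) auto
  finally show "fps_nth (sc g * F) r = fps_nth (F * sc g) r"
    by (simp only: sc_mult_nth)
qed

lemma sc_one: "sc 1 = 1"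
  by (rule fps_ext) (simp add: sc_nth lop.scl_simps)

lemma sc_mult: "sc (g * h) = sc g * sc h"
proof (rule fps_ext)
  fix r
  have "(\<Sum>s\<in>S. f s) \<star> (1 :: 'a lop) = (\<Sum>s\<in>S. f s \<star> 1)" for f :: "nat \<Rightarrow> complex" and S
    by (rule lop_eqI) (simp add: app_lscale app_sum app_one fvs.scale_sum_left)
  then show "fps_nth (sc (g * h)) r = fps_nth (sc g * sc h :: 'a lop fps) r"
    by (simp add: sc_mult_nth sc_nth fps_mult_nth lop.scl_simps mult.commute)
qed

lemma lscale_commute: "S * T = T * S \<Longrightarrow> (a \<star> S) * (b \<star> T) = (b \<star> T) * (a \<star> S)"
  by (simp add: lop.scl_simps mult.commute)

lemma sc_prod_list: "sc (prod_list gs) = prod_list (map sc gs)"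
  by (induction gs) (simp_all add: sc_one sc_mult)

context fock
begin

text \<open>In a row with sign \<open>-1\<close> the action has its pole at \<open>z - 1\<close>, and \<open>q\<^sub>i p\<^sub>j\<close> is \<open>\<delta>\<^sub>i\<^sub>j - x\<^sub>j \<partial>\<^sub>i\<close>.
  The factor \<open>1 - (z - 1) / u\<close> removes the pole and turns the row into that of \<^const>\<open>Lf\<close>.\<close>

definition pole :: "(nat \<Rightarrow> complex) \<Rightarrow> nat \<Rightarrow> complex" where
  "pole z a = (if eps a = 1 then z a else z a - 1)"

definition B :: "nat \<Rightarrow> nat \<Rightarrow> nat \<Rightarrow> xvar set lop" where
  "B a i j = (if eps a = 1 then cre (XV a i) * ann (XV a j) else - (cre (XV a j) * ann (XV a i)))"

lemma B_E: "B a i j = E a i j - (if i = j then (z a - pole z a) \<star> 1 else 0)"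
  by (simp add: B_def E_def qo_def po_def pole_def cre_ann lop.scl_simps)

definition La :: "(nat \<Rightarrow> complex) \<Rightarrow> nat \<Rightarrow> nat \<Rightarrow> nat \<Rightarrow> xvar set lop fps" where
  "La z a i j = Abs_fps (\<lambda>r. if r = 0 then (if i = j then 1 else 0) else pole z a ^ (r - 1) \<star> B a i j)"

lemma La_nth: "fps_nth (La z a i j) r = (if r = 0 then (if i = j then 1 else 0) else pole z a ^ (r - 1) \<star> B a i j)"
  by (simp add: La_def)

definition Tact :: "(nat \<Rightarrow> complex) \<Rightarrow> nat list \<Rightarrow> nat \<Rightarrow> nat \<Rightarrow> nat \<Rightarrow> xvar set lop" where
  "Tact z l r i j = fps_nth (mat_prod n (La z) l i j) r"

definition gp :: "(nat \<Rightarrow> complex) \<Rightarrow> nat \<Rightarrow> complex fps" where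
  "gp z a = 1 - fps_const (pole z a) * fps_X"

text \<open>The entries of \<open>La\<close> are geometric series in the pole, and the factor 1 -
  pole / u cuts them down to the linear entries of \<open>Lf\<close>.\<close>

lemma Lf_La: "Lf z a i j = sc (gp z a) * La z a i j"
proof (rule fps_ext)
  fix r
  have "sc (gp z a) = (1 - fps_const (pole z a \<star> 1) * fps_X :: xvar set lop fps)"
    by (rule fps_ext) (simp add: sc_nth gp_def lop.scl_simps lop.scl_minus_left)
  then have "sc (gp z a) * La z a i j = La z a i j - fps_const (pole z a \<star> 1) * (fps_X * La z a i j)"
    by (simp add: left_diff_distrib mult.assoc)
  then have R: "fps_nth (sc (gp z a) * La z a i j) r = fps_nth (La z a i j) r -
      pole z a \<star> (if r = 0 then 0 else fps_nth (La z a i j) (r - 1))"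
    by (simp add: lop.scl_simps)
  show "fps_nth (Lf z a i j) r = fps_nth (sc (gp z a) * La z a i j) r"
  proof (cases "r \<le> 1")
    case True
    then have "r = 0 \<or> r = 1" by auto
    then show ?thesis unfolding R
      by (elim disjE) (simp_all add: Lf_def La_nth B_E[of a i j z] lop.scl_simps lop.scl_diff_left)
  next
    case False
    then have "pole z a ^ (r - 1) = pole z a * pole z a ^ (r - 2)"
      by (metis One_nat_def Suc_1 Suc_diff_Suc not_le power_Suc)
    then show ?thesis unfolding R
      using False by (simp add: Lf_def La_nth lop.scl_simps numeral_2_eq_2)
  qed
qed

lemma gp_inverse: "inverse (gp z a) * gp z a = 1"
  by (rule inverse_mult_eq_1) (simp add: gp_def)

lemma La_Lf: "La z a i j = sc (inverse (gp z a)) * Lf z a i j"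
proof -
  have "sc (inverse (gp z a)) * Lf z a i j = sc (inverse (gp z a) * gp z a) * La z a i j"
    by (simp only: Lf_La sc_mult mult.assoc)
  then show ?thesis by (simp only: gp_inverse sc_one mult_1_left)
qed

lemma Tact_cf: "Tact z l r i j =
    (\<Sum>s = 0..r. fps_nth (prod_list (map (\<lambda>a. inverse (gp z a)) l)) s \<star> cf z l (r - s) i j)"
proof -
  have "mat_prod n (La z) l i j = prod_list (map (\<lambda>a. sc (inverse (gp z a))) l) * mat_prod n (Lf z) l i j"
    by (rule mat_prod_central_factor[OF La_Lf sc_central])
  also have "prod_list (map (\<lambda>a. sc (inverse (gp z a))) l) = sc (prod_list (map (\<lambda>a. inverse (gp z a)) l))"
    unfolding sc_prod_list by (simp add: comp_def)
  finally show ?thesis by (simp only: Tact_def cf_def sc_mult_nth)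
qed

lemma cf_Tact: "cf z l r i j = (\<Sum>s = 0..r. fps_nth (prod_list (map (gp z) l)) s \<star> Tact z l (r - s) i j)"
proof -
  have "mat_prod n (Lf z) l i j = prod_list (map (\<lambda>a. sc (gp z a)) l) * mat_prod n (La z) l i j"
    by (rule mat_prod_central_factor[OF Lf_La sc_central])
  also have "prod_list (map (\<lambda>a. sc (gp z a)) l) = sc (prod_list (map (gp z) l))"
    unfolding sc_prod_list by (simp add: comp_def)
  finally show ?thesis by (simp only: Tact_def cf_def sc_mult_nth)
qed

text \<open>The scalar series between \<open>Tact\<close> and \<open>cf\<close> is a product over
  the rows, independent of their order, so intertwining passes from one normalisation to the
  other.\<close>

lemma intertwines_Tact:
  assumes T: "intertwines \<nu> z R l (rev l) T" and w: "w \<in> Wt \<nu> R" and ij: "i \<in> {1..n}" "j \<in> {1..n}"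
  shows "app T (app (Tact z l r i j) w) = app (Tact z (rev l) r i j) (app T w)"
proof -
  have "prod_list (map (\<lambda>a. inverse (gp z a)) (rev l)) = prod_list (map (\<lambda>a. inverse (gp z a)) l)"
    by (simp only: rev_map[symmetric] prod_list.rev)
  then show ?thesis
    using intertwines_cf[OF T _ w ij]
    by (simp add: Tact_cf app_sum app_lscale linop_sum[OF linop_app] linop_fscale[OF linop_app] app_times)
qed

lemma stable_Tact:
  assumes S: "fvs.subspace S"
    and act: "\<And>i j r v. i \<in> {1..n} \<Longrightarrow> j \<in> {1..n} \<Longrightarrow> v \<in> S \<Longrightarrow> app (Tact z l r i j) v \<in> S"
  shows "stable z l S"
  unfolding stable_def
proof (intro allI ballI)
  fix t i j v assume *: "i \<in> {1..n}" "j \<in> {1..n}" "v \<in> S"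
  show "app (cf z l t i j) v \<in> S"
    unfolding cf_Tact app_sum app_lscale
    by (intro subspace_sum[OF S]) (rule fvs.subspace_scale[OF S act[OF *]])
qed

lemma Tact_mem:
  assumes S: "fvs.subspace S" and st: "stable z l S" and "i \<in> {1..n}" "j \<in> {1..n}" "v \<in> S"
  shows "app (Tact z l r i j) v \<in> S"
  unfolding Tact_cf app_sum app_lscale
  using assms by (intro subspace_sum[OF S]) (rule fvs.subspace_scale[OF S], simp add: stable_def)

lemma Tact_Fk:
  assumes "i \<in> {1..n}" "j \<in> {1..n}" "set l \<subseteq> {1..k}" "v \<in> Fk \<nu> k"
  shows "app (Tact z l r i j) v \<in> Fk \<nu> k"
proof (rule Tact_mem[OF subspace_Fk _ assms(1,2,4)])
  show "stable z l (Fk \<nu> k)"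
    unfolding stable_def Fk_def using cf_Wt cf_VS assms(3) by blast
qed

text \<open>Normal ordering of E E leaves a quartic term that is symmetric in the two factors and
  drops out of the commutator; \<open>B\<close> differs from \<open>E\<close> by scalars.\<close>

lemma B_B: "B a i j * B a k l - B a k l * B a i j = (if k = j then B a i l else 0) - (if i = l then B a k j else 0)"
proof -
  have EE: "E a i j * E a k l = (if k = j then E a i l else 0) - q a i * q a k * (p a j * p a l)" for i j k l
  proof -
    have "E a i j * E a k l = q a i * (p a j * q a k) * p a l"
      by (simp only: E_def mult.assoc)
    also have "\<dots> = q a i * ((if k = j then 1 else 0) - q a k * p a j) * p a l"
      unfolding po_qo by (cases "k = j") simp_all
    also have "\<dots> = (if k = j then E a i l else 0) - q a i * q a k * (p a j * p a l)"
      by (simp add: right_diff_distrib left_diff_distrib mult.assoc E_def)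
    finally show ?thesis .
  qed
  have sym: "q a k * q a i * (p a l * p a j) = q a i * q a k * (p a j * p a l)"
    unfolding qo_qo[of eps a k a i] po_po[of eps a l a j] by simp
  have BE: "B a i j = E a i j - c i j \<star> 1" if "c = (\<lambda>i j. if i = j then (if eps a = 1 then 0 else 1) else 0)" for c i j
    using B_E[of a i j "\<lambda>_. 0"] that by (simp add: pole_def lop.scl_simps)
  obtain c where c: "\<And>i j. B a i j = E a i j - c i j \<star> 1" "\<And>i j. i \<noteq> j \<Longrightarrow> c i j = 0" "\<And>i j. c i i = c j j"
    using BE by auto
  have "B a i j * B a k l - B a k l * B a i j = E a i j * E a k l - E a k l * E a i j"
    by (simp add: c(1) left_diff_distrib right_diff_distrib lop.scl_simps mult.commute)
  also have "\<dots> = (if k = j then E a i l else 0) - (if i = l then E a k j else 0)"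
    unfolding EE sym by simp
  also have "\<dots> = (if k = j then B a i l else 0) - (if i = l then B a k j else 0)"
    using c(2)[of i j] c(2)[of i l] c(2)[of k j] c(3)[of i j] by (auto simp: c(1))
  finally show ?thesis .
qed

text \<open>The evaluation module. For positive r and s both sides vanish, since the powers of the
  pole depend only on r + s; if exactly one of them is 0, the relation is that of gl_n.\<close>

lemma rttc_La: "rttc n (La z a)"
  unfolding rttc_def
proof (intro conjI ballI allI)
  fix i j k l r s
  let ?d = "pole z a"
  have Bc: "?d ^ t \<star> (B a i j * B a k l) - ?d ^ t \<star> (B a k l * B a i j) =
      (if k = j then ?d ^ t \<star> B a i l else 0) - (if i = l then ?d ^ t \<star> B a k j else 0)" for t
  proof -
    have "?d ^ t \<star> (B a i j * B a k l) - ?d ^ t \<star> (B a k l * B a i j) = ?d ^ t \<star> (B a i j * B a k l - B a k l * B a i j)"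
      by (rule lop_eqI) (simp add: app_ops app_lscale fvs.scale_right_diff_distrib)
    then show ?thesis unfolding B_B
      by (simp only:) (rule lop_eqI, simp add: app_ops app_lscale fvs.scale_right_diff_distrib)
  qed
  show "(fps_nth (La z a i j) (r + 1) * fps_nth (La z a k l) s - fps_nth (La z a k l) s * fps_nth (La z a i j) (r + 1)) -
       (fps_nth (La z a i j) r * fps_nth (La z a k l) (s + 1) - fps_nth (La z a k l) (s + 1) * fps_nth (La z a i j) r) =
       fps_nth (La z a k j) r * fps_nth (La z a i l) s - fps_nth (La z a k j) s * fps_nth (La z a i l) r"
  proof (cases r; cases s)
    fix r' s' assume "r = Suc r'" "s = Suc s'"
    then show ?thesis by (simp add: La_nth lop.scl_simps mult_ac power_add)
  next
    fix s' assume "r = 0" "s = Suc s'"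
    then show ?thesis using Bc[of s'] by (simp add: La_nth lop.scl_simps)
  next
    fix r' assume "r = Suc r'" "s = 0"
    then show ?thesis using Bc[of r'] by (simp add: La_nth lop.scl_simps)
  qed (simp add: La_nth)
qed (simp add: La_nth)

lemma La_La_other: "a \<noteq> b \<Longrightarrow> fps_nth (La z a i j) r * fps_nth (La z b k l) s = fps_nth (La z b k l) s * fps_nth (La z a i j) r"
proof -
  assume ab: "a \<noteq> b"
  have "B a i j * B b k l = B b k l * B a i j"
    unfolding B_E[of a i j "\<lambda>_. 0"] B_E[of b k l "\<lambda>_. 0"]
    by (simp add: left_diff_distrib right_diff_distrib E_E_other[OF ab] lop.scl_simps)
  then have "(c \<star> B a i j) * (d \<star> B b k l) = (d \<star> B b k l) * (c \<star> B a i j)" for c d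
    by (rule lscale_commute)
  then show ?thesis by (cases r; cases s) (simp_all only: La_nth, auto)
qed

lemma rttc_mat_prod: "distinct l \<Longrightarrow> rttc n (mat_prod n (La z) l)"
proof (induction l)
  case Nil
  show ?case by (simp add: rttc_def)
next
  case (Cons a l)
  have comm: "fps_nth (La z a i j) r * fps_nth (mat_prod n (La z) l k h) s =
      fps_nth (mat_prod n (La z) l k h) s * fps_nth (La z a i j) r" for i j k h r s
  proof -
    let ?w = "fps_const (fps_nth (La z a i j) r)"
    have "?w * La z b k h = La z b k h * ?w" if "b \<in> set l" for b k h
      using that Cons.prems La_La_other[of a b z i j r k h] by (intro fps_ext) auto
    then have "?w * mat_prod n (La z) l k h = mat_prod n (La z) l k h * ?w"
      by (rule mat_prod_commutes_all)
    then have "fps_nth (?w * mat_prod n (La z) l k h) s = fps_nth (mat_prod n (La z) l k h * ?w) s"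
      by simp
    then show ?thesis by simp
  qed
  have "mat_prod n (La z) (a # l) = (\<lambda>i j. \<Sum>x = 1..n. La z a i x * mat_prod n (La z) l x j)"
    by (intro ext) simp
  then show ?case using rttc_mult[OF rttc_La Cons.IH comm] Cons.prems by simp
qed

end

section \<open>Tensor products and Grassmann variables\<close>

definition row_cre :: "nat \<Rightarrow> nat set \<Rightarrow> xvar set lop" where
  "row_cre k I = prod_list (map (\<lambda>i. cre (XV k i)) (sorted_list_of_set I))"

text \<open>\<open>G_map\<close> with the numbering of the rows starting at k, for induction over
  the tensor factors.\<close>

definition Gk :: "nat \<Rightarrow> tens \<Rightarrow> grass" where
  "Gk k = lin_ext (\<lambda>Is.
     gword (concat (map (\<lambda>(a, I). map (XV a) (sorted_list_of_set I)) (List.enumerate k Is))))"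

lemma G_map_Gk: "G_map = Gk 1"
  by (simp add: G_map_def Gk_def)

lemma gword_append: "gword (xs @ ys) = app (prod_list (map cre xs)) (gword ys)"
  by (induction xs) (simp_all add: app_ops gword_Cons(1))

lemma Gk_Nil: "Gk k (Poly_Mapping.single [] 1) = Poly_Mapping.single {} 1"
  by (simp add: Gk_def gword_Nil)

lemma Gk_Cons: "Gk k (Poly_Mapping.single (I # Is) 1) = app (row_cre k I) (Gk (Suc k) (Poly_Mapping.single Is 1))"
  by (simp add: Gk_def gword_append row_cre_def comp_def)

lemma linop_Gk [simp]: "linop (Gk k)"
  by (simp add: Gk_def)

definition later :: "nat \<Rightarrow> xvar set \<Rightarrow> bool" where
  "later k A \<longleftrightarrow> finite A \<and> (\<forall>x\<in>A. k < vrow x)"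

lemma row_cre_single:
  assumes "finite I" and A: "later k A"
  shows "app (row_cre k I) (Poly_Mapping.single A 1) = Poly_Mapping.single (XV k ` I \<union> A) 1"
proof -
  have "app (prod_list (map (\<lambda>i. cre (XV k i)) xs)) (Poly_Mapping.single A 1) =
      Poly_Mapping.single (XV k ` set xs \<union> A) 1" if "sorted_wrt (<) xs" for xs
    using that
  proof (induction xs)
    case Nil
    then show ?case by (simp add: app_ops)
  next
    case (Cons x xs)
    let ?B = "XV k ` set xs \<union> A"
    have fin: "finite ?B" using A by (simp add: later_def)
    have x: "XV k x \<notin> ?B" using Cons.prems A by (auto simp: later_def)
    have "\<not> b < XV k x" if bB: "b \<in> ?B" for b
    proof (cases "b \<in> A")
      case True
      then show ?thesis using A by (auto simp: later_def less_xvar_def)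
    next
      case False
      then obtain y where "b = XV k y" "y \<in> set xs" using bB by blast
      then show ?thesis using Cons.prems by (auto simp: less_xvar_def)
    qed
    then have "{b \<in> ?B. b < XV k x} = {}" by blast
    then have "gsign ?B (XV k x) = 1" by (simp only: gsign_finite[OF fin] card.empty power_0)
    then show ?case
      using Cons x by (simp add: app_ops cre_single del: Un_iff)
  qed
  from this[of "sorted_list_of_set I"] show ?thesis
    using assms(1) by (simp add: row_cre_def)
qed

fun rows :: "nat \<Rightarrow> nat set list \<Rightarrow> xvar set" where
  "rows k [] = {}"
| "rows k (I # Is) = XV k ` I \<union> rows (Suc k) Is"

lemma later_rows: "(\<And>I. I \<in> set Is \<Longrightarrow> finite I) \<Longrightarrow> a < k \<Longrightarrow> later a (rows k Is)"
proof (induction Is arbitrary: k)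
  case (Cons I Is)
  then have "later a (rows (Suc k) Is)" "finite I" by simp_all
  then show ?case using Cons.prems(2) by (auto simp: later_def)
qed (simp add: later_def)

lemma Gk_single: "(\<And>I. I \<in> set Is \<Longrightarrow> finite I) \<Longrightarrow> Gk k (Poly_Mapping.single Is 1) = Poly_Mapping.single (rows k Is) 1"
proof (induction Is arbitrary: k)
  case (Cons I Is)
  have "later k (rows (Suc k) Is)" using Cons.prems by (intro later_rows) auto
  then show ?case using Cons by (simp add: Gk_Cons row_cre_single)
qed (simp add: Gk_Nil)

lemma rows_iff: "x \<in> rows k Is \<longleftrightarrow> k \<le> vrow x \<and> vrow x < k + length Is \<and> vcol x \<in> Is ! (vrow x - k)"
proof (induction Is arbitrary: k)
  case (Cons I Is)
  have "x \<in> XV k ` I \<longleftrightarrow> vrow x = k \<and> vcol x \<in> I" by (cases x) auto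
  then show ?case unfolding rows.simps Un_iff Cons.IH
    by (cases "vrow x = k") (auto simp: nth_Cons' Suc_diff_Suc)
qed simp

text \<open>The counterpart of \<open>tensor\<close> on the Grassmann side: the content of row k
  multiplies a vector in later rows from the left.\<close>

definition join :: "nat \<Rightarrow> ext \<Rightarrow> grass \<Rightarrow> grass" where
  "join k v w = lin_ext (\<lambda>I. app (row_cre k I) w) v"

lemma linop_join_left [simp]: "linop (\<lambda>v. join k v w)"
  by (simp add: join_def)

lemma linop_join_right [simp]: "linop (join k v)"
  by (rule linopI)
    (simp_all add: join_def lin_ext_def linop_add[OF linop_app] linop_fscale[OF linop_app]
      fvs.scale_right_distrib sum.distrib fscale_sum mult.commute)

lemma join_single: "join k (Poly_Mapping.single I 1) w = app (row_cre k I) w"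
  by (simp add: join_def)

lemma linop_tensor_left [simp]: "linop (\<lambda>v. tensor v w)"
  by (simp add: tensor_def)

lemma linop_tensor_right [simp]: "linop (tensor v)"
  by (rule linopI)
    (simp_all add: tensor_def lin_ext_add lin_ext_fscale lin_ext_def[of _ v]
      fvs.scale_right_distrib sum.distrib fscale_sum mult.commute)

lemma Gk_tensor: "Gk k (tensor v w) = join k v (Gk (Suc k) w)"
proof (rule linop_eq_on_keys[of "\<lambda>v. Gk k (tensor v w)" "\<lambda>v. join k v (Gk (Suc k) w)"])
  fix I
  show "Gk k (tensor (Poly_Mapping.single I 1) w) = join k (Poly_Mapping.single I 1) (Gk (Suc k) w)"
  proof (rule linop_eq_on_keys[of "\<lambda>w. Gk k (tensor (Poly_Mapping.single I 1) w)" "\<lambda>w. join k (Poly_Mapping.single I 1) (Gk (Suc k) w)"])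
    fix Is
    show "Gk k (tensor (Poly_Mapping.single I 1) (Poly_Mapping.single Is 1)) =
        join k (Poly_Mapping.single I 1) (Gk (Suc k) (Poly_Mapping.single Is 1))"
      by (simp add: tensor_def join_single Gk_Cons)
  qed (rule linop_compose[OF linop_Gk linop_tensor_right] linop_compose[OF linop_join_right linop_Gk])+
qed (rule linop_compose[OF linop_Gk linop_tensor_left] linop_join_left)+

text \<open>Row k precedes the later rows in the order of the variables, so these do not enter the
  sign.\<close>

lemma gsign_row:
  assumes "finite I" "later k A"
  shows "gsign (XV k ` I \<union> A) (XV k i) = gsign I i"
proof -
  have "{b \<in> XV k ` I \<union> A. b < XV k i} = XV k ` {b \<in> I. b < i}"
    using assms(2) by (auto simp: later_def less_xvar_def)
  moreover have "inj_on (XV k) {b \<in> I. b < i}" by (rule inj_onI) simp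
  ultimately have "card {b \<in> XV k ` I \<union> A. b < XV k i} = card {b \<in> I. b < i}"
    by (simp only: card_image)
  moreover have "finite (XV k ` I \<union> A)" using assms by (simp add: later_def)
  ultimately show ?thesis using assms(1) by (simp only: gsign_finite)
qed

lemma join_cre_ann:
  assumes v: "\<And>I. I \<in> Poly_Mapping.keys v \<Longrightarrow> finite I" and w: "\<And>A. A \<in> Poly_Mapping.keys w \<Longrightarrow> later k A"
  shows "app (cre (XV k i)) (join k v w) = join k (app (cre i) v) w"
    "app (ann (XV k i)) (join k v w) = join k (app (ann i) v) w"
proof -
  have mem: "XV k i \<in> XV k ` I \<union> A \<longleftrightarrow> i \<in> I" if "later k A" for I A
    using that by (auto simp: later_def)
  have single: "join k (Poly_Mapping.single I c) (Poly_Mapping.single A 1) = Poly_Mapping.single (XV k ` I \<union> A) c"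
    if "finite I" "later k A" for I A c
    using row_cre_single[OF that] by (simp add: join_def)
  have remove: "XV k ` I \<union> A - {XV k i} = XV k ` (I - {i}) \<union> A" if "later k A" for I A
    using that by (auto simp: later_def)
  have C: "app (cre (XV k i)) (join k (Poly_Mapping.single I 1) (Poly_Mapping.single A 1)) =
      join k (app (cre i) (Poly_Mapping.single I 1)) (Poly_Mapping.single A 1)"
    "app (ann (XV k i)) (join k (Poly_Mapping.single I 1) (Poly_Mapping.single A 1)) =
      join k (app (ann i) (Poly_Mapping.single I 1)) (Poly_Mapping.single A 1)"
    if I: "finite I" and A: "later k A" for I A
    unfolding single[OF I A] cre_single ann_single mem[OF A] gsign_row[OF I A]
    using I A linop_zero[OF linop_join_left, of k]
    by (auto simp: single remove[OF A])
  have "app (cre (XV k i)) (join k (Poly_Mapping.single I 1) w) = join k (app (cre i) (Poly_Mapping.single I 1)) w"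
    "app (ann (XV k i)) (join k (Poly_Mapping.single I 1) w) = join k (app (ann i) (Poly_Mapping.single I 1)) w"
    if I: "finite I" for I
    by (rule linop_eq_on_keys[of "\<lambda>w. app (cre (XV k i)) (join k (Poly_Mapping.single I 1) w)"
          "\<lambda>w. join k (app (cre i) (Poly_Mapping.single I 1)) w"],
        rule linop_compose[OF linop_app linop_join_right], rule linop_join_right, rule C(1)[OF I w], assumption,
        rule linop_eq_on_keys[of "\<lambda>w. app (ann (XV k i)) (join k (Poly_Mapping.single I 1) w)"
          "\<lambda>w. join k (app (ann i) (Poly_Mapping.single I 1)) w"],
        rule linop_compose[OF linop_app linop_join_right], rule linop_join_right, rule C(2)[OF I w], assumption)
  note single_w = this
  show "app (cre (XV k i)) (join k v w) = join k (app (cre i) v) w"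
    by (rule linop_eq_on_keys[of "\<lambda>v. app (cre (XV k i)) (join k v w)" "\<lambda>v. join k (app (cre i) v) w"],
        rule linop_compose[OF linop_app linop_join_left], rule linop_compose[OF linop_join_left linop_app],
        rule single_w(1)[OF v])
  show "app (ann (XV k i)) (join k v w) = join k (app (ann i) v) w"
    by (rule linop_eq_on_keys[of "\<lambda>v. app (ann (XV k i)) (join k v w)" "\<lambda>v. join k (app (ann i) v) w"],
        rule linop_compose[OF linop_app linop_join_left], rule linop_compose[OF linop_join_left linop_app],
        rule single_w(2)[OF v])
qed

text \<open>Taking e_j out of the wedge product and putting e_i into its position cost the same
  sign, so replacement in place is the derivative by e_j followed by multiplication with
  e_i.\<close>

lemma gl_act_single:
  assumes I: "finite I"
  shows "gl_act i j (Poly_Mapping.single I 1) = app (cre i * ann j) (Poly_Mapping.single I 1)"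
proof -
  let ?js = "sorted_list_of_set I"
  have gl: "gl_act i j (Poly_Mapping.single I 1) = (\<Sum>k | k < length ?js \<and> ?js ! k = j. gword (?js[k := i]))"
    by (simp add: gl_act_def Let_def)
  show ?thesis
  proof (cases "j \<in> I")
    case False
    then have "?js ! k \<noteq> j" if "k < length ?js" for k
      using nth_mem[OF that] I by auto
    then have "{k. k < length ?js \<and> ?js ! k = j} = {}" by blast
    then show ?thesis unfolding gl using False by (simp only: app_times ann_single linop_zero[OF linop_app] if_False sum.empty)
  next
    case True
    define J where "J = I - {j}"
    have J: "finite J" "j \<notin> J" "I = insert j J" using True I by (auto simp: J_def)
    obtain xs ys where xy: "sorted_list_of_set J = xs @ ys" "?js = xs @ j # ys" "length xs = card {b \<in> J. b < j}"
      using sorted_list_of_set_split[OF J(1,2)] J(3) by blast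
    have d: "distinct (xs @ j # ys)" using distinct_sorted_list_of_set[of I] xy(2) by simp
    have "k = length xs" if "k < length (xs @ j # ys)" "(xs @ j # ys) ! k = j" for k
      using nth_eq_iff_index_eq[OF d that(1), of "length xs"] that(2) by simp
    then have "{k. k < length ?js \<and> ?js ! k = j} = {length xs}"
      unfolding xy(2) by force
    then have "gl_act i j (Poly_Mapping.single I 1) = gword (xs @ i # ys)"
      unfolding gl by (simp add: xy(2))
    also have "\<dots> = fscale ((-1) ^ length xs) (app (cre i) (gword (sorted_list_of_set J)))"
      by (simp only: gword_move xy(1))
    also have "gword (sorted_list_of_set J) = Poly_Mapping.single J 1"
      using gword_sorted[of "sorted_list_of_set J"] J(1) by simp
    also have "fscale ((-1) ^ length xs) (app (cre i) (Poly_Mapping.single J 1)) =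
        app (cre i) (app (ann j) (Poly_Mapping.single I 1))"
    proof -
      have "{b \<in> I. b < j} = {b \<in> J. b < j}" using J by auto
      then have "gsign I j = (-1) ^ length xs" using I xy(3) by (simp add: gsign_finite)
      then have "app (ann j) (Poly_Mapping.single I 1) = fscale ((-1) ^ length xs) (Poly_Mapping.single J 1)"
        using True by (simp add: ann_single J_def)
      then show ?thesis by (simp only: linop_fscale[OF linop_app])
    qed
    finally show ?thesis by (simp only: app_times)
  qed
qed

lemma linop_Phi_list_act: "linop (Phi_list_act n ps i j r)"
proof (cases ps)
  case Nil
  show ?thesis unfolding Nil by (rule linopI) simp_all
next
  case (Cons p ps')
  obtain d z where p: "p = (d, z)" by (cases p)
  show ?thesis unfolding Cons p
    by (rule linopI) (simp_all add: tensor_op_def lin_ext_add lin_ext_fscale sum.distrib fscale_sum)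
qed

context fock
begin

text \<open>The entries of the row matrices are even, so they commute with the variables of another
  row without signs.\<close>

lemma row_cre_Tact:
  assumes "k \<notin> set l"
  shows "app (Tact z l r i j) (app (row_cre k I) w) = app (row_cre k I) (app (Tact z l r i j) w)"
proof -
  let ?w = "row_cre k I"
  have cB: "cre (XV k c) * B b i j = B b i j * cre (XV k c)" if "b \<noteq> k" for b c i j
    unfolding B_E[of b i j "\<lambda>_. 0"]
    by (simp add: left_diff_distrib right_diff_distrib E_cre_other[OF that] lop.scl_simps)
  have "prod_list (map (\<lambda>i. cre (XV k i)) xs) * B b i j = B b i j * prod_list (map (\<lambda>i. cre (XV k i)) xs)"
    if "b \<noteq> k" for b i j xs
  proof (induction xs)
    case (Cons c xs)
    then show ?case using cB[OF that, of c i j] by simp (metis mult.assoc)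
  qed simp
  then have wB: "?w * B b i j = B b i j * ?w" if "b \<noteq> k" for b i j
    using that by (simp add: row_cre_def)
  have "fps_const ?w * La z b i j = La z b i j * fps_const ?w" if "b \<in> set l" for b i j
  proof (rule fps_ext)
    fix r
    have "b \<noteq> k" using that assms by blast
    from wB[OF this, of i j] show "fps_nth (fps_const ?w * La z b i j) r = fps_nth (La z b i j * fps_const ?w) r"
      by (cases "r = 0") (simp_all add: La_nth lop.scl_simps)
  qed
  then have "fps_const ?w * mat_prod n (La z) l i j = mat_prod n (La z) l i j * fps_const ?w"
    by (rule mat_prod_commutes_all)
  then have "fps_nth (fps_const ?w * mat_prod n (La z) l i j) r = fps_nth (mat_prod n (La z) l i j * fps_const ?w) r"
    by simp
  then have "?w * Tact z l r i j = Tact z l r i j * ?w" by (simp add: Tact_def)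
  then show ?thesis by (simp only: app_times[symmetric])
qed

lemma join_Phi1_act:
  assumes k: "eps k = (if d \<ge> 0 then 1 else -1)" and I: "finite I"
    and w: "\<And>A. A \<in> Poly_Mapping.keys w \<Longrightarrow> later k A"
  shows "join k (Phi1_act d (z k) i j r (Poly_Mapping.single I 1)) w =
    app (fps_nth (La z k i j) r) (app (row_cre k I) w)"
proof -
  have fin: "finite A" if "A \<in> Poly_Mapping.keys (app (ann j) (Poly_Mapping.single I (1::complex)))" for A j
    using that I by (auto simp: ann_single split: if_splits)
  have gl: "join k (gl_act i j (Poly_Mapping.single I 1)) w = app (cre (XV k i) * ann (XV k j)) (app (row_cre k I) w)" for i j
  proof -
    have "join k (gl_act i j (Poly_Mapping.single I 1)) w = app (cre (XV k i)) (join k (app (ann j) (Poly_Mapping.single I 1)) w)"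
      using I by (simp only: gl_act_single app_times join_cre_ann(1)[OF fin w])
    also have "join k (app (ann j) (Poly_Mapping.single I 1)) w = app (ann (XV k j)) (join k (Poly_Mapping.single I 1) w)"
      using I by (intro join_cre_ann(2)[symmetric] w) (simp_all split: if_splits)
    finally show ?thesis by (simp only: app_times join_single)
  qed
  show ?thesis
  proof (cases "r = 0")
    case True
    then show ?thesis
      using linop_zero[OF linop_join_left, of k w] by (simp add: Phi1_act_def La_nth app_ops join_single)
  next
    case False
    then show ?thesis
      using k by (simp add: Phi1_act_def La_nth B_def pole_def app_lscale app_uminus gl linop_minus[OF linop_join_left]
          linop_fscale[OF linop_join_left] linop_minus[OF linop_scale])
  qed
qed

text \<open>The comultiplication becomes multiplication of row matrices: the first tensor factor
  acts through the matrix of row k, and the action on the other factors passes through the monomial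
  of row k.\<close>

lemma Gk_Phi_list_act:
  assumes "\<And>a. k \<le> a \<Longrightarrow> a < k + length ps \<Longrightarrow>
      eps a = (if fst (ps ! (a - k)) \<ge> 0 then 1 else -1) \<and> z a = snd (ps ! (a - k))"
    and "length Is = length ps" "\<And>I. I \<in> set Is \<Longrightarrow> finite I \<and> I \<subseteq> {1..n}"
    and "i \<in> {1..n}" "j \<in> {1..n}"
  shows "Gk k (Phi_list_act n ps i j r (Poly_Mapping.single Is 1)) =
    app (Tact z [k..<k + length ps] r i j) (Gk k (Poly_Mapping.single Is 1))"
  using assms
proof (induction ps arbitrary: k Is i r)
  case Nil
  have "Tact z [] r i j = (if i = j \<and> r = 0 then 1 else 0)"
    by (simp add: Tact_def)
  then show ?case
    using linop_zero[OF linop_Gk, of k] by (auto simp: app_ops)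
next
  case (Cons p ps)
  obtain d zk where p: "p = (d, zk)" by (cases p)
  obtain I Is' where Is: "Is = I # Is'" using Cons.prems(2) by (cases Is) auto
  have k: "eps k = (if d \<ge> 0 then 1 else -1)" "zk = z k"
    using Cons.prems(1)[of k] p by simp_all
  let ?l = "[Suc k..<Suc k + length ps]"
  let ?g = "Gk (Suc k) (Poly_Mapping.single Is' 1)"
  have IH: "Gk (Suc k) (Phi_list_act n ps c j r (Poly_Mapping.single Is' 1)) = app (Tact z ?l r c j) ?g"
    if "c \<in> {1..n}" for c r
  proof (rule Cons.IH)
    show "eps a = (if 0 \<le> fst (ps ! (a - Suc k)) then 1 else - 1) \<and> z a = snd (ps ! (a - Suc k))"
      if "Suc k \<le> a" "a < Suc k + length ps" for a
    proof -
      have "(p # ps) ! (a - k) = ps ! (a - Suc k)" using that(1) by (simp add: nth_Cons' )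
      then show ?thesis using Cons.prems(1)[of a] that by simp
    qed
  qed (use Cons.prems that Is in auto)
  have fin: "finite I" and fin': "\<And>I. I \<in> set Is' \<Longrightarrow> finite I \<and> I \<subseteq> {1..n}"
    using Cons.prems(3) Is by auto
  have "later k A \<and> (\<forall>x\<in>A. vrow x \<in> set ?l \<and> vcol x \<in> {1..n})" if "A \<in> Poly_Mapping.keys ?g" for A
  proof -
    have "A = rows (Suc k) Is'"
      using that fin' by (simp add: Gk_single split: if_splits)
    moreover have "length Is' = length ps" using Cons.prems(2) Is by simp
    moreover have "vcol x \<in> {1..n}" if "x \<in> rows (Suc k) Is'" for x
    proof -
      have "vcol x \<in> Is' ! (vrow x - Suc k)" "vrow x - Suc k < length Is'" using that by (auto simp: rows_iff)
      then show ?thesis using fin'[OF nth_mem] by blast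
    qed
    moreover have "vrow x \<in> set ?l" if "x \<in> rows (Suc k) Is'" for x
      using that \<open>length Is' = length ps\<close> unfolding rows_iff set_upt atLeastLessThan_iff by simp
    ultimately show ?thesis
      using later_rows[of Is' k "Suc k"] fin' by blast
  qed
  then have "?g \<in> VS n (set ?l)" by (auto simp: VS_def later_def)
  then have later: "later k A" if "A \<in> Poly_Mapping.keys (app (Tact z ?l r c j) ?g)" "c \<in> {1..n}" for A r c
  proof -
    have "stable z ?l (VS n (set ?l))"
      unfolding stable_def using cf_VS by blast
    then have "app (Tact z ?l r c j) ?g \<in> VS n (set ?l)"
      using Tact_mem[OF subspace_VS, of z ?l n "set ?l" c j ?g] \<open>?g \<in> _\<close> that(2) Cons.prems(5) by blast
    then have "finite A" "\<forall>x\<in>A. vrow x \<in> set ?l" using that(1) by (auto simp: VS_def)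
    moreover have "k < a" if "a \<in> set ?l" for a using that by (simp only: set_upt atLeastLessThan_iff Suc_le_eq)
    ultimately show ?thesis by (simp add: later_def del: set_upt)
  qed
  have "Gk k (Phi_list_act n (p # ps) i j r (Poly_Mapping.single Is 1)) =
      (\<Sum>c = 1..n. \<Sum>s = 0..r. join k (Phi1_act d zk i c s (Poly_Mapping.single I 1))
         (app (Tact z ?l (r - s) c j) ?g))"
    using IH by (simp add: p Is linop_sum[OF linop_Gk] tensor_op_def Gk_tensor)
  also have "\<dots> = (\<Sum>c = 1..n. \<Sum>s = 0..r. app (fps_nth (La z k i c) s) (app (Tact z ?l (r - s) c j) (app (row_cre k I) ?g)))"
  proof (intro sum.cong refl)
    fix c s assume "c \<in> {1..n}"
    then have "join k (Phi1_act d zk i c s (Poly_Mapping.single I 1)) (app (Tact z ?l (r - s) c j) ?g) =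
        app (fps_nth (La z k i c) s) (app (row_cre k I) (app (Tact z ?l (r - s) c j) ?g))"
      unfolding k(2) by (intro join_Phi1_act[OF k(1) fin] later)
    then show "join k (Phi1_act d zk i c s (Poly_Mapping.single I 1)) (app (Tact z ?l (r - s) c j) ?g) =
        app (fps_nth (La z k i c) s) (app (Tact z ?l (r - s) c j) (app (row_cre k I) ?g))"
      by (subst row_cre_Tact) auto
  qed
  also have "\<dots> = app (Tact z (k # ?l) r i j) (app (row_cre k I) ?g)"
    by (simp add: Tact_def fps_sum_nth fps_mult_nth app_sum app_times)
  also have "k # ?l = [k..<k + length (p # ps)]"
  proof -
    have "Suc k + length ps = k + length (p # ps)" by simp
    then show ?thesis using upt_conv_Cons[of k "k + length (p # ps)"] by (simp only:)
  qed
  finally show ?case by (simp only: Is Gk_Cons)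
qed

end

section \<open>Tensor products of standard rational modules as modules over the Yangian\<close>

lemma keys_tensor: "Poly_Mapping.keys (tensor v w) \<subseteq> {I # Is | I Is. I \<in> Poly_Mapping.keys v \<and> Is \<in> Poly_Mapping.keys w}"
proof (rule keys_lin[of "\<lambda>v. tensor v w", OF linop_tensor_left])
  fix I assume I: "I \<in> Poly_Mapping.keys v"
  show "Poly_Mapping.keys (tensor (Poly_Mapping.single I 1) w) \<subseteq> {I # Is | I Is. I \<in> Poly_Mapping.keys v \<and> Is \<in> Poly_Mapping.keys w}"
    by (rule keys_lin[OF linop_tensor_right]) (use I in \<open>auto simp: tensor_def\<close>)
qed

lemma keys_Phi1_act:
  assumes "finite I" "I \<subseteq> {1..n}" "i \<in> {1..n}" "j \<in> {1..n}"
  shows "Poly_Mapping.keys (Phi1_act d z i j r (Poly_Mapping.single I 1)) \<subseteq> {I'. I' \<subseteq> {1..n} \<and> card I' = card I}"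
    (is "_ \<subseteq> ?B")
proof -
  have gl: "gl_act i j (Poly_Mapping.single I 1) \<in> {v. Poly_Mapping.keys v \<subseteq> ?B}"
    if ij: "i \<in> {1..n}" "j \<in> {1..n}" for i j
  proof (cases "j \<in> I \<and> i \<notin> I - {j}")
    case True
    then have "card (insert i (I - {j})) = card I"
      using assms(1) card_Suc_Diff1[of I j] card_insert_disjoint[of "I - {j}" i] by auto
    then have "insert i (I - {j}) \<in> ?B"
      using assms(2) ij by auto
    then show ?thesis using True assms(1) by (simp add: gl_act_single app_times ann_single cre_single)
  next
    case False
    then have "gl_act i j (Poly_Mapping.single I 1) = 0"
      using assms(1) by (auto simp: gl_act_single app_times ann_single cre_single linop_zero[OF linop_app])
    then show ?thesis by simp
  qed
  have S: "fvs.subspace {v :: ext. Poly_Mapping.keys v \<subseteq> ?B}" by (rule subspace_keys)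
  have "Phi1_act d z i j r (Poly_Mapping.single I 1) \<in> {v. Poly_Mapping.keys v \<subseteq> ?B}"
    unfolding Phi1_act_def
    using fvs.subspace_scale[OF S gl[OF assms(3,4)]] fvs.subspace_neg[OF S fvs.subspace_scale[OF S gl[OF assms(4,3)]]]
      fvs.subspace_0[OF S] assms(2) by (simp split: if_splits)
  then show ?thesis by simp
qed

lemma keys_Phi_list_act:
  assumes "\<And>I. I \<in> set Is \<Longrightarrow> finite I \<and> I \<subseteq> {1..n}" "length Is = length ps" "i \<in> {1..n}" "j \<in> {1..n}"
  shows "Poly_Mapping.keys (Phi_list_act n ps i j r (Poly_Mapping.single Is 1)) \<subseteq>
    {Is'. list_all2 (\<lambda>I' I. I' \<subseteq> {1..n} \<and> card I' = card I) Is' Is}"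
  using assms
proof (induction ps arbitrary: Is i r)
  case Nil
  then show ?case by simp
next
  case (Cons p ps)
  obtain d z where p: "p = (d, z)" by (cases p)
  obtain I Is' where Is: "Is = I # Is'" using Cons.prems(2) by (cases Is) auto
  let ?B = "{Is'. list_all2 (\<lambda>I' I. I' \<subseteq> {1..n} \<and> card I' = card I) Is' Is}"
  have "tensor (Phi1_act d z i k s (Poly_Mapping.single I 1)) (Phi_list_act n ps k j (r - s) (Poly_Mapping.single Is' 1))
      \<in> {v. Poly_Mapping.keys v \<subseteq> ?B}" if k: "k \<in> {1..n}" for k s
  proof -
    have 1: "Poly_Mapping.keys (Phi1_act d z i k s (Poly_Mapping.single I 1)) \<subseteq> {I'. I' \<subseteq> {1..n} \<and> card I' = card I}"
      using Cons.prems Is k by (intro keys_Phi1_act) auto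
    have 2: "Poly_Mapping.keys (Phi_list_act n ps k j (r - s) (Poly_Mapping.single Is' 1)) \<subseteq>
        {Js. list_all2 (\<lambda>I' I. I' \<subseteq> {1..n} \<and> card I' = card I) Js Is'}"
      using Cons.prems Is k by (intro Cons.IH) auto
    show ?thesis
      using keys_tensor 1 2 unfolding Is by fastforce
  qed
  then have "(\<Sum>k = 1..n. \<Sum>s = 0..r. tensor (Phi1_act d z i k s (Poly_Mapping.single I 1))
      (Phi_list_act n ps k j (r - s) (Poly_Mapping.single Is' 1))) \<in> {v. Poly_Mapping.keys v \<subseteq> ?B}"
    by (intro subspace_sum[OF subspace_keys])
  then show ?case by (simp add: p Is tensor_op_def)
qed

text \<open>The data of the rows are parameters tied to the weights on 1, ..., m only; beyond m they
  stay free, which leaves room for auxiliary rows.\<close>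

locale rational_modules = fock n eps for n :: nat and eps :: "nat \<Rightarrow> int" +
  fixes m :: nat and lam mu :: wt and z :: "nat \<Rightarrow> complex" and nb :: "nat \<Rightarrow> nat"
  assumes eps: "a \<in> {1..m} \<Longrightarrow> eps a = nu_sign lam mu a"
    and z: "a \<in> {1..m} \<Longrightarrow> z a = mu a"
    and nb: "a \<in> {1..m} \<Longrightarrow> nb a = nubar n lam mu a"
    and bound: "a \<in> {1..m} \<Longrightarrow> \<bar>nu lam mu a\<bar> \<le> int n"
begin

abbreviation "V \<equiv> Phi_space m n lam mu"

abbreviation "T \<equiv> Phi_act m n lam mu"

abbreviation "F \<equiv> Fk nb m"

lemma nb_le: "a \<in> {1..m} \<Longrightarrow> nb a \<le> n"
  using bound[of a] nb[of a] unfolding nubar_def by (cases "nu lam mu a \<ge> 0") auto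

definition index :: "nat set list \<Rightarrow> bool" where
  "index Is \<longleftrightarrow> length Is = m \<and> (\<forall>a\<in>{1..m}. Is ! (a - 1) \<subseteq> {1..n} \<and> int (card (Is ! (a - 1))) = \<bar>nu lam mu a\<bar>)"

lemma V_iff: "v \<in> V \<longleftrightarrow> Poly_Mapping.keys v \<subseteq> {Is. index Is}"
proof -
  have "list_all2 (\<lambda>I a. I \<subseteq> {1..n} \<and> int (card I) = \<bar>nu lam mu a\<bar>) Is [1..<m + 1] \<longleftrightarrow> index Is" for Is
  proof -
    have "(\<forall>k<m. P (Is ! k) ([1..<m + 1] ! k)) \<longleftrightarrow> (\<forall>a\<in>{1..m}. P (Is ! (a - 1)) a)" for P
    proof -
      have "(\<forall>k<m. P (Is ! k) ([1..<m + 1] ! k)) \<longleftrightarrow> (\<forall>k<m. P (Is ! k) (Suc k))"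
        by (intro all_cong) (simp add: nth_upt del: upt_Suc)
      also have "\<dots> \<longleftrightarrow> (\<forall>a\<in>{1..m}. P (Is ! (a - 1)) a)"
      proof
        assume L: "\<forall>k<m. P (Is ! k) (Suc k)"
        show "\<forall>a\<in>{1..m}. P (Is ! (a - 1)) a"
        proof
          fix a assume "a \<in> {1..m}"
          then show "P (Is ! (a - 1)) a" using L[rule_format, of "a - 1"] by (cases a) auto
        qed
      qed force
      finally show ?thesis .
    qed
    from this[of "\<lambda>I a. I \<subseteq> {1..n} \<and> int (card I) = \<bar>nu lam mu a\<bar>"] show ?thesis
      unfolding list_all2_conv_all_nth index_def by (auto simp del: upt_Suc)
  qed
  then show ?thesis unfolding Phi_space_def by blast
qed

lemma subspace_V: "fvs.subspace V"
proof -
  have "V = {v. Poly_Mapping.keys v \<subseteq> {Is. index Is}}" using V_iff by blast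
  then show ?thesis using subspace_keys by simp
qed

lemma index_finite: "index Is \<Longrightarrow> I \<in> set Is \<Longrightarrow> finite I \<and> I \<subseteq> {1..n}"
proof -
  assume "index Is" "I \<in> set Is"
  then obtain k where "k < m" "I = Is ! k" by (auto simp: in_set_conv_nth index_def)
  then have "I \<subseteq> {1..n}" using \<open>index Is\<close> unfolding index_def by (elim conjE ballE[of _ _ "Suc k"]) auto
  then show ?thesis using finite_subset by auto
qed

definition split :: "xvar set \<Rightarrow> nat set list" where
  "split A = map (\<lambda>a. {i. XV a i \<in> A}) [1..<m + 1]"

lemma split_nth: "a \<in> {1..m} \<Longrightarrow> split A ! (a - 1) = {i. XV a i \<in> A}"
  by (auto simp: split_def simp del: upt_Suc)

lemma length_split: "length (split A) = m"
  by (simp add: split_def del: upt_Suc)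

definition Findex :: "xvar set \<Rightarrow> bool" where
  "Findex A \<longleftrightarrow> finite A \<and> (\<forall>x\<in>A. vrow x \<in> {1..m} \<and> vcol x \<in> {1..n}) \<and> (\<forall>a\<in>{1..m}. nocc a A = nb a)"

lemma F_iff: "w \<in> F \<longleftrightarrow> Poly_Mapping.keys w \<subseteq> {A. Findex A}"
  unfolding Fk_def VS_def Wt_def wt_iff_keys Findex_def by blast

text \<open>For sign -1 the row contains -nu a variables and the occupied columns are the remaining
  n + nu a.\<close>

lemma nocc_iff:
  assumes a: "a \<in> {1..m}" and A: "{i. XV a i \<in> A} \<subseteq> {1..n}"
  shows "nocc a A = nb a \<longleftrightarrow> int (card {i. XV a i \<in> A}) = \<bar>nu lam mu a\<bar>"
proof (cases "nu lam mu a \<ge> 0")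
  case True
  then have "{i \<in> {1..n}. occupied a i A} = {i. XV a i \<in> A}"
    using A eps[OF a] by (auto simp: occupied_def nu_sign_def)
  then show ?thesis using True by (auto simp: nocc_def nb[OF a] nubar_def)
next
  case False
  then have "{i \<in> {1..n}. occupied a i A} = {1..n} - {i. XV a i \<in> A}"
    using eps[OF a] by (auto simp: occupied_def nu_sign_def)
  then have "nocc a A = n - card {i. XV a i \<in> A}"
    unfolding nocc_def using A by (simp add: card_Diff_subset finite_subset)
  moreover have "card {i. XV a i \<in> A} \<le> n" using card_mono[OF _ A] by simp
  ultimately show ?thesis using False bound[OF a] by (auto simp: nb[OF a] nubar_def)
qed

lemma rows_split:
  assumes A: "\<And>x. x \<in> A \<Longrightarrow> vrow x \<in> {1..m}"
  shows "rows 1 (split A) = A"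
proof (intro equalityI subsetI)
  fix x assume "x \<in> rows 1 (split A)"
  then have "vrow x \<in> {1..m}" "vcol x \<in> split A ! (vrow x - 1)" by (auto simp: rows_iff length_split)
  then show "x \<in> A" by (cases x) (simp add: split_nth[simplified])
next
  fix x assume x: "x \<in> A"
  then have "vrow x \<in> {1..m}" by (rule A)
  moreover have "vcol x \<in> split A ! (vrow x - 1)" using calculation x by (cases x) (simp add: split_nth[simplified])
  ultimately show "x \<in> rows 1 (split A)" by (auto simp: rows_iff length_split)
qed

lemma split_rows: "length Is = m \<Longrightarrow> split (rows 1 Is) = Is"
  by (rule nth_equalityI) (auto simp: length_split split_def rows_iff simp del: upt_Suc)

lemma index_split: "Findex A \<Longrightarrow> index (split A)"
proof -
  assume A: "Findex A"
  have "{i. XV a i \<in> A} \<subseteq> {1..n} \<and> int (card {i. XV a i \<in> A}) = \<bar>nu lam mu a\<bar>" if "a \<in> {1..m}" for a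
  proof -
    have "\<forall>x\<in>A. vcol x \<in> {1..n}" using A by (simp add: Findex_def)
    then have "{i. XV a i \<in> A} \<subseteq> {1..n}" by force
    then show ?thesis using nocc_iff[OF that, of A] A that by (simp add: Findex_def)
  qed
  then show ?thesis by (simp add: index_def length_split split_nth[simplified])
qed

lemma Findex_rows: "index Is \<Longrightarrow> Findex (rows 1 Is)"
proof -
  assume Is: "index Is"
  have len: "length Is = m" using Is by (simp add: index_def)
  have sub: "{i. XV a i \<in> rows 1 Is} = Is ! (a - 1)" "Is ! (a - 1) \<subseteq> {1..n}" if "a \<in> {1..m}" for a
    using that Is by (auto simp: rows_iff index_def)
  have "vrow x \<in> {1..m} \<and> vcol x \<in> {1..n}" if "x \<in> rows 1 Is" for x
  proof -
    have 1: "vrow x \<in> {1..m}" "vcol x \<in> Is ! (vrow x - 1)" using that len by (auto simp: rows_iff)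
    then show ?thesis using sub(2)[OF 1(1)] by blast
  qed
  moreover have "finite (rows 1 Is)"
    using later_rows[of Is 0 1] index_finite[OF Is] by (simp add: later_def)
  moreover have "nocc a (rows 1 Is) = nb a" if "a \<in> {1..m}" for a
    using nocc_iff[OF that, of "rows 1 Is"] sub[OF that] Is that by (simp add: index_def)
  ultimately show ?thesis by (simp add: Findex_def)
qed

definition Ginv :: "grass \<Rightarrow> tens" where
  "Ginv = lin_ext (\<lambda>A. Poly_Mapping.single (split A) 1)"

lemma linop_Ginv [simp]: "linop Ginv"
  by (simp add: Ginv_def)

lemma linop_G_map [simp]: "linop G_map"
  by (simp add: G_map_Gk)

lemma G_single: "index Is \<Longrightarrow> G_map (Poly_Mapping.single Is 1) = Poly_Mapping.single (rows 1 Is) 1"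
  unfolding G_map_Gk using index_finite by (intro Gk_single) blast

lemma G_V: "v \<in> V \<Longrightarrow> G_map v \<in> F"
  unfolding V_iff F_iff by (rule keys_lin[OF linop_G_map]) (use Findex_rows in \<open>auto simp: G_single\<close>)

lemma Ginv_F: "w \<in> F \<Longrightarrow> Ginv w \<in> V"
  unfolding V_iff F_iff by (rule keys_lin[OF linop_Ginv]) (use index_split in \<open>auto simp: Ginv_def\<close>)

lemma Ginv_G: "v \<in> V \<Longrightarrow> Ginv (G_map v) = v"
proof (rule linop_eq_on_keys[of "\<lambda>v. Ginv (G_map v)" "\<lambda>v. v"])
  fix Is assume "v \<in> V" "Is \<in> Poly_Mapping.keys v"
  then have "index Is" using V_iff by blast
  then show "Ginv (G_map (Poly_Mapping.single Is 1)) = Poly_Mapping.single Is 1"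
    using split_rows[of Is] by (simp add: G_single Ginv_def index_def)
qed (simp_all add: linop_compose)

lemma G_Ginv: "w \<in> F \<Longrightarrow> G_map (Ginv w) = w"
proof (rule linop_eq_on_keys[of "\<lambda>w. G_map (Ginv w)" "\<lambda>w. w"])
  fix A assume "w \<in> F" "A \<in> Poly_Mapping.keys w"
  then have A: "Findex A" using F_iff by blast
  then have "rows 1 (split A) = A" by (intro rows_split) (simp add: Findex_def)
  then show "G_map (Ginv (Poly_Mapping.single A 1)) = Poly_Mapping.single A 1"
    using G_single[OF index_split[OF A]] by (simp add: Ginv_def)
qed (simp_all add: linop_compose)

lemma inv_into_G: "w \<in> F \<Longrightarrow> inv_into V G_map w = Ginv w"
proof -
  assume w: "w \<in> F"
  have "inj_on G_map V" using Ginv_G by (rule inj_on_inverseI)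
  then show ?thesis using inv_into_f_f[of G_map V "Ginv w"] w Ginv_F G_Ginv by simp
qed

lemma G_T:
  assumes v: "v \<in> V" and ij: "i \<in> {1..n}" "j \<in> {1..n}"
  shows "G_map (T i j r v) = app (Tact z [1..<Suc m] r i j) (G_map v)"
proof (rule linop_eq_on_keys[of "\<lambda>v. G_map (T i j r v)" "\<lambda>v. app (Tact z [1..<Suc m] r i j) (G_map v)"])
  let ?ps = "map (\<lambda>a. (nu lam mu a, mu a)) [1..<m + 1]"
  show "linop (\<lambda>v. G_map (T i j r v))"
    unfolding Phi_act_def by (rule linop_compose[OF linop_G_map linop_Phi_list_act])
  show "linop (\<lambda>v. app (Tact z [1..<Suc m] r i j) (G_map v))"
    by (rule linop_compose[OF linop_app linop_G_map])
  have len: "length ?ps = m" by (simp del: upt_Suc)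
  fix Is assume "Is \<in> Poly_Mapping.keys v"
  then have Is: "index Is" using v V_iff by blast
  have "Gk 1 (Phi_list_act n ?ps i j r (Poly_Mapping.single Is 1)) =
      app (Tact z [1..<1 + length ?ps] r i j) (Gk 1 (Poly_Mapping.single Is 1))"
  proof (rule Gk_Phi_list_act[OF _ _ _ ij])
    fix a assume "1 \<le> a" "a < 1 + length ?ps"
    then have a: "a \<in> {1..m}" using len by simp
    then have "?ps ! (a - 1) = (nu lam mu a, mu a)" by (subst nth_map) (auto simp: nth_upt simp del: upt_Suc)
    then show "eps a = (if 0 \<le> fst (?ps ! (a - 1)) then 1 else - 1) \<and> z a = snd (?ps ! (a - 1))"
      using eps[OF a] z[OF a] by (simp add: nu_sign_def del: upt_Suc)
  next
    show "length Is = length ?ps" using Is len by (simp add: index_def del: upt_Suc)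
  qed (use index_finite[OF Is] in blast)
  then show "G_map (T i j r (Poly_Mapping.single Is 1)) = app (Tact z [1..<Suc m] r i j) (G_map (Poly_Mapping.single Is 1))"
    unfolding Phi_act_def G_map_Gk len by (simp del: upt_Suc)
qed

lemma T_V:
  assumes v: "v \<in> V" and ij: "i \<in> {1..n}" "j \<in> {1..n}"
  shows "T i j r v \<in> V"
  unfolding V_iff
proof (rule keys_lin[of "T i j r" v])
  show "linop (T i j r)" unfolding Phi_act_def by (rule linop_Phi_list_act)
  fix Is assume "Is \<in> Poly_Mapping.keys v"
  then have Is: "index Is" using v V_iff by blast
  have "index Js" if Js: "list_all2 (\<lambda>I' I. I' \<subseteq> {1..n} \<and> card I' = card I) Js Is" for Js
    unfolding index_def
  proof (intro conjI ballI)
    show "length Js = m" using Is Js by (simp add: index_def list_all2_lengthD)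
    fix a assume a: "a \<in> {1..m}"
    then have "a - 1 < length Js" using \<open>length Js = m\<close> by auto
    then show "Js ! (a - 1) \<subseteq> {1..n}" "int (card (Js ! (a - 1))) = \<bar>nu lam mu a\<bar>"
      using list_all2_nthD[OF Js] Is a by (simp_all add: index_def)
  qed
  then show "Poly_Mapping.keys (T i j r (Poly_Mapping.single Is 1)) \<subseteq> {Is. index Is}"
    using keys_Phi_list_act[OF index_finite[OF Is] _ ij, of Is "map (\<lambda>a. (nu lam mu a, mu a)) [1..<m + 1]" r] Is
    unfolding Phi_act_def by (auto simp: index_def simp del: upt_Suc)
qed

lemma linop_T: "linop (T i j r)"
  unfolding Phi_act_def by (rule linop_Phi_list_act)

text \<open>The relations are carried through \<open>G_map\<close>, where they are those of the
  product of the row matrices, and brought back by its left inverse on \<open>V\<close>.\<close>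

lemma yangian_module: "yangian_module n T V"
proof -
  interpret yangian_action T by standard (rule linop_T)
  show ?thesis
  proof
    show "fvs.subspace V" by (rule subspace_V)
    show "T i j r v \<in> V" if "i \<in> {1..n}" "j \<in> {1..n}" "r \<ge> 1" "v \<in> V" for i j r v
      using T_V that by blast
    fix i j k l v and r s :: nat
    assume ij: "i \<in> {1..n}" "j \<in> {1..n}" "k \<in> {1..n}" "l \<in> {1..n}" and v: "v \<in> V"
    let ?t = "mat_prod n (La z) [1..<Suc m]"
    have R: "rttc n ?t" by (rule rttc_mat_prod) simp
    have yT: "yfree_act T (yT i j r) v \<in> V"
        "G_map (yfree_act T (yT i j r) v) = app (fps_nth (?t i j) r) (G_map v)"
      if "i \<in> {1..n}" "j \<in> {1..n}" "v \<in> V" for i j r v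
    proof -
      have "fps_nth (?t i j) 0 = (if i = j then 1 else 0)" using R that unfolding rttc_def by blast
      then show "yfree_act T (yT i j r) v \<in> V"
        "G_map (yfree_act T (yT i j r) v) = app (fps_nth (?t i j) r) (G_map v)"
        using that T_V G_T[of v i j r] fvs.subspace_0[OF subspace_V] linop_zero[OF linop_G_map]
        by (auto simp: yfree_act_yT Tact_def app_ops simp del: upt_Suc)
    qed
    have yy: "G_map (yfree_act T (yT i j r * yT k l s) v) = app (fps_nth (?t i j) r * fps_nth (?t k l) s) (G_map v)"
      if "i \<in> {1..n}" "j \<in> {1..n}" "k \<in> {1..n}" "l \<in> {1..n}" for i j k l r s
      using yT(2)[OF that(1,2) yT(1)[OF that(3,4) v]] yT(2)[OF that(3,4) v]
      by (simp add: yfree_act_mult app_times del: upt_Suc)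
    let ?R = "(fps_nth (?t i j) (r + 1) * fps_nth (?t k l) s - fps_nth (?t k l) s * fps_nth (?t i j) (r + 1))
     - (fps_nth (?t i j) r * fps_nth (?t k l) (s + 1) - fps_nth (?t k l) (s + 1) * fps_nth (?t i j) r)
     - (fps_nth (?t k j) r * fps_nth (?t i l) s - fps_nth (?t k j) s * fps_nth (?t i l) r)"
    have "G_map (yfree_act T (yangian_relation i j k l r s) v) = app ?R (G_map v)"
      unfolding yangian_relation_def yfree_act_diff linop_diff[OF linop_G_map] app_minus
      using ij by (simp only: yy)
    also have "?R = 0" using R ij unfolding rttc_def by simp
    finally have "G_map (yfree_act T (yangian_relation i j k l r s) v) = 0" by (simp only: app_zero)
    moreover have "yfree_act T (yangian_relation i j k l r s) v \<in> V"
      unfolding yangian_relation_def yfree_act_diff yfree_act_mult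
      using ij v by (intro fvs.subspace_diff[OF subspace_V] yT(1))
    ultimately show "yfree_act T (yangian_relation i j k l r s) v = 0"
      using Ginv_G linop_zero[OF linop_Ginv] by metis
  qed
qed

end

lemma lop_series:
  fixes P Q :: "'b lop"
  assumes Q: "Q ^ Suc n = 0" and c: "c 0 = 1"
  shows "v + Sum_any (\<lambda>r. if r \<ge> 1 then fscale (c r) (app (P ^ r * Q ^ r) v) else 0) =
    app (\<Sum>r\<le>n. c r \<star> (P ^ r * Q ^ r)) v"
proof -
  have "Q ^ r = 0" if "r > n" for r
  proof -
    have "Q ^ r = Q ^ (r - Suc n) * Q ^ Suc n" using that by (simp only: power_add[symmetric]) simp
    then show ?thesis by (simp only: Q mult_zero_right)
  qed
  then have "{r. (if r \<ge> 1 then fscale (c r) (app (P ^ r * Q ^ r) v) else 0) \<noteq> 0} \<subseteq> {1..n}"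
    by (auto simp: app_zero linorder_not_less[symmetric])
  then have "Sum_any (\<lambda>r. if r \<ge> 1 then fscale (c r) (app (P ^ r * Q ^ r) v) else 0) =
      (\<Sum>r = 1..n. if r \<ge> 1 then fscale (c r) (app (P ^ r * Q ^ r) v) else 0)"
    by (rule Sum_any.expand_superset[rotated]) simp
  also have "\<dots> = (\<Sum>r = 1..n. fscale (c r) (app (P ^ r * Q ^ r) v))"
    by (rule sum.cong) auto
  finally have S: "Sum_any (\<lambda>r. if r \<ge> 1 then fscale (c r) (app (P ^ r * Q ^ r) v) else 0) =
      (\<Sum>r = 1..n. fscale (c r) (app (P ^ r * Q ^ r) v))" .
  have "{..n} = insert 0 {1..n}" by auto
  then have "app (\<Sum>r\<le>n. c r \<star> (P ^ r * Q ^ r)) v = v + (\<Sum>r = 1..n. fscale (c r) (app (P ^ r * Q ^ r) v))"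
    using c by (simp add: app_sum app_lscale app_ops)
  then show ?thesis by (simp only: S)
qed

section \<open>Agreement of the operators in the statement with the finite series\<close>

context rational_modules
begin

lemma q_op_p_op:
  assumes "\<And>A. A \<in> Poly_Mapping.keys v \<Longrightarrow> finite A" "a \<in> {1..m}"
  shows "q_op (nu_sign lam mu) a i v = app (q a i) v" "p_op (nu_sign lam mu) a i v = app (p a i) v"
  using gmult_gvar[OF assms(1)] gderiv_ann[OF assms(1)] eps[OF assms(2)]
  by (simp_all add: q_op_def p_op_def qo_def po_def)

lemma D_op_D:
  assumes v: "v \<in> VS n {1..m}" and ab: "a \<in> {1..m}" "b \<in> {1..m}"
  shows "D_op n (nu_sign lam mu) a b v = app (D a b) v"
proof -
  have "q_op (nu_sign lam mu) a i (p_op (nu_sign lam mu) b i v) = app (q a i * p b i) v" if "i \<in> {1..n}" for i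
    using q_op_p_op(2)[OF VS_finite[OF v] ab(2)] q_op_p_op(1)[OF VS_finite[OF po_VS[OF v ab(2) that]] ab(1)]
    by (simp add: app_times)
  then show ?thesis unfolding D_op_def D_def app_sum by (intro sum.cong) auto
qed

lemma D_op_pow:
  assumes v: "v \<in> VS n {1..m}" and ab: "a \<in> {1..m}" "b \<in> {1..m}"
  shows "(D_op n (nu_sign lam mu) a b ^^ r) v = app (D a b ^ r) v \<and> app (D a b ^ r) v \<in> VS n {1..m}"
proof (induction r)
  case 0
  then show ?case using v by (simp add: app_one)
next
  case (Suc r)
  then show ?case using D_op_D[OF _ ab] D_VS[OF _ ab] by (simp add: app_times)
qed

lemma X_op_X_ser:
  assumes v: "v \<in> VS n {1..m}" and ab: "a \<in> {1..m}" "b \<in> {1..m}" "a \<noteq> b"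
  shows "X_op n kap (nu_sign lam mu) a b v = app (X_ser a b (kap b - kap a)) v"
    "Y_op n kap (nu_sign lam mu) a b v = app (Y_ser a b (kap b - kap a)) v"
proof -
  have c: "(-1) ^ r / (fact r * pochhammer (kap a - kap b + 1) r) = rcoef (kap b - kap a) r" for r
  proof -
    have "kap a - kap b + 1 = 1 - (kap b - kap a)" by simp
    then show ?thesis by (simp only: rcoef_def)
  qed
  have X: "(D_op n (nu_sign lam mu) b a ^^ r) ((D_op n (nu_sign lam mu) a b ^^ r) v) = app (D b a ^ r * D a b ^ r) v" for r
    using D_op_pow[OF v ab(1,2), of r] D_op_pow[OF _ ab(2,1)] by (simp add: app_times)
  have Y: "(D_op n (nu_sign lam mu) a b ^^ r) ((D_op n (nu_sign lam mu) b a ^^ r) v) = app (D a b ^ r * D b a ^ r) v" for r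
    using D_op_pow[OF v ab(2,1), of r] D_op_pow[OF _ ab(1,2)] by (simp add: app_times)
  show "X_op n kap (nu_sign lam mu) a b v = app (X_ser a b (kap b - kap a)) v"
    unfolding X_op_def X_ser_def c X by (rule lop_series[OF D_nilpotent[OF ab(3)], where c = "rcoef _"]) (rule rcoef_0)
  show "Y_op n kap (nu_sign lam mu) a b v = app (Y_ser a b (kap b - kap a)) v"
    unfolding Y_op_def Y_ser_def c Y by (rule lop_series[OF D_nilpotent[OF ab(3)[symmetric]], where c = "rcoef _"]) (rule rcoef_0)
qed

lemma Z_op_Zprod:
  assumes v: "v \<in> VS n {1..m}" and ps: "\<And>a b. (a, b) \<in> set ps \<Longrightarrow> a \<in> {1..m} \<and> b \<in> {1..m} \<and> a \<noteq> b"
  shows "Z_op n lam mu ps v = app (Zprod nb z ps) v"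
  using ps
proof (induction ps)
  case Nil
  then show ?case by (simp add: Z_op_def app_one)
next
  case (Cons ab ps)
  obtain a b where ab: "ab = (a, b)" by (cases ab)
  have R: "a \<in> {1..m}" "b \<in> {1..m}" "a \<noteq> b" using Cons.prems[of a b] ab by auto
  have IH: "Z_op n lam mu ps v = app (Zprod nb z ps) v"
    using Cons.prems by (intro Cons.IH) auto
  have VS: "app (Zprod nb z ps) v \<in> VS n {1..m}"
    using Cons.prems by (intro Zprod_VS v) auto
  have "Z_op n lam mu (ab # ps) v = (if nubar n lam mu a \<ge> nubar n lam mu b
     then X_op n (lambar n lam mu) (nu_sign lam mu) a b
     else Y_op n mu (nu_sign lam mu) a b) (Z_op n lam mu ps v)"
    by (simp add: Z_op_def ab)
  also have "\<dots> = app (Zfac nb z (a, b)) (app (Zprod nb z ps) v)"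
    unfolding IH
    by (simp add: X_op_X_ser[OF VS R] lambar_def Zfac_def nb[OF R(1)] nb[OF R(2)] z[OF R(1)] z[OF R(2)])
  finally show ?case by (simp add: ab app_times)
qed

end

section \<open>Independence of the normal ordering\<close>

context fock
begin

lemma intertwines_diff:
  "intertwines \<nu> z R l l' S \<Longrightarrow> intertwines \<nu> z R l l' T \<Longrightarrow> intertwines \<nu> z R l l' (S - T)"
  unfolding intertwines_def
  by (simp add: app_ops linop_diff[OF linop_app] fvs.subspace_diff[OF subspace_Wt])

lemma stable_image:
  assumes T: "intertwines \<nu> z {1..k} l (rev l) T" and l: "set l \<subseteq> {1..k}"
  shows "stable z (rev l) (app T ` Fk \<nu> k)"
  unfolding stable_def
proof (intro allI ballI)
  fix t i j v assume ij: "i \<in> {1..n}" "j \<in> {1..n}" and "v \<in> app T ` Fk \<nu> k"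
  then obtain f where f: "f \<in> Fk \<nu> k" "v = app T f" by blast
  have "app (cf z l t i j) f \<in> Fk \<nu> k"
    using f(1) ij l cf_Wt cf_VS unfolding Fk_def by blast
  moreover have "app (cf z (rev l) t i j) v = app T (app (cf z l t i j) f)"
    using intertwines_cf[OF T _ _ ij, of f t] f by (simp add: app_times Fk_def)
  ultimately show "app (cf z (rev l) t i j) v \<in> app T ` Fk \<nu> k" by blast
qed

lemma subspace_image: "fvs.subspace S \<Longrightarrow> fvs.subspace (app T ` S)"
proof (rule fvs.subspaceI)
  assume S: "fvs.subspace S"
  show "0 \<in> app T ` S"
    using fvs.subspace_0[OF S] linop_zero[OF linop_app, of T] by force
  show "x + y \<in> app T ` S" if "x \<in> app T ` S" "y \<in> app T ` S" for x y
    using that fvs.subspace_add[OF S] by (auto simp: linop_add[OF linop_app, symmetric])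
  show "fscale c x \<in> app T ` S" if "x \<in> app T ` S" for c x
    using that fvs.subspace_scale[OF S] by (auto simp: linop_fscale[OF linop_app, symmetric])
qed

lemma Zrec_VS: "k \<le> m \<Longrightarrow> v \<in> VS n {1..m} \<Longrightarrow> app (Zrec \<nu> z k) v \<in> VS n {1..m}"
proof (induction k)
  case (Suc k)
  have "app (Zrec \<nu> z k) v \<in> VS n {1..m}" using Suc by simp
  then show ?case unfolding Zrec.simps app_times
    by (rule Zprod_VS) (use Suc.prems(1) in \<open>auto simp del: upt_Suc\<close>)
qed (simp add: app_one)

text \<open>If the product for a normal ordering differed from \<^const>\<open>Zrec\<close>, the image of the
  difference would be a nonzero submodule, which by \<open>Zrec_image_mem\<close> contains the vacuum.
  But the difference kills the vacuum and preserves the \<open>gl\<close>-weight.\<close>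

lemma Zprod_eq_Zrec:
  assumes good: "\<And>a b. 1 \<le> a \<Longrightarrow> a < b \<Longrightarrow> b \<le> m \<Longrightarrow> good \<nu> z a b"
    and aux: "\<And>k. 1 \<le> k \<Longrightarrow> k \<le> m \<Longrightarrow> eps (m + k) = eps k \<and> z (m + k) = z k \<and> \<nu> (m + k) = \<nu> k \<and> \<nu> k \<le> n"
    and N: "normal_ordering m ps" and f: "f \<in> Fk \<nu> m"
  shows "app (Zprod \<nu> z ps) f = app (Zrec \<nu> z m) f"
proof (rule ccontr)
  assume ne: "app (Zprod \<nu> z ps) f \<noteq> app (Zrec \<nu> z m) f"
  define T where "T = Zprod \<nu> z ps - Zrec \<nu> z m"
  have ps: "a \<in> {1..m} \<and> b \<in> {1..m} \<and> a \<noteq> b" if "(a, b) \<in> set ps" for a b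
    using N that by (auto simp: normal_ordering_def)
  have T: "intertwines \<nu> z {1..m} [1..<Suc m] (rev [1..<Suc m]) T"
    unfolding T_def using good
    by (intro intertwines_diff intertwines_normal_ordering[OF _ N] intertwines_Zrec) auto
  have TF: "app T w \<in> Fk \<nu> m" if "w \<in> Fk \<nu> m" for w
  proof -
    have "app T w \<in> Wt \<nu> {1..m}" using T that by (simp add: intertwines_def Fk_def)
    moreover have "app (Zprod \<nu> z ps) w \<in> VS n {1..m}"
      using that ps by (intro Zprod_VS) (auto simp: Fk_def)
    moreover have "app (Zrec \<nu> z m) w \<in> VS n {1..m}"
      using that by (intro Zrec_VS) (auto simp: Fk_def)
    ultimately show ?thesis
      by (simp add: Fk_def T_def app_minus fvs.subspace_diff[OF subspace_VS])
  qed
  have "app (Zrec \<nu> z m) (Poly_Mapping.single (vac \<nu> m) 1) \<in> app T ` Fk \<nu> m"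
  proof (rule Zrec_image_mem[OF good aux order_refl])
    show "fvs.subspace (app T ` Fk \<nu> m)" by (rule subspace_image[OF subspace_Fk])
    have "app T f \<noteq> 0" using ne by (simp add: T_def app_minus)
    then show "app T ` Fk \<nu> m \<noteq> {0}" using f by blast
    show "stable z (rev [1..<Suc m]) (app T ` Fk \<nu> m)"
      by (rule stable_image[OF T]) (auto simp del: upt_Suc)
    show "Poly_Mapping.single (vac \<nu> m) 1 \<in> Fk \<nu> m"
      using aux by (intro vac_Fk) auto
  qed (use TF in auto)
  then obtain g where g: "g \<in> Fk \<nu> m" "app T g = Poly_Mapping.single (vac \<nu> m) 1"
    by (auto simp: Zrec_vac)
  moreover have "app T g \<noteq> Poly_Mapping.single (vac \<nu> m) 1"
  proof (rule not_in_image[OF _ _ _ g(1)])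
    show "app T (Poly_Mapping.single (vac \<nu> m) 1) = 0"
      unfolding T_def app_minus using Zprod_vac[OF ps] Zrec_vac by simp
    show "\<nu> a \<le> n" if "a \<in> {1..m}" for a using that aux by auto
    fix i assume i: "i \<in> {1..n}"
    let ?S = "\<Sum>a\<in>{1..m}. E a i i"
    have "?S * Zprod \<nu> z ps = Zprod \<nu> z ps * ?S"
      using ps i by (intro Zprod_commutes) (metis D_E_total)
    moreover have "?S * Zrec \<nu> z m = Zrec \<nu> z m * ?S"
      using i by (intro Zrec_commutes conjI D_E_total) auto
    ultimately show "T * ?S = ?S * T"
      by (simp add: T_def left_diff_distrib right_diff_distrib)
  qed
  ultimately show False by blast
qed

end

section \<open>Transport of modules and operators along the permutation
  \<open>sigma0\<close>\<close>

lemma grass_perm_involution: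
  assumes "\<And>a. \<sigma> (\<sigma> a) = a" and v: "v \<in> VS n R"
  shows "grass_perm \<sigma> (grass_perm \<sigma> v) = v"
proof (rule linop_eq_on_keys[of "\<lambda>v. grass_perm \<sigma> (grass_perm \<sigma> v)" "\<lambda>v. v"])
  fix A assume "A \<in> Poly_Mapping.keys v"
  then have A: "finite A" using VS_finite v by blast
  have word: "grass_perm \<sigma> (gword xs) = gword (map (row_map \<sigma>) xs)" for xs
  proof (induction xs)
    case Nil
    then show ?case by (simp add: gword_Nil grass_perm_single)
  next
    case (Cons x xs)
    have "finite A" if "A \<in> Poly_Mapping.keys (gword xs)" for A using that gword_Cons(2) by blast
    from grass_perm_cre[OF this] show ?case using Cons by (simp add: gword_Cons(1))
  qed
  have "row_map \<sigma> (row_map \<sigma> x) = x" for x using assms(1) by (cases x) (simp add: row_map_def)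
  then have "map (row_map \<sigma>) (map (row_map \<sigma>) xs) = xs" for xs by (simp add: map_idI)
  then have "grass_perm \<sigma> (grass_perm \<sigma> (Poly_Mapping.single A 1)) = gword (sorted_list_of_set A)"
    by (simp add: grass_perm_single word del: map_map)
  also have "\<dots> = Poly_Mapping.single A 1" using gword_sorted[of "sorted_list_of_set A"] A by simp
  finally show "grass_perm \<sigma> (grass_perm \<sigma> (Poly_Mapping.single A 1)) = Poly_Mapping.single A 1" .
qed (simp_all add: linop_compose)

lemma grass_perm_Fk:
  assumes "inj \<sigma>" "\<sigma> ` {1..k} = {1..k}" "v \<in> fock.Fk n eps \<nu> k"
    and eq: "\<And>a. a \<in> {1..k} \<Longrightarrow> eps' (\<sigma> a) = eps a \<and> \<nu>' (\<sigma> a) = \<nu> a"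
  shows "grass_perm \<sigma> v \<in> fock.Fk n eps' \<nu>' k"
proof -
  have v: "v \<in> VS n {1..k}" "\<And>a. a \<in> {1..k} \<Longrightarrow> app (fock.D n eps a a) v = fscale (of_nat (\<nu> a)) v"
    using assms(3) by (auto simp: fock.Fk_def fock.Wt_def wt_def)
  have "app (fock.D n eps' b b) (grass_perm \<sigma> v) = fscale (of_nat (\<nu>' b)) (grass_perm \<sigma> v)" if "b \<in> {1..k}" for b
  proof -
    have "b \<in> \<sigma> ` {1..k}" using that by (simp only: assms(2))
    then obtain a where a: "a \<in> {1..k}" "b = \<sigma> a" by blast
    have e: "eps' (\<sigma> a) = eps a" "\<nu>' (\<sigma> a) = \<nu> a" using eq[OF a(1)] by auto
    have "app (fock.D n eps' b b) (grass_perm \<sigma> v) = grass_perm \<sigma> (app (fock.D n eps a a) v)"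
      using grass_perm_D[of \<sigma> v n "{1..k}" a a eps' eps, OF assms(1) v(1) a(1) a(1) e(1) e(1)]
      by (simp only: a(2))
    then show ?thesis by (simp only: v(2)[OF a(1)] linop_fscale[OF linop_grass_perm] a(2) e(2))
  qed
  then show ?thesis
    using grass_perm_VS[OF v(1), of \<sigma>] assms(2) by (simp add: fock.Fk_def fock.Wt_def wt_def)
qed

lemma grass_perm_Tact:
  assumes \<sigma>: "inj \<sigma>" and v: "v \<in> VS n R" and l: "set l \<subseteq> R"
    and eq: "\<And>a. a \<in> R \<Longrightarrow> eps' (\<sigma> a) = eps a \<and> z' (\<sigma> a) = z a"
    and ij: "i \<in> {1..n}" "j \<in> {1..n}"
  shows "grass_perm \<sigma> (app (fock.Tact n eps z l r i j) v) = app (fock.Tact n eps' z' (map \<sigma> l) r i j) (grass_perm \<sigma> v)"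
  using l ij(1)
proof (induction l arbitrary: i r)
  case Nil
  then show ?case by (simp add: fock.Tact_def app_ops linop_zero)
next
  case (Cons a l)
  have La: "grass_perm \<sigma> (app (fps_nth (fock.La eps z a i c) s) w) = app (fps_nth (fock.La eps' z' (\<sigma> a) i c) s) (grass_perm \<sigma> w)"
    if w: "w \<in> VS n R" and c: "c \<in> {1..n}" for w s c
  proof -
    have e: "eps' (\<sigma> a) = eps a" "z' (\<sigma> a) = z a" using eq Cons.prems by auto
    have ca: "grass_perm \<sigma> (app (cre (XV a i)) (app (ann (XV a j)) w)) =
        app (cre (XV (\<sigma> a) i)) (app (ann (XV (\<sigma> a) j)) (grass_perm \<sigma> w))" for i j
      using grass_perm_cre[of "app (ann (XV a j)) w" \<sigma> "XV a i"] grass_perm_ann[of \<sigma> w "XV a j"]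
        VS_finite[OF w] VS_finite[OF ann_VS[OF w]] \<sigma> by (simp add: row_map_def)
    then show ?thesis
      by (simp add: fock.La_nth fock.B_def fock.pole_def e app_lscale app_uminus app_times app_ops
          linop_fscale[OF linop_grass_perm] linop_minus[OF linop_grass_perm] linop_zero[OF linop_grass_perm])
  qed
  have VS: "app (fock.Tact n eps z l s c j) v \<in> VS n R" if "c \<in> {1..n}" for s c
  proof (rule fock.Tact_mem[OF subspace_VS _ that ij(2) v])
    show "fock.stable n eps z l (VS n R)"
      unfolding fock.stable_def using fock.cf_VS Cons.prems(1) by fastforce
  qed
  have unfold: "app (fock.Tact n e y (b # k) r i j) w =
      (\<Sum>c = 1..n. \<Sum>s = 0..r. app (fps_nth (fock.La e y b i c) s) (app (fock.Tact n e y k (r - s) c j) w))" for e y b k w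
    by (simp add: fock.Tact_def fps_sum_nth fps_mult_nth app_sum app_times)
  show ?case
    unfolding list.map unfold linop_sum[OF linop_grass_perm]
    using Cons.IH Cons.prems by (intro sum.cong refl) (simp add: La VS)
qed

lemma sigma0_sigma0: "sigma0 m (sigma0 m a) = a"
  by (auto simp: sigma0_def)

lemma inj_sigma0: "inj (sigma0 m)"
  by (rule inj_on_inverseI[of _ "sigma0 m"]) (rule sigma0_sigma0)

lemma sigma0_mem: "a \<in> {1..m} \<Longrightarrow> sigma0 m a \<in> {1..m}"
  by (auto simp: sigma0_def)

lemma sigma0_image: "sigma0 m ` {1..m} = {1..m}"
proof
  show "{1..m} \<subseteq> sigma0 m ` {1..m}"
    using sigma0_mem sigma0_sigma0 by (metis image_eqI subsetI)
qed (use sigma0_mem in blast)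

lemma wt_perm_sigma0: "wt_perm (sigma0 m) lam a = lam (sigma0 m a)"
  unfolding wt_perm_def using inv_into_f_f[OF inj_sigma0 UNIV_I, of m "sigma0 m a"] by (simp only: sigma0_sigma0)

lemma map_sigma0: "map (sigma0 m) (rev [1..<Suc m]) = [1..<Suc m]"
  by (rule nth_equalityI) (auto simp: rev_nth sigma0_def simp del: upt_Suc)

text \<open>The assumption \<open>aux\<close> fills the rows m + 1, ..., 2 m with copies of the rows
  1, ..., m for use in \<open>Zrec_image_mem\<close>.\<close>

locale intertwiner = rational_modules +
  assumes good: "1 \<le> a \<Longrightarrow> a < b \<Longrightarrow> b \<le> m \<Longrightarrow> good nb z a b"
    and aux: "1 \<le> k \<Longrightarrow> k \<le> m \<Longrightarrow> eps (m + k) = eps k \<and> z (m + k) = z k \<and> nb (m + k) = nb k"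
begin

abbreviation "\<sigma> \<equiv> sigma0 m"

abbreviation "lam' \<equiv> wt_perm \<sigma> lam"

abbreviation "mu' \<equiv> wt_perm \<sigma> mu"

lemma nu_sigma0: "nu lam' mu' a = nu lam mu (\<sigma> a)"
  by (simp only: nu_def wt_perm_sigma0)

text \<open>The target is a module of the same kind with reversed rows, so all facts about
  \<open>G_map\<close> hold for it as well.\<close>

interpretation target: rational_modules n "\<lambda>a. eps (\<sigma> a)" m lam' mu' "\<lambda>a. z (\<sigma> a)" "\<lambda>a. nb (\<sigma> a)"
proof
  fix a assume "a \<in> {1..m}"
  note a = sigma0_mem[OF this]
  show "eps (\<sigma> a) = nu_sign lam' mu' a" unfolding eps[OF a] by (simp only: nu_sign_def nu_sigma0)
  show "z (\<sigma> a) = mu' a" unfolding z[OF a] by (simp only: wt_perm_sigma0)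
  show "nb (\<sigma> a) = nubar n lam' mu' a" unfolding nb[OF a] by (simp only: nubar_def nu_sigma0)
  show "\<bar>nu lam' mu' a\<bar> \<le> int n" using bound[OF a] by (simp only: nu_sigma0)
qed

lemma sigma0_F: "w \<in> F \<Longrightarrow> grass_perm \<sigma> w \<in> target.F"
  by (rule grass_perm_Fk[OF inj_sigma0 sigma0_image]) (simp_all only: sigma0_sigma0 simp_thms)

lemma sigma0_target_F: "w \<in> target.F \<Longrightarrow> grass_perm \<sigma> w \<in> F"
  by (rule grass_perm_Fk[OF inj_sigma0 sigma0_image]) simp_all

lemma sigma0_involution: "w \<in> VS n {1..m} \<Longrightarrow> grass_perm \<sigma> (grass_perm \<sigma> w) = w"
  using grass_perm_involution[of \<sigma>] sigma0_sigma0 by blast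

text \<open>\<open>L\<close> and \<open>K\<close> identify the target with the space
  \<open>F\<close> of the source, where its action is given by the row matrices multiplied in
  reversed order. Submodules of the target are studied there.\<close>

definition L :: "grass \<Rightarrow> tens" where
  "L w = target.Ginv (grass_perm \<sigma> w)"

definition K :: "tens \<Rightarrow> grass" where
  "K v = grass_perm \<sigma> (G_map v)"

lemma linop_L [simp]: "linop L"
  unfolding L_def by (rule linop_compose[OF target.linop_Ginv linop_grass_perm])

lemma linop_K [simp]: "linop K"
  unfolding K_def by (rule linop_compose[OF linop_grass_perm linop_G_map])

lemma L_F: "w \<in> F \<Longrightarrow> L w \<in> target.V"
  unfolding L_def by (intro target.Ginv_F sigma0_F)

lemma K_V: "v \<in> target.V \<Longrightarrow> K v \<in> F"
  unfolding K_def by (intro sigma0_target_F target.G_V)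

lemma K_L: "w \<in> F \<Longrightarrow> K (L w) = w"
  unfolding K_def L_def target.G_Ginv[OF sigma0_F] by (rule sigma0_involution) (simp add: Fk_def)

lemma L_K: "v \<in> target.V \<Longrightarrow> L (K v) = v"
  unfolding K_def L_def using target.G_V[of v] sigma0_involution[of "G_map v"] target.Ginv_G
  by (simp add: target.Fk_def)

lemma K_T:
  assumes v: "v \<in> target.V" and ij: "i \<in> {1..n}" "j \<in> {1..n}"
  shows "K (target.T i j r v) = app (Tact z (rev [1..<Suc m]) r i j) (K v)"
proof -
  have G: "G_map v \<in> VS n {1..m}" using target.G_V[OF v] by (simp add: target.Fk_def)
  have l: "map \<sigma> [1..<Suc m] = rev [1..<Suc m]"
    by (metis map_sigma0 rev_map rev_rev_ident)
  have "K (target.T i j r v) = grass_perm \<sigma> (app (target.Tact (\<lambda>a. z (\<sigma> a)) [1..<Suc m] r i j) (G_map v))"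
    unfolding K_def target.G_T[OF v ij] ..
  also have "\<dots> = app (Tact z (map \<sigma> [1..<Suc m]) r i j) (grass_perm \<sigma> (G_map v))"
    by (rule grass_perm_Tact[OF inj_sigma0 G _ _ ij]) (auto simp del: upt_Suc)
  finally show ?thesis unfolding l K_def .
qed

lemma L_Tact:
  assumes w: "w \<in> F" and ij: "i \<in> {1..n}" "j \<in> {1..n}"
  shows "L (app (Tact z (rev [1..<Suc m]) r i j) w) = target.T i j r (L w)"
  using K_T[OF L_F[OF w] ij, of r] L_K[OF target.T_V[OF L_F[OF w] ij, of r]] K_L[OF w] by simp

abbreviation "vacuum \<equiv> (Poly_Mapping.single (vac nb m) 1 :: grass)"

lemma aux': "1 \<le> k \<Longrightarrow> k \<le> m \<Longrightarrow> eps (m + k) = eps k \<and> z (m + k) = z k \<and> nb (m + k) = nb k \<and> nb k \<le> n"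
  using aux[of k] nb_le[of k] by simp

lemma Zrec_F: "w \<in> F \<Longrightarrow> app (Zrec nb z m) w \<in> F"
  using intertwines_Zrec[OF order_refl good] Zrec_VS[OF order_refl, of w m] unfolding intertwines_def Fk_def by blast

text \<open>The common value of all \<open>I_op\<close> on the source, with \<open>Zrec\<close>
  standing for the product over a normal ordering.\<close>

definition J :: "tens \<Rightarrow> tens" where
  "J v = fscale ((-1) ^ Nbar m n lam mu) (L (app (Zrec nb z m) (G_map v)))"

lemma I_op_eq:
  assumes N: "normal_ordering m ps" and v: "v \<in> V"
  shows "I_op m n lam mu ps v = J v"
proof -
  have G: "G_map v \<in> F" "G_map v \<in> VS n {1..m}" using G_V[OF v] by (simp_all add: Fk_def)
  have "Z_op n lam mu ps (G_map v) = app (Zprod nb z ps) (G_map v)"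
    by (rule Z_op_Zprod[OF G(2)]) (use N in \<open>auto simp: normal_ordering_def\<close>)
  also have "\<dots> = app (Zrec nb z m) (G_map v)"
    by (rule Zprod_eq_Zrec[OF good aux' N G(1)])
  finally show ?thesis
    unfolding I_op_def J_def L_def using target.inv_into_G[OF sigma0_F[OF Zrec_F[OF G(1)]]] by simp
qed

lemma J_V: "v \<in> V \<Longrightarrow> J v \<in> target.V"
  unfolding J_def by (intro fvs.subspace_scale[OF target.subspace_V] L_F Zrec_F G_V)

lemma linop_J: "linop J"
  unfolding J_def
  by (rule linop_compose[OF linop_scale linop_compose[OF linop_L linop_compose[OF linop_app linop_G_map]]])

lemma J_T:
  assumes v: "v \<in> V" and ij: "i \<in> {1..n}" "j \<in> {1..n}"
  shows "J (T i j r v) = target.T i j r (J v)"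
proof -
  have Z: "app (Zrec nb z m) (app (Tact z [1..<Suc m] r i j) (G_map v)) =
      app (Tact z (rev [1..<Suc m]) r i j) (app (Zrec nb z m) (G_map v))"
    using G_V[OF v] by (intro intertwines_Tact[OF intertwines_Zrec[OF order_refl good] _ ij]) (auto simp: Fk_def)
  show ?thesis
    unfolding J_def G_T[OF v ij] Z linop_fscale[OF target.linop_T]
    by (simp only: L_Tact[OF Zrec_F[OF G_V[OF v]] ij])
qed

lemma J_nonzero: "\<exists>v\<in>V. J v \<noteq> 0"
proof -
  have vac: "vacuum \<in> F" by (rule vac_Fk) (rule nb_le)
  have "vacuum \<noteq> 0" by (metis lookup_single_eq lookup_zero zero_neq_one)
  then have "K (L vacuum) \<noteq> 0" using K_L[OF vac] by simp
  then have "L vacuum \<noteq> 0" using linop_zero[OF linop_K] by metis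
  then have "J (Ginv vacuum) \<noteq> 0"
    unfolding J_def G_Ginv[OF vac] Zrec_vac[OF order_refl] by (simp add: fvs.scale_eq_0_iff)
  then show ?thesis using Ginv_F[OF vac] by blast
qed

lemma J_hom: "yangian_hom n T V target.T target.V J"
  by (rule yangian_homI[OF yangian_module target.yangian_module])
    (simp_all add: J_V linop_add[OF linop_J] linop_fscale[OF linop_J] J_T)

text \<open>A nonzero submodule of the image contains all of it: the vectors of \<open>F\<close>
  that \<open>L\<close> sends into the submodule form a nonzero stable subspace, and
  \<open>Zrec_image_mem\<close> puts the image of \<open>Zrec\<close> into that.\<close>

lemma J_irreducible: "yangian_irreducible n target.T (J ` V)"
  unfolding yangian_irreducible_def
proof (intro conjI allI impI)
  interpret M: yangian_module n target.T target.V by (rule target.yangian_module)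
  have JV: "J ` V \<subseteq> target.V" using J_V by blast
  have "fvs.subspace (J ` V)"
  proof (rule fvs.subspaceI)
    show "0 \<in> J ` V" using fvs.subspace_0[OF subspace_V] linop_zero[OF linop_J] by force
    show "x + y \<in> J ` V" if "x \<in> J ` V" "y \<in> J ` V" for x y
      using that fvs.subspace_add[OF subspace_V] by (auto simp: linop_add[OF linop_J, symmetric])
    show "fscale c x \<in> J ` V" if "x \<in> J ` V" for c x
      using that fvs.subspace_scale[OF subspace_V] by (auto simp: linop_fscale[OF linop_J, symmetric])
  qed
  moreover have "target.T i j r x \<in> J ` V" if "i \<in> {1..n}" "j \<in> {1..n}" "x \<in> J ` V" for i j r x
    using that T_V by (auto simp: J_T[symmetric])
  ultimately show "yangian_submodule n target.T (J ` V)"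
    unfolding M.yangian_submodule_iff[OF JV] by blast
  show "J ` V \<noteq> {0}" using J_nonzero by blast
  fix U assume U: "yangian_submodule n target.T U \<and> U \<subseteq> J ` V"
  then have UV: "U \<subseteq> target.V" using JV by blast
  from U have U': "fvs.subspace U" "\<And>i j r v. i \<in> {1..n} \<Longrightarrow> j \<in> {1..n} \<Longrightarrow> r \<ge> 1 \<Longrightarrow> v \<in> U \<Longrightarrow> target.T i j r v \<in> U"
    unfolding M.yangian_submodule_iff[OF UV] by blast+
  let ?S = "{w \<in> F. L w \<in> U}"
  have S: "fvs.subspace ?S"
    using fvs.subspace_inter[OF subspace_Fk[of nb m] subspace_preimage[OF linop_L U'(1)]] by (simp add: Int_def)
  have stable: "stable z (rev [1..<Suc m]) ?S"
  proof (rule stable_Tact[OF S])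
    fix i j r w assume ij: "i \<in> {1..n}" "j \<in> {1..n}" and w: "w \<in> ?S"
    have "L (app (Tact z (rev [1..<Suc m]) r i j) w) \<in> U"
    \<comment> \<open>A submodule is closed under the generators, which have r at least 1; the
      coefficient of order 0 is the identity matrix.\<close>
    proof (cases "r = 0")
      case True
      have "rttc n (mat_prod n (La z) (rev [1..<Suc m]))" by (rule rttc_mat_prod) (simp del: upt_Suc)
      then have "Tact z (rev [1..<Suc m]) 0 i j = (if i = j then 1 else 0)"
        using ij unfolding rttc_def Tact_def by blast
      then show ?thesis
        using True w fvs.subspace_0[OF U'(1)] linop_zero[OF linop_L] by (simp add: app_ops)
    next
      case False
      then show ?thesis using L_Tact[of w i j r] U'(2)[OF ij, of r "L w"] w ij by simp
    qed
    then show "app (Tact z (rev [1..<Suc m]) r i j) w \<in> ?S"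
      using w Tact_Fk[OF ij, of "rev [1..<Suc m]" m w nb z r] by (simp add: atLeastLessThanSuc_atLeastAtMost del: upt_Suc)
  qed
  show "U = {0} \<or> U = J ` V"
  proof (rule disjCI)
    assume "U \<noteq> J ` V"
    then obtain v where v: "v \<in> V" "J v \<notin> U" using U by blast
    show "U = {0}"
    proof (rule ccontr)
      assume "U \<noteq> {0}"
      then obtain u where u: "u \<in> U" "u \<noteq> 0" using fvs.subspace_0[OF U'(1)] by blast
      have "K u \<in> ?S" "K u \<noteq> 0"
        using u UV K_V L_K linop_zero[OF linop_L] by (auto simp: subset_iff) metis
      then have "?S \<noteq> {0}" by blast
      then have "app (Zrec nb z m) (G_map v) \<in> ?S"
        using S stable by (intro Zrec_image_mem[OF good aux' order_refl _ _ _ _ G_V[OF v(1)]]) auto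
      then have "J v \<in> U" unfolding J_def by (auto intro: fvs.subspace_scale[OF U'(1)])
      then show False using v(2) by blast
    qed
  qed
qed

end

theorem theorem3p1:
  fixes m n :: nat and lam mu :: "nat \<Rightarrow> complex"
  assumes "m \<ge> 1" and "n \<ge> 1"
    and "\<forall>a\<in>{1..m}. \<exists>k::int. lam a - mu a = of_int k \<and> \<bar>k\<bar> \<le> int n"
    and "dominant m (lambar n lam mu)"
  shows "(\<forall>ps. normal_ordering m ps \<longrightarrow>
            (\<exists>v\<in>Phi_space m n lam mu. I_op m n lam mu ps v \<noteq> 0))
       \<and> (\<forall>ps ps'. normal_ordering m ps \<and> normal_ordering m ps' \<longrightarrow>
            (\<forall>v\<in>Phi_space m n lam mu. I_op m n lam mu ps v = I_op m n lam mu ps' v))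
       \<and> (\<forall>ps. normal_ordering m ps \<longrightarrow>
            yangian_hom n
              (Phi_act m n lam mu) (Phi_space m n lam mu)
              (Phi_act m n (wt_perm (sigma0 m) lam) (wt_perm (sigma0 m) mu))
              (Phi_space m n (wt_perm (sigma0 m) lam) (wt_perm (sigma0 m) mu))
              (I_op m n lam mu ps))
       \<and> (\<forall>ps. normal_ordering m ps \<longrightarrow>
            yangian_irreducible n
              (Phi_act m n (wt_perm (sigma0 m) lam) (wt_perm (sigma0 m) mu))
              (I_op m n lam mu ps ` Phi_space m n lam mu))"
proof -
  \<comment> \<open>Folds the auxiliary rows m + k back onto the rows k.\<close>
  define e where "e k = (if k \<le> m then k else k - m)" for k
  have e: "e k = k" "e (m + k) = k" if "1 \<le> k" "k \<le> m" for k
    using that by (auto simp: e_def)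
  interpret intertwiner n "\<lambda>a. nu_sign lam mu (e a)" m lam mu "\<lambda>a. mu (e a)" "\<lambda>a. nubar n lam mu (e a)"
  proof
    fix a assume a: "a \<in> {1..m}"
    then obtain k :: int where k: "lam a - mu a = of_int k" "\<bar>k\<bar> \<le> int n" using assms(3) by blast
    then show "\<bar>nu lam mu a\<bar> \<le> int n" by (simp add: nu_def)
    show "nu_sign lam mu (e a) = nu_sign lam mu a" "mu (e a) = mu a" "nubar n lam mu (e a) = nubar n lam mu a"
      using a by (simp_all add: e)
  next
    fix a b assume "1 \<le> a" "a < b" "b \<le> m"
    then show "fock.good (\<lambda>a. nubar n lam mu (e a)) (\<lambda>a. mu (e a)) a b"
      using assms(4) unfolding dominant_def lambar_def fock.good_def by (simp add: e)
  next
    fix k assume "1 \<le> k" "k \<le> m"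
    then show "nu_sign lam mu (e (m + k)) = nu_sign lam mu (e k) \<and> mu (e (m + k)) = mu (e k) \<and>
        nubar n lam mu (e (m + k)) = nubar n lam mu (e k)"
      by (simp add: e)
  qed
  have img: "I_op m n lam mu ps ` V = J ` V" if "normal_ordering m ps" for ps
    using I_op_eq[OF that] by (intro image_cong) auto
  have hom: "yangian_hom n T V (Phi_act m n lam' mu') (Phi_space m n lam' mu') (I_op m n lam mu ps)"
    if "normal_ordering m ps" for ps
  proof -
    \<comment> \<open>\<open>I_op\<close> is known to agree with the linear map \<open>J\<close> on
      \<open>V\<close> only, so carrying commutation over from \<open>J\<close> requires that the
      action stays in \<open>V\<close>.\<close>
    have "yangian_act T y v \<in> V" if "y \<in> carrier (yangian n)" "v \<in> V" for y v
    proof -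
      interpret M: yangian_module n T V by (rule yangian_module)
      have "yangian_submodule n T V"
        unfolding M.yangian_submodule_iff[OF order_refl] using subspace_V T_V by blast
      then show ?thesis using that unfolding yangian_submodule_def by blast
    qed
    then show ?thesis
      using J_hom I_op_eq[OF \<open>normal_ordering m ps\<close>] fvs.subspace_add[OF subspace_V] fvs.subspace_scale[OF subspace_V]
      unfolding yangian_hom_def by (auto simp: image_subset_iff)
  qed
  show ?thesis
    using J_nonzero J_irreducible img hom I_op_eq by (intro conjI allI impI ballI) auto
qed

end
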